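(* Assume $n\ge 2k$, $\mathfrak g=\mathfrak{gl}_n(\mathbb{C})$ with universal enveloping algebra $U(\mathfrak g)$, $M=V^{\otimes k}\otimes(V^* )^{\otimes k}$, and $e=(\mathrm{id}-p_1)\cdots(\mathrm{id}-p_k)$ (so $eM\cong\mathfrak{sl}_n^{\otimes k}$ as $\mathfrak g$-modules). (1) Let $0\le r\le k$, $\underline s=(s_1<\cdots<s_{k-r})$ a subset of $\{1,\dots,k\}$, $\underline t=(t_1,\dots,t_{k-r})$ a sequence of distinct elements of $\{1,\dots,k\}$ with $s_i\ne t_i$ for every $i$, $\lambda,\mu$ partitions of $r$, $T$ a standard tableau of shape $\lambda$ with entries in $\{1,\dots,k\}\setminus\underline s$, $T^*$ a standard tableau of shape $\mu$ with entries in $\{1,\dots,k\}\setminus\underline t$; let $y=y_Ty_{T^*}c_{\underline s,\underline t}$ and $x'=x'_{T,T^*,\underline s,\underline t}=u'_1\otimes\cdots\otimes u'_k\otimes(w_1^* )'\otimes\cdots\otimes(w_k^* )'$ where $u'_p=v_{r+i}$ if $p=s_i$, $u'_p=v_j$ if $p\notin\underline s$ lies in row $j$ of $T$, $(w_p^* )'=v_{r+i}^*$ if $p=t_i$, and $(w_p^* )'=v_{n-j+1}^*$ if $p\notin\underline t$ lies in row $j$ of $T^*$. Then $eyeU(\mathfrak g)x'=U(\mathfrak g)eyx'=eU(\mathfrak g)yx'$ is an irreducible $\mathfrak g$-submodule of $eM$ of highest weight $(\lambda,\mu)$, i.e. isomorphic to $L(\lambda,\mu)$. (2) $\mathfrak{sl}_n^{\otimes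 k}\cong eM=\bigoplus U(\mathfrak g)eyx'$ (a direct sum), where the sum runs over all data $(r,\underline s,\underline t,\lambda,\mu,T,T^* )$ as in (1), i.e. $r=0,1,\dots,k$, $\underline s,\underline t$ as in (1) with $s_i\ne t_i$ for all $i$, $\lambda,\mu$ all partitions of $r$, and $T$, $T^*$ all standard tableaux of shapes $\lambda$, $\mu$ with entries in $\{1,\dots,k\}\setminus\underline s$, $\{1,\dots,k\}\setminus\underline t$ respectively.
   Context: $V=\mathbb{C}^n$ (column vectors, standard basis $v_1,\dots,v_n$), $V^*$ row vectors with dual basis $v_1^*,\dots,v_n^*$; $\mathfrak g$ acts on $V$ by left multiplication, on $V^*$ by $w^*\mapsto -w^*x$, and on $M$ by the tensor product action; $\mathfrak g$ acts on $\mathfrak{sl}_n$ by the adjoint action, and $eM\cong\mathfrak{sl}_n^{\otimes k}$ via $V\otimes V^*\cong\mathfrak{gl}_n$, $u\otimes w^*\mapsto uw^*$. For $1\le i,j\le k$ the contraction $c_{i,j}:M\to M$ is $c_{i,j}(u_1\otimes\cdots\otimes u_k\otimes w_1^*\otimes\cdots\otimes w_k^* )=(w_j^*u_i)\sum_{\ell=1}^n(\text{same tensor with }u_i\text{ replaced by }v_\ell\text{ and }w_j^*\text{ by }v_\ell^* )$; $p_i=\frac1n c_{i,i}$; $c_{\underline s,\underline t}=c_{s_1,t_1}\cdots c_{s_{k-r},t_{k-r}}$. For a standard tableau $T$ (rows and columns increasing) with entries in a subset of $\{1,\dots,k\}$, $R_T$ (resp. $C_T$) denotes the permutations of $\{1,\dots,k\}$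 fixing all non-entries and preserving each row (resp. column) of $T$ setwise, and $y_T=(\sum_{\rho\in R_T}\rho)(\sum_{\gamma\in C_T}\mathrm{sgn}(\gamma)\gamma)$; $y_T$ acts by place permutations on the factors of $V^{\otimes k}$, $y_{T^*}$ on the factors of $(V^* )^{\otimes k}$. For partitions $\lambda=(\lambda_1\ge\dots\ge\lambda_a>0)$, $\mu=(\mu_1\ge\dots\ge\mu_b>0)$ with $a+b\le n$, $L(\lambda,\mu)$ is the irreducible $\mathfrak{gl}_n$-module with highest weight $\sum_{i=1}^a\lambda_i\epsilon_i-\sum_{i=1}^b\mu_i\epsilon_{n+1-i}$, where $\epsilon_i$ picks out the $(i,i)$ entry of a diagonal matrix; "highest weight $(\lambda,\mu)$" means this weight. *)

theory Defs
  imports Complex_Main "HOL-Library.FuncSet" "HOL-Combinatorics.Permutations"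
begin

(* Basis of M = V^{\<otimes>k} \<otimes> (V-dual)^{\<otimes>k}: pairs (a,b) with a,b : {1..k} \<rightarrow> {1..n}
   (extensional); (a,b) stands for v_{a 1}\<otimes>..\<otimes>v_{a k}\<otimes>vdual_{b 1}\<otimes>..\<otimes>vdual_{b k}.
   A vector of M is its coefficient function, vanishing off the basis index set. *)
type_synonym idx = "(nat \<Rightarrow> nat) \<times> (nat \<Rightarrow> nat)"
type_synonym tens = "idx \<Rightarrow> complex"

definition Idx :: "nat \<Rightarrow> nat \<Rightarrow> idx set" where
  "Idx n k = (PiE {1..k} (\<lambda>_. {1..n})) \<times> (PiE {1..k} (\<lambda>_. {1..n}))"

definition Mcar :: "nat \<Rightarrow> nat \<Rightarrow> tens set" where
  "Mcar n k = {x. \<forall>\<iota>. \<iota> \<notin> Idx n k \<longrightarrow> x \<iota> = 0}"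

definition zerot :: tens where "zerot = (\<lambda>_. 0)"

(* action of X \<in> gl_n (an n\<times>n matrix, entries X i j for 1\<le>i,j\<le>n) on M:
   left multiplication on V, w-dual \<mapsto> -w-dual X on V-dual, tensor product action *)
definition act :: "nat \<Rightarrow> nat \<Rightarrow> (nat \<Rightarrow> nat \<Rightarrow> complex) \<Rightarrow> tens \<Rightarrow> tens" where
  "act n k X x = (\<lambda>\<iota>. if \<iota> \<in> Idx n k then
      (\<Sum>p\<in>{1..k}. \<Sum>c\<in>{1..n}. X (fst \<iota> p) c * x ((fst \<iota>)(p := c), snd \<iota>))
    - (\<Sum>p\<in>{1..k}. \<Sum>c\<in>{1..n}. x (fst \<iota>, (snd \<iota>)(p := c)) * X c (snd \<iota> p))
    else 0)"

definition is_submod :: "nat \<Rightarrow> nat \<Rightarrow> tens set \<Rightarrow> bool" where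
  "is_submod n k S \<longleftrightarrow> S \<subseteq> Mcar n k \<and> zerot \<in> S
     \<and> (\<forall>x\<in>S. \<forall>y\<in>S. (\<lambda>\<iota>. x \<iota> + y \<iota>) \<in> S)
     \<and> (\<forall>x\<in>S. \<forall>c::complex. (\<lambda>\<iota>. c * x \<iota>) \<in> S)
     \<and> (\<forall>x\<in>S. \<forall>X. act n k X x \<in> S)"

definition Ugen :: "nat \<Rightarrow> nat \<Rightarrow> tens \<Rightarrow> tens set" where
  "Ugen n k x = \<Inter>{S. is_submod n k S \<and> x \<in> S}"

definition irreducible_mod :: "nat \<Rightarrow> nat \<Rightarrow> tens set \<Rightarrow> bool" where
  "irreducible_mod n k W \<longleftrightarrow> is_submod n k W \<and> W \<noteq> {zerot}
     \<and> (\<forall>S. is_submod n k S \<and> S \<subseteq> W \<longrightarrow> S = {zerot} \<or> S = W)"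

definition Eij :: "nat \<Rightarrow> nat \<Rightarrow> nat \<Rightarrow> nat \<Rightarrow> complex" where
  "Eij i j = (\<lambda>a b. if a = i \<and> b = j then 1 else 0)"

definition has_highest_weight :: "nat \<Rightarrow> nat \<Rightarrow> tens set \<Rightarrow> (nat \<Rightarrow> complex) \<Rightarrow> bool" where
  "has_highest_weight n k W \<omega> \<longleftrightarrow> (\<exists>v\<in>W. v \<noteq> zerot
     \<and> (\<forall>i\<in>{1..n}. act n k (Eij i i) v = (\<lambda>\<iota>. \<omega> i * v \<iota>))
     \<and> (\<forall>i j. 1 \<le> i \<and> i < j \<and> j \<le> n \<longrightarrow> act n k (Eij i j) v = zerot))"

definition partition_of :: "nat \<Rightarrow> nat list \<Rightarrow> bool" where
  "partition_of r la \<longleftrightarrow> sorted_wrt (\<ge>) la \<and> (\<forall>x\<in>set la. 0 < x) \<and> sum_list la = r"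

definition hw :: "nat \<Rightarrow> nat list \<Rightarrow> nat list \<Rightarrow> nat \<Rightarrow> complex" where
  "hw n la mu i =
     (if 1 \<le> i \<and> i \<le> length la then of_nat (la ! (i - 1)) else 0)
   - (if 1 \<le> i \<and> i \<le> n \<and> n + 1 - i \<le> length mu then of_nat (mu ! (n - i)) else 0)"

definition cells :: "nat list \<Rightarrow> (nat \<times> nat) set" where
  "cells la = {(i, j). 1 \<le> i \<and> i \<le> length la \<and> 1 \<le> j \<and> j \<le> la ! (i - 1)}"

definition std_tab :: "nat list \<Rightarrow> nat set \<Rightarrow> (nat \<times> nat \<Rightarrow> nat) \<Rightarrow> bool" where
  "std_tab la A T \<longleftrightarrow> bij_betw T (cells la) A \<and> (\<forall>c. c \<notin> cells la \<longrightarrow> T c = 0)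
     \<and> (\<forall>i j. (i, j) \<in> cells la \<and> (i, j + 1) \<in> cells la \<longrightarrow> T (i, j) < T (i, j + 1))
     \<and> (\<forall>i j. (i, j) \<in> cells la \<and> (i + 1, j) \<in> cells la \<longrightarrow> T (i, j) < T (i + 1, j))"

definition tab_row :: "nat list \<Rightarrow> (nat \<times> nat \<Rightarrow> nat) \<Rightarrow> nat \<Rightarrow> nat" where
  "tab_row la T p = (THE i. \<exists>j. (i, j) \<in> cells la \<and> T (i, j) = p)"

definition tab_col :: "nat list \<Rightarrow> (nat \<times> nat \<Rightarrow> nat) \<Rightarrow> nat \<Rightarrow> nat" where
  "tab_col la T p = (THE j. \<exists>i. (i, j) \<in> cells la \<and> T (i, j) = p)"

definition row_grp :: "nat list \<Rightarrow> (nat \<times> nat \<Rightarrow> nat) \<Rightarrow> (nat \<Rightarrow> nat) set" where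
  "row_grp la T = {\<sigma>. \<sigma> permutes (T ` cells la)
     \<and> (\<forall>p\<in>T ` cells la. tab_row la T (\<sigma> p) = tab_row la T p)}"

definition col_grp :: "nat list \<Rightarrow> (nat \<times> nat \<Rightarrow> nat) \<Rightarrow> (nat \<Rightarrow> nat) set" where
  "col_grp la T = {\<sigma>. \<sigma> permutes (T ` cells la)
     \<and> (\<forall>p\<in>T ` cells la. tab_col la T (\<sigma> p) = tab_col la T p)}"

(* place permutation sigma on the V-factors: v_{a1}\<otimes>..\<otimes>v_{ak} \<mapsto> v_{a(\<sigma>^-1 1)}\<otimes>..;
   in coefficients (\<sigma>x)(a,b) = x(a \<circ> \<sigma>, b). Similarly on the V-dual-factors. *)
definition yV :: "nat list \<Rightarrow> (nat \<times> nat \<Rightarrow> nat) \<Rightarrow> tens \<Rightarrow> tens" where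
  "yV la T x = (let z = (\<lambda>\<iota>. \<Sum>\<gamma>\<in>col_grp la T. of_int (sign \<gamma>) * x (fst \<iota> \<circ> \<gamma>, snd \<iota>))
                in (\<lambda>\<iota>. \<Sum>\<rho>\<in>row_grp la T. z (fst \<iota> \<circ> \<rho>, snd \<iota>)))"

definition yW :: "nat list \<Rightarrow> (nat \<times> nat \<Rightarrow> nat) \<Rightarrow> tens \<Rightarrow> tens" where
  "yW la T x = (let z = (\<lambda>\<iota>. \<Sum>\<gamma>\<in>col_grp la T. of_int (sign \<gamma>) * x (fst \<iota>, snd \<iota> \<circ> \<gamma>))
                in (\<lambda>\<iota>. \<Sum>\<rho>\<in>row_grp la T. z (fst \<iota>, snd \<iota> \<circ> \<rho>)))"

definition contr :: "nat \<Rightarrow> nat \<Rightarrow> nat \<Rightarrow> nat \<Rightarrow> tens \<Rightarrow> tens" where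
  "contr n k i j x = (\<lambda>\<iota>. if \<iota> \<in> Idx n k \<and> fst \<iota> i = snd \<iota> j then
       (\<Sum>l\<in>{1..n}. x ((fst \<iota>)(i := l), (snd \<iota>)(j := l))) else 0)"

definition e_op :: "nat \<Rightarrow> nat \<Rightarrow> tens \<Rightarrow> tens" where
  "e_op n k x = foldr (\<lambda>i y. (\<lambda>\<iota>. y \<iota> - contr n k i i y \<iota> / of_nat n)) [1..<k+1] x"

definition cst :: "nat \<Rightarrow> nat \<Rightarrow> nat list \<Rightarrow> nat list \<Rightarrow> tens \<Rightarrow> tens" where
  "cst n k s t x = foldr (\<lambda>(i, j) y. contr n k i j y) (zip s t) x"

definition yop :: "nat \<Rightarrow> nat \<Rightarrow> nat list \<Rightarrow> nat list \<Rightarrow> nat list \<Rightarrow> nat list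
    \<Rightarrow> (nat \<times> nat \<Rightarrow> nat) \<Rightarrow> (nat \<times> nat \<Rightarrow> nat) \<Rightarrow> tens \<Rightarrow> tens" where
  "yop n k s t la mu T T' x = yV la T (yW mu T' (cst n k s t x))"

definition lpos :: "nat list \<Rightarrow> nat \<Rightarrow> nat" where
  "lpos s p = Suc (THE i. i < length s \<and> s ! i = p)"

definition basis_vec :: "idx \<Rightarrow> tens" where
  "basis_vec \<iota>0 = (\<lambda>\<iota>. if \<iota> = \<iota>0 then 1 else 0)"

definition xprime :: "nat \<Rightarrow> nat \<Rightarrow> nat \<Rightarrow> nat list \<Rightarrow> nat list \<Rightarrow> nat list \<Rightarrow> nat list
    \<Rightarrow> (nat \<times> nat \<Rightarrow> nat) \<Rightarrow> (nat \<times> nat \<Rightarrow> nat) \<Rightarrow> tens" where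
  "xprime n k r s t la mu T T' = basis_vec
     (restrict (\<lambda>p. if p \<in> set s then r + lpos s p else tab_row la T p) {1..k},
      restrict (\<lambda>p. if p \<in> set t then r + lpos t p else n + 1 - tab_row mu T' p) {1..k})"

type_synonym datum = "nat \<times> nat list \<times> nat list \<times> nat list \<times> nat list
   \<times> (nat \<times> nat \<Rightarrow> nat) \<times> (nat \<times> nat \<Rightarrow> nat)"

definition data :: "nat \<Rightarrow> datum set" where
  "data k = {(r, s, t, la, mu, T, T'). r \<le> k
     \<and> length s = k - r \<and> sorted_wrt (<) s \<and> set s \<subseteq> {1..k}
     \<and> length t = k - r \<and> distinct t \<and> set t \<subseteq> {1..k}
     \<and> (\<forall>i < k - r. s ! i \<noteq> t ! i)
     \<and> partition_of r la \<and> partition_of r mu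
     \<and> std_tab la ({1..k} - set s) T \<and> std_tab mu ({1..k} - set t) T'}"

definition Wmod :: "nat \<Rightarrow> nat \<Rightarrow> datum \<Rightarrow> tens set" where
  "Wmod n k d = (case d of (r, s, t, la, mu, T, T') \<Rightarrow>
      Ugen n k (e_op n k (yop n k s t la mu T T' (xprime n k r s t la mu T T'))))"

end

theory Submission
  imports Defs
begin

text \<open>
  Equip \<open>M\<close> with the Hermitian form for which the basis tensors are orthonormal. The adjoint of a
  lowering operator is then a raising operator, so a highest weight vector \<open>v\<close> generates a module
  whose other elements are, up to multiples of \<open>v\<close>, orthogonal to every highest weight vector.
  Hence \<open>U(g)v\<close> is irreducible, and \<open>eM\<close> is the direct sum of the modules \<open>U(g)\<theta>\<^sub>d\<close> as soon as the
  highest weight vectors \<open>\<theta>\<^sub>d = eyx'\<close> are linearly independent and no nonzero highest weight vector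
  of \<open>eM\<close> is orthogonal to all of them.

  Independence: at an index that is generic for a matching of \<open>s\<close> with \<open>t\<close>, \<open>\<theta>\<^sub>d\<close> vanishes unless its
  own matching is contained in that one, and equality reduces the question to Young symmetrizer
  vectors, whose pairing with column antisymmetrized vectors is triangular.

  Completeness: apply a maximal contraction that does not kill a given highest weight vector. The
  result is traceless and killed by the raising operators, and since \<open>2r \<le> n\<close> a positivity argument
  confines the entries of the \<open>V\<close> slots to \<open>{1..r}\<close> and those of the dual slots to \<open>{r+1..n}\<close>. There
  the two kinds of slots decouple, and induction on the number of slots shows that vectors killed by
  raising operators are spanned by column antisymmetrized ones.
\<close>

text \<open>The generators are not orthogonal to each other in general, so both halves rest on an
  extremal choice. Independence looks at a datum with nonzero coefficient and largest
  \<open>r\<close>: every competitor then contracts at least as many pairs, and inclusion of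
  matchings forces equality. Completeness takes a largest family of pairs whose contraction is
  nonzero, so that each further contraction vanishes, which is the tracelessness used there. No
  dimensions are counted: the triangular pairing is read along its rows for independence and along
  its columns for completeness. The projection \<open>e\<close> disappears in both halves: it
  changes no coefficient at an index with \<open>a i \<noteq> b i\<close> for all \<open>i\<close>,
  and, its factors being self-adjoint and fixing \<open>eM\<close>, pairing an element of
  \<open>eM\<close> with \<open>e q\<close> is pairing it with \<open>q\<close>. The bound
  \<open>2 * r \<le> n\<close> has its origin in an average: if \<open>m\<close> is the largest
  squared norm that \<open>r\<close> slots of one kind carry on forbidden values and
  \<open>L\<close> is the set of allowed values, then \<open>card L * m \<le> (r - 1) * m\<close>,
  hence \<open>m = 0\<close> once \<open>r \<le> card L\<close>; this must hold for
  \<open>{1..r}\<close> and for \<open>{r + 1..n}\<close>.\<close>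

declare One_nat_def [simp del]

section \<open>The action of matrices on tensors with given slot sets, and its adjoint\<close>

definition left_act :: "nat \<Rightarrow> nat set \<Rightarrow> (nat \<Rightarrow> nat \<Rightarrow> complex) \<Rightarrow> tens \<Rightarrow> tens" where
  "left_act n A X x \<iota> = (\<Sum>p\<in>A. \<Sum>c\<in>{1..n}. X (fst \<iota> p) c * x ((fst \<iota>)(p := c), snd \<iota>))"

definition right_act :: "nat \<Rightarrow> nat set \<Rightarrow> (nat \<Rightarrow> nat \<Rightarrow> complex) \<Rightarrow> tens \<Rightarrow> tens" where
  "right_act n B X x \<iota> = (\<Sum>q\<in>B. \<Sum>c\<in>{1..n}. x (fst \<iota>, (snd \<iota>)(q := c)) * X c (snd \<iota> q))"

text \<open>The slot sets \<open>A\<close> and \<open>B\<close> are parameters because the same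
  action is needed on all slots, on the slots left free by a contraction, and with \<open>B\<close>
  empty. Unlike \<open>act\<close>, nothing is cut off outside the index box, so the commutator
  identity holds at every index.\<close>

definition gl_act :: "nat \<Rightarrow> nat set \<Rightarrow> nat set \<Rightarrow> (nat \<Rightarrow> nat \<Rightarrow> complex) \<Rightarrow> tens \<Rightarrow> tens" where
  "gl_act n A B X x \<iota> = left_act n A X x \<iota> - right_act n B X x \<iota>"

definition comm :: "nat \<Rightarrow> (nat \<Rightarrow> nat \<Rightarrow> complex) \<Rightarrow> (nat \<Rightarrow> nat \<Rightarrow> complex) \<Rightarrow> nat \<Rightarrow> nat \<Rightarrow> complex" where
  "comm n X Y i j = (\<Sum>c\<in>{1..n}. X i c * Y c j - Y i c * X c j)"

definition adj :: "(nat \<Rightarrow> nat \<Rightarrow> complex) \<Rightarrow> nat \<Rightarrow> nat \<Rightarrow> complex" where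
  "adj X i j = cnj (X j i)"

definition trp :: "(nat \<Rightarrow> nat \<Rightarrow> complex) \<Rightarrow> nat \<Rightarrow> nat \<Rightarrow> complex" where
  "trp X i j = X j i"

abbreviation fbox :: "nat \<Rightarrow> nat set \<Rightarrow> (nat \<Rightarrow> nat) set" where
  "fbox n A \<equiv> PiE A (\<lambda>_. {1..n})"

definition herm :: "nat \<Rightarrow> nat set \<Rightarrow> nat set \<Rightarrow> tens \<Rightarrow> tens \<Rightarrow> complex" where
  "herm n A B x y = (\<Sum>\<iota>\<in>fbox n A \<times> fbox n B. x \<iota> * cnj (y \<iota>))"

lemma finite_fbox [simp]: "finite A \<Longrightarrow> finite (fbox n A)"
  by (rule finite_PiE) auto

lemma fbox_upd: "a \<in> fbox n A \<Longrightarrow> p \<in> A \<Longrightarrow> c \<in> {1..n} \<Longrightarrow> a(p := c) \<in> fbox n A"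
  by (auto simp: PiE_def extensional_def Pi_def)

lemma fbox_val: "a \<in> fbox n A \<Longrightarrow> p \<in> A \<Longrightarrow> a p \<in> {1..n}"
  by (auto simp: PiE_def)

lemma left_act_left_act:
  "left_act n A X (left_act n A Y x) (a, b) = (\<Sum>p\<in>A. \<Sum>p'\<in>A. \<Sum>c\<in>{1..n}. \<Sum>c'\<in>{1..n}.
     X (a p) c * Y ((a(p := c)) p') c' * x (a(p := c, p' := c'), b))"
proof -
  have "left_act n A X (left_act n A Y x) (a, b) = (\<Sum>p\<in>A. \<Sum>c\<in>{1..n}. \<Sum>p'\<in>A. \<Sum>c'\<in>{1..n}.
     X (a p) c * Y ((a(p := c)) p') c' * x (a(p := c, p' := c'), b))"
    unfolding left_act_def by (simp only: fst_conv snd_conv sum_distrib_left mult.assoc)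
  also have "\<dots> = (\<Sum>p\<in>A. \<Sum>p'\<in>A. \<Sum>c\<in>{1..n}. \<Sum>c'\<in>{1..n}.
     X (a p) c * Y ((a(p := c)) p') c' * x (a(p := c, p' := c'), b))"
    by (intro sum.cong refl sum.swap)
  finally show ?thesis .
qed

text \<open>Terms at two different slots commute and cancel; where both matrices meet the same slot,
  the remaining difference is the matrix commutator.\<close>

lemma left_act_comm:
  assumes "finite A"
  shows "left_act n A X (left_act n A Y x) \<iota> - left_act n A Y (left_act n A X x) \<iota> = left_act n A (comm n X Y) x \<iota>"
proof (cases \<iota>)
  case (Pair a b)
  define T where "T X Y p p' = (\<Sum>c\<in>{1..n}. \<Sum>c'\<in>{1..n}.
     X (a p) c * Y ((a(p := c)) p') c' * x (a(p := c, p' := c'), b))" for X Y :: "nat \<Rightarrow> nat \<Rightarrow> complex" and p p'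
  have off: "T X Y p p' = T Y X p' p" if "p \<noteq> p'" for p p'
  proof -
    have "T X Y p p' = (\<Sum>c\<in>{1..n}. \<Sum>c'\<in>{1..n}. Y (a p') c' * X ((a(p' := c')) p) c * x (a(p' := c', p := c), b))"
      unfolding T_def using that by (intro sum.cong refl) (simp add: fun_upd_twist mult.commute)
    also have "\<dots> = T Y X p' p" unfolding T_def by (rule sum.swap)
    finally show ?thesis .
  qed
  have diag: "T X Y p p - T Y X p p = (\<Sum>c\<in>{1..n}. comm n X Y (a p) c * x (a(p := c), b))" for p
  proof -
    have "T X Y p p - T Y X p p = (\<Sum>c\<in>{1..n}. \<Sum>c'\<in>{1..n}.
      (X (a p) c * Y c c' - Y (a p) c * X c c') * x (a(p := c'), b))"
      unfolding T_def by (simp add: sum_subtractf algebra_simps)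
    also have "\<dots> = (\<Sum>c'\<in>{1..n}. \<Sum>c\<in>{1..n}.
      (X (a p) c * Y c c' - Y (a p) c * X c c') * x (a(p := c'), b))" by (rule sum.swap)
    also have "\<dots> = (\<Sum>c\<in>{1..n}. comm n X Y (a p) c * x (a(p := c), b))"
      unfolding comm_def by (simp add: sum_distrib_right)
    finally show ?thesis .
  qed
  have "left_act n A X (left_act n A Y x) \<iota> - left_act n A Y (left_act n A X x) \<iota>
      = (\<Sum>p\<in>A. \<Sum>p'\<in>A. T X Y p p') - (\<Sum>p\<in>A. \<Sum>p'\<in>A. T Y X p p')"
    unfolding Pair left_act_left_act T_def ..
  also have "(\<Sum>p\<in>A. \<Sum>p'\<in>A. T Y X p p') = (\<Sum>p\<in>A. \<Sum>p'\<in>A. T Y X p' p)" by (rule sum.swap)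
  also have "(\<Sum>p\<in>A. \<Sum>p'\<in>A. T X Y p p') - \<dots> = (\<Sum>p\<in>A. \<Sum>p'\<in>A. T X Y p p' - T Y X p' p)"
    by (simp add: sum_subtractf)
  also have "\<dots> = (\<Sum>p\<in>A. \<Sum>p'\<in>A. if p' = p then T X Y p p - T Y X p p else 0)"
    by (intro sum.cong refl) (auto simp: off)
  also have "\<dots> = (\<Sum>p\<in>A. T X Y p p - T Y X p p)" using assms by simp
  also have "\<dots> = left_act n A (comm n X Y) x \<iota>" unfolding left_act_def Pair by (simp add: diag)
  finally show ?thesis .
qed

text \<open>On coefficients the action on dual slots is left multiplication by the transpose. With
  the two components of the index swapped, facts about \<open>left_act\<close> carry over.\<close>

lemma right_act_eq_left_act: "right_act n B X x (a, b) = left_act n B (trp X) (x \<circ> prod.swap) (b, a)"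
  unfolding right_act_def left_act_def trp_def by (simp add: mult.commute)

text \<open>Transposition reverses products, whence the minus sign. It matches the minus sign in
  \<open>gl_act\<close>, so that the difference of the two actions is again a
  representation.\<close>

lemma right_act_comm:
  assumes "finite B"
  shows "right_act n B X (right_act n B Y x) \<iota> - right_act n B Y (right_act n B X x) \<iota> = - right_act n B (comm n X Y) x \<iota>"
proof (cases \<iota>)
  case (Pair a b)
  have sw: "right_act n B Y x \<circ> prod.swap = left_act n B (trp Y) (x \<circ> prod.swap)" for Y
    by (auto simp: fun_eq_iff right_act_eq_left_act)
  have "right_act n B X (right_act n B Y x) (a, b) - right_act n B Y (right_act n B X x) (a, b)
    = left_act n B (comm n (trp X) (trp Y)) (x \<circ> prod.swap) (b, a)"
    unfolding right_act_eq_left_act sw by (rule left_act_comm[OF assms])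
  also have "\<dots> = - left_act n B (trp (comm n X Y)) (x \<circ> prod.swap) (b, a)"
    unfolding left_act_def comm_def trp_def
    by (simp add: sum_negf[symmetric] sum_distrib_right sum_subtractf algebra_simps)
  finally show ?thesis unfolding Pair right_act_eq_left_act .
qed

lemma left_act_right_act: "left_act n A X (right_act n B Y x) \<iota> = right_act n B Y (left_act n A X x) \<iota>"
proof -
  have "left_act n A X (right_act n B Y x) \<iota> = (\<Sum>p\<in>A. \<Sum>c\<in>{1..n}. \<Sum>q\<in>B. \<Sum>d\<in>{1..n}.
     X (fst \<iota> p) c * (x ((fst \<iota>)(p := c), (snd \<iota>)(q := d)) * Y d (snd \<iota> q)))"
    unfolding left_act_def right_act_def by (simp add: sum_distrib_left)
  also have "\<dots> = (\<Sum>p\<in>A. \<Sum>q\<in>B. \<Sum>c\<in>{1..n}. \<Sum>d\<in>{1..n}.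
     X (fst \<iota> p) c * (x ((fst \<iota>)(p := c), (snd \<iota>)(q := d)) * Y d (snd \<iota> q)))"
    by (intro sum.cong refl sum.swap)
  also have "\<dots> = (\<Sum>q\<in>B. \<Sum>p\<in>A. \<Sum>d\<in>{1..n}. \<Sum>c\<in>{1..n}.
     X (fst \<iota> p) c * (x ((fst \<iota>)(p := c), (snd \<iota>)(q := d)) * Y d (snd \<iota> q)))"
    by (subst sum.swap) (intro sum.cong refl sum.swap)
  also have "\<dots> = (\<Sum>q\<in>B. \<Sum>d\<in>{1..n}. \<Sum>p\<in>A. \<Sum>c\<in>{1..n}.
     X (fst \<iota> p) c * (x ((fst \<iota>)(p := c), (snd \<iota>)(q := d)) * Y d (snd \<iota> q)))"
    by (intro sum.cong refl sum.swap)
  also have "\<dots> = right_act n B Y (left_act n A X x) \<iota>"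
    unfolding left_act_def right_act_def by (simp add: sum_distrib_right mult.assoc)
  finally show ?thesis .
qed

lemma left_act_diff: "left_act n A X (\<lambda>\<iota>. x \<iota> - y \<iota>) \<iota> = left_act n A X x \<iota> - left_act n A X y \<iota>"
  unfolding left_act_def by (simp add: sum_subtractf algebra_simps)

lemma right_act_diff: "right_act n A X (\<lambda>\<iota>. x \<iota> - y \<iota>) \<iota> = right_act n A X x \<iota> - right_act n A X y \<iota>"
  unfolding right_act_def by (simp add: sum_subtractf algebra_simps)

lemma gl_act_comm:
  assumes "finite A" "finite B"
  shows "gl_act n A B X (gl_act n A B Y x) \<iota> = gl_act n A B Y (gl_act n A B X x) \<iota> + gl_act n A B (comm n X Y) x \<iota>"
proof -
  have e: "gl_act n A B X x = (\<lambda>\<iota>. left_act n A X x \<iota> - right_act n B X x \<iota>)" for X x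
    by (simp add: gl_act_def fun_eq_iff)
  show ?thesis
    using left_act_comm[OF assms(1), of n X Y x \<iota>, unfolded diff_eq_eq]
      right_act_comm[OF assms(2), of n X Y x \<iota>, unfolded diff_eq_eq]
    unfolding gl_act_def[of _ _ _ _ "gl_act _ _ _ _ _"]
    unfolding gl_act_def[of _ _ _ "comm _ _ _"] e
    by (simp add: left_act_diff right_act_diff left_act_right_act)
qed

lemma gl_act_add: "gl_act n A B X (\<lambda>\<iota>. x \<iota> + y \<iota>) \<iota> = gl_act n A B X x \<iota> + gl_act n A B X y \<iota>"
  unfolding gl_act_def left_act_def right_act_def by (simp add: sum.distrib algebra_simps)

lemma gl_act_smult: "gl_act n A B X (\<lambda>\<iota>. c * x \<iota>) \<iota> = c * gl_act n A B X x \<iota>"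
  unfolding gl_act_def left_act_def right_act_def by (simp add: sum_distrib_left algebra_simps)

text \<open>The map sending \<open>(a, c)\<close> to \<open>(a(p := c), a p)\<close> is an
  involution of the summation range. It carries the changed slot from one factor of a Hermitian
  product to the other and yields \<open>left_act_adj\<close>.\<close>

lemma sum_update_swap:
  assumes "p \<in> A"
  shows "(\<Sum>a\<in>fbox n A. \<Sum>c\<in>{1..n}. G a c) = (\<Sum>a\<in>fbox n A. \<Sum>c\<in>{1..n}. (G (a(p := c)) (a p) :: 'b :: comm_monoid_add))"
  unfolding sum.cartesian_product
  by (rule sum.reindex_bij_witness[where i = "\<lambda>(a, c). (a(p := c), a p)" and j = "\<lambda>(a, c). (a(p := c), a p)"])
    (auto simp: assms fbox_upd dest: fbox_val[OF _ assms])

lemma herm_alt: "herm n A B x y = (\<Sum>a\<in>fbox n A. \<Sum>b\<in>fbox n B. x (a, b) * cnj (y (a, b)))"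
  by (simp add: herm_def sum.cartesian_product case_prod_unfold)

lemma left_act_adj:
  "herm n A B (left_act n A X x) y = herm n A B x (left_act n A (adj X) y)"
proof -
  have "herm n A B (left_act n A X x) y =
    (\<Sum>a\<in>fbox n A. \<Sum>b\<in>fbox n B. \<Sum>p\<in>A. \<Sum>c\<in>{1..n}. X (a p) c * x (a(p := c), b) * cnj (y (a, b)))"
    unfolding herm_alt left_act_def
    by (simp add: sum_distrib_right)
  also have "\<dots> = (\<Sum>b\<in>fbox n B. \<Sum>p\<in>A. \<Sum>a\<in>fbox n A. \<Sum>c\<in>{1..n}. X (a p) c * x (a(p := c), b) * cnj (y (a, b)))"
    by (subst sum.swap) (intro sum.cong refl sum.swap)
  also have "\<dots> = (\<Sum>b\<in>fbox n B. \<Sum>p\<in>A. \<Sum>a\<in>fbox n A. \<Sum>c\<in>{1..n}. X c (a p) * x (a, b) * cnj (y (a(p := c), b)))"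
    by (rule sum.cong[OF refl], rule sum.cong[OF refl], subst sum_update_swap) auto
  also have "\<dots> = (\<Sum>a\<in>fbox n A. \<Sum>b\<in>fbox n B. \<Sum>p\<in>A. \<Sum>c\<in>{1..n}. X c (a p) * x (a, b) * cnj (y (a(p := c), b)))"
    by (subst sum.swap[of _ "fbox n A"]) (intro sum.cong refl sum.swap)
  also have "\<dots> = herm n A B x (left_act n A (adj X) y)"
    unfolding herm_alt left_act_def
    by (simp add: sum_distrib_left adj_def algebra_simps)
  finally show ?thesis .
qed

lemma herm_swap: "herm n A B x y = herm n B A (x \<circ> prod.swap) (y \<circ> prod.swap)"
  unfolding herm_def
  by (rule sum.reindex_bij_witness[where i = prod.swap and j = prod.swap]) auto

lemma right_act_adj:
  "herm n A B (right_act n B X x) y = herm n A B x (right_act n B (adj X) y)"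
proof -
  have sw: "right_act n B Y x \<circ> prod.swap = left_act n B (trp Y) (x \<circ> prod.swap)" for Y x
    by (auto simp: fun_eq_iff right_act_eq_left_act)
  have tr: "adj (trp X) = trp (adj X)" by (simp add: adj_def trp_def fun_eq_iff)
  show ?thesis
    by (subst (1 2) herm_swap) (simp only: sw left_act_adj tr)
qed

lemma herm_diff_left: "herm n A B (\<lambda>\<iota>. x \<iota> - y \<iota>) z = herm n A B x z - herm n A B y z"
  unfolding herm_def by (simp add: sum_subtractf algebra_simps)

lemma herm_diff_right: "herm n A B z (\<lambda>\<iota>. x \<iota> - y \<iota>) = herm n A B z x - herm n A B z y"
  unfolding herm_def by (simp add: sum_subtractf algebra_simps)

lemma herm_add_left: "herm n A B (\<lambda>\<iota>. x \<iota> + y \<iota>) z = herm n A B x z + herm n A B y z"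
  unfolding herm_def by (simp add: sum.distrib algebra_simps)

lemma herm_smult_left: "herm n A B (\<lambda>\<iota>. c * x \<iota>) z = c * herm n A B x z"
  unfolding herm_def by (simp add: sum_distrib_left algebra_simps)

lemma herm_smult_right: "herm n A B z (\<lambda>\<iota>. c * x \<iota>) = cnj c * herm n A B z x"
  unfolding herm_def by (simp add: sum_distrib_left algebra_simps)

lemma herm_cnj: "cnj (herm n A B x y) = herm n A B y x"
  unfolding herm_def by (simp add: mult.commute)

lemma herm_sum_left: "herm n A B (\<lambda>\<iota>. \<Sum>d\<in>D. f d \<iota>) z = (\<Sum>d\<in>D. herm n A B (f d) z)"
  unfolding herm_def by (subst sum.swap) (simp add: sum_distrib_right)

lemma herm_zero_left [simp]: "herm n A B (\<lambda>_. 0) z = 0"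
  unfolding herm_def by simp

lemma herm_zero_right [simp]: "herm n A B z (\<lambda>_. 0) = 0"
  unfolding herm_def by simp

lemma herm_cong: "(\<And>\<iota>. \<iota> \<in> fbox n A \<times> fbox n B \<Longrightarrow> x \<iota> = x' \<iota>) \<Longrightarrow>
  (\<And>\<iota>. \<iota> \<in> fbox n A \<times> fbox n B \<Longrightarrow> y \<iota> = y' \<iota>) \<Longrightarrow> herm n A B x y = herm n A B x' y'"
  unfolding herm_def by (intro sum.cong) auto

lemma herm_self_eq_0:
  assumes "finite A" "finite B" "herm n A B x x = 0" "\<iota> \<in> fbox n A \<times> fbox n B"
  shows "x \<iota> = 0"
proof -
  have "herm n A B x x = of_real (\<Sum>\<iota>\<in>fbox n A \<times> fbox n B. (cmod (x \<iota>))\<^sup>2)"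
    unfolding herm_def by (simp add: complex_norm_square del: of_real_power)
  then have "(\<Sum>\<iota>\<in>fbox n A \<times> fbox n B. (cmod (x \<iota>))\<^sup>2) = 0"
    using assms(3) by (metis of_real_eq_0_iff)
  then have "\<forall>\<iota>\<in>fbox n A \<times> fbox n B. (cmod (x \<iota>))\<^sup>2 = 0"
    by (subst (asm) sum_nonneg_eq_0_iff) (auto simp: assms)
  then show ?thesis using assms(4) by (cases \<iota>) auto
qed

lemma gl_act_adj: "herm n A B (gl_act n A B X x) y = herm n A B x (gl_act n A B (adj X) y)"
proof -
  have e: "gl_act n A B X x = (\<lambda>\<iota>. left_act n A X x \<iota> - right_act n B X x \<iota>)" for X x
    by (simp add: gl_act_def fun_eq_iff)
  show ?thesis unfolding e herm_diff_left herm_diff_right left_act_adj right_act_adj ..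
qed

text \<open>\<open>Eij i j\<close> sends \<open>v_j\<close> to \<open>v_i\<close> and the dual
  vector of \<open>v_i\<close> to minus that of \<open>v_j\<close>. Coefficients are read off in the
  other direction: in the argument, an entry \<open>i\<close> of \<open>a\<close> is replaced by
  \<open>j\<close> and an entry \<open>j\<close> of \<open>b\<close> by \<open>i\<close>.\<close>

lemma gl_act_Eij:
  assumes "finite A" "finite B" "i \<in> {1..n}" "j \<in> {1..n}"
  shows "gl_act n A B (Eij i j) x (a, b) =
    (\<Sum>p\<in>{p\<in>A. a p = i}. x (a(p := j), b)) - (\<Sum>q\<in>{q\<in>B. b q = j}. x (a, b(q := i)))"
proof -
  have 1: "(\<Sum>c\<in>{1..n}. Eij i j (a p) c * x (a(p := c), b)) = (if a p = i then x (a(p := j), b) else 0)" for p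
  proof -
    have "(\<Sum>c\<in>{1..n}. Eij i j (a p) c * x (a(p := c), b))
      = (\<Sum>c\<in>{1..n}. if c = j then (if a p = i then x (a(p := j), b) else 0) else 0)"
      by (intro sum.cong) (auto simp: Eij_def)
    also have "\<dots> = (if a p = i then x (a(p := j), b) else 0)" using assms(4) by simp
    finally show ?thesis .
  qed
  have 2: "(\<Sum>c\<in>{1..n}. x (a, b(q := c)) * Eij i j c (b q)) = (if b q = j then x (a, b(q := i)) else 0)" for q
  proof -
    have "(\<Sum>c\<in>{1..n}. x (a, b(q := c)) * Eij i j c (b q))
      = (\<Sum>c\<in>{1..n}. if c = i then (if b q = j then x (a, b(q := i)) else 0) else 0)"
      by (intro sum.cong) (auto simp: Eij_def)
    also have "\<dots> = (if b q = j then x (a, b(q := i)) else 0)" using assms(3) by simp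
    finally show ?thesis .
  qed
  show ?thesis
    unfolding gl_act_def left_act_def right_act_def fst_conv snd_conv 1 2
    using assms by (simp add: sum.If_cases Int_def)
qed

lemma comm_Eij:
  assumes "i \<in> {1..n}" "j \<in> {1..n}"
  shows "comm n (Eij i j) (Eij j i) = (\<lambda>a b. Eij i i a b - Eij j j a b)"
proof (intro ext)
  fix a b
  have "comm n (Eij i j) (Eij j i) a b = (\<Sum>c\<in>{1..n}. (if c = j then Eij i i a b else 0) - (if c = i then Eij j j a b else 0))"
    unfolding comm_def by (intro sum.cong) (auto simp: Eij_def)
  also have "\<dots> = Eij i i a b - Eij j j a b" using assms by (simp add: sum_subtractf)
  finally show "comm n (Eij i j) (Eij j i) a b = Eij i i a b - Eij j j a b" .
qed

lemma adj_Eij: "adj (Eij i j) = Eij j i"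
  by (auto simp: adj_def Eij_def fun_eq_iff)

lemma gl_act_diff_mat: "gl_act n A B (\<lambda>i j. X i j - Y i j) x \<iota> = gl_act n A B X x \<iota> - gl_act n A B Y x \<iota>"
  unfolding gl_act_def left_act_def right_act_def by (simp add: sum_subtractf algebra_simps)

text \<open>Gram-Schmidt one coordinate at a time: the members of \<open>S\<close> that vanish at
  the new coordinate form a subspace \<open>S'\<close> of codimension at most one, to which the
  induction hypothesis applies.\<close>

lemma orthogonal_projection_exists:
  fixes S :: "('i \<Rightarrow> complex) set"
  assumes "finite I" "(\<lambda>_. 0) \<in> S"
    and "\<And>x y. x \<in> S \<Longrightarrow> y \<in> S \<Longrightarrow> (\<lambda>\<iota>. x \<iota> + y \<iota>) \<in> S"
    and "\<And>x c. x \<in> S \<Longrightarrow> (\<lambda>\<iota>. c * x \<iota>) \<in> S"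
    and "\<And>x \<iota>. x \<in> S \<Longrightarrow> \<iota> \<notin> I \<Longrightarrow> x \<iota> = 0"
  shows "\<exists>s\<in>S. \<forall>u\<in>S. (\<Sum>\<iota>\<in>I. (v \<iota> - s \<iota>) * cnj (u \<iota>)) = 0"
  using assms
proof (induction I arbitrary: S v rule: finite_induct)
  case empty
  then show ?case by auto
next
  case (insert i I)
  note S0 = insert.prems(1) and Sadd = insert.prems(2) and Ssm = insert.prems(3) and Svan = insert.prems(4)
  define P where "P w u = (\<Sum>\<iota>\<in>insert i I. w \<iota> * cnj (u \<iota>))" for w u :: "'i \<Rightarrow> complex"
  have Padd: "P w (\<lambda>\<iota>. x \<iota> + c * y \<iota>) = P w x + cnj c * P w y" for w x y c
    unfolding P_def by (simp add: sum.distrib sum_distrib_left algebra_simps)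
  have Pdiff: "P (\<lambda>\<iota>. x \<iota> - (s \<iota> + c * y \<iota>)) w = P (\<lambda>\<iota>. x \<iota> - s \<iota>) w - c * P y w" for w x y s c
    unfolding P_def by (simp add: sum.distrib sum_subtractf sum_distrib_left algebra_simps)
  define S' where "S' = {x\<in>S. x i = 0}"
  have IH: "\<exists>s\<in>S'. \<forall>u\<in>S'. P (\<lambda>\<iota>. w \<iota> - s \<iota>) u = 0" for w
  proof -
    have "\<exists>s\<in>S'. \<forall>u\<in>S'. (\<Sum>\<iota>\<in>I. (w \<iota> - s \<iota>) * cnj (u \<iota>)) = 0"
      by (rule insert.IH) (auto simp: S'_def S0 Sadd Ssm, metis Svan insertE)
    moreover have "P (\<lambda>\<iota>. w \<iota> - s \<iota>) u = (\<Sum>\<iota>\<in>I. (w \<iota> - s \<iota>) * cnj (u \<iota>))" if "u \<in> S'" for u s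
      using that insert.hyps by (simp add: P_def S'_def)
    ultimately show ?thesis by auto
  qed
  have "\<exists>s\<in>S. \<forall>u\<in>S. P (\<lambda>\<iota>. v \<iota> - s \<iota>) u = 0"
  proof (cases "S' = S")
    case True
    then show ?thesis using IH[of v] by simp
  next
    case False
    then obtain u where u: "u \<in> S" "u i \<noteq> 0" by (auto simp: S'_def)
    obtain u' where u': "u' \<in> S'" "\<forall>x\<in>S'. P (\<lambda>\<iota>. u \<iota> - u' \<iota>) x = 0" using IH by blast
    \<comment> \<open>\<open>u1\<close> spans the orthogonal complement of \<open>S'\<close> in
      \<open>S\<close>; it does not vanish at \<open>i\<close> because \<open>u\<close> does not and
      \<open>u'\<close> does.\<close>
    define u1 where "u1 = (\<lambda>\<iota>. u \<iota> + (-1) * u' \<iota>)"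
    have u1S: "u1 \<in> S" unfolding u1_def using u u' by (intro Sadd Ssm) (auto simp: S'_def)
    have u1i: "u1 i \<noteq> 0" using u u' by (simp add: u1_def S'_def)
    have u1o: "P u1 x = 0" if "x \<in> S'" for x using u' that by (simp add: u1_def)
    have n2: "P u1 u1 \<noteq> 0"
    proof
      assume "P u1 u1 = 0"
      moreover have "P u1 u1 = of_real (\<Sum>\<iota>\<in>insert i I. (cmod (u1 \<iota>))\<^sup>2)"
        unfolding P_def by (simp only: of_real_sum complex_norm_square)
      ultimately have "(\<Sum>\<iota>\<in>insert i I. (cmod (u1 \<iota>))\<^sup>2) = 0"
        by (metis of_real_eq_0_iff)
      then have "(cmod (u1 i))\<^sup>2 = 0"
        using insert.hyps by (subst (asm) sum_nonneg_eq_0_iff) auto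
      then show False using u1i by simp
    qed
    obtain s0 where s0: "s0 \<in> S'" "\<forall>x\<in>S'. P (\<lambda>\<iota>. v \<iota> - s0 \<iota>) x = 0" using IH by blast
    define k where "k = P (\<lambda>\<iota>. v \<iota> - s0 \<iota>) u1 / P u1 u1"
    define s where "s = (\<lambda>\<iota>. s0 \<iota> + k * u1 \<iota>)"
    have sS: "s \<in> S" unfolding s_def using s0 u1S by (intro Sadd Ssm) (auto simp: S'_def)
    have a: "P (\<lambda>\<iota>. v \<iota> - s \<iota>) x = 0" if "x \<in> S'" for x
      unfolding s_def Pdiff using s0 u1o that by simp
    have b: "P (\<lambda>\<iota>. v \<iota> - s \<iota>) u1 = 0"
      unfolding s_def Pdiff k_def using n2 by simp
    have "P (\<lambda>\<iota>. v \<iota> - s \<iota>) x = 0" if x: "x \<in> S" for x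
    proof -
      define c where "c = x i / u1 i"
      define x0 where "x0 = (\<lambda>\<iota>. x \<iota> + (-c) * u1 \<iota>)"
      have "x0 \<in> S" unfolding x0_def using x u1S by (intro Sadd Ssm)
      then have "x0 \<in> S'" using u1i by (simp add: S'_def x0_def c_def)
      then have "P (\<lambda>\<iota>. v \<iota> - s \<iota>) (\<lambda>\<iota>. x0 \<iota> + c * u1 \<iota>) = 0" using a b by (simp only: Padd) simp
      then show ?thesis by (simp add: x0_def)
    qed
    then show ?thesis using sS by blast
  qed
  then show ?case by (simp add: P_def)
qed

section \<open>The action on the module \<open>M\<close>\<close>

abbreviation herm_k :: "nat \<Rightarrow> nat \<Rightarrow> tens \<Rightarrow> tens \<Rightarrow> complex" where
  "herm_k n k \<equiv> herm n {1..k} {1..k}"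

lemma act_eq: "act n k X x \<iota> = (if \<iota> \<in> Idx n k then gl_act n {1..k} {1..k} X x \<iota> else 0)"
  unfolding act_def gl_act_def left_act_def right_act_def by simp

lemma Idx_eq: "Idx n k = fbox n {1..k} \<times> fbox n {1..k}"
  by (simp add: Idx_def)

lemma gl_act_cong:
  assumes "\<And>\<iota>. \<iota> \<in> fbox n A \<times> fbox n B \<Longrightarrow> x \<iota> = y \<iota>" "\<iota> \<in> fbox n A \<times> fbox n B"
  shows "gl_act n A B X x \<iota> = gl_act n A B X y \<iota>"
proof -
  obtain a b where [simp]: "\<iota> = (a, b)" by (cases \<iota>)
  have "x (a(p := c), b) = y (a(p := c), b)" if "p \<in> A" "c \<in> {1..n}" for p c
    using that assms by (intro assms(1)) (auto intro!: fbox_upd)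
  moreover have "x (a, b(p := c)) = y (a, b(p := c))" if "p \<in> B" "c \<in> {1..n}" for p c
    using that assms by (intro assms(1)) (auto intro!: fbox_upd)
  ultimately show ?thesis unfolding gl_act_def left_act_def right_act_def by simp
qed

lemma McarD: "x \<in> Mcar n k \<Longrightarrow> \<iota> \<notin> Idx n k \<Longrightarrow> x \<iota> = 0"
  unfolding Mcar_def by blast

lemma act_Mcar [simp]: "act n k X x \<in> Mcar n k"
  by (simp add: Mcar_def act_eq)

lemma act_add: "act n k X (\<lambda>\<iota>. x \<iota> + y \<iota>) = (\<lambda>\<iota>. act n k X x \<iota> + act n k X y \<iota>)"
  by (auto simp: act_eq gl_act_add)

lemma act_smult: "act n k X (\<lambda>\<iota>. c * x \<iota>) = (\<lambda>\<iota>. c * act n k X x \<iota>)"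
  by (auto simp: act_eq gl_act_smult)

lemma act_sum: "act n k X (\<lambda>\<iota>. \<Sum>d\<in>D. f d \<iota>) = (\<lambda>\<iota>. \<Sum>d\<in>D. act n k X (f d) \<iota>)"
proof (cases "finite D")
  case True
  then show ?thesis
    by (induction D rule: finite_induct) (auto simp: act_add act_smult[of n k X 0, simplified])
qed (simp add: act_smult[of n k X 0, simplified])

lemma act_comm:
  "act n k X (act n k Y x) = (\<lambda>\<iota>. act n k Y (act n k X x) \<iota> + act n k (comm n X Y) x \<iota>)"
proof
  fix \<iota>
  have "gl_act n {1..k} {1..k} X (act n k Y x) \<iota> = gl_act n {1..k} {1..k} X (gl_act n {1..k} {1..k} Y x) \<iota>"
    if "\<iota> \<in> Idx n k" for X Y
    by (rule gl_act_cong) (use that in \<open>auto simp: act_eq Idx_eq\<close>)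
  then show "act n k X (act n k Y x) \<iota> = act n k Y (act n k X x) \<iota> + act n k (comm n X Y) x \<iota>"
    using gl_act_comm[of "{1..k}" "{1..k}" n X Y x \<iota>] by (simp add: act_eq)
qed

lemma act_adj: "herm_k n k (act n k X x) y = herm_k n k x (act n k (adj X) y)"
proof -
  have "herm_k n k (act n k X x) y = herm_k n k (gl_act n {1..k} {1..k} X x) y"
    by (rule herm_cong) (auto simp: act_eq Idx_eq)
  also have "\<dots> = herm_k n k x (gl_act n {1..k} {1..k} (adj X) y)" by (rule gl_act_adj)
  also have "\<dots> = herm_k n k x (act n k (adj X) y)"
    by (rule herm_cong) (auto simp: act_eq Idx_eq)
  finally show ?thesis .
qed

lemma sum_Eij_left:
  assumes "i0 \<in> {1..n}" "c \<in> {1..n}"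
  shows "(\<Sum>i\<in>{1..n}. \<Sum>j\<in>{1..n}. X i j * Eij i j i0 c) = X i0 c"
proof -
  have "(\<Sum>i\<in>{1..n}. \<Sum>j\<in>{1..n}. X i j * Eij i j i0 c)
    = (\<Sum>i\<in>{1..n}. \<Sum>j\<in>{1..n}. if j = c then (if i = i0 then X i0 c else 0) else 0)"
    by (intro sum.cong) (auto simp: Eij_def)
  also have "\<dots> = X i0 c" using assms by simp
  finally show ?thesis .
qed

text \<open>Submodules are closed under all matrices, whereas the highest weight argument knows only
  the matrix units; this expansion connects the two.\<close>

lemma act_expand:
  "act n k X x = (\<lambda>\<iota>. \<Sum>ij\<in>{1..n}\<times>{1..n}. X (fst ij) (snd ij) * act n k (Eij (fst ij) (snd ij)) x \<iota>)"
proof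
  fix \<iota>
  have "act n k X x \<iota> = (\<Sum>i\<in>{1..n}. \<Sum>j\<in>{1..n}. X i j * act n k (Eij i j) x \<iota>)"
  proof (cases "\<iota> \<in> Idx n k")
    case True
    then obtain a b where ab: "\<iota> = (a, b)" "a \<in> fbox n {1..k}" "b \<in> fbox n {1..k}" by (auto simp: Idx_eq)
    have 1: "left_act n {1..k} X x (a, b) = (\<Sum>i\<in>{1..n}. \<Sum>j\<in>{1..n}. X i j * left_act n {1..k} (Eij i j) x (a, b))"
    proof -
      have "left_act n {1..k} X x (a, b) = (\<Sum>p\<in>{1..k}. \<Sum>c\<in>{1..n}. (\<Sum>i\<in>{1..n}. \<Sum>j\<in>{1..n}. X i j * Eij i j (a p) c) * x (a(p := c), b))"
        unfolding left_act_def by (intro sum.cong refl) (use fbox_val[OF ab(2)] in \<open>simp add: sum_Eij_left\<close>)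
      also have "\<dots> = (\<Sum>p\<in>{1..k}. \<Sum>i\<in>{1..n}. \<Sum>c\<in>{1..n}. \<Sum>j\<in>{1..n}. X i j * Eij i j (a p) c * x (a(p := c), b))"
        unfolding sum_distrib_right by (intro sum.cong refl sum.swap)
      also have "\<dots> = (\<Sum>i\<in>{1..n}. \<Sum>p\<in>{1..k}. \<Sum>j\<in>{1..n}. \<Sum>c\<in>{1..n}. X i j * Eij i j (a p) c * x (a(p := c), b))"
        by (subst sum.swap) (intro sum.cong refl sum.swap)
      also have "\<dots> = (\<Sum>i\<in>{1..n}. \<Sum>j\<in>{1..n}. \<Sum>p\<in>{1..k}. \<Sum>c\<in>{1..n}. X i j * Eij i j (a p) c * x (a(p := c), b))"
        by (intro sum.cong refl sum.swap)
      finally show ?thesis by (simp add: left_act_def sum_distrib_left mult.assoc)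
    qed
    have 2: "right_act n {1..k} X x (a, b) = (\<Sum>i\<in>{1..n}. \<Sum>j\<in>{1..n}. X i j * right_act n {1..k} (Eij i j) x (a, b))"
    proof -
      have "right_act n {1..k} X x (a, b) = (\<Sum>p\<in>{1..k}. \<Sum>c\<in>{1..n}. (\<Sum>i\<in>{1..n}. \<Sum>j\<in>{1..n}. X i j * Eij i j c (b p)) * x (a, b(p := c)))"
        unfolding right_act_def by (intro sum.cong refl) (use fbox_val[OF ab(3)] in \<open>simp add: sum_Eij_left mult.commute\<close>)
      also have "\<dots> = (\<Sum>p\<in>{1..k}. \<Sum>i\<in>{1..n}. \<Sum>c\<in>{1..n}. \<Sum>j\<in>{1..n}. X i j * Eij i j c (b p) * x (a, b(p := c)))"
        unfolding sum_distrib_right by (intro sum.cong refl sum.swap)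
      also have "\<dots> = (\<Sum>i\<in>{1..n}. \<Sum>p\<in>{1..k}. \<Sum>j\<in>{1..n}. \<Sum>c\<in>{1..n}. X i j * Eij i j c (b p) * x (a, b(p := c)))"
        by (subst sum.swap) (intro sum.cong refl sum.swap)
      also have "\<dots> = (\<Sum>i\<in>{1..n}. \<Sum>j\<in>{1..n}. \<Sum>p\<in>{1..k}. \<Sum>c\<in>{1..n}. X i j * Eij i j c (b p) * x (a, b(p := c)))"
        by (intro sum.cong refl sum.swap)
      finally show ?thesis by (simp add: right_act_def sum_distrib_left mult.assoc mult.commute mult.left_commute)
    qed
    show ?thesis using True unfolding act_eq gl_act_def ab(1) 1 2
      by (simp add: sum_subtractf right_diff_distrib)
  qed (simp add: act_eq)
  then show "act n k X x \<iota> = (\<Sum>ij\<in>{1..n}\<times>{1..n}. X (fst ij) (snd ij) * act n k (Eij (fst ij) (snd ij)) x \<iota>)"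
    by (simp add: sum.cartesian_product case_prod_unfold)
qed

subsection \<open>Submodules\<close>

lemma is_submodD:
  assumes "is_submod n k S"
  shows "S \<subseteq> Mcar n k" "zerot \<in> S" "\<And>x y. x \<in> S \<Longrightarrow> y \<in> S \<Longrightarrow> (\<lambda>\<iota>. x \<iota> + y \<iota>) \<in> S"
    "\<And>x c. x \<in> S \<Longrightarrow> (\<lambda>\<iota>. c * x \<iota>) \<in> S" "\<And>x X. x \<in> S \<Longrightarrow> act n k X x \<in> S"
  using assms unfolding is_submod_def by auto

lemma submod_diff: "is_submod n k S \<Longrightarrow> x \<in> S \<Longrightarrow> y \<in> S \<Longrightarrow> (\<lambda>\<iota>. x \<iota> - y \<iota>) \<in> S"
  using is_submodD(3)[of n k S x "\<lambda>\<iota>. (-1) * y \<iota>"] is_submodD(4)[of n k S y "-1"] by simp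

lemma submod_sum:
  assumes "is_submod n k S" "\<And>d. d \<in> D \<Longrightarrow> f d \<in> S"
  shows "(\<lambda>\<iota>. \<Sum>d\<in>D. f d \<iota>) \<in> S"
proof (cases "finite D")
  case True
  then show ?thesis using assms(2)
  proof (induction D rule: finite_induct)
    case empty
    then show ?case by (simp add: is_submodD(2)[OF assms(1), unfolded zerot_def])
  next
    case (insert d D)
    then show ?case using is_submodD(3)[OF assms(1), of "f d" "\<lambda>\<iota>. \<Sum>d\<in>D. f d \<iota>"] by simp
  qed
qed (simp add: is_submodD(2)[OF assms(1), unfolded zerot_def])

lemma Mcar_submod: "is_submod n k (Mcar n k)"
  by (auto simp: is_submod_def zerot_def) (auto simp: Mcar_def)

lemma Ugen_submod: "x \<in> Mcar n k \<Longrightarrow> is_submod n k (Ugen n k x)"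
  unfolding is_submod_def[of n k "Ugen n k x"]
  unfolding Ugen_def using Mcar_submod[of n k]
  by (auto simp: is_submodD)

lemma Ugen_self: "x \<in> Ugen n k x"
  by (auto simp: Ugen_def)

lemma Ugen_least: "is_submod n k S \<Longrightarrow> x \<in> S \<Longrightarrow> Ugen n k x \<subseteq> S"
  by (auto simp: Ugen_def)

lemma submod_Int: "is_submod n k S \<Longrightarrow> is_submod n k S' \<Longrightarrow> is_submod n k (S \<inter> S')"
  unfolding is_submod_def[of n k "S \<inter> S'"] by (auto dest: is_submodD)

text \<open>Endomorphisms of \<open>M\<close>. Membership is demanded only for arguments in
  \<open>Mcar n k\<close>, since the identity and the place permutations do not cut off functions
  outside the index set.\<close>

definition mhom :: "nat \<Rightarrow> nat \<Rightarrow> (tens \<Rightarrow> tens) \<Rightarrow> bool" where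
  "mhom n k f \<longleftrightarrow> (\<forall>x\<in>Mcar n k. f x \<in> Mcar n k)
     \<and> (\<forall>x y. f (\<lambda>\<iota>. x \<iota> + y \<iota>) = (\<lambda>\<iota>. f x \<iota> + f y \<iota>))
     \<and> (\<forall>x c. f (\<lambda>\<iota>. c * x \<iota>) = (\<lambda>\<iota>. c * f x \<iota>))
     \<and> (\<forall>X. \<forall>x\<in>Mcar n k. f (act n k X x) = act n k X (f x))"

lemma mhomD:
  assumes "mhom n k f"
  shows "\<And>x. x \<in> Mcar n k \<Longrightarrow> f x \<in> Mcar n k"
    "\<And>x y. f (\<lambda>\<iota>. x \<iota> + y \<iota>) = (\<lambda>\<iota>. f x \<iota> + f y \<iota>)"
    "\<And>x c. f (\<lambda>\<iota>. c * x \<iota>) = (\<lambda>\<iota>. c * f x \<iota>)"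
    "\<And>x X. x \<in> Mcar n k \<Longrightarrow> f (act n k X x) = act n k X (f x)"
  using assms unfolding mhom_def by blast+

lemma mhom_zero:
  assumes "mhom n k f"
  shows "f zerot = zerot"
  using mhomD(3)[OF assms, of 0 zerot] by (simp add: zerot_def)

lemma mhom_comp:
  assumes "mhom n k f" "mhom n k g"
  shows "mhom n k (f \<circ> g)"
  unfolding mhom_def[of n k "f \<circ> g"]
  by (simp add: mhomD[OF assms(1)] mhomD[OF assms(2)])

lemma mhom_image_submod:
  assumes "mhom n k f" "is_submod n k S"
  shows "is_submod n k (f ` S)"
  unfolding is_submod_def
proof (intro conjI ballI allI)
  show "f ` S \<subseteq> Mcar n k" using mhomD(1)[OF assms(1)] is_submodD(1)[OF assms(2)] by blast
  show "zerot \<in> f ` S"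
    using imageI[OF is_submodD(2)[OF assms(2)], of f] by (simp add: mhom_zero[OF assms(1)])
next
  fix x y assume "x \<in> f ` S" "y \<in> f ` S"
  then obtain x' y' where "x = f x'" "x' \<in> S" "y = f y'" "y' \<in> S" by blast
  then show "(\<lambda>\<iota>. x \<iota> + y \<iota>) \<in> f ` S"
    by (intro image_eqI[of _ f "\<lambda>\<iota>. x' \<iota> + y' \<iota>"])
      (simp_all add: mhomD(2)[OF assms(1)] is_submodD(3)[OF assms(2)])
next
  fix x c assume "x \<in> f ` S"
  then obtain x' where "x = f x'" "x' \<in> S" by blast
  then show "(\<lambda>\<iota>. c * x \<iota>) \<in> f ` S"
    by (intro image_eqI[of _ f "\<lambda>\<iota>. c * x' \<iota>"])
      (simp_all add: mhomD(3)[OF assms(1)] is_submodD(4)[OF assms(2)])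
next
  fix x X assume "x \<in> f ` S"
  then obtain x' where x': "x = f x'" "x' \<in> S" by blast
  then have "x' \<in> Mcar n k" using is_submodD(1)[OF assms(2)] by blast
  with x' show "act n k X x \<in> f ` S"
    by (intro image_eqI[of _ f "act n k X x'"])
      (simp_all add: mhomD(4)[OF assms(1)] is_submodD(5)[OF assms(2)])
qed

text \<open>Images and preimages of submodules under an equivariant map are submodules, so both
  inclusions follow from minimality of \<open>Ugen\<close>. This is the source of the equalities
  between the three descriptions of the module in part (1).\<close>

lemma Ugen_image:
  assumes "mhom n k f" "x \<in> Mcar n k"
  shows "f ` Ugen n k x = Ugen n k (f x)"
proof
  have fx: "f x \<in> Mcar n k" using mhomD(1)[OF assms(1)] assms(2) by blast
  note U = is_submodD[OF Ugen_submod[OF fx]] and M = is_submodD[OF Mcar_submod[of n k]]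
  let ?S = "{z\<in>Mcar n k. f z \<in> Ugen n k (f x)}"
  have "is_submod n k ?S"
    unfolding is_submod_def
    by (simp add: mhom_zero[OF assms(1)] mhomD[OF assms(1)] U(2-5) M(2-4) Collect_subset)
  then have "Ugen n k x \<subseteq> ?S"
    by (rule Ugen_least) (simp add: assms(2) Ugen_self)
  then show "f ` Ugen n k x \<subseteq> Ugen n k (f x)" by blast
  show "Ugen n k (f x) \<subseteq> f ` Ugen n k x"
    by (intro Ugen_least mhom_image_submod assms Ugen_submod imageI Ugen_self)
qed

lemma herm_k_self_eq_0:
  assumes "x \<in> Mcar n k" "herm_k n k x x = 0"
  shows "x = zerot"
proof
  fix \<iota>
  show "x \<iota> = zerot \<iota>"
  proof (cases "\<iota> \<in> Idx n k")
    case True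
    then show ?thesis using herm_self_eq_0[of "{1..k}" "{1..k}" n x \<iota>] assms(2) by (simp add: Idx_eq zerot_def)
  qed (simp add: McarD[OF assms(1)] zerot_def)
qed

definition orth :: "nat \<Rightarrow> nat \<Rightarrow> tens set \<Rightarrow> tens set" where
  "orth n k S = {x\<in>Mcar n k. \<forall>u\<in>S. herm_k n k x u = 0}"

text \<open>The adjoint of \<open>X\<close> is again a matrix and maps \<open>S\<close> into itself,
  so the complement is stable. This takes the place of a general theorem on complete
  reducibility.\<close>

lemma orth_submod:
  assumes "is_submod n k S"
  shows "is_submod n k (orth n k S)"
  unfolding is_submod_def
proof (intro conjI ballI allI)
  show "orth n k S \<subseteq> Mcar n k" by (auto simp: orth_def)
  show "zerot \<in> orth n k S" using is_submodD(2)[OF Mcar_submod] by (simp add: orth_def zerot_def)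
qed (auto simp: orth_def herm_add_left herm_smult_left act_adj is_submodD[OF assms]
    intro: is_submodD[OF Mcar_submod])

lemma submod_projection:
  assumes "is_submod n k S" "v \<in> Mcar n k"
  obtains s where "s \<in> S" "(\<lambda>\<iota>. v \<iota> - s \<iota>) \<in> orth n k S"
proof -
  have "\<exists>s\<in>S. \<forall>u\<in>S. (\<Sum>\<iota>\<in>Idx n k. (v \<iota> - s \<iota>) * cnj (u \<iota>)) = 0"
  proof (rule orthogonal_projection_exists)
    show "finite (Idx n k)" by (simp add: Idx_eq)
    show "(\<lambda>_. 0) \<in> S" using is_submodD(2)[OF assms(1)] by (simp add: zerot_def)
    show "x \<iota> = 0" if "x \<in> S" "\<iota> \<notin> Idx n k" for x \<iota>
      using McarD[OF subsetD[OF is_submodD(1)[OF assms(1)]]] that by blast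
  qed (simp_all add: is_submodD[OF assms(1)])
  then obtain s where s: "s \<in> S" "\<forall>u\<in>S. herm_k n k (\<lambda>\<iota>. v \<iota> - s \<iota>) u = 0"
    by (auto simp: herm_def Idx_eq)
  moreover have "(\<lambda>\<iota>. v \<iota> - s \<iota>) \<in> Mcar n k"
    using s(1) assms is_submodD(1) by (intro submod_diff[OF Mcar_submod]) auto
  ultimately show ?thesis using that by (auto simp: orth_def)
qed

subsection \<open>Highest weight vectors\<close>

text \<open>Singular vectors, without any condition on the weight: sums of highest weight vectors of
  different weights are included.\<close>

definition killed :: "nat \<Rightarrow> nat \<Rightarrow> tens \<Rightarrow> bool" where
  "killed n k x \<longleftrightarrow> x \<in> Mcar n k \<and> (\<forall>i j. 1 \<le> i \<longrightarrow> i < j \<longrightarrow> j \<le> n \<longrightarrow> act n k (Eij i j) x = zerot)"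

definition hw_vector :: "nat \<Rightarrow> nat \<Rightarrow> (nat \<Rightarrow> complex) \<Rightarrow> tens \<Rightarrow> bool" where
  "hw_vector n k \<omega> v \<longleftrightarrow> killed n k v \<and> (\<forall>i\<in>{1..n}. act n k (Eij i i) v = (\<lambda>\<iota>. \<omega> i * v \<iota>))"

text \<open>Takes the place of the enveloping algebra of the strictly lower triangular matrices: the
  span of all words in lowering operators applied to \<open>v\<close>.\<close>

inductive lowgen :: "nat \<Rightarrow> nat \<Rightarrow> tens \<Rightarrow> tens \<Rightarrow> bool" for n k v where
  base: "lowgen n k v v"
| add: "lowgen n k v x \<Longrightarrow> lowgen n k v y \<Longrightarrow> lowgen n k v (\<lambda>\<iota>. x \<iota> + y \<iota>)"
| smult: "lowgen n k v x \<Longrightarrow> lowgen n k v (\<lambda>\<iota>. c * x \<iota>)"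
| low: "lowgen n k v x \<Longrightarrow> 1 \<le> j \<Longrightarrow> j < i \<Longrightarrow> i \<le> n \<Longrightarrow> lowgen n k v (act n k (Eij i j) x)"

lemma lowgen_zero: "lowgen n k v (\<lambda>_. 0)"
  using lowgen.smult[OF lowgen.base, of n k v 0] by simp

lemma lowgen_sum: "(\<And>d. d \<in> D \<Longrightarrow> lowgen n k v (f d)) \<Longrightarrow> lowgen n k v (\<lambda>\<iota>. \<Sum>d\<in>D. f d \<iota>)"
proof (induction D rule: infinite_finite_induct)
  case (insert d D)
  then show ?case using lowgen.add[of n k v "f d" "\<lambda>\<iota>. \<Sum>d\<in>D. f d \<iota>"] by simp
qed (auto simp: lowgen_zero)

text \<open>Moving \<open>X\<close> past a lowering operator costs a commutator, which is again one
  matrix applied to the shorter word. Hence \<open>X\<close> has to be arbitrary in the induction,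
  not just a matrix unit.\<close>

lemma lowgen_act:
  assumes "lowgen n k v x" "hw_vector n k \<omega> v"
  shows "lowgen n k v (act n k X x)"
  using assms(1)
proof (induction arbitrary: X)
  case base
  have "lowgen n k v (act n k (Eij i j) v)" if "i \<in> {1..n}" "j \<in> {1..n}" for i j
  proof -
    consider "i < j" | "i = j" | "j < i" by linarith
    then show ?thesis
    proof cases
      case 1
      then show ?thesis using assms(2) that by (simp add: hw_vector_def killed_def zerot_def lowgen_zero)
    next
      case 2
      then show ?thesis using assms(2) that by (simp add: hw_vector_def lowgen.smult[OF lowgen.base])
    next
      case 3
      then show ?thesis using that by (intro lowgen.low lowgen.base) auto
    qed
  qed
  then show ?case by (subst act_expand) (intro lowgen_sum lowgen.smult, auto)
next
  case (add x y)
  then show ?case by (simp add: act_add lowgen.add)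
next
  case (smult x c)
  then show ?case by (simp add: act_smult lowgen.smult)
next
  case (low x j i)
  show ?case by (subst act_comm) (intro lowgen.add low.IH lowgen.low low.hyps)
qed

lemma lowgen_Mcar:
  assumes "lowgen n k v x" "v \<in> Mcar n k"
  shows "x \<in> Mcar n k"
  using assms(1) by induction (simp_all add: assms(2) is_submodD[OF Mcar_submod])

lemma Ugen_lowgen:
  assumes "hw_vector n k \<omega> v"
  shows "Ugen n k v \<subseteq> {x. lowgen n k v x}"
proof (rule Ugen_least)
  have "v \<in> Mcar n k" using assms by (simp add: hw_vector_def killed_def)
  then show "is_submod n k {x. lowgen n k v x}"
    unfolding is_submod_def
    by (auto simp: lowgen_Mcar lowgen_zero zerot_def lowgen.add lowgen.smult lowgen_act[OF _ assms])
qed (simp add: lowgen.base)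

lemma herm_k_lower_killed:
  assumes "killed n k u" "1 \<le> j" "j < i" "i \<le> n"
  shows "herm_k n k (act n k (Eij i j) x) u = 0"
  using assms by (simp add: act_adj adj_Eij killed_def zerot_def)

text \<open>Since the adjoint of a lowering operator is a raising operator, everything generated below
  \<open>v\<close> is orthogonal to all highest weight vectors.\<close>

lemma Ugen_decomp:
  assumes "hw_vector n k \<omega> v" "x \<in> Ugen n k v"
  shows "\<exists>c. \<forall>u. killed n k u \<longrightarrow> herm_k n k x u = c * herm_k n k v u"
proof -
  have "lowgen n k v x" using Ugen_lowgen[OF assms(1)] assms(2) by blast
  then show ?thesis
  proof induction
    case base
    show ?case by (rule exI[of _ 1]) simp
  next
    case (add x y)
    then obtain c d where "\<forall>u. killed n k u \<longrightarrow> herm_k n k x u = c * herm_k n k v u"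
      "\<forall>u. killed n k u \<longrightarrow> herm_k n k y u = d * herm_k n k v u" by blast
    then show ?case by (intro exI[of _ "c + d"]) (simp add: herm_add_left algebra_simps)
  next
    case (smult x c)
    then obtain d where "\<forall>u. killed n k u \<longrightarrow> herm_k n k x u = d * herm_k n k v u" by blast
    then show ?case by (intro exI[of _ "c * d"]) (simp add: herm_smult_left)
  next
    case (low x j i)
    then show ?case by (intro exI[of _ 0]) (simp add: herm_k_lower_killed)
  qed
qed

lemma killed_diff:
  assumes "killed n k x" "killed n k y"
  shows "killed n k (\<lambda>\<iota>. x \<iota> - y \<iota>)"
proof -
  have "act n k X (\<lambda>\<iota>. x \<iota> - y \<iota>) = (\<lambda>\<iota>. act n k X x \<iota> + (- 1) * act n k X y \<iota>)" for X
    using act_add[of n k X x "\<lambda>\<iota>. (-1) * y \<iota>"] by (simp add: act_smult[of n k X "-1" y, simplified])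
  then show ?thesis using assms submod_diff[OF Mcar_submod, of x n k y]
    by (simp add: killed_def zerot_def)
qed

text \<open>With \<open>s\<close> the projection of \<open>v\<close>, \<open>act n k X s\<close>
  lies in \<open>S\<close>; as \<open>act n k X v\<close> vanishes, it is minus the image of
  \<open>v - s\<close> and so lies in the complement too. It is therefore orthogonal to
  itself.\<close>

lemma killed_split:
  assumes "killed n k v" "is_submod n k S" "s \<in> S" "(\<lambda>\<iota>. v \<iota> - s \<iota>) \<in> orth n k S"
  shows "killed n k s"
  unfolding killed_def
proof (intro conjI allI impI)
  show "s \<in> Mcar n k" using is_submodD(1)[OF assms(2)] assms(3) by blast
  fix i j assume ij: "1 \<le> i" "i < j" "j \<le> n"
  define X where "X = Eij i j"
  have v: "act n k X v = zerot" using assms(1) ij by (simp add: killed_def X_def)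
  have "act n k X (\<lambda>\<iota>. v \<iota> - s \<iota>) = (\<lambda>\<iota>. act n k X v \<iota> + (- 1) * act n k X s \<iota>)"
    using act_add[of n k X v "\<lambda>\<iota>. (-1) * s \<iota>"] by (simp add: act_smult[of n k X "-1" s, simplified])
  then have "act n k X (\<lambda>\<iota>. v \<iota> - s \<iota>) = (\<lambda>\<iota>. (-1) * act n k X s \<iota>)" by (simp add: v zerot_def)
  then have "(\<lambda>\<iota>. (-1) * act n k X s \<iota>) \<in> orth n k S"
    using is_submodD(5)[OF orth_submod[OF assms(2)] assms(4), of X] by simp
  then have "act n k X s \<in> orth n k S"
    using is_submodD(4)[OF orth_submod[OF assms(2)], of _ "-1"] by fastforce
  moreover have "act n k X s \<in> S" using assms by (intro is_submodD(5))
  ultimately have "herm_k n k (act n k X s) (act n k X s) = 0" by (simp add: orth_def)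
  then show "act n k (Eij i j) s = zerot" using herm_k_self_eq_0[OF act_Mcar] by (simp add: X_def)
qed

text \<open>Splitting \<open>v = s' + s\<close> along \<open>S\<close> gives two singular vectors.
  By \<open>Ugen_decomp\<close>, \<open>s\<close> pairs with singular vectors like a multiple
  \<open>c * v\<close>; pairing with \<open>s'\<close> yields \<open>c * |s'|^2 = 0\<close>. Either
  \<open>s' = 0\<close> and \<open>v\<close> lies in \<open>S\<close>, or \<open>c = 0\<close>,
  hence \<open>s = 0\<close> and \<open>S\<close> is orthogonal to all of
  \<open>Ugen n k v\<close>.\<close>

theorem hw_vector_irreducible:
  assumes hw: "hw_vector n k \<omega> v" and "v \<noteq> zerot"
  shows "irreducible_mod n k (Ugen n k v)"
  unfolding irreducible_mod_def
proof (intro conjI allI impI)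
  have kv: "killed n k v" using hw by (simp add: hw_vector_def)
  then have vM: "v \<in> Mcar n k" by (simp add: killed_def)
  show U: "is_submod n k (Ugen n k v)" by (rule Ugen_submod[OF vM])
  show "Ugen n k v \<noteq> {zerot}" using Ugen_self[of v n k] assms(2) by blast
  fix S assume "is_submod n k S \<and> S \<subseteq> Ugen n k v"
  then have S: "is_submod n k S" "S \<subseteq> Ugen n k v" by auto
  obtain s where s: "s \<in> S" "(\<lambda>\<iota>. v \<iota> - s \<iota>) \<in> orth n k S" using submod_projection[OF S(1) vM] by blast
  define s' where "s' = (\<lambda>\<iota>. v \<iota> - s \<iota>)"
  have ks: "killed n k s" by (rule killed_split[OF kv S(1) s])
  have ks': "killed n k s'" unfolding s'_def by (rule killed_diff[OF kv ks])
  have vs: "v = (\<lambda>\<iota>. s' \<iota> + s \<iota>)" by (simp add: s'_def)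
  have "herm_k n k s' s = 0" using s by (simp add: orth_def s'_def)
  then have s's: "herm_k n k s s' = 0" using herm_cnj[of n "{1..k}" "{1..k}" s' s] by simp
  obtain c where c: "\<And>u. killed n k u \<Longrightarrow> herm_k n k s u = c * herm_k n k v u"
    using Ugen_decomp[OF hw] s(1) S(2) by blast
  have "c * herm_k n k s' s' = 0" using c[OF ks'] s's by (simp add: vs herm_add_left)
  then consider "c = 0" | "s' = zerot"
    using herm_k_self_eq_0[of s' n k] ks' by (auto simp: killed_def)
  then show "S = {zerot} \<or> S = Ugen n k v"
  proof cases
    case 1
    then have "s = zerot" using c[OF ks] herm_k_self_eq_0[of s n k] ks by (simp add: killed_def)
    then have "v \<in> orth n k S" using s(2) by (simp add: zerot_def)
    then have "Ugen n k v \<subseteq> orth n k S" by (intro Ugen_least orth_submod S(1))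
    then have "x = zerot" if "x \<in> S" for x
      using that S herm_k_self_eq_0[of x n k] is_submodD(1)[OF S(1)] by (auto simp: orth_def)
    then show ?thesis using is_submodD(2)[OF S(1)] by blast
  next
    case 2
    then have "v = s" using vs by (simp add: zerot_def)
    then show ?thesis using Ugen_least[OF S(1), of v] s(1) S(2) by blast
  qed
qed

text \<open>Raising operators strictly lower this number on the support: an entry \<open>j\<close>
  of a \<open>V\<close> slot becomes a smaller \<open>i\<close>, an entry \<open>i\<close> of a dual
  slot becomes a larger \<open>j\<close>, hence the reflected summand
  \<open>n - snd \<iota> p\<close>.\<close>

definition height :: "nat \<Rightarrow> nat \<Rightarrow> idx \<Rightarrow> nat" where
  "height n k \<iota> = (\<Sum>p\<in>{1..k}. fst \<iota> p) + (\<Sum>p\<in>{1..k}. n - snd \<iota> p)"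

text \<open>Stated with sums on both sides to stay clear of subtraction on the naturals; the
  function \<open>f\<close> covers both halves of \<open>height\<close>.\<close>

lemma sum_upd_nat:
  fixes a :: "nat \<Rightarrow> nat"
  assumes "finite A" "p \<in> A"
  shows "(\<Sum>q\<in>A. f ((a(p := c)) q)) + f (a p) = (\<Sum>q\<in>A. f (a q)) + (f c :: nat)"
  using assms by (subst (1 2) sum.remove[of _ p]) auto

lemma act_height:
  assumes "\<And>\<iota>. x \<iota> \<noteq> 0 \<Longrightarrow> height n k \<iota> < Suc D" "1 \<le> i" "i < j" "j \<le> n"
    "act n k (Eij i j) x \<iota> \<noteq> 0"
  shows "height n k \<iota> < D"
proof -
  obtain a b where ab: "\<iota> = (a, b)" by (cases \<iota>)
  have "gl_act n {1..k} {1..k} (Eij i j) x (a, b) \<noteq> 0" using assms(5) by (auto simp: act_eq ab split: if_splits)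
  then have "(\<Sum>p\<in>{p\<in>{1..k}. a p = i}. x (a(p := j), b)) \<noteq> 0 \<or> (\<Sum>q\<in>{q\<in>{1..k}. b q = j}. x (a, b(q := i))) \<noteq> 0"
    using assms(2-4) by (subst (asm) gl_act_Eij) auto
  then consider p where "p \<in> {1..k}" "a p = i" "x (a(p := j), b) \<noteq> 0"
    | q where "q \<in> {1..k}" "b q = j" "x (a, b(q := i)) \<noteq> 0"
    by (metis (mono_tags, lifting) mem_Collect_eq sum.neutral)
  then show ?thesis
  proof cases
    case 1
    then show ?thesis using assms(1)[OF 1(3)] assms(3) sum_upd_nat[of "{1..k}" p "\<lambda>x. x" a j]
      by (simp add: height_def ab)
  next
    case 2
    then show ?thesis using assms(1)[OF 2(3)] assms(3,4) sum_upd_nat[of "{1..k}" q "\<lambda>x. n - x" b i]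
      by (simp add: height_def ab)
  qed
qed

text \<open>Among the nonzero members of \<open>S\<close> one is chosen with the smallest strict
  bound on the heights of its support. A raising operator could only produce a member with a smaller
  bound, so its result is zero.\<close>

lemma killed_exists:
  assumes "is_submod n k S" "S \<noteq> {zerot}"
  shows "\<exists>z\<in>S. z \<noteq> zerot \<and> killed n k z"
proof -
  obtain z0 where z0: "z0 \<in> S" "z0 \<noteq> zerot" using assms is_submodD(2)[OF assms(1)] by blast
  define P where "P D \<longleftrightarrow> (\<exists>z\<in>S. z \<noteq> zerot \<and> (\<forall>\<iota>. z \<iota> \<noteq> 0 \<longrightarrow> height n k \<iota> < D))" for D
  have fin: "finite (height n k ` Idx n k)" by (simp add: Idx_eq)
  have "height n k \<iota> < Suc (Max (height n k ` Idx n k))" if "z0 \<iota> \<noteq> 0" for \<iota>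
  proof -
    have "\<iota> \<in> Idx n k" using McarD[of z0 n k \<iota>] that z0(1) is_submodD(1)[OF assms(1)] by blast
    then show ?thesis using fin by (simp add: less_Suc_eq_le)
  qed
  then have "P (Suc (Max (height n k ` Idx n k)))" unfolding P_def using z0 by blast
  then have "P (LEAST D. P D)" by (rule LeastI)
  then obtain z where z: "z \<in> S" "z \<noteq> zerot" "\<And>\<iota>. z \<iota> \<noteq> 0 \<Longrightarrow> height n k \<iota> < (LEAST D. P D)"
    unfolding P_def by blast
  have "(LEAST D. P D) \<noteq> 0"
  proof
    assume "(LEAST D. P D) = 0"
    then have "z = zerot" using z(3) by (force simp: zerot_def)
    then show False using z(2) by simp
  qed
  then obtain D where D: "(LEAST D. P D) = Suc D" by (cases "LEAST D. P D") auto
  have "act n k (Eij i j) z = zerot" if "1 \<le> i" "i < j" "j \<le> n" for i j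
  proof (rule ccontr)
    assume "act n k (Eij i j) z \<noteq> zerot"
    moreover have "act n k (Eij i j) z \<in> S" using z(1) is_submodD(5)[OF assms(1)] by blast
    ultimately have "P D" unfolding P_def using act_height[of z n k D i j] z(3) that D by auto
    then show False using D not_less_Least[of D P] by simp
  qed
  then show ?thesis using z is_submodD(1)[OF assms(1)] by (auto simp: killed_def)
qed

subsection \<open>Direct sums of highest weight modules\<close>

definition family_sum :: "nat \<Rightarrow> nat \<Rightarrow> 'd set \<Rightarrow> ('d \<Rightarrow> tens set) \<Rightarrow> tens set" where
  "family_sum n k D W = {x. \<exists>f. (\<forall>d\<in>D. f d \<in> W d) \<and> x = (\<lambda>\<iota>. \<Sum>d\<in>D. f d \<iota>)}"

lemma family_sum_submod:
  assumes "\<And>d. d \<in> D \<Longrightarrow> is_submod n k (W d)"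
  shows "is_submod n k (family_sum n k D W)"
  unfolding is_submod_def
proof (intro conjI ballI allI)
  note W = is_submodD[OF assms]
  show "family_sum n k D W \<subseteq> Mcar n k"
    unfolding family_sum_def using W(1) by (auto intro!: submod_sum[OF Mcar_submod])
  show "zerot \<in> family_sum n k D W"
    unfolding family_sum_def using W(2) by (auto simp: zerot_def intro!: exI[of _ "\<lambda>_ _. 0"])
  fix x assume "x \<in> family_sum n k D W"
  then obtain f where f: "\<And>d. d \<in> D \<Longrightarrow> f d \<in> W d" "x = (\<lambda>\<iota>. \<Sum>d\<in>D. f d \<iota>)" unfolding family_sum_def by blast
  {
    fix y assume "y \<in> family_sum n k D W"
    then obtain g where g: "\<And>d. d \<in> D \<Longrightarrow> g d \<in> W d" "y = (\<lambda>\<iota>. \<Sum>d\<in>D. g d \<iota>)" unfolding family_sum_def by blast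
    show "(\<lambda>\<iota>. x \<iota> + y \<iota>) \<in> family_sum n k D W"
      unfolding family_sum_def using f g W(3)
      by (intro CollectI exI[of _ "\<lambda>d \<iota>. f d \<iota> + g d \<iota>"]) (simp add: sum.distrib)
  next
    fix c show "(\<lambda>\<iota>. c * x \<iota>) \<in> family_sum n k D W"
      unfolding family_sum_def using f W(4)
      by (intro CollectI exI[of _ "\<lambda>d \<iota>. c * f d \<iota>"]) (simp add: sum_distrib_left)
  next
    fix X show "act n k X x \<in> family_sum n k D W"
      unfolding family_sum_def using f W(5)
      by (intro CollectI exI[of _ "\<lambda>d. act n k X (f d)"]) (simp add: act_sum)
  }
qed

lemma killed_sum:
  assumes "\<And>d. d \<in> D \<Longrightarrow> killed n k (\<theta> d)"
  shows "killed n k (\<lambda>\<iota>. \<Sum>d\<in>D. c d * \<theta> d \<iota>)"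
proof -
  have M: "(\<lambda>\<iota>. c d * \<theta> d \<iota>) \<in> Mcar n k" if "d \<in> D" for d
    using assms[OF that] by (intro is_submodD(4)[OF Mcar_submod]) (simp add: killed_def)
  have "act n k (Eij i j) (\<lambda>\<iota>. c d * \<theta> d \<iota>) = (\<lambda>_. 0)" if "1 \<le> i" "i < j" "j \<le> n" "d \<in> D" for i j d
    using assms[OF that(4)] that by (simp add: act_smult killed_def zerot_def)
  then show ?thesis unfolding killed_def
    using submod_sum[OF Mcar_submod, of D "\<lambda>d \<iota>. c d * \<theta> d \<iota>"] M
    by (auto simp: act_sum zerot_def)
qed

text \<open>A nonzero complement of the sum inside \<open>E\<close> would contain a singular vector,
  excluded by \<open>compl\<close>. For directness, a nontrivial relation makes some summand meet
  the sum of the others; by irreducibility the whole summand lies in that sum, and pairing with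
  singular vectors turns this into a relation among the \<open>\<theta> d\<close>.\<close>

theorem hw_direct_sum:
  assumes fin: "finite D" and E: "is_submod n k E"
    and th: "\<And>d. d \<in> D \<Longrightarrow> \<theta> d \<in> E" "\<And>d. d \<in> D \<Longrightarrow> hw_vector n k (\<omega> d) (\<theta> d)"
    and indep_of_pairs: "\<And>c. (\<lambda>\<iota>. \<Sum>d\<in>D. c d * \<theta> d \<iota>) = zerot \<Longrightarrow> \<forall>d\<in>D. c d = 0"
    and compl: "\<And>z. z \<in> E \<Longrightarrow> killed n k z \<Longrightarrow> (\<And>d. d \<in> D \<Longrightarrow> herm_k n k z (\<theta> d) = 0) \<Longrightarrow> z = zerot"
  shows "E \<subseteq> family_sum n k D (\<lambda>d. Ugen n k (\<theta> d))"
    and "\<And>f. (\<And>d. d \<in> D \<Longrightarrow> f d \<in> Ugen n k (\<theta> d)) \<Longrightarrow> (\<lambda>\<iota>. \<Sum>d\<in>D. f d \<iota>) = zerot \<Longrightarrow> \<forall>d\<in>D. f d = zerot"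
proof -
  define W where "W d = Ugen n k (\<theta> d)" for d
  have kth: "killed n k (\<theta> d)" if "d \<in> D" for d using th(2)[OF that] by (simp add: hw_vector_def)
  have W: "is_submod n k (W d)" if "d \<in> D" for d
    unfolding W_def using kth[OF that] by (intro Ugen_submod) (simp add: killed_def)
  have WE: "W d \<subseteq> E" if "d \<in> D" for d
    unfolding W_def by (intro Ugen_least E th that)
  have S: "is_submod n k (family_sum n k D W)" by (rule family_sum_submod[OF W])
  have SE: "family_sum n k D W \<subseteq> E" unfolding family_sum_def using WE by (auto intro!: submod_sum[OF E])
  have Win: "W d \<subseteq> family_sum n k D W" if "d \<in> D" for d
  proof
    fix x assume x: "x \<in> W d"
    have "x = (\<lambda>\<iota>. \<Sum>d'\<in>D. (if d' = d then x else zerot) \<iota>)"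
    proof
      fix \<iota>
      have "(\<Sum>d'\<in>D. (if d' = d then x else zerot) \<iota>) = (\<Sum>d'\<in>D. if d' = d then x \<iota> else 0)"
        by (intro sum.cong) (auto simp: zerot_def)
      then show "x \<iota> = (\<Sum>d'\<in>D. (if d' = d then x else zerot) \<iota>)" using fin that by simp
    qed
    then show "x \<in> family_sum n k D W" unfolding family_sum_def
      using x is_submodD(2)[OF W] by (intro CollectI exI[of _ "\<lambda>d'. if d' = d then x else zerot"]) auto
  qed
  let ?Z = "E \<inter> orth n k (family_sum n k D W)"
  have Z: "is_submod n k ?Z" by (intro submod_Int E orth_submod S)
  have "?Z = {zerot}"
  proof (rule ccontr)
    assume "?Z \<noteq> {zerot}"
    then obtain z where z: "z \<in> ?Z" "z \<noteq> zerot" "killed n k z" using killed_exists[OF Z] by blast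
    have "herm_k n k z (\<theta> d) = 0" if "d \<in> D" for d
      using z(1) Win[OF that] Ugen_self[of "\<theta> d" n k] by (auto simp: orth_def W_def)
    then show False using compl[of z] z by blast
  qed
  show "E \<subseteq> family_sum n k D (\<lambda>d. Ugen n k (\<theta> d))"
  proof
    fix v assume v: "v \<in> E"
    then have "v \<in> Mcar n k" using is_submodD(1)[OF E] by blast
    then obtain s where s: "s \<in> family_sum n k D W" "(\<lambda>\<iota>. v \<iota> - s \<iota>) \<in> orth n k (family_sum n k D W)"
      using submod_projection[OF S] by blast
    then have "(\<lambda>\<iota>. v \<iota> - s \<iota>) \<in> ?Z" using submod_diff[OF E v] SE by blast
    then have "(\<lambda>\<iota>. v \<iota> - s \<iota>) = zerot" using \<open>?Z = {zerot}\<close> by blast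
    then have "v = s" by (auto simp: zerot_def fun_eq_iff)
    then show "v \<in> family_sum n k D (\<lambda>d. Ugen n k (\<theta> d))" using s(1) by (simp add: W_def[abs_def])
  qed
  fix f assume f: "\<And>d. d \<in> D \<Longrightarrow> f d \<in> Ugen n k (\<theta> d)" "(\<lambda>\<iota>. \<Sum>d\<in>D. f d \<iota>) = zerot"
  show "\<forall>d\<in>D. f d = zerot"
  proof (rule ccontr)
    assume "\<not> (\<forall>d\<in>D. f d = zerot)"
    then obtain d0 where d0: "d0 \<in> D" "f d0 \<noteq> zerot" by blast
    let ?D = "D - {d0}"
    let ?S = "W d0 \<inter> family_sum n k ?D W"
    have Sm: "is_submod n k ?S" by (intro submod_Int W d0 family_sum_submod) auto
    have nz: "\<theta> d0 \<noteq> zerot"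
    proof
      assume "\<theta> d0 = zerot"
      then have "W d0 \<subseteq> {zerot}" unfolding W_def
        by (intro Ugen_least) (auto simp: is_submod_def zerot_def Mcar_def act_smult[of n k _ 0, simplified])
      then show False using f(1)[OF d0(1)] d0(2) by (auto simp: W_def)
    qed
    have "f d0 = (\<lambda>\<iota>. \<Sum>d\<in>?D. (\<lambda>\<iota>. (-1) * f d \<iota>) \<iota>)"
    proof
      fix \<iota>
      have "0 = (\<Sum>d\<in>D. f d \<iota>)" using fun_cong[OF f(2), of \<iota>] by (simp add: zerot_def)
      then have "0 = f d0 \<iota> + (\<Sum>d\<in>?D. f d \<iota>)" using sum.remove[OF fin d0(1), of "\<lambda>d. f d \<iota>"] by simp
      then show "f d0 \<iota> = (\<Sum>d\<in>?D. (\<lambda>\<iota>. (-1) * f d \<iota>) \<iota>)"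
        by (simp add: sum_negf eq_neg_iff_add_eq_0)
    qed
    moreover have "(\<lambda>\<iota>. (-1) * f d \<iota>) \<in> W d" if "d \<in> ?D" for d
      using f(1) that by (intro is_submodD(4)[OF W]) (auto simp: W_def)
    ultimately have "f d0 \<in> family_sum n k ?D W"
      unfolding family_sum_def by (intro CollectI exI[of _ "\<lambda>d \<iota>. (-1) * f d \<iota>"] conjI ballI)
    then have "f d0 \<in> ?S" using f(1)[OF d0(1)] by (simp add: W_def)
    then have "?S \<noteq> {zerot}" using d0(2) by blast
    moreover have "irreducible_mod n k (W d0)" unfolding W_def by (rule hw_vector_irreducible[OF th(2)[OF d0(1)] nz])
    ultimately have "?S = W d0" using Sm unfolding irreducible_mod_def by blast
    then have "\<theta> d0 \<in> family_sum n k ?D W" using Ugen_self[of "\<theta> d0" n k] by (auto simp: W_def)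
    then obtain g where g: "\<And>d. d \<in> ?D \<Longrightarrow> g d \<in> W d" "\<theta> d0 = (\<lambda>\<iota>. \<Sum>d\<in>?D. g d \<iota>)" unfolding family_sum_def by blast
    have "\<exists>c. \<forall>u. killed n k u \<longrightarrow> herm_k n k (g d) u = c * herm_k n k (\<theta> d) u" if "d \<in> ?D" for d
      using Ugen_decomp[OF th(2), of d "g d"] g(1)[OF that] that by (auto simp: W_def)
    then obtain c where c: "\<And>d u. d \<in> ?D \<Longrightarrow> killed n k u \<Longrightarrow> herm_k n k (g d) u = c d * herm_k n k (\<theta> d) u"
      by metis
    \<comment> \<open>\<open>g d\<close> and \<open>c d * \<theta> d\<close> have the same pairing
      with every singular vector. The combination \<open>u\<close> is singular itself, so it is
      orthogonal to itself and vanishes, although \<open>\<theta> d0\<close> enters with coefficient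
      1.\<close>
    define c' where "c' d = (if d = d0 then 1 else - c d)" for d
    define u where "u = (\<lambda>\<iota>. \<Sum>d\<in>D. c' d * \<theta> d \<iota>)"
    have ku: "killed n k u" unfolding u_def by (rule killed_sum[OF kth])
    have "u = (\<lambda>\<iota>. \<theta> d0 \<iota> - (\<Sum>d\<in>?D. c d * \<theta> d \<iota>))"
      unfolding u_def by (simp add: sum.remove[OF fin d0(1)] c'_def sum_negf)
    then have u: "u = (\<lambda>\<iota>. (\<Sum>d\<in>?D. g d \<iota>) - (\<Sum>d\<in>?D. c d * \<theta> d \<iota>))" using g(2) by (metis)
    have "herm_k n k u u = 0"
    proof -
      have "herm_k n k u u = herm_k n k (\<lambda>\<iota>. (\<Sum>d\<in>?D. g d \<iota>) - (\<Sum>d\<in>?D. c d * \<theta> d \<iota>)) u" using u by simp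
      also have "\<dots> = (\<Sum>d\<in>?D. herm_k n k (g d) u) - (\<Sum>d\<in>?D. herm_k n k (\<lambda>\<iota>. c d * \<theta> d \<iota>) u)"
        by (simp only: herm_diff_left herm_sum_left)
      also have "\<dots> = 0" using c[OF _ ku] by (simp add: herm_smult_left)
      finally show ?thesis .
    qed
    then have "u = zerot" using herm_k_self_eq_0 ku by (auto simp: killed_def)
    then have "c' d0 = 0" using indep_of_pairs[of c'] d0(1) unfolding u_def by blast
    then show False by (simp add: c'_def)
  qed
qed

subsection \<open>Row and column symmetrizers\<close>

text \<open>With \<open>f\<close> the row number or the column number of a slot this is the row or
  the column group of a tableau; leaving \<open>f\<close> abstract treats both at once.\<close>

definition fixgrp :: "nat set \<Rightarrow> (nat \<Rightarrow> nat) \<Rightarrow> (nat \<Rightarrow> nat) set" where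
  "fixgrp A f = {\<sigma>. \<sigma> permutes A \<and> (\<forall>p\<in>A. f (\<sigma> p) = f p)}"

lemma fixgrp_permutes: "\<sigma> \<in> fixgrp A f \<Longrightarrow> \<sigma> permutes A"
  by (simp add: fixgrp_def)

lemma fixgrp_in: "\<sigma> \<in> fixgrp A f \<Longrightarrow> p \<in> A \<Longrightarrow> \<sigma> p \<in> A"
  by (simp add: fixgrp_def permutes_in_image)

lemma finite_fixgrp [simp]: "finite A \<Longrightarrow> finite (fixgrp A f)"
  unfolding fixgrp_def by (rule finite_subset[OF _ finite_permutations]) auto

lemma fixgrp_id: "id \<in> fixgrp A f"
  by (simp add: fixgrp_def permutes_id)

lemma fixgrp_comp: "\<sigma> \<in> fixgrp A f \<Longrightarrow> \<tau> \<in> fixgrp A f \<Longrightarrow> \<sigma> \<circ> \<tau> \<in> fixgrp A f"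
  by (auto simp: fixgrp_def permutes_compose permutes_in_image)

lemma fixgrp_inv:
  assumes "\<sigma> \<in> fixgrp A f"
  shows "inv \<sigma> \<in> fixgrp A f"
proof -
  have p: "\<sigma> permutes A" using assms by (simp add: fixgrp_def)
  have "f (inv \<sigma> q) = f q" if "q \<in> A" for q
  proof -
    have "inv \<sigma> q \<in> A" using that permutes_in_image[OF permutes_inv[OF p]] by simp
    then have "f (\<sigma> (inv \<sigma> q)) = f (inv \<sigma> q)" using assms by (simp add: fixgrp_def)
    then show ?thesis by (simp add: permutes_inverses(1)[OF p])
  qed
  then show ?thesis by (simp add: fixgrp_def permutes_inv[OF p])
qed

lemma fixgrp_transpose: "p \<in> A \<Longrightarrow> q \<in> A \<Longrightarrow> f p = f q \<Longrightarrow> transpose p q \<in> fixgrp A f"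
  by (auto simp: fixgrp_def permutes_swap_id transpose_def)

lemma fixgrp_sum_right:
  assumes "\<tau> \<in> fixgrp A f"
  shows "(\<Sum>\<sigma>\<in>fixgrp A f. h (\<sigma> \<circ> \<tau>)) = (\<Sum>\<sigma>\<in>fixgrp A f. h \<sigma>)"
  using permutes_inv_o[OF fixgrp_permutes[OF assms]]
  by (intro sum.reindex_bij_witness[where i = "\<lambda>\<sigma>. \<sigma> \<circ> inv \<tau>" and j = "\<lambda>\<sigma>. \<sigma> \<circ> \<tau>"])
    (auto simp: fixgrp_comp fixgrp_inv assms comp_assoc)

lemma fixgrp_sum_left:
  assumes "\<tau> \<in> fixgrp A f"
  shows "(\<Sum>\<sigma>\<in>fixgrp A f. h (\<tau> \<circ> \<sigma>)) = (\<Sum>\<sigma>\<in>fixgrp A f. h \<sigma>)"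
  using permutes_inv_o[OF fixgrp_permutes[OF assms]]
  by (intro sum.reindex_bij_witness[where i = "\<lambda>\<sigma>. inv \<tau> \<circ> \<sigma>" and j = "\<lambda>\<sigma>. \<tau> \<circ> \<sigma>"])
    (auto simp: fixgrp_comp fixgrp_inv assms comp_assoc[symmetric])

lemma sign_fixgrp_comp:
  assumes "finite A" "\<sigma> \<in> fixgrp A f" "\<tau> \<in> fixgrp A f"
  shows "sign (\<sigma> \<circ> \<tau>) = sign \<sigma> * sign \<tau>"
  using assms by (intro sign_compose) (auto intro: permutation_permutes[THEN iffD2] fixgrp_permutes)

text \<open>Right translation by the transposition is a bijection of the group that reverses the
  sign and leaves \<open>F\<close> unchanged, so the sum equals its own negative.\<close>

lemma antisym_sum_zero:
  fixes F :: "(nat \<Rightarrow> nat) \<Rightarrow> int"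
  assumes "finite A" "p \<in> A" "q \<in> A" "p \<noteq> q" "f p = f q"
    and "\<And>a. F (a \<circ> transpose p q) = F a"
  shows "(\<Sum>\<gamma>\<in>fixgrp A f. sign \<gamma> * F (a \<circ> \<gamma>)) = 0"
proof -
  let ?t = "transpose p q"
  have t: "?t \<in> fixgrp A f" using assms by (intro fixgrp_transpose)
  have "(\<Sum>\<gamma>\<in>fixgrp A f. sign \<gamma> * F (a \<circ> \<gamma>)) = (\<Sum>\<gamma>\<in>fixgrp A f. sign (\<gamma> \<circ> ?t) * F (a \<circ> (\<gamma> \<circ> ?t)))"
    by (rule fixgrp_sum_right[OF t, symmetric])
  also have "\<dots> = (\<Sum>\<gamma>\<in>fixgrp A f. - (sign \<gamma> * F (a \<circ> \<gamma>)))"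
    using assms(4) by (intro sum.cong refl)
      (simp add: sign_fixgrp_comp[OF assms(1) _ t] sign_swap_id assms(6) comp_assoc[symmetric])
  finally show ?thesis by (simp add: sum_negf)
qed

text \<open>\<open>col_vec\<close> and \<open>young_vec\<close> give the coordinates of \<open>C\<^sub>T v\<close> and \<open>R\<^sub>T C\<^sub>T v\<close>, where \<open>v\<close> is the
  basis tensor carrying in each slot its row number.\<close>

definition col_vec :: "nat set \<Rightarrow> (nat \<Rightarrow> nat) \<Rightarrow> (nat \<Rightarrow> nat) \<Rightarrow> (nat \<Rightarrow> nat) \<Rightarrow> int" where
  "col_vec A rw cl a = (\<Sum>\<gamma>\<in>fixgrp A cl. sign \<gamma> * (if \<forall>p\<in>A. (a \<circ> \<gamma>) p = rw p then 1 else 0))"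

definition young_vec :: "nat set \<Rightarrow> (nat \<Rightarrow> nat) \<Rightarrow> (nat \<Rightarrow> nat) \<Rightarrow> (nat \<Rightarrow> nat) \<Rightarrow> int" where
  "young_vec A rw cl a = (\<Sum>\<rho>\<in>fixgrp A rw. col_vec A rw cl (a \<circ> \<rho>))"

lemma col_vec_cong:
  assumes "\<And>p. p \<in> A \<Longrightarrow> a p = a' p"
  shows "col_vec A rw cl a = col_vec A rw cl a'"
  unfolding col_vec_def using assms by (intro sum.cong refl) (auto simp: fixgrp_in)

lemma young_vec_cong:
  assumes "\<And>p. p \<in> A \<Longrightarrow> a p = a' p"
  shows "young_vec A rw cl a = young_vec A rw cl a'"
  unfolding young_vec_def using assms by (intro sum.cong refl col_vec_cong) (auto simp: fixgrp_in)

lemma col_vec_antisym: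
  assumes "finite A" "\<tau> \<in> fixgrp A cl"
  shows "col_vec A rw cl (a \<circ> \<tau>) = sign \<tau> * col_vec A rw cl a"
proof -
  have "col_vec A rw cl a = (\<Sum>\<gamma>\<in>fixgrp A cl. sign (\<tau> \<circ> \<gamma>) * (if \<forall>p\<in>A. (a \<circ> (\<tau> \<circ> \<gamma>)) p = rw p then 1 else 0))"
    unfolding col_vec_def by (rule fixgrp_sum_left[OF assms(2), symmetric])
  also have "\<dots> = sign \<tau> * col_vec A rw cl (a \<circ> \<tau>)"
    unfolding col_vec_def sum_distrib_left using assms
    by (intro sum.cong refl) (simp add: sign_fixgrp_comp)
  finally have "sign \<tau> * col_vec A rw cl a = (sign \<tau> * sign \<tau>) * col_vec A rw cl (a \<circ> \<tau>)" by simp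
  moreover have "sign \<tau> * sign \<tau> = 1" by (simp add: sign_def)
  ultimately show ?thesis by simp
qed

lemma young_vec_sym:
  assumes "\<tau> \<in> fixgrp A rw"
  shows "young_vec A rw cl (a \<circ> \<tau>) = young_vec A rw cl a"
  unfolding young_vec_def using fixgrp_sum_left[OF assms, of "\<lambda>\<rho>. col_vec A rw cl (a \<circ> \<rho>)"] by (simp add: comp_assoc)

text \<open>A column permutation that also preserves row numbers fixes every cell, so the identity
  is the only term that contributes.\<close>

lemma col_vec_rw:
  assumes "finite A" "\<And>p q. p \<in> A \<Longrightarrow> q \<in> A \<Longrightarrow> rw p = rw q \<Longrightarrow> cl p = cl q \<Longrightarrow> p = q"
    and "\<And>p. p \<in> A \<Longrightarrow> a p = rw p"
  shows "col_vec A rw cl a = 1"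
proof -
  have "(\<forall>p\<in>A. (a \<circ> \<gamma>) p = rw p) \<longleftrightarrow> \<gamma> = id" if g: "\<gamma> \<in> fixgrp A cl" for \<gamma>
  proof
    assume *: "\<forall>p\<in>A. (a \<circ> \<gamma>) p = rw p"
    show "\<gamma> = id"
    proof
      fix p
      show "\<gamma> p = id p"
      proof (cases "p \<in> A")
        case True
        then have "rw (\<gamma> p) = rw p" "cl (\<gamma> p) = cl p" "\<gamma> p \<in> A"
          using * g assms(3)[of "\<gamma> p"] by (auto simp: fixgrp_in fixgrp_def permutes_in_image)
        then show ?thesis using assms(2) True by simp
      next
        case False
        then show ?thesis using fixgrp_permutes[OF g] by (simp add: permutes_def)
      qed
    qed
  qed (use assms(3) in simp)
  then have "col_vec A rw cl a = (\<Sum>\<gamma>\<in>fixgrp A cl. if \<gamma> = id then 1 else 0)"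
    unfolding col_vec_def by (intro sum.cong refl) auto
  then show ?thesis using assms(1) by (simp add: fixgrp_id)
qed

lemma young_vec_rw:
  assumes "finite A" "\<And>p q. p \<in> A \<Longrightarrow> q \<in> A \<Longrightarrow> rw p = rw q \<Longrightarrow> cl p = cl q \<Longrightarrow> p = q"
    and "\<And>p. p \<in> A \<Longrightarrow> a p = rw p"
  shows "young_vec A rw cl a = int (card (fixgrp A rw))"
proof -
  have "col_vec A rw cl (a \<circ> \<rho>) = 1" if "\<rho> \<in> fixgrp A rw" for \<rho>
    using that assms(3) fixgrp_in[OF that] by (intro col_vec_rw[OF assms(1,2)]) (auto simp: fixgrp_def)
  then show ?thesis by (simp add: young_vec_def)
qed

lemma fbox_comp: "a \<in> fbox n A \<Longrightarrow> \<sigma> permutes A \<Longrightarrow> a \<circ> \<sigma> \<in> fbox n A"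
  by (auto simp: PiE_iff extensional_def permutes_in_image permutes_not_in)

lemma fbox_sum_comp:
  assumes "\<sigma> permutes A"
  shows "(\<Sum>a\<in>fbox n A. h (a \<circ> \<sigma>)) = (\<Sum>a\<in>fbox n A. h a)"
  using permutes_inv_o[OF assms] permutes_inv[OF assms] assms
  by (intro sum.reindex_bij_witness[where i = "\<lambda>a. a \<circ> inv \<sigma>" and j = "\<lambda>a. a \<circ> \<sigma>"])
    (auto simp: fbox_comp comp_assoc)

section \<open>Pairing column antisymmetrized vectors with Young symmetrizer vectors\<close>

definition pairing :: "nat \<Rightarrow> nat set \<Rightarrow> ((nat \<Rightarrow> nat) \<Rightarrow> int) \<Rightarrow> ((nat \<Rightarrow> nat) \<Rightarrow> int) \<Rightarrow> int" where
  "pairing n A f g = (\<Sum>a\<in>fbox n A. f a * g a)"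

text \<open>The transposition of \<open>p\<close> and \<open>q\<close> changes the sign of the
  column vector of one tableau and fixes the Young vector of the other; the pairing is therefore its
  own negative.\<close>

lemma pairing_zero:
  assumes "finite A" "p \<in> A" "q \<in> A" "p \<noteq> q" "cl' p = cl' q" "rw p = rw q"
  shows "pairing n A (col_vec A rw' cl') (young_vec A rw cl) = 0"
proof -
  let ?t = "transpose p q"
  have t: "?t \<in> fixgrp A cl'" "?t \<in> fixgrp A rw" using assms by (auto intro!: fixgrp_transpose)
  have "pairing n A (col_vec A rw' cl') (young_vec A rw cl)
    = (\<Sum>a\<in>fbox n A. col_vec A rw' cl' (a \<circ> ?t) * young_vec A rw cl (a \<circ> ?t))"
    unfolding pairing_def by (rule fbox_sum_comp[symmetric]) (rule fixgrp_permutes[OF t(1)])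
  also have "\<dots> = (\<Sum>a\<in>fbox n A. - (col_vec A rw' cl' a * young_vec A rw cl a))"
    using assms(4) by (intro sum.cong refl)
      (simp add: col_vec_antisym[OF assms(1) t(1)] young_vec_sym[OF t(2)] sign_swap_id)
  finally show ?thesis by (simp add: sum_negf pairing_def)
qed

text \<open>Summing the column vector over the row group gives the Young vector, which is row
  invariant itself. Hence \<open>card (fixgrp A rw)\<close> times the pairing is the squared norm of
  the Young vector, and that vector is nonzero at the index \<open>rw\<close>.\<close>

lemma pairing_pos:
  assumes "finite A" "\<And>p q. p \<in> A \<Longrightarrow> q \<in> A \<Longrightarrow> rw p = rw q \<Longrightarrow> cl p = cl q \<Longrightarrow> p = q"
    and "\<And>p. p \<in> A \<Longrightarrow> rw p \<in> {1..n}"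
  shows "pairing n A (col_vec A rw cl) (young_vec A rw cl) > 0"
proof -
  let ?R = "fixgrp A rw" and ?c = "col_vec A rw cl" and ?y = "young_vec A rw cl"
  have fR: "finite ?R" "?R \<noteq> {}" using assms(1) fixgrp_id by auto
  have cR: "int (card ?R) > 0" using fR by (simp add: card_gt_0_iff)
  have "(\<Sum>a\<in>fbox n A. ?y a * ?y a) = (\<Sum>a\<in>fbox n A. \<Sum>\<rho>\<in>?R. ?c (a \<circ> \<rho>) * ?y (a \<circ> \<rho>))"
  proof (rule sum.cong[OF refl])
    fix a
    have "(\<Sum>\<rho>\<in>?R. ?c (a \<circ> \<rho>) * ?y (a \<circ> \<rho>)) = (\<Sum>\<rho>\<in>?R. ?c (a \<circ> \<rho>)) * ?y a"
      unfolding sum_distrib_right by (intro sum.cong refl) (simp add: young_vec_sym)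
    then show "?y a * ?y a = (\<Sum>\<rho>\<in>?R. ?c (a \<circ> \<rho>) * ?y (a \<circ> \<rho>))"
      unfolding young_vec_def[of A rw cl a, symmetric] by (rule sym)
  qed
  also have "\<dots> = (\<Sum>\<rho>\<in>?R. \<Sum>a\<in>fbox n A. ?c (a \<circ> \<rho>) * ?y (a \<circ> \<rho>))" by (rule sum.swap)
  also have "\<dots> = (\<Sum>\<rho>\<in>?R. pairing n A ?c ?y)"
    unfolding pairing_def
    by (rule sum.cong[OF refl], rule fbox_sum_comp[of _ A "\<lambda>a. ?c a * ?y a"], rule fixgrp_permutes)
  finally have eq: "(\<Sum>a\<in>fbox n A. ?y a * ?y a) = int (card ?R) * pairing n A ?c ?y" by simp
  let ?a = "restrict rw A"
  have a: "?a \<in> fbox n A" using assms(3) by auto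
  have "0 < ?y ?a * ?y ?a"
  proof -
    have "?y ?a = int (card ?R)" by (rule young_vec_rw[OF assms(1,2)]) auto
    then show ?thesis using cR by simp
  qed
  also have "\<dots> \<le> (\<Sum>a\<in>fbox n A. ?y a * ?y a)"
    using a assms(1) by (intro member_le_sum) auto
  finally show ?thesis unfolding eq using cR by (simp add: zero_less_mult_iff)
qed

text \<open>The coefficient form of \<open>Eij i j\<close> on \<open>V\<close> slots, see
  \<open>gl_act_raise_op\<close>. The values may lie in any commutative monoid, since integer and
  complex coefficient functions both occur.\<close>

definition raise_op :: "nat set \<Rightarrow> nat \<Rightarrow> nat \<Rightarrow> ((nat \<Rightarrow> nat) \<Rightarrow> 'b :: comm_monoid_add) \<Rightarrow> (nat \<Rightarrow> nat) \<Rightarrow> 'b" where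
  "raise_op A i j \<phi> a = (\<Sum>p\<in>{p\<in>A. a p = i}. \<phi> (a(p := j)))"

lemma upd_comp: "inj \<sigma> \<Longrightarrow> (a(\<sigma> p := j)) \<circ> \<sigma> = (a \<circ> \<sigma>)(p := j)"
  by (auto simp: fun_eq_iff dest: injD)

lemma raise_op_comp:
  assumes "\<sigma> permutes A"
  shows "raise_op A i j \<phi> (a \<circ> \<sigma>) = raise_op A i j (\<lambda>a. \<phi> (a \<circ> \<sigma>)) a"
  unfolding raise_op_def
  by (rule sum.reindex_bij_witness[where i = "inv \<sigma>" and j = \<sigma>])
    (auto simp: permutes_inverses[OF assms] permutes_in_image[OF assms]
      permutes_in_image[OF permutes_inv[OF assms]] upd_comp[OF permutes_inj[OF assms]])

lemma raise_op_alt: "finite A \<Longrightarrow> raise_op A i j \<phi> a = (\<Sum>p\<in>A. if a p = i then \<phi> (a(p := j)) else 0)"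
  unfolding raise_op_def by (simp add: sum.inter_filter)

lemma raise_op_sum: "raise_op A i j (\<lambda>a. \<Sum>d\<in>D. f d a) a = (\<Sum>d\<in>D. raise_op A i j (f d) a)"
  unfolding raise_op_def by (rule sum.swap)

lemma raise_op_mult: "raise_op A i j (\<lambda>a. c * f a) a = (c :: 'b :: semiring_0) * raise_op A i j f a"
  unfolding raise_op_def by (simp add: sum_distrib_left)

lemma raise_op_of_int: "raise_op A i j (\<lambda>a. of_int (f a)) a = of_int (raise_op A i j f a)"
  unfolding raise_op_def by simp

text \<open>Only a slot \<open>p\<close> of row \<open>j\<close> contributes, and its column
  contains a slot \<open>p'\<close> of row \<open>i\<close>. After raising, both carry the value
  \<open>i\<close>, so the contribution of \<open>p\<close> is symmetric in \<open>p\<close> and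
  \<open>p'\<close> and dies under antisymmetrization.\<close>

lemma raise_op_col_vec:
  assumes "finite A" "i < j"
    and col: "\<And>p. p \<in> A \<Longrightarrow> rw p = j \<Longrightarrow> \<exists>p'\<in>A. cl p' = cl p \<and> rw p' = i"
  shows "raise_op A i j (col_vec A rw cl) a = 0"
proof -
  define F where "F p a = (if a p = i \<and> (\<forall>q\<in>A. (a(p := j)) q = rw q) then 1 else 0 :: int)" for p a
  have "raise_op A i j (col_vec A rw cl) a = (\<Sum>\<gamma>\<in>fixgrp A cl. sign \<gamma> * raise_op A i j (\<lambda>a. if \<forall>p\<in>A. a p = rw p then 1 else 0) (a \<circ> \<gamma>))"
    unfolding col_vec_def raise_op_sum raise_op_mult
    by (rule sum.cong[OF refl], subst raise_op_comp[OF fixgrp_permutes], assumption) simp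
  also have "\<dots> = (\<Sum>\<gamma>\<in>fixgrp A cl. \<Sum>p\<in>A. sign \<gamma> * F p (a \<circ> \<gamma>))"
    unfolding sum_distrib_left[symmetric] raise_op_alt[OF assms(1)] F_def
    by (rule sum.cong[OF refl], rule arg_cong2[of _ _ _ _ "(*)"], rule refl, rule sum.cong[OF refl]) auto
  also have "\<dots> = (\<Sum>p\<in>A. \<Sum>\<gamma>\<in>fixgrp A cl. sign \<gamma> * F p (a \<circ> \<gamma>))" by (rule sum.swap)
  also have "\<dots> = 0"
  proof (rule sum.neutral, rule ballI)
    fix p assume p: "p \<in> A"
    show "(\<Sum>\<gamma>\<in>fixgrp A cl. sign \<gamma> * F p (a \<circ> \<gamma>)) = 0"
    proof (cases "rw p = j")
      case False
      then have "F p b = 0" for b using p by (auto simp: F_def)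
      then show ?thesis by simp
    next
      case True
      then obtain p' where p': "p' \<in> A" "cl p' = cl p" "rw p' = i" using col p by blast
      have ne: "p \<noteq> p'" using True p' assms(2) by auto
      \<comment> \<open>The condition is the same at \<open>p\<close> and at \<open>p'\<close>,
        namely value \<open>i\<close>; this is the symmetry that \<open>antisym_sum_zero\<close>
        needs.\<close>
      have Feq: "F p b = (if b p = i \<and> b p' = i \<and> (\<forall>q\<in>A - {p, p'}. b q = rw q) then 1 else 0)" for b
        using p p' ne True unfolding F_def by auto
      have "F p (b \<circ> transpose p p') = F p b" for b
        using ne unfolding Feq by (auto simp: transpose_def)
      then show ?thesis using antisym_sum_zero[OF assms(1) p p'(1) ne, of cl "F p" a] p'(2) by simp
    qed
  qed
  finally show ?thesis .
qed

lemma raise_op_young_vec: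
  assumes "\<And>a. raise_op A i j (col_vec A rw cl) a = 0"
  shows "raise_op A i j (young_vec A rw cl) a = 0"
proof -
  have "raise_op A i j (young_vec A rw cl) a = (\<Sum>\<rho>\<in>fixgrp A rw. raise_op A i j (col_vec A rw cl) (a \<circ> \<rho>))"
    unfolding young_vec_def raise_op_sum
    by (rule sum.cong[OF refl], subst raise_op_comp[OF fixgrp_permutes], assumption) simp
  then show ?thesis using assms by simp
qed

text \<open>The weight of the basis tensor with index \<open>a\<close>.\<close>

definition content :: "nat set \<Rightarrow> (nat \<Rightarrow> nat) \<Rightarrow> nat \<Rightarrow> nat" where
  "content A a i = card {p\<in>A. a p = i}"

lemma raise_op_diag: "raise_op A i i \<phi> a = of_nat (content A a i) * (\<phi> a :: 'b :: semiring_1)"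
proof -
  have "raise_op A i i \<phi> a = (\<Sum>p\<in>{p\<in>A. a p = i}. \<phi> a)"
    unfolding raise_op_def by (intro sum.cong refl) auto
  then show ?thesis by (simp add: content_def)
qed

lemma content_comp:
  assumes "\<sigma> permutes A"
  shows "content A (a \<circ> \<sigma>) = content A a"
proof
  fix i
  have "bij_betw \<sigma> {p\<in>A. a (\<sigma> p) = i} {p\<in>A. a p = i}"
    by (rule bij_betw_byWitness[where f' = "inv \<sigma>"])
      (auto simp: permutes_inverses[OF assms] permutes_in_image[OF assms] permutes_in_image[OF permutes_inv[OF assms]])
  then show "content A (a \<circ> \<sigma>) i = content A a i" unfolding content_def by (simp add: bij_betw_same_card)
qed

lemma content_cong: "(\<And>p. p \<in> A \<Longrightarrow> a p = a' p) \<Longrightarrow> content A a = content A a'"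
  unfolding content_def by (intro ext arg_cong[of _ _ card]) auto

lemma col_vec_content:
  assumes "col_vec A rw cl a \<noteq> 0"
  shows "content A a = content A rw"
proof -
  have "\<exists>\<gamma>\<in>fixgrp A cl. \<forall>p\<in>A. (a \<circ> \<gamma>) p = rw p"
  proof (rule ccontr)
    assume "\<not> ?thesis"
    then have "col_vec A rw cl a = 0" unfolding col_vec_def by (intro sum.neutral ballI) auto
    then show False using assms by simp
  qed
  then obtain \<gamma> where g: "\<gamma> \<in> fixgrp A cl" "\<forall>p\<in>A. (a \<circ> \<gamma>) p = rw p" by blast
  then have "content A (a \<circ> \<gamma>) = content A rw" by (intro content_cong) auto
  then show ?thesis using content_comp[OF fixgrp_permutes[OF g(1)]] by simp
qed

lemma young_vec_content:
  assumes "young_vec A rw cl a \<noteq> 0"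
  shows "content A a = content A rw"
proof -
  obtain \<rho> where g: "\<rho> \<in> fixgrp A rw" "col_vec A rw cl (a \<circ> \<rho>) \<noteq> 0"
    using assms sum.not_neutral_contains_not_neutral unfolding young_vec_def by blast
  then show ?thesis using col_vec_content[OF g(2)] content_comp[OF fixgrp_permutes[OF g(1)]] by simp
qed

subsection \<open>Standard tableaux\<close>

lemma cells_up:
  assumes "partition_of r la" "(i', j) \<in> cells la" "1 \<le> i" "i \<le> i'"
  shows "(i, j) \<in> cells la"
proof (cases "i = i'")
  case False
  then have "la ! (i - 1) \<ge> la ! (i' - 1)"
    using assms by (intro sorted_wrt_nth_less[of "(\<ge>)" la]) (auto simp: partition_of_def cells_def)
  then show ?thesis using assms by (auto simp: cells_def)
qed (use assms in simp)

lemma cells_left: "(i, j') \<in> cells la \<Longrightarrow> 1 \<le> j \<Longrightarrow> j \<le> j' \<Longrightarrow> (i, j) \<in> cells la"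
  by (auto simp: cells_def)

lemma std_tab_inj: "std_tab la A T \<Longrightarrow> c \<in> cells la \<Longrightarrow> c' \<in> cells la \<Longrightarrow> T c = T c' \<Longrightarrow> c = c'"
  by (auto simp: std_tab_def bij_betw_def dest: inj_onD)

lemma std_tab_img: "std_tab la A T \<Longrightarrow> T ` cells la = A"
  by (auto simp: std_tab_def bij_betw_def)

lemma std_tab_in: "std_tab la A T \<Longrightarrow> c \<in> cells la \<Longrightarrow> T c \<in> A"
  using std_tab_img by blast

lemma std_tab_out: "std_tab la A T \<Longrightarrow> c \<notin> cells la \<Longrightarrow> T c = 0"
  unfolding std_tab_def by blast

lemma tab_row_T: "std_tab la A T \<Longrightarrow> (i, j) \<in> cells la \<Longrightarrow> tab_row la T (T (i, j)) = i"
  unfolding tab_row_def by (rule the_equality) (auto dest: std_tab_inj)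

lemma tab_col_T: "std_tab la A T \<Longrightarrow> (i, j) \<in> cells la \<Longrightarrow> tab_col la T (T (i, j)) = j"
  unfolding tab_col_def by (rule the_equality) (auto dest: std_tab_inj)

lemma tab_pos:
  assumes "std_tab la A T" "p \<in> A"
  shows "(tab_row la T p, tab_col la T p) \<in> cells la" "T (tab_row la T p, tab_col la T p) = p"
proof -
  obtain i j where ij: "(i, j) \<in> cells la" "p = T (i, j)"
    using assms std_tab_img by (metis imageE surj_pair)
  then show "(tab_row la T p, tab_col la T p) \<in> cells la" "T (tab_row la T p, tab_col la T p) = p"
    using tab_row_T[OF assms(1) ij(1)] tab_col_T[OF assms(1) ij(1)] by simp_all
qed

lemma std_tab_row_less:
  assumes "std_tab la A T" "(i, j') \<in> cells la" "1 \<le> j" "j < j'"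
  shows "T (i, j) < T (i, j')"
  using assms(4,2)
proof (induction j')
  case (Suc m)
  have m: "(i, m) \<in> cells la" using Suc.prems assms(3) by (intro cells_left[OF Suc.prems(2)]) auto
  have "T (i, m) < T (i, m + 1)" using assms(1) m Suc.prems(2) by (simp add: std_tab_def flip: Suc_eq_plus1)
  then show ?case using Suc.IH m Suc.prems(1) by (cases "j = m") (auto simp flip: Suc_eq_plus1)
qed simp

lemma std_tab_col_less:
  assumes "partition_of r la" "std_tab la A T" "(i', j) \<in> cells la" "1 \<le> i" "i < i'"
  shows "T (i, j) < T (i', j)"
  using assms(5,3)
proof (induction i')
  case (Suc m)
  have m: "(m, j) \<in> cells la" using Suc.prems assms(4) by (intro cells_up[OF assms(1) Suc.prems(2)]) auto
  have "T (m, j) < T (m + 1, j)" using assms(2) m Suc.prems(2) by (simp add: std_tab_def flip: Suc_eq_plus1)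
  then show ?case using Suc.IH m Suc.prems(1) by (cases "i = m") (auto simp flip: Suc_eq_plus1)
qed simp

lemma row_grp_eq: "std_tab la A T \<Longrightarrow> row_grp la T = fixgrp A (tab_row la T)"
  by (simp add: row_grp_def fixgrp_def std_tab_img)

lemma col_grp_eq: "std_tab la A T \<Longrightarrow> col_grp la T = fixgrp A (tab_col la T)"
  by (simp add: col_grp_def fixgrp_def std_tab_img)

lemma tab_pos_inj:
  assumes "std_tab la A T" "p \<in> A" "q \<in> A" "tab_row la T p = tab_row la T q" "tab_col la T p = tab_col la T q"
  shows "p = q"
  using tab_pos(2)[OF assms(1,2)] tab_pos(2)[OF assms(1,3)] assms(4,5) by metis

lemma tab_col_above:
  assumes "partition_of r la" "std_tab la A T" "p \<in> A" "1 \<le> i" "i \<le> tab_row la T p"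
  shows "\<exists>p'\<in>A. tab_col la T p' = tab_col la T p \<and> tab_row la T p' = i"
proof -
  have c: "(i, tab_col la T p) \<in> cells la" by (rule cells_up[OF assms(1) tab_pos(1)[OF assms(2,3)] assms(4,5)])
  then show ?thesis using tab_row_T[OF assms(2) c] tab_col_T[OF assms(2) c] std_tab_in[OF assms(2) c] by blast
qed

text \<open>Shapes as functions on all row numbers, zero past the last row, so that they can be
  compared with weights as functions, see \<open>content_tab_row\<close>.\<close>

definition shape_fun :: "nat list \<Rightarrow> nat \<Rightarrow> nat" where
  "shape_fun la i = (if 1 \<le> i \<and> i \<le> length la then la ! (i - 1) else 0)"

lemma cells_shape_fun: "(i, j) \<in> cells la \<longleftrightarrow> 1 \<le> j \<and> j \<le> shape_fun la i"
  by (auto simp: cells_def shape_fun_def)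

text \<open>All parts are positive, so the number of rows can be recovered from the
  function.\<close>

lemma shape_fun_inj:
  assumes "partition_of r la" "partition_of r' la'" "shape_fun la = shape_fun la'"
  shows "la = la'"
proof -
  have le: "length l \<le> length l'" if "partition_of r l" "shape_fun l = shape_fun l'" for l l' r
  proof (rule ccontr)
    assume less: "\<not> ?thesis"
    then have "shape_fun l (length l) = 0" using that(2) by (auto simp: shape_fun_def)
    moreover have "shape_fun l (length l) > 0" using that(1) less
      by (auto simp: shape_fun_def partition_of_def intro!: nth_mem)
    ultimately show False by simp
  qed
  have len: "length la = length la'" using le[OF assms(1,3)] le[OF assms(2) assms(3)[symmetric]] by simp
  show ?thesis
  proof (rule nth_equalityI[OF len])
    fix i assume "i < length la"
    then show "la ! i = la' ! i" using fun_cong[OF assms(3), of "Suc i"] len by (simp add: shape_fun_def)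
  qed
qed

lemma content_tab_row:
  assumes "std_tab la A T"
  shows "content A (tab_row la T) = shape_fun la"
proof
  fix i
  have "{p\<in>A. tab_row la T p = i} = T ` ({i} \<times> {1..shape_fun la i})"
  proof (intro equalityI subsetI)
    fix p assume "p \<in> {p\<in>A. tab_row la T p = i}"
    then show "p \<in> T ` ({i} \<times> {1..shape_fun la i})"
      using tab_pos[OF assms, of p] by (intro image_eqI[of _ _ "(i, tab_col la T p)"]) (auto simp: cells_shape_fun)
  next
    fix p assume "p \<in> T ` ({i} \<times> {1..shape_fun la i})"
    then obtain j where "p = T (i, j)" "(i, j) \<in> cells la" by (auto simp: cells_shape_fun)
    then show "p \<in> {p\<in>A. tab_row la T p = i}" using tab_row_T[OF assms] std_tab_in[OF assms] by auto
  qed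
  moreover have "inj_on T ({i} \<times> {1..shape_fun la i})"
    by (rule inj_onI) (rule std_tab_inj[OF assms], auto simp: cells_shape_fun)
  ultimately show "content A (tab_row la T) i = shape_fun la i" by (simp add: content_def card_image)
qed

lemma length_partition: "partition_of r la \<Longrightarrow> length la \<le> r"
proof -
  assume p: "partition_of r la"
  have "(\<forall>x\<in>set la. 0 < x) \<Longrightarrow> length la \<le> sum_list la"
    by (induction la) auto
  then show ?thesis using p by (simp add: partition_of_def)
qed

lemma tab_row_range:
  assumes "partition_of r la" "std_tab la A T" "p \<in> A"
  shows "tab_row la T p \<in> {1..r}"
  using tab_pos(1)[OF assms(2,3)] length_partition[OF assms(1)] by (auto simp: cells_def)

text \<open>Rows increase, so the column of an entry is its rank within the row.\<close>

lemma tab_card: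
  assumes "std_tab la A T" "(i, j) \<in> cells la"
  shows "card {p\<in>A. tab_row la T p = i \<and> p \<le> T (i, j)} = j"
proof -
  have "{p\<in>A. tab_row la T p = i \<and> p \<le> T (i, j)} = (\<lambda>j. T (i, j)) ` {1..j}"
  proof (intro equalityI subsetI)
    fix p assume p: "p \<in> {p\<in>A. tab_row la T p = i \<and> p \<le> T (i, j)}"
    define j' where "j' = tab_col la T p"
    have j': "(i, j') \<in> cells la" "T (i, j') = p" using tab_pos[OF assms(1), of p] p by (auto simp: j'_def)
    have "1 \<le> j" using assms(2) by (auto simp: cells_def)
    then have "\<not> j < j'" using std_tab_row_less[OF assms(1) j'(1), of j] j'(2) p by auto
    then show "p \<in> (\<lambda>j. T (i, j)) ` {1..j}" using j' by (intro image_eqI[of _ _ j']) (auto simp: cells_def)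
  next
    fix p assume "p \<in> (\<lambda>j. T (i, j)) ` {1..j}"
    then obtain j' where j': "p = T (i, j')" "1 \<le> j'" "j' \<le> j" by auto
    have c: "(i, j') \<in> cells la" by (rule cells_left[OF assms(2) j'(2,3)])
    have "T (i, j') \<le> T (i, j)" using std_tab_row_less[OF assms j'(2)] j'(3) by (cases "j' = j") auto
    then show "p \<in> {p\<in>A. tab_row la T p = i \<and> p \<le> T (i, j)}"
      using j'(1) tab_row_T[OF assms(1) c] std_tab_in[OF assms(1) c] by auto
  qed
  moreover have "inj_on (\<lambda>j. T (i, j)) {1..j}"
  proof (rule inj_onI)
    fix x y assume xy: "x \<in> {1..j}" "y \<in> {1..j}" "T (i, x) = T (i, y)"
    have "(i, x) \<in> cells la" "(i, y) \<in> cells la" using xy by (auto intro: cells_left[OF assms(2)])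
    then show "x = y" using std_tab_inj[OF assms(1) _ _ xy(3)] by simp
  qed
  ultimately show ?thesis by (simp add: card_image)
qed

text \<open>The entry in column \<open>j\<close> of a row is the \<open>j\<close>-th smallest of
  that row, so a standard tableau is determined by which row each entry occupies. Distinct tableaux
  of one shape are thus separated by \<open>row_less\<close>.\<close>

lemma std_tab_eqI:
  assumes "finite A" "std_tab la A T" "std_tab la A T'"
    and eq: "\<And>p. p \<in> A \<Longrightarrow> tab_row la T p = tab_row la T' p"
  shows "T = T'"
proof
  fix c
  show "T c = T' c"
  proof (cases "c \<in> cells la")
    case False
    then show ?thesis using assms(2,3) by (simp add: std_tab_out)
  next
    case True
    then obtain i j where c: "c = (i, j)" "(i, j) \<in> cells la" by (cases c) auto
    define S where "S q = {p\<in>A. tab_row la T p = i \<and> p \<le> q}" for q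
    have card: "card (S (T c)) = j" "card (S (T' c)) = j"
    proof -
      have "S (T' c) = {p\<in>A. tab_row la T' p = i \<and> p \<le> T' (i, j)}" using eq unfolding S_def c(1) by auto
      then show "card (S (T c)) = j" "card (S (T' c)) = j"
        using tab_card[OF assms(2) c(2)] tab_card[OF assms(3) c(2)] by (simp_all add: S_def c(1))
    qed
    have mem: "T c \<in> A" "tab_row la T (T c) = i" "T' c \<in> A" "tab_row la T' (T' c) = i"
      using std_tab_in[OF assms(2)] std_tab_in[OF assms(3)] tab_row_T[OF assms(2)] tab_row_T[OF assms(3)] c
      by simp_all
    then have mem': "tab_row la T (T' c) = i" using eq by simp
    have fin: "finite (S q)" for q using assms(1) by (simp add: S_def)
    have nl: "\<not> q < q'" if "q' \<in> A" "tab_row la T q' = i" "card (S q) = card (S q')" for q q'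
    proof
      assume "q < q'"
      then have "q' \<in> S q'" "q' \<notin> S q" "S q \<subseteq> S q'" using that by (auto simp: S_def)
      then have "S q \<subset> S q'" by blast
      then have "card (S q) < card (S q')" by (rule psubset_card_mono[OF fin])
      then show False using that(3) by simp
    qed
    have "\<not> T c < T' c" by (rule nl[OF mem(3) mem' trans[OF card(1) card(2)[symmetric]]])
    moreover have "\<not> T' c < T c" by (rule nl[OF mem(1,2) trans[OF card(2) card(1)[symmetric]]])
    ultimately show ?thesis by simp
  qed
qed

text \<open>The lexicographic order of row functions, decided at the smallest slot where they
  differ. It is the order in which the pairing of column and Young vectors is triangular.\<close>

definition row_less :: "nat set \<Rightarrow> (nat \<Rightarrow> nat) \<Rightarrow> (nat \<Rightarrow> nat) \<Rightarrow> bool" where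
  "row_less A f g \<longleftrightarrow> (\<exists>m\<in>A. (\<forall>m'\<in>A. m' < m \<longrightarrow> f m' = g m') \<and> f m < g m)"

lemma row_less_asym: "row_less A f g \<Longrightarrow> \<not> row_less A g f"
proof
  assume "row_less A f g" "row_less A g f"
  then obtain m m' where m: "m \<in> A" "\<forall>x\<in>A. x < m \<longrightarrow> f x = g x" "f m < g m"
    and m': "m' \<in> A" "\<forall>x\<in>A. x < m' \<longrightarrow> g x = f x" "g m' < f m'" unfolding row_less_def by blast
  consider "m < m'" | "m = m'" | "m' < m" by linarith
  then show False
  proof cases
    case 1
    then have "g m = f m" using m m' by blast
    then show False using m by simp
  next
    case 2
    then show False using m m' by simp
  next
    case 3
    then have "f m' = g m'" using m m' by blast
    then show False using m' by simp
  qed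
qed

lemma row_less_trans:
  assumes "row_less A f g" "row_less A g h"
  shows "row_less A f h"
proof -
  obtain m m' where m: "m \<in> A" "\<forall>x\<in>A. x < m \<longrightarrow> f x = g x" "f m < g m"
    and m': "m' \<in> A" "\<forall>x\<in>A. x < m' \<longrightarrow> g x = h x" "g m' < h m'" using assms unfolding row_less_def by blast
  consider "m < m'" | "m = m'" | "m' < m" by linarith
  then show ?thesis
  proof cases
    case 1
    then show ?thesis unfolding row_less_def using m m' by (intro bexI[of _ m] conjI ballI impI) auto
  next
    case 2
    then show ?thesis unfolding row_less_def using m m' by (intro bexI[of _ m] conjI ballI impI) auto
  next
    case 3
    then show ?thesis unfolding row_less_def using m m' by (intro bexI[of _ m'] conjI ballI impI) auto
  qed
qed

lemma row_less_total:
  assumes "m \<in> A" "f m \<noteq> g m"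
  shows "row_less A f g \<or> row_less A g f"
proof -
  define m0 where "m0 = (LEAST m. m \<in> A \<and> f m \<noteq> g m)"
  have m0: "m0 \<in> A \<and> f m0 \<noteq> g m0" unfolding m0_def using assms by (intro LeastI[of "\<lambda>m. m \<in> A \<and> f m \<noteq> g m" m]) simp
  have "f x = g x" if "x \<in> A" "x < m0" for x
    using not_less_Least[of x "\<lambda>m. m \<in> A \<and> f m \<noteq> g m"] that unfolding m0_def by blast
  then show ?thesis using m0 unfolding row_less_def by (metis linorder_neqE_nat)
qed

text \<open>At the first disagreement \<open>m\<close>, going up the column of \<open>m\<close> in
  \<open>T'\<close> to the row that \<open>m\<close> has in \<open>T\<close> reaches an entry
  \<open>x\<close>. It is smaller than \<open>m\<close>, so both tableaux give it the same row; thus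
  \<open>x\<close> and \<open>m\<close> share a row of \<open>T\<close> and a column of
  \<open>T'\<close>.\<close>

lemma tableau_collision:
  assumes la: "partition_of r la" and T: "std_tab la A T" and T': "std_tab la A T'"
    and less: "row_less A (tab_row la T) (tab_row la T')"
  shows "\<exists>x\<in>A. \<exists>m\<in>A. x \<noteq> m \<and> tab_row la T x = tab_row la T m \<and> tab_col la T' x = tab_col la T' m"
proof -
  obtain m where m: "m \<in> A" "\<And>x. x \<in> A \<Longrightarrow> x < m \<Longrightarrow> tab_row la T x = tab_row la T' x"
    "tab_row la T m < tab_row la T' m" using less unfolding row_less_def by blast
  define i i' j' where "i = tab_row la T m" and "i' = tab_row la T' m" and "j' = tab_col la T' m"
  have c': "(i', j') \<in> cells la" "T' (i', j') = m" using tab_pos[OF T' m(1)] by (auto simp: i'_def j'_def)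
  have i1: "1 \<le> i" using tab_row_range[OF la T m(1)] by (simp add: i_def)
  have ii': "i < i'" using m(3) by (simp add: i_def i'_def)
  have c: "(i, j') \<in> cells la" using ii' by (intro cells_up[OF la c'(1) i1]) simp
  have lt: "T' (i, j') < m" using std_tab_col_less[OF la T' c'(1) i1 ii'] c'(2) by simp
  have xA: "T' (i, j') \<in> A" by (rule std_tab_in[OF T' c])
  have "tab_row la T (T' (i, j')) = i" using m(2)[OF xA lt] tab_row_T[OF T' c] by simp
  moreover have "tab_col la T' (T' (i, j')) = j'" by (rule tab_col_T[OF T' c])
  ultimately show ?thesis using xA m(1) lt by (intro bexI[of _ "T' (i, j')"] bexI[of _ m]) (auto simp: i_def j'_def)
qed

section \<open>Triangularity and nondegeneracy of the pairing of standard tableaux\<close>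

type_synonym tab = "nat list \<times> (nat \<times> nat \<Rightarrow> nat)"

definition tableaux_on :: "nat set \<Rightarrow> tab set" where
  "tableaux_on A = {(la, T). partition_of (card A) la \<and> std_tab la A T}"

definition tab_col_vec :: "nat set \<Rightarrow> tab \<Rightarrow> (nat \<Rightarrow> nat) \<Rightarrow> int" where
  "tab_col_vec A d = col_vec A (tab_row (fst d) (snd d)) (tab_col (fst d) (snd d))"

definition tab_young_vec :: "nat set \<Rightarrow> tab \<Rightarrow> (nat \<Rightarrow> nat) \<Rightarrow> int" where
  "tab_young_vec A d = young_vec A (tab_row (fst d) (snd d)) (tab_col (fst d) (snd d))"

lemma finite_partitions: "finite {la. partition_of r la}"
proof (rule finite_subset)
  show "{la. partition_of r la} \<subseteq> {la. set la \<subseteq> {0..r} \<and> length la \<le> r}"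
    using member_le_sum_list by (auto simp: length_partition) (auto simp: partition_of_def)
  show "finite {la. set la \<subseteq> {0..r} \<and> length la \<le> r}" by (rule finite_lists_length_le) simp
qed

lemma finite_cells: "finite (cells la)"
proof -
  have "cells la = (SIGMA i:{1..length la}. {1..la ! (i - 1)})" by (auto simp: cells_def)
  then show ?thesis by simp
qed

lemma finite_std_tab: "finite A \<Longrightarrow> finite {T. std_tab la A T}"
proof (rule finite_subset)
  assume "finite A"
  show "{T. std_tab la A T} \<subseteq> {f. \<forall>x. (x \<in> cells la \<longrightarrow> f x \<in> A) \<and> (x \<notin> cells la \<longrightarrow> f x = 0)}"
    by (auto simp: std_tab_in std_tab_out)
  show "finite {f. \<forall>x. (x \<in> cells la \<longrightarrow> f x \<in> A) \<and> (x \<notin> cells la \<longrightarrow> f x = 0)}"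
    by (rule finite_set_of_finite_funs[OF finite_cells \<open>finite A\<close>])
qed

lemma finite_tableaux_on:
  assumes "finite A"
  shows "finite (tableaux_on A)"
proof (rule finite_subset)
  show "tableaux_on A \<subseteq> (SIGMA la:{la. partition_of (card A) la}. {T. std_tab la A T})"
    by (auto simp: tableaux_on_def)
  show "finite (SIGMA la:{la. partition_of (card A) la}. {T. std_tab la A T})"
    using finite_std_tab[OF assms] finite_partitions by blast
qed

text \<open>Column and Young vectors live in the weight given by their shape, so for different
  shapes the supports are disjoint.\<close>

lemma pairing_tab_shape:
  assumes "d \<in> tableaux_on A" "d' \<in> tableaux_on A" "fst d \<noteq> fst d'"
  shows "pairing n A (tab_col_vec A d') (tab_young_vec A d) = 0"
proof -
  have "tab_col_vec A d' a * tab_young_vec A d a = 0" for a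
  proof (rule ccontr)
    assume "tab_col_vec A d' a * tab_young_vec A d a \<noteq> 0"
    then have "shape_fun (fst d) = shape_fun (fst d')"
      using col_vec_content[of A "tab_row (fst d') (snd d')" _ a] young_vec_content[of A "tab_row (fst d) (snd d)" _ a]
        content_tab_row[of "fst d" A "snd d"] content_tab_row[of "fst d'" A "snd d'"] assms
      by (auto simp: tab_col_vec_def tab_young_vec_def tableaux_on_def)
    then show False using shape_fun_inj assms by (auto simp: tableaux_on_def)
  qed
  then show ?thesis unfolding pairing_def by (intro sum.neutral ballI)
qed

lemma pairing_tab_less:
  assumes "finite A" "d \<in> tableaux_on A" "d' \<in> tableaux_on A" "fst d = fst d'"
    "row_less A (tab_row (fst d) (snd d)) (tab_row (fst d') (snd d'))"
  shows "pairing n A (tab_col_vec A d') (tab_young_vec A d) = 0"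
proof -
  obtain x m where "x \<in> A" "m \<in> A" "x \<noteq> m" "tab_row (fst d) (snd d) x = tab_row (fst d) (snd d) m"
    "tab_col (fst d') (snd d') x = tab_col (fst d') (snd d') m"
    using tableau_collision[of "card A" "fst d" A "snd d" "snd d'"] assms by (auto simp: tableaux_on_def)
  then show ?thesis unfolding tab_col_vec_def tab_young_vec_def by (intro pairing_zero[OF assms(1)])
qed

lemma pairing_tab_pos:
  assumes "finite A" "d \<in> tableaux_on A" "card A \<le> n"
  shows "pairing n A (tab_col_vec A d) (tab_young_vec A d) > 0"
  unfolding tab_col_vec_def tab_young_vec_def
proof (rule pairing_pos[OF assms(1)])
  fix p q assume "p \<in> A" "q \<in> A" "tab_row (fst d) (snd d) p = tab_row (fst d) (snd d) q"
    "tab_col (fst d) (snd d) p = tab_col (fst d) (snd d) q"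
  then show "p = q" using assms(2) tab_pos_inj[of "fst d" A "snd d" p q] by (auto simp: tableaux_on_def)
next
  fix p assume "p \<in> A"
  then show "tab_row (fst d) (snd d) p \<in> {1..n}"
    using tab_row_range[of "card A" "fst d" A "snd d" p] assms by (auto simp: tableaux_on_def)
qed

lemma tableaux_on_total:
  assumes "finite A" "d \<in> tableaux_on A" "d' \<in> tableaux_on A" "fst d = fst d'" "d \<noteq> d'"
  shows "row_less A (tab_row (fst d) (snd d)) (tab_row (fst d') (snd d'))
    \<or> row_less A (tab_row (fst d') (snd d')) (tab_row (fst d) (snd d))"
proof (rule ccontr)
  assume *: "\<not> ?thesis"
  have "snd d = snd d'"
    using row_less_total[of _ A "tab_row (fst d) (snd d)" "tab_row (fst d') (snd d')"] * assms
    by (intro std_tab_eqI[of A "fst d"]) (auto simp: tableaux_on_def)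
  then show False using assms by (simp add: prod_eq_iff)
qed

lemma pairing_tab_zero:
  assumes "finite A" "d \<in> tableaux_on A" "d' \<in> tableaux_on A" "d \<noteq> d'"
    "\<not> row_less A (tab_row (fst d') (snd d')) (tab_row (fst d) (snd d))"
  shows "pairing n A (tab_col_vec A d') (tab_young_vec A d) = 0"
proof (cases "fst d = fst d'")
  case True
  then show ?thesis using tableaux_on_total[OF assms(1-3) True assms(4)] assms(5)
    by (intro pairing_tab_less[OF assms(1-3)]) auto
qed (rule pairing_tab_shape[OF assms(2,3)])

text \<open>The matrix is triangular for \<open>row_less\<close> with positive diagonal. In the
  first system the equation at a maximal index with nonzero coefficient has a single term left, in
  the second the one at a minimal index. Independence of the generators uses the first,
  \<open>rkilled_eq_zero\<close> the second.\<close>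

lemma pairing_nondegenerate:
  assumes "finite A" "card A \<le> n"
  shows "(\<And>d'. d' \<in> tableaux_on A \<Longrightarrow> (\<Sum>d\<in>tableaux_on A. of_int (pairing n A (tab_col_vec A d') (tab_young_vec A d)) * x d) = (0::complex))
      \<Longrightarrow> \<forall>d\<in>tableaux_on A. x d = 0"
    and "(\<And>d. d \<in> tableaux_on A \<Longrightarrow> (\<Sum>d'\<in>tableaux_on A. of_int (pairing n A (tab_col_vec A d') (tab_young_vec A d)) * x d') = (0::complex))
      \<Longrightarrow> \<forall>d\<in>tableaux_on A. x d = 0"
proof -
  define R where "R d d' = row_less A (tab_row (fst d) (snd d)) (tab_row (fst d') (snd d'))" for d d' :: tab
  define B where "B = {d\<in>tableaux_on A. x d \<noteq> 0}"
  have fB: "finite B" using finite_tableaux_on[OF assms(1)] by (simp add: B_def)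
  have R: "R d d' \<Longrightarrow> \<not> R d' d" "R d d' \<Longrightarrow> R d' d'' \<Longrightarrow> R d d''" for d d' d''
    unfolding R_def by (fact row_less_asym, fact row_less_trans)
  have asy: "asymp_on B R" "asymp_on B R\<inverse>\<inverse>" and tr: "transp_on B R" "transp_on B R\<inverse>\<inverse>"
    unfolding asymp_on_def transp_on_def conversep_iff using R by blast+
  {
    assume eq: "\<And>d'. d' \<in> tableaux_on A \<Longrightarrow> (\<Sum>d\<in>tableaux_on A. of_int (pairing n A (tab_col_vec A d') (tab_young_vec A d)) * x d) = 0"
    show "\<forall>d\<in>tableaux_on A. x d = 0"
    proof (rule ccontr)
      assume "\<not> ?thesis"
      then have "B \<noteq> {}" by (auto simp: B_def)
      from Finite_Set.bex_min_element[OF fB asy(2) tr(2) this] obtain d0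
        where d0: "d0 \<in> B" "\<And>d. d \<in> B \<Longrightarrow> d \<noteq> d0 \<Longrightarrow> \<not> R d0 d" by auto
      have "of_int (pairing n A (tab_col_vec A d0) (tab_young_vec A d)) * x d
          = (if d = d0 then of_int (pairing n A (tab_col_vec A d0) (tab_young_vec A d0)) * x d0 else 0)" if "d \<in> tableaux_on A" for d
      proof (cases "d = d0 \<or> x d = 0")
        case False
        then have "d \<in> B" using that by (simp add: B_def)
        then have "pairing n A (tab_col_vec A d0) (tab_young_vec A d) = 0"
          using d0 False that by (intro pairing_tab_zero assms) (auto simp: B_def R_def)
        then show ?thesis using False by simp
      qed auto
      then have "(\<Sum>d\<in>tableaux_on A. of_int (pairing n A (tab_col_vec A d0) (tab_young_vec A d)) * x d)
          = (\<Sum>d\<in>tableaux_on A. if d = d0 then of_int (pairing n A (tab_col_vec A d0) (tab_young_vec A d0)) * x d0 else 0)"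
        by (rule sum.cong[OF refl])
      also have "\<dots> = of_int (pairing n A (tab_col_vec A d0) (tab_young_vec A d0)) * x d0"
        using d0(1) finite_tableaux_on[OF assms(1)] by (simp add: B_def)
      finally have "of_int (pairing n A (tab_col_vec A d0) (tab_young_vec A d0)) * x d0 = 0"
        using eq[of d0] d0(1) by (simp add: B_def)
      then show False using d0(1) pairing_tab_pos[OF assms(1) _ assms(2), of d0] by (auto simp: B_def)
    qed
  }
  {
    assume eq: "\<And>d. d \<in> tableaux_on A \<Longrightarrow> (\<Sum>d'\<in>tableaux_on A. of_int (pairing n A (tab_col_vec A d') (tab_young_vec A d)) * x d') = 0"
    show "\<forall>d\<in>tableaux_on A. x d = 0"
    proof (rule ccontr)
      assume "\<not> ?thesis"
      then have "B \<noteq> {}" by (auto simp: B_def)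
      from Finite_Set.bex_min_element[OF fB asy(1) tr(1) this] obtain d0
        where d0: "d0 \<in> B" "\<And>d. d \<in> B \<Longrightarrow> d \<noteq> d0 \<Longrightarrow> \<not> R d d0" by auto
      have "of_int (pairing n A (tab_col_vec A d) (tab_young_vec A d0)) * x d
          = (if d = d0 then of_int (pairing n A (tab_col_vec A d0) (tab_young_vec A d0)) * x d0 else 0)" if "d \<in> tableaux_on A" for d
      proof (cases "d = d0 \<or> x d = 0")
        case False
        then have "d \<in> B" using that by (simp add: B_def)
        then have "pairing n A (tab_col_vec A d) (tab_young_vec A d0) = 0"
          using d0 False that by (intro pairing_tab_zero assms) (auto simp: B_def R_def)
        then show ?thesis using False by simp
      qed auto
      then have "(\<Sum>d\<in>tableaux_on A. of_int (pairing n A (tab_col_vec A d) (tab_young_vec A d0)) * x d)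
          = (\<Sum>d\<in>tableaux_on A. if d = d0 then of_int (pairing n A (tab_col_vec A d0) (tab_young_vec A d0)) * x d0 else 0)"
        by (rule sum.cong[OF refl])
      also have "\<dots> = of_int (pairing n A (tab_col_vec A d0) (tab_young_vec A d0)) * x d0"
        using d0(1) finite_tableaux_on[OF assms(1)] by (simp add: B_def)
      finally have "of_int (pairing n A (tab_col_vec A d0) (tab_young_vec A d0)) * x d0 = 0"
        using eq[of d0] d0(1) by (simp add: B_def)
      then show False using d0(1) pairing_tab_pos[OF assms(1) _ assms(2), of d0] by (auto simp: B_def)
    qed
  }
qed

lemma raise_op_tab_col_vec:
  assumes "finite A" "d \<in> tableaux_on A" "1 \<le> i" "i < j"
  shows "raise_op A i j (tab_col_vec A d) a = 0"
  unfolding tab_col_vec_def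
  using assms tab_col_above[of "card A" "fst d" A "snd d" _ i]
  by (intro raise_op_col_vec) (auto simp: tableaux_on_def)

lemma raise_op_tab_young_vec:
  assumes "finite A" "d \<in> tableaux_on A" "1 \<le> i" "i < j"
  shows "raise_op A i j (tab_young_vec A d) a = 0"
  unfolding tab_young_vec_def using raise_op_tab_col_vec[OF assms] by (intro raise_op_young_vec) (simp add: tab_col_vec_def)

lemma tab_col_vec_content: "d \<in> tableaux_on A \<Longrightarrow> tab_col_vec A d a \<noteq> 0 \<Longrightarrow> content A a = shape_fun (fst d)"
  using col_vec_content[of A "tab_row (fst d) (snd d)" "tab_col (fst d) (snd d)" a] content_tab_row[of "fst d" A "snd d"]
  by (auto simp: tab_col_vec_def tableaux_on_def)

lemma tab_young_vec_content: "d \<in> tableaux_on A \<Longrightarrow> tab_young_vec A d a \<noteq> 0 \<Longrightarrow> content A a = shape_fun (fst d)"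
  using young_vec_content[of A "tab_row (fst d) (snd d)" "tab_col (fst d) (snd d)" a] content_tab_row[of "fst d" A "snd d"]
  by (auto simp: tab_young_vec_def tableaux_on_def)

section \<open>Commutators, adjoints and weights for raising operators\<close>

lemma fbox_empty: "fbox n {} = {\<lambda>_. undefined}"
  by (rule PiE_empty_domain)

text \<open>With no dual slots \<open>gl_act\<close> reduces to \<open>raise_op\<close>, which
  thereby inherits the commutator and adjoint identities.\<close>

lemma gl_act_raise_op:
  assumes "finite A" "i \<in> {1..n}" "j \<in> {1..n}"
  shows "gl_act n A {} (Eij i j) (\<lambda>\<iota>. \<phi> (fst \<iota>)) = (\<lambda>\<iota>. raise_op A i j \<phi> (fst \<iota>))"
proof
  fix \<iota>
  show "gl_act n A {} (Eij i j) (\<lambda>\<iota>. \<phi> (fst \<iota>)) \<iota> = raise_op A i j \<phi> (fst \<iota>)"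
    using gl_act_Eij[OF assms(1) _ assms(2,3), of "{}" "\<lambda>\<iota>. \<phi> (fst \<iota>)" "fst \<iota>" "snd \<iota>"]
    by (simp add: raise_op_def)
qed

lemma raise_op_commutator:
  fixes \<phi> :: "(nat \<Rightarrow> nat) \<Rightarrow> complex"
  assumes "finite A" "1 \<le> i" "1 \<le> j"
  shows "raise_op A i j (raise_op A j i \<phi>) a = raise_op A j i (raise_op A i j \<phi>) a + (of_nat (content A a i) - of_nat (content A a j)) * \<phi> a"
proof -
  \<comment> \<open>\<open>raise_op\<close> carries no bound on values, but \<open>gl_act\<close>
    does; any \<open>n\<close> with both indices in range will serve.\<close>
  define n where "n = max i j"
  have ij: "i \<in> {1..n}" "j \<in> {1..n}" using assms by (auto simp: n_def)
  have "gl_act n A {} (Eij i j) (gl_act n A {} (Eij j i) (\<lambda>\<iota>. \<phi> (fst \<iota>))) (a, undefined)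
    = gl_act n A {} (Eij j i) (gl_act n A {} (Eij i j) (\<lambda>\<iota>. \<phi> (fst \<iota>))) (a, undefined)
      + (gl_act n A {} (Eij i i) (\<lambda>\<iota>. \<phi> (fst \<iota>)) (a, undefined) - gl_act n A {} (Eij j j) (\<lambda>\<iota>. \<phi> (fst \<iota>)) (a, undefined))"
    unfolding gl_act_diff_mat[symmetric] comm_Eij[OF ij, symmetric] using assms by (intro gl_act_comm) auto
  then show ?thesis
    unfolding gl_act_raise_op[OF assms(1) ij] gl_act_raise_op[OF assms(1) ij(2,1)]
      gl_act_raise_op[OF assms(1) ij(1,1)] gl_act_raise_op[OF assms(1) ij(2,2)]
    by (simp add: raise_op_diag algebra_simps)
qed

lemma raise_op_adj:
  assumes "finite A" "i \<in> {1..n}" "j \<in> {1..n}"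
  shows "(\<Sum>a\<in>fbox n A. raise_op A i j \<phi> a * cnj (\<chi> a)) = (\<Sum>a\<in>fbox n A. \<phi> a * cnj (raise_op A j i \<chi> a))"
proof -
  have "herm n A {} (gl_act n A {} (Eij i j) (\<lambda>\<iota>. \<phi> (fst \<iota>))) (\<lambda>\<iota>. \<chi> (fst \<iota>))
    = herm n A {} (\<lambda>\<iota>. \<phi> (fst \<iota>)) (gl_act n A {} (Eij j i) (\<lambda>\<iota>. \<chi> (fst \<iota>)))"
    unfolding gl_act_adj adj_Eij ..
  then show ?thesis
    unfolding gl_act_raise_op[OF assms] gl_act_raise_op[OF assms(1) assms(3,2)] herm_alt fbox_empty by simp
qed

lemma content_upd:
  assumes "finite A" "p \<in> A" "a p = i" "i \<noteq> j"
  shows "content A (a(p := j)) = (content A a)(i := content A a i - 1, j := content A a j + 1)"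
proof
  fix l
  have i: "{q\<in>A. (a(p := j)) q = i} = {q\<in>A. a q = i} - {p}" using assms by auto
  have j: "{q\<in>A. (a(p := j)) q = j} = insert p {q\<in>A. a q = j}" using assms by auto
  have l: "{q\<in>A. (a(p := j)) q = l} = {q\<in>A. a q = l}" if "l \<noteq> i" "l \<noteq> j" using that assms by auto
  have "p \<in> {q\<in>A. a q = i}" "p \<notin> {q\<in>A. a q = j}" using assms by auto
  then show "content A (a(p := j)) l = ((content A a)(i := content A a i - 1, j := content A a j + 1)) l"
    using i j l assms unfolding content_def by (auto simp: card_Diff_singleton)
qed

text \<open>All values of \<open>\<phi>\<close> that enter \<open>raise_op A i j \<phi> a\<close>
  belong to one weight, determined by that of \<open>a\<close>; so each weight component of a killed
  function is killed.\<close>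

lemma raise_op_restrict_content:
  assumes "finite A" "i \<noteq> j" "raise_op A i j \<phi> a = 0"
  shows "raise_op A i j (\<lambda>a. if content A a = \<kappa> then \<phi> a else 0) a = 0"
proof -
  have "raise_op A i j (\<lambda>a. if content A a = \<kappa> then \<phi> a else 0) a
    = (if (content A a)(i := content A a i - 1, j := content A a j + 1) = \<kappa> then raise_op A i j \<phi> a else 0)"
    unfolding raise_op_def using content_upd[OF assms(1) _ _ assms(2), of _ a] by (auto intro!: sum.cong)
  then show ?thesis using assms(3) by simp
qed

text \<open>Comparing the norms of \<open>E\<^sub>i\<^sub>j \<phi>\<close> and \<open>E\<^sub>j\<^sub>i \<phi>\<close> on a weight space.\<close>

lemma killed_dominant:
  fixes \<phi> :: "(nat \<Rightarrow> nat) \<Rightarrow> complex"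
  assumes "finite A" "i \<in> {1..n}" "j \<in> {1..n}" "i \<noteq> j" "\<And>a. raise_op A i j \<phi> a = 0"
    and "a0 \<in> fbox n A" "\<phi> a0 \<noteq> 0"
  shows "content A a0 j \<le> content A a0 i"
proof (rule ccontr)
  assume less: "\<not> ?thesis"
  define \<kappa> where "\<kappa> = content A a0"
  define \<psi> where "\<psi> a = (if content A a = \<kappa> then \<phi> a else 0)" for a
  define \<chi> where "\<chi> = raise_op A j i \<psi>"
  have k: "raise_op A i j \<psi> a = 0" for a
    unfolding \<psi>_def using raise_op_restrict_content[OF assms(1,4)] assms(5) by blast
  have z: "raise_op A j i (raise_op A i j \<psi>) a = 0" for a
    unfolding raise_op_def[of _ j i] by (simp add: k)
  have c: "raise_op A i j \<chi> a = of_real (real (\<kappa> i) - real (\<kappa> j)) * \<psi> a" for a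
    using raise_op_commutator[OF assms(1), of i j \<psi> a] assms(2,3) z[of a] by (auto simp: \<chi>_def \<psi>_def)
  \<comment> \<open>Here \<open>\<chi>\<close> is the image of \<open>\<psi>\<close> under the
    transposed operator. Its squared norm equals \<open>\<kappa> i - \<kappa> j\<close> times that
    of \<open>\<psi>\<close>, which would be negative.\<close>
  have "(\<Sum>a\<in>fbox n A. \<chi> a * cnj (\<chi> a)) = (\<Sum>a\<in>fbox n A. raise_op A i j \<chi> a * cnj (\<psi> a))"
    using raise_op_adj[OF assms(1-3), of \<chi> \<psi>] by (simp add: \<chi>_def)
  also have "\<dots> = of_real (real (\<kappa> i) - real (\<kappa> j)) * (\<Sum>a\<in>fbox n A. \<psi> a * cnj (\<psi> a))"
    by (simp add: c sum_distrib_left mult.assoc)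
  finally have eq: "(\<Sum>a\<in>fbox n A. \<chi> a * cnj (\<chi> a)) = of_real (real (\<kappa> i) - real (\<kappa> j)) * (\<Sum>a\<in>fbox n A. \<psi> a * cnj (\<psi> a))" .
  have norm: "(\<Sum>a\<in>fbox n A. f a * cnj (f a)) = of_real (\<Sum>a\<in>fbox n A. (cmod (f a))\<^sup>2)" for f
    by (simp only: of_real_sum complex_norm_square)
  have re: "(\<Sum>a\<in>fbox n A. (cmod (\<chi> a))\<^sup>2) = (real (\<kappa> i) - real (\<kappa> j)) * (\<Sum>a\<in>fbox n A. (cmod (\<psi> a))\<^sup>2)"
    using eq unfolding norm of_real_mult[symmetric] of_real_eq_iff .
  have "0 < (cmod (\<psi> a0))\<^sup>2" using assms(7) by (simp add: \<psi>_def \<kappa>_def)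
  also have "\<dots> \<le> (\<Sum>a\<in>fbox n A. (cmod (\<psi> a))\<^sup>2)"
    using assms(1,6) by (intro member_le_sum) auto
  finally have "(real (\<kappa> i) - real (\<kappa> j)) * (\<Sum>a\<in>fbox n A. (cmod (\<psi> a))\<^sup>2) < 0"
    using less by (simp add: mult_less_0_iff \<kappa>_def)
  moreover have "0 \<le> (\<Sum>a\<in>fbox n A. (cmod (\<chi> a))\<^sup>2)" by (intro sum_nonneg) simp
  ultimately show False using re by simp
qed

section \<open>Adding a cell with the largest entry to a standard tableau\<close>

definition addable :: "nat \<Rightarrow> tab \<Rightarrow> bool" where
  "addable l d \<longleftrightarrow> 1 \<le> l \<and> (l = 1 \<or> shape_fun (fst d) l < shape_fun (fst d) (l - 1))"

definition ext_la :: "nat \<Rightarrow> nat list \<Rightarrow> nat list" where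
  "ext_la l la = (if l \<le> length la then la[l - 1 := la ! (l - 1) + 1] else la @ [1])"

definition ext :: "nat \<Rightarrow> nat \<Rightarrow> tab \<Rightarrow> tab" where
  "ext p0 l d = (ext_la l (fst d), (snd d)((l, shape_fun (fst d) l + 1) := p0))"

lemma addable_length:
  assumes "addable l (la, T)"
  shows "l \<le> length la + 1"
proof (rule ccontr)
  assume "\<not> ?thesis"
  then have "shape_fun la (l - 1) = 0" "l \<noteq> 1" by (auto simp: shape_fun_def)
  then show False using assms by (simp add: addable_def)
qed

lemma shape_fun_ext_la:
  assumes "addable l (la, T)"
  shows "shape_fun (ext_la l la) = (shape_fun la)(l := shape_fun la l + 1)"
proof
  fix i
  have l: "1 \<le> l" "l \<le> length la + 1" using assms addable_length[OF assms] by (auto simp: addable_def)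
  show "shape_fun (ext_la l la) i = ((shape_fun la)(l := shape_fun la l + 1)) i"
  proof (cases "l \<le> length la")
    case True
    then show ?thesis using l unfolding ext_la_def shape_fun_def by (auto simp: nth_list_update)
  next
    case False
    then have "l = length la + 1" using l by simp
    then show ?thesis unfolding ext_la_def shape_fun_def by (auto simp: nth_append)
  qed
qed

lemma cells_ext_la:
  assumes "addable l (la, T)"
  shows "cells (ext_la l la) = insert (l, shape_fun la l + 1) (cells la)"
proof (rule set_eqI, clarify)
  fix i j
  show "(i, j) \<in> cells (ext_la l la) \<longleftrightarrow> (i, j) \<in> insert (l, shape_fun la l + 1) (cells la)"
    unfolding cells_shape_fun insert_iff shape_fun_ext_la[OF assms] by (cases "i = l") auto
qed

lemma partition_ext:
  assumes "addable l (la, T)" "partition_of r la"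
  shows "partition_of (r + 1) (ext_la l la)"
proof (cases "l \<le> length la")
  case True
  define k where "k = l - 1"
  have k: "k < length la" using True assms(1) by (auto simp: k_def addable_def)
  have lt: "la ! k < la ! (k - 1)" if "k > 0"
    using assms(1) True that by (auto simp: addable_def shape_fun_def k_def split: if_splits)
  have srt: "i < j \<Longrightarrow> j < length la \<Longrightarrow> la ! i \<ge> la ! j" for i j
    using assms(2) by (auto simp: partition_of_def dest: sorted_wrt_nth_less)
  have lt': "la ! k < la ! i" if "i < k" for i
  proof (cases "i = k - 1")
    case False
    then have "i < k - 1" using that by linarith
    then have "la ! (k - 1) \<le> la ! i" using srt k by simp
    then show ?thesis using lt that by simp
  qed (use lt that in simp)
  have e: "ext_la l la = la[k := la ! k + 1]" using True by (simp add: ext_la_def k_def)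
  have "sorted_wrt (\<ge>) (la[k := la ! k + 1])"
    unfolding sorted_wrt_iff_nth_less
  proof (intro allI impI)
    fix i j assume ij: "i < j" "j < length (la[k := la ! k + 1])"
    then show "la[k := la ! k + 1] ! i \<ge> la[k := la ! k + 1] ! j"
      using srt[of i j] lt'[of i] ij k by (cases "i = k"; cases "j = k") (simp_all add: nth_list_update)
  qed
  moreover have "\<forall>x\<in>set (la[k := la ! k + 1]). 0 < x"
    using assms(2) set_update_subset_insert[of la k "la ! k + 1"] by (auto simp: partition_of_def)
  moreover have "sum_list (la[k := la ! k + 1]) = r + 1"
    using assms(2) k elem_le_sum_list[of k la] by (auto simp: partition_of_def sum_list_update)
  ultimately show ?thesis unfolding e partition_of_def by blast
next
  case False
  then show ?thesis using assms(2) by (auto simp: ext_la_def partition_of_def sorted_wrt_append Suc_le_eq One_nat_def)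
qed

text \<open>The new cell is the lowest of its column, so a term of the column vector that is nonzero
  at \<open>a\<close> gives slot \<open>p0\<close> a value at most \<open>l\<close>. Value
  \<open>l\<close> forces the permutation to fix \<open>p0\<close>, and what remains is the column
  group of \<open>d\<close>.\<close>

lemma ext_tableaux_on:
  assumes fin: "finite A" "p0 \<in> A" "\<And>p. p \<in> A \<Longrightarrow> p \<le> p0"
    and d: "d \<in> tableaux_on (A - {p0})" "addable l d"
  shows "ext p0 l d \<in> tableaux_on A"
    and "\<And>a. a p0 > l \<Longrightarrow> tab_col_vec A (ext p0 l d) a = 0"
    and "\<And>a. a p0 = l \<Longrightarrow> tab_col_vec A (ext p0 l d) a = tab_col_vec (A - {p0}) d a"
proof -
  obtain la' T' where d': "d = (la', T')" by (cases d)
  let ?A = "A - {p0}"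
  have part': "partition_of (card ?A) la'" and T': "std_tab la' ?A T'" using d(1) by (auto simp: tableaux_on_def d')
  define m where "m = shape_fun la' l + 1"
  define la where "la = ext_la l la'"
  define T where "T = T'((l, m) := p0)"
  have e: "ext p0 l d = (la, T)" by (simp add: ext_def d' la_def T_def m_def)
  note g = d(2)[unfolded d']
  have C: "cells la = insert (l, m) (cells la')" unfolding la_def m_def by (rule cells_ext_la[OF g])
  have new: "(l, m) \<notin> cells la'" by (simp add: cells_shape_fun m_def)
  have cardA: "card A = card ?A + 1" using card.remove[OF fin(1,2)] unfolding Suc_eq_plus1 .
  have part: "partition_of (card A) la" unfolding cardA la_def by (rule partition_ext[OF g part'])
  have Told: "T c = T' c" if "c \<in> cells la'" for c using that new by (auto simp: T_def)
  have Tnew: "T (l, m) = p0" by (simp add: T_def)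
  have Tlt: "T c < p0" if "c \<in> cells la'" for c
    using std_tab_in[OF T' that] fin(3)[of "T' c"] Told[OF that] by auto
  \<comment> \<open>The new cell is a corner, so it is never the left or the upper cell in a
    comparison.\<close>
  have right: "(l, m + 1) \<notin> cells la" "(l + 1, m) \<notin> cells la"
    using cells_up[OF part', of "l + 1" m l] new g by (auto simp: C cells_shape_fun m_def addable_def)
  have bij: "bij_betw T (cells la) A"
  proof -
    have "bij_betw T' (cells la') ?A" using T' unfolding std_tab_def by (rule conjunct1)
    then have "bij_betw T (cells la') ?A" using bij_betw_cong[of "cells la'" T T' ?A] Told by blast
    moreover have "T (l, m) \<notin> ?A" by (simp add: Tnew)
    ultimately have "bij_betw T (cells la' \<union> {(l, m)}) (?A \<union> {T (l, m)})"
      using notIn_Un_bij_betw3[OF new] by blast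
    moreover have "?A \<union> {T (l, m)} = A" using fin(2) by (auto simp: Tnew)
    ultimately show ?thesis by (simp add: C)
  qed
  have T: "std_tab la A T"
    unfolding std_tab_def
  proof (intro conjI allI impI)
    fix c assume "c \<notin> cells la"
    then have "c \<noteq> (l, m)" "c \<notin> cells la'" unfolding C by blast+
    then show "T c = 0" by (simp add: T_def std_tab_out[OF T'])
  next
    fix i j assume ij: "(i, j) \<in> cells la \<and> (i, j + 1) \<in> cells la"
    have "(i, j) \<noteq> (l, m)" using ij right(1) by (metis prod.inject)
    then have c: "(i, j) \<in> cells la'" using ij unfolding C by blast
    show "T (i, j) < T (i, j + 1)"
    proof (cases "(i, j + 1) = (l, m)")
      case True
      show ?thesis unfolding True Tnew by (rule Tlt[OF c])
    next
      case False
      then have c2: "(i, j + 1) \<in> cells la'" using ij unfolding C by blast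
      have "1 \<le> j" using c by (simp add: cells_shape_fun)
      then have "T' (i, j) < T' (i, j + 1)" by (intro std_tab_row_less[OF T' c2]) auto
      then show ?thesis unfolding Told[OF c] Told[OF c2] .
    qed
  next
    fix i j assume ij: "(i, j) \<in> cells la \<and> (i + 1, j) \<in> cells la"
    have "(i, j) \<noteq> (l, m)" using ij right(2) by (metis prod.inject)
    then have c: "(i, j) \<in> cells la'" using ij unfolding C by blast
    show "T (i, j) < T (i + 1, j)"
    proof (cases "(i + 1, j) = (l, m)")
      case True
      show ?thesis unfolding True Tnew by (rule Tlt[OF c])
    next
      case False
      then have c2: "(i + 1, j) \<in> cells la'" using ij unfolding C by blast
      have "1 \<le> i" using c by (simp add: cells_def)
      then have "T' (i, j) < T' (i + 1, j)" by (intro std_tab_col_less[OF part' T' c2]) auto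
      then show ?thesis unfolding Told[OF c] Told[OF c2] .
    qed
  qed (rule bij)
  show "ext p0 l d \<in> tableaux_on A" unfolding e tableaux_on_def using part T by simp
  define rw cl rw' cl' where "rw = tab_row la T" and "cl = tab_col la T"
    and "rw' = tab_row la' T'" and "cl' = tab_col la' T'"
  have old: "rw p = rw' p" "cl p = cl' p" if "p \<in> ?A" for p
  proof -
    have c: "(rw' p, cl' p) \<in> cells la'" "T' (rw' p, cl' p) = p"
      using tab_pos[OF T' that] by (auto simp: rw'_def cl'_def)
    have c': "(rw' p, cl' p) \<in> cells la" using c(1) by (simp add: C)
    have "T (rw' p, cl' p) = p" using Told[OF c(1)] c(2) by simp
    then show "rw p = rw' p" "cl p = cl' p"
      using tab_row_T[OF T c'] tab_col_T[OF T c'] by (simp_all add: rw_def cl_def)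
  qed
  have p0: "rw p0 = l" "cl p0 = m"
    using tab_row_T[OF T, of l m] tab_col_T[OF T, of l m] by (auto simp: rw_def cl_def Tnew C)
  \<comment> \<open>The slot \<open>p1\<close> sent to \<open>p0\<close> lies in the column of the
    new cell and in row \<open>a p0\<close>, which is at least \<open>l\<close>. That column has no
    row beyond \<open>l\<close>, so \<open>p1\<close> is \<open>p0\<close> itself.\<close>
  have key: "\<gamma> p0 = p0 \<and> a p0 = l"
    if "\<gamma> \<in> fixgrp A cl" "\<forall>p\<in>A. (a \<circ> \<gamma>) p = rw p" "l \<le> a p0" for \<gamma> a
  proof -
    define p1 where "p1 = inv \<gamma> p0"
    have perm: "\<gamma> permutes A" using that(1) by (rule fixgrp_permutes)
    have p1: "p1 \<in> A" "\<gamma> p1 = p0"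
      using permutes_in_image[OF permutes_inv[OF perm]] permutes_inverses(1)[OF perm] fin(2) by (auto simp: p1_def)
    have "cl p1 = m" using that(1) p1 p0(2) by (auto simp: fixgrp_def)
    moreover have r: "rw p1 = a p0" using that(2) p1 by auto
    ultimately have c: "(a p0, m) \<in> cells la" using tab_pos(1)[OF T p1(1)] by (simp add: rw_def cl_def)
    have "a p0 = l"
    proof (rule ccontr)
      assume "a p0 \<noteq> l"
      then have "(a p0, m) \<in> cells la'" using c by (simp add: C)
      then have "(l, m) \<in> cells la'" using that(3) g by (elim cells_up[OF part']) (auto simp: addable_def)
      then show False using new by simp
    qed
    moreover have "p1 = p0"
      using tab_pos_inj[OF T p1(1) fin(2)] r \<open>a p0 = l\<close> \<open>cl p1 = m\<close> p0 by (simp add: rw_def cl_def)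
    ultimately show ?thesis using p1(2) by simp
  qed
  have cvt_e: "tab_col_vec A (ext p0 l d) = col_vec A rw cl" by (simp add: e tab_col_vec_def rw_def cl_def fun_eq_iff)
  have cvt_d: "tab_col_vec ?A d = col_vec ?A rw' cl'" by (simp add: d' tab_col_vec_def rw'_def cl'_def fun_eq_iff)
  fix a
  {
    assume gt: "a p0 > l"
    have "\<not> (\<forall>p\<in>A. (a \<circ> \<gamma>) p = rw p)" if "\<gamma> \<in> fixgrp A cl" for \<gamma>
      using key[OF that, of a] gt by auto
    then have "sign \<gamma> * (if \<forall>p\<in>A. (a \<circ> \<gamma>) p = rw p then 1 else 0) = 0" if "\<gamma> \<in> fixgrp A cl" for \<gamma>
      using that by (simp only: if_False mult_zero_right)
    then show "tab_col_vec A (ext p0 l d) a = 0" unfolding cvt_e col_vec_def by (rule sum.neutral[OF ballI])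
  }
  {
    assume al: "a p0 = l"
    have sub: "\<gamma> \<in> fixgrp A cl \<and> \<gamma> p0 = p0 \<longleftrightarrow> \<gamma> \<in> fixgrp ?A cl'" for \<gamma>
    proof
      assume \<gamma>: "\<gamma> \<in> fixgrp A cl \<and> \<gamma> p0 = p0"
      have "\<gamma> permutes ?A"
        by (rule permutes_superset[of \<gamma> A]) (use \<gamma> in \<open>auto simp: fixgrp_def\<close>)
      moreover have "cl' (\<gamma> p) = cl' p" if p: "p \<in> ?A" for p
      proof -
        have "\<gamma> p \<in> ?A" using permutes_in_image[OF \<open>\<gamma> permutes ?A\<close>] p by blast
        then show ?thesis using \<gamma> p old(2)[OF p] old(2)[of "\<gamma> p"] by (simp add: fixgrp_def)
      qed
      ultimately show "\<gamma> \<in> fixgrp ?A cl'" unfolding fixgrp_def by blast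
    next
      assume \<gamma>: "\<gamma> \<in> fixgrp ?A cl'"
      then have perm: "\<gamma> permutes ?A" by (rule fixgrp_permutes)
      have fx: "\<gamma> p0 = p0" using perm by (simp add: permutes_def)
      have "\<gamma> permutes A" by (rule permutes_subset[OF perm]) auto
      moreover have "cl (\<gamma> p) = cl p" if "p \<in> A" for p
      proof (cases "p = p0")
        case False
        then have "p \<in> ?A" "\<gamma> p \<in> ?A" using that fixgrp_in[OF \<gamma>] by auto
        then show ?thesis using \<gamma> old(2) by (simp add: fixgrp_def)
      qed (simp add: fx)
      ultimately show "\<gamma> \<in> fixgrp A cl \<and> \<gamma> p0 = p0" using fx by (simp add: fixgrp_def)
    qed
    have "col_vec A rw cl a = (\<Sum>\<gamma>\<in>fixgrp ?A cl'. sign \<gamma> * (if \<forall>p\<in>A. (a \<circ> \<gamma>) p = rw p then 1 else 0))"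
      unfolding col_vec_def
    proof (rule sum.mono_neutral_right)
      show "finite (fixgrp A cl)" using fin(1) by simp
      show "fixgrp ?A cl' \<subseteq> fixgrp A cl" using sub by blast
      show "\<forall>\<gamma>\<in>fixgrp A cl - fixgrp ?A cl'. sign \<gamma> * (if \<forall>p\<in>A. (a \<circ> \<gamma>) p = rw p then 1 else 0) = 0"
        using key[of _ a] sub al by auto
    qed
    also have "\<dots> = col_vec ?A rw' cl' a"
      unfolding col_vec_def
    proof (rule sum.cong[OF refl])
      fix \<gamma> assume "\<gamma> \<in> fixgrp ?A cl'"
      then have "\<gamma> p0 = p0" using sub by blast
      then have "(a \<circ> \<gamma>) p0 = rw p0" using p0(1) al by simp
      then have "(\<forall>p\<in>A. (a \<circ> \<gamma>) p = rw p) \<longleftrightarrow> (\<forall>p\<in>?A. (a \<circ> \<gamma>) p = rw p)" by blast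
      also have "\<dots> \<longleftrightarrow> (\<forall>p\<in>?A. (a \<circ> \<gamma>) p = rw' p)"
        by (rule ball_cong[OF refl]) (simp only: old(1))
      finally have "(\<forall>p\<in>A. (a \<circ> \<gamma>) p = rw p) \<longleftrightarrow> (\<forall>p\<in>?A. (a \<circ> \<gamma>) p = rw' p)" .
      then show "sign \<gamma> * (if \<forall>p\<in>A. (a \<circ> \<gamma>) p = rw p then 1 else 0)
        = sign \<gamma> * (if \<forall>p\<in>?A. (a \<circ> \<gamma>) p = rw' p then 1 else 0)" by simp
    qed
    finally show "tab_col_vec A (ext p0 l d) a = tab_col_vec ?A d a" unfolding cvt_e cvt_d .
  }
qed

section \<open>Functions killed by raising operators are spanned by column vectors\<close>

lemma raise_op_diff: "raise_op A i j (\<lambda>a. f a - g a) a = raise_op A i j f a - (raise_op A i j g a :: complex)"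
  unfolding raise_op_def by (simp add: sum_subtractf)

lemma tableaux_on_empty: "(la, T) \<in> tableaux_on {} \<longleftrightarrow> la = [] \<and> T = (\<lambda>_. 0)"
proof
  assume "(la, T) \<in> tableaux_on {}"
  then have "partition_of 0 la" "std_tab la {} T" by (auto simp: tableaux_on_def)
  then show "la = [] \<and> T = (\<lambda>_. 0)"
    using length_partition[of 0 la] std_tab_img[of la "{}" T] std_tab_out[of la "{}" T] by (auto simp: fun_eq_iff)
next
  assume "la = [] \<and> T = (\<lambda>_. 0)"
  moreover have "cells [] = {}" by (auto simp: cells_def)
  ultimately show "(la, T) \<in> tableaux_on {}" by (auto simp: tableaux_on_def partition_of_def std_tab_def bij_betw_def)
qed

lemma tab_col_vec_empty: "tab_col_vec {} d a = 1"
  unfolding tab_col_vec_def by (rule col_vec_rw) auto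

text \<open>Arguments are total functions, hence the first clause. The bound \<open>h\<close> on the
  values is a parameter because the \<open>V\<close> slots and, after reflection, the dual slots are
  confined to ranges of their own.\<close>

definition raise_killed :: "nat set \<Rightarrow> nat \<Rightarrow> ((nat \<Rightarrow> nat) \<Rightarrow> complex) \<Rightarrow> bool" where
  "raise_killed A h \<phi> \<longleftrightarrow> (\<forall>a a'. (\<forall>p\<in>A. a p = a' p) \<longrightarrow> \<phi> a = \<phi> a')
     \<and> (\<forall>a. \<phi> a \<noteq> 0 \<longrightarrow> (\<forall>p\<in>A. a p \<in> {1..h}))
     \<and> (\<forall>i j a. 1 \<le> i \<longrightarrow> i < j \<longrightarrow> j \<le> h \<longrightarrow> raise_op A i j \<phi> a = 0)"

lemma raise_killedD:
  assumes "raise_killed A h \<phi>"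
  shows "\<And>a a'. (\<And>p. p \<in> A \<Longrightarrow> a p = a' p) \<Longrightarrow> \<phi> a = \<phi> a'"
    "\<And>a p. \<phi> a \<noteq> 0 \<Longrightarrow> p \<in> A \<Longrightarrow> a p \<in> {1..h}"
    "\<And>i j a. 1 \<le> i \<Longrightarrow> i < j \<Longrightarrow> j \<le> h \<Longrightarrow> raise_op A i j \<phi> a = 0"
  using assms unfolding raise_killed_def by blast+

text \<open>\<open>killed_dominant\<close> speaks of extensional indices; restricting
  \<open>a\<close> to \<open>A\<close> changes neither its weight nor the value of
  \<open>\<phi>\<close>.\<close>

lemma raise_killed_dominant:
  assumes "finite A" "raise_killed A h \<phi>" "1 \<le> i" "i < j" "j \<le> h" "\<phi> a \<noteq> 0"
  shows "content A a j \<le> content A a i"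
proof -
  let ?a = "restrict a A"
  have "content A ?a j \<le> content A ?a i"
  proof (rule killed_dominant[OF assms(1), of i h j \<phi>])
    show "raise_op A i j \<phi> a = 0" for a by (rule raise_killedD(3)[OF assms(2-5)])
    show "?a \<in> fbox h A" using raise_killedD(2)[OF assms(2,6)] by auto
    show "\<phi> ?a \<noteq> 0" using raise_killedD(1)[OF assms(2), of ?a a] assms(6) by simp
  qed (use assms(3-5) in auto)
  moreover have "content A ?a = content A a" by (rule content_cong) simp
  ultimately show ?thesis by simp
qed

lemma shape_fun_pos: "0 < shape_fun la i \<Longrightarrow> i \<in> {1..length la}"
  by (auto simp: shape_fun_def split: if_splits)

lemma tab_col_vec_length:
  assumes "finite A" "d \<in> tableaux_on A" "tab_col_vec A d a \<noteq> 0" "p \<in> A"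
  shows "a p \<in> {1..length (fst d)}"
proof -
  have "p \<in> {q\<in>A. a q = a p}" using assms(4) by simp
  then have "0 < content A a (a p)" using assms(1) unfolding content_def card_gt_0_iff by auto
  then show ?thesis using tab_col_vec_content[OF assms(2,3)] by (intro shape_fun_pos) simp
qed

lemma length_ext:
  assumes "addable l d"
  shows "length (fst (ext p0 l d)) = max (length (fst d)) l"
  using addable_length[of l "fst d" "snd d"] assms by (auto simp: ext_def ext_la_def)

lemma raise_killed_tab_col_vec:
  assumes "finite A" "d \<in> tableaux_on A" "length (fst d) \<le> h"
  shows "raise_killed A h (\<lambda>a. of_int (tab_col_vec A d a))"
  unfolding raise_killed_def
proof (intro conjI allI impI ballI)
  fix a a' :: "nat \<Rightarrow> nat" assume "\<forall>p\<in>A. a p = a' p"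
  then show "of_int (tab_col_vec A d a) = (of_int (tab_col_vec A d a') :: complex)"
    unfolding tab_col_vec_def using col_vec_cong[of A a a'] by simp
next
  fix a p assume "of_int (tab_col_vec A d a) \<noteq> (0 :: complex)" "p \<in> A"
  then show "a p \<in> {1..h}" using tab_col_vec_length[OF assms(1,2), of a p] assms(3) by simp
next
  fix i j a assume "1 \<le> i" "i < j" "j \<le> h"
  then show "raise_op A i j (\<lambda>a. of_int (tab_col_vec A d a)) a = (0 :: complex)"
    unfolding raise_op_of_int using raise_op_tab_col_vec[OF assms(1,2)] by simp
qed

text \<open>The hypothesis on \<open>f d\<close> is restricted to nonzero coefficients because the
  column vectors of tableaux with more than \<open>h\<close> rows leave the range
  \<open>{1..h}\<close>; their coefficients are zero.\<close>

lemma raise_killed_lincomb: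
  assumes "raise_killed A h \<phi>" "\<And>d. d \<in> D \<Longrightarrow> c d \<noteq> 0 \<Longrightarrow> raise_killed A h (f d)"
  shows "raise_killed A h (\<lambda>a. \<phi> a - (\<Sum>d\<in>D. c d * f d a))"
  unfolding raise_killed_def
proof (intro conjI allI impI ballI)
  fix a a' :: "nat \<Rightarrow> nat" assume e: "\<forall>p\<in>A. a p = a' p"
  have "c d * f d a = c d * f d a'" if "d \<in> D" for d
    using raise_killedD(1)[OF assms(2)[OF that], of a a'] e by (cases "c d = 0") auto
  then have "(\<Sum>d\<in>D. c d * f d a) = (\<Sum>d\<in>D. c d * f d a')" by (rule sum.cong[OF refl])
  then show "\<phi> a - (\<Sum>d\<in>D. c d * f d a) = \<phi> a' - (\<Sum>d\<in>D. c d * f d a')"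
    using raise_killedD(1)[OF assms(1), of a a'] e by simp
next
  fix a p assume "\<phi> a - (\<Sum>d\<in>D. c d * f d a) \<noteq> 0" and p: "p \<in> A"
  then have "\<phi> a \<noteq> 0 \<or> (\<Sum>d\<in>D. c d * f d a) \<noteq> 0" by auto
  then show "a p \<in> {1..h}"
  proof
    assume "\<phi> a \<noteq> 0"
    then show ?thesis by (rule raise_killedD(2)[OF assms(1) _ p])
  next
    assume "(\<Sum>d\<in>D. c d * f d a) \<noteq> 0"
    then obtain d where d: "d \<in> D" "c d * f d a \<noteq> 0" by (rule sum.not_neutral_contains_not_neutral)
    then show ?thesis by (intro raise_killedD(2)[OF assms(2) _ p, of d]) auto
  qed
next
  fix i j a assume ij: "1 \<le> i" "i < j" "j \<le> h"
  have "c d * raise_op A i j (f d) a = 0" if "d \<in> D" for d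
    using raise_killedD(3)[OF assms(2)[OF that] ij] by (cases "c d = 0") auto
  then have "(\<Sum>d\<in>D. c d * raise_op A i j (f d) a) = 0" by (rule sum.neutral[OF ballI])
  then show "raise_op A i j (\<lambda>a. \<phi> a - (\<Sum>d\<in>D. c d * f d a)) a = 0"
    using raise_killedD(3)[OF assms(1) ij] by (simp add: raise_op_diff raise_op_sum raise_op_mult)
qed

text \<open>The coefficient functions with the largest value of \<open>a p0\<close> form, for the maximal position
  \<open>p0\<close>, a highest weight vector on the remaining positions; subtracting the column
  antisymmetrizers of the tableaux extended by a cell with entry \<open>p0\<close> lowers this value, and
  dominance rules out the shapes that cannot be extended.\<close>

theorem raise_killed_span:
  assumes "finite A" "raise_killed A h \<phi>"
  shows "\<exists>c. (\<forall>d. h < length (fst d) \<longrightarrow> c d = 0) \<and> (\<forall>a. \<phi> a = (\<Sum>d\<in>tableaux_on A. c d * of_int (tab_col_vec A d a)))"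
  using assms
proof (induction "card A" arbitrary: A \<phi>)
  case 0
  then have A: "A = {}" by simp
  have T: "tableaux_on {} = {([], \<lambda>_. 0)}" using tableaux_on_empty by (auto simp: set_eq_iff)
  have "\<phi> a = \<phi> undefined" for a using raise_killedD(1)[OF 0(3)] A by blast
  then show ?case unfolding A T
    by (intro exI[of _ "\<lambda>d. if d = ([], \<lambda>_. 0) then \<phi> undefined else 0"]) (auto simp: tab_col_vec_empty)
next
  case (Suc k)
  note fin = Suc.prems(1)
  define p0 where "p0 = Max A"
  define A' where "A' = A - {p0}"
  have ne: "A \<noteq> {}" using Suc.hyps(2) by auto
  have p0: "p0 \<in> A" "\<And>p. p \<in> A \<Longrightarrow> p \<le> p0" using fin ne by (auto simp: p0_def)
  have A': "finite A'" "k = card A'" "p0 \<notin> A'" using fin Suc.hyps(2) p0(1) by (auto simp: A'_def)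
  have AA': "A = insert p0 A'" using p0 by (auto simp: A'_def)
  have main: "\<exists>c. (\<forall>d. h < length (fst d) \<longrightarrow> c d = 0) \<and> (\<forall>a. \<phi> a = (\<Sum>d\<in>tableaux_on A. c d * of_int (tab_col_vec A d a)))"
    if "l \<le> h" "raise_killed A h \<phi>" "\<And>a. \<phi> a \<noteq> 0 \<Longrightarrow> a p0 \<le> l" for l \<phi>
    using that
  proof (induction l arbitrary: \<phi>)
    case 0
    have "\<phi> a = 0" for a
      using raise_killedD(2)[OF "0.prems"(2) _ p0(1), of a] "0.prems"(3)[of a] by auto
    then show ?case by (intro exI[of _ "\<lambda>_. 0"]) simp
  next
    case (Suc l0)
    define l where "l = Suc l0"
    have l: "1 \<le> l" "l \<le> h" using Suc.prems(1) by (auto simp: l_def)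
    note dep = raise_killedD(1)[OF Suc.prems(2)] and val = raise_killedD(2)[OF Suc.prems(2)]
      and kil = raise_killedD(3)[OF Suc.prems(2)]
    define w where "w a = \<phi> (a(p0 := l))" for a
    have "raise_killed A' h w"
      unfolding raise_killed_def
    proof (intro conjI allI impI ballI)
      fix a a' :: "nat \<Rightarrow> nat" assume "\<forall>p\<in>A'. a p = a' p"
      then show "w a = w a'" unfolding w_def by (intro dep) (auto simp: AA')
    next
      fix a p assume "w a \<noteq> 0" "p \<in> A'"
      then have "\<phi> (a(p0 := l)) \<noteq> 0" "p \<in> A" "p \<noteq> p0" using A'(3) by (auto simp: w_def AA')
      then show "a p \<in> {1..h}" using val[OF \<open>\<phi> (a(p0 := l)) \<noteq> 0\<close> \<open>p \<in> A\<close>]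
        by (simp only: fun_upd_other[OF \<open>p \<noteq> p0\<close>])
    next
      fix i j a assume ij: "1 \<le> i" "i < j" "j \<le> h"
      let ?b = "a(p0 := l)"
      \<comment> \<open>Slot \<open>p0\<close> contributes nothing: its value \<open>l\<close> would
        become \<open>j > l\<close>, and by assumption \<open>\<phi>\<close> vanishes there.\<close>
      have z: "\<phi> (?b(p0 := j)) = 0" if "l = i"
      proof (rule ccontr)
        assume "\<phi> (?b(p0 := j)) \<noteq> 0"
        from Suc.prems(3)[OF this] have "j \<le> Suc l0" by (simp only: fun_upd_same)
        then show False using that ij by (simp add: l_def)
      qed
      have "raise_op A i j \<phi> ?b = (\<Sum>p\<in>A. if ?b p = i then \<phi> (?b(p := j)) else 0)" by (rule raise_op_alt[OF fin])
      also have "\<dots> = (if l = i then \<phi> (?b(p0 := j)) else 0) + (\<Sum>p\<in>A'. if ?b p = i then \<phi> (?b(p := j)) else 0)"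
        unfolding AA' using A' by simp
      also have "\<dots> = (\<Sum>p\<in>A'. if ?b p = i then \<phi> (?b(p := j)) else 0)" using z by simp
      also have "\<dots> = (\<Sum>p\<in>A'. if a p = i then w (a(p := j)) else 0)"
      proof (rule sum.cong[OF refl])
        fix p assume "p \<in> A'"
        then have "p \<noteq> p0" using A'(3) by blast
        then show "(if ?b p = i then \<phi> (?b(p := j)) else 0) = (if a p = i then w (a(p := j)) else 0)"
          by (simp add: w_def fun_upd_twist)
      qed
      also have "\<dots> = raise_op A' i j w a" by (rule raise_op_alt[OF A'(1), symmetric])
      finally show "raise_op A' i j w a = 0" using kil[OF ij] by simp
    qed
    then obtain c' where c'0: "\<And>d. h < length (fst d) \<Longrightarrow> c' d = 0"
      and c': "\<And>a. w a = (\<Sum>d\<in>tableaux_on A'. c' d * of_int (tab_col_vec A' d a))"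
      using Suc.hyps(1)[OF A'(2,1)] by blast
    \<comment> \<open>Only tableaux to which a cell can be added in row \<open>l\<close> are
      extended; the others together contribute nothing on the layer \<open>a p0 = l\<close>, as
      dominance shows below.\<close>
    define G where "G = {d\<in>tableaux_on A'. addable l d}"
    have fG: "finite G" "G \<subseteq> tableaux_on A'" using finite_tableaux_on[OF A'(1)] by (auto simp: G_def)
    have ext: "ext p0 l d \<in> tableaux_on A" "a p0 > l \<Longrightarrow> tab_col_vec A (ext p0 l d) a = 0"
      "a p0 = l \<Longrightarrow> tab_col_vec A (ext p0 l d) a = tab_col_vec A' d a" if "d \<in> G" for d a
      using ext_tableaux_on[OF fin p0, of d l] that by (auto simp: G_def A'_def)
    \<comment> \<open>The length bound is carried through both inductions so that the subtracted
      column vectors take values in \<open>{1..h}\<close> and \<open>\<phi>'\<close> stays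
      \<open>raise_killed\<close>.\<close>
    have extl: "length (fst (ext p0 l d)) \<le> h" if "d \<in> G" "c' d \<noteq> 0" for d
    proof -
      have "length (fst d) \<le> h" using c'0[of d] that(2) by linarith
      then show ?thesis using length_ext[of l d p0] that(1) l by (simp add: G_def)
    qed
    define \<phi>' where "\<phi>' a = \<phi> a - (\<Sum>d\<in>G. c' d * of_int (tab_col_vec A (ext p0 l d) a))" for a
    have kl': "raise_killed A h \<phi>'"
      unfolding \<phi>'_def by (intro raise_killed_lincomb raise_killed_tab_col_vec Suc.prems(2) fin ext(1) extl)
    have wl: "\<phi> a = w a" if "a p0 = l" for a using that by (simp add: w_def fun_upd_idem)
    have low: "a p0 \<le> l0" if nz: "\<phi>' a \<noteq> 0" for a
    proof (rule ccontr)
      assume "\<not> a p0 \<le> l0"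
      then consider "a p0 > l" | "a p0 = l" unfolding l_def by linarith
      then show False
      proof cases
        case 1
        then have "\<phi> a = 0" using Suc.prems(3)[of a] by (auto simp: l_def)
        moreover have "(\<Sum>d\<in>G. c' d * of_int (tab_col_vec A (ext p0 l d) a)) = 0"
          by (rule sum.neutral) (simp add: ext(2) 1)
        ultimately show False using nz by (simp add: \<phi>'_def)
      next
        case 2
        have "\<phi>' a = w a - (\<Sum>d\<in>G. c' d * of_int (tab_col_vec A' d a))"
          unfolding \<phi>'_def wl[of a, OF 2] using ext(3)[of _ a, OF _ 2] by simp
        also have "\<dots> = (\<Sum>d\<in>tableaux_on A' - G. c' d * of_int (tab_col_vec A' d a))"
          unfolding c' by (rule sum_diff[OF finite_tableaux_on[OF A'(1)] fG(2), symmetric])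
        finally have "(\<Sum>d\<in>tableaux_on A' - G. c' d * of_int (tab_col_vec A' d a)) \<noteq> 0" using nz by simp
        then obtain d where "d \<in> tableaux_on A' - G" "c' d * of_int (tab_col_vec A' d a) \<noteq> 0"
          by (rule sum.not_neutral_contains_not_neutral)
        then have d: "d \<in> tableaux_on A'" "d \<notin> G" "tab_col_vec A' d a \<noteq> 0" by auto
        have cnt': "content A' a = shape_fun (fst d)" by (rule tab_col_vec_content[OF d(1,3)])
        have cntA: "content A a i = shape_fun (fst d) i + (if i = l then 1 else 0)" for i
        proof -
          have "{p\<in>A. a p = i} = (if i = l then insert p0 {p\<in>A'. a p = i} else {p\<in>A'. a p = i})"
            using 2 by (auto simp: AA')
          then show ?thesis using A' unfolding cnt'[symmetric] content_def by simp
        qed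
        show False
        proof (cases "l = 1")
          case True
          then show False using d l by (simp add: G_def addable_def)
        next
          case False
          have l1: "l - 1 \<noteq> l" using l by linarith
          \<comment> \<open>At this index the weight is the shape of \<open>d\<close> with one more
            in row \<open>l\<close>; dominance of \<open>\<phi>'\<close> therefore says that row
            \<open>l\<close> of \<open>d\<close> is shorter than the row above, so that
            \<open>d\<close> is addable.\<close>
          from False have "content A a l \<le> content A a (l - 1)"
            using l nz by (intro raise_killed_dominant[OF fin kl']) auto
          then have "shape_fun (fst d) l < shape_fun (fst d) (l - 1)" using cntA[of l] cntA[of "l - 1"] l1 by simp
          then show False using d l by (simp add: G_def addable_def)
        qed
      qed
    qed
    have l0h: "l0 \<le> h" using l by (simp add: l_def)
    have "\<exists>c. (\<forall>d. h < length (fst d) \<longrightarrow> c d = 0) \<and> (\<forall>a. \<phi>' a = (\<Sum>d\<in>tableaux_on A. c d * of_int (tab_col_vec A d a)))"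
      by (rule Suc.IH[OF l0h kl']) (rule low)
    then obtain c'' where c''0: "\<And>d. h < length (fst d) \<Longrightarrow> c'' d = 0"
      and c'': "\<And>a. \<phi>' a = (\<Sum>d\<in>tableaux_on A. c'' d * of_int (tab_col_vec A d a))"
      by blast
    \<comment> \<open>Coefficients are collected over all \<open>e\<close> whose extension is
      \<open>d\<close>, however many there are.\<close>
    define c where "c d = c'' d + (\<Sum>e\<in>G. if ext p0 l e = d then c' e else 0)" for d
    have "c d = 0" if "h < length (fst d)" for d
    proof -
      have "(\<Sum>e\<in>G. if ext p0 l e = d then c' e else 0) = 0"
        using extl that by (intro sum.neutral ballI) (metis leD)
      then show ?thesis using c''0[OF that] by (simp add: c_def)
    qed
    moreover have "\<phi> a = (\<Sum>d\<in>tableaux_on A. c d * of_int (tab_col_vec A d a))" for a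
    proof -
      have "(\<Sum>d\<in>tableaux_on A. (\<Sum>e\<in>G. if ext p0 l e = d then c' e else 0) * of_int (tab_col_vec A d a))
        = (\<Sum>d\<in>tableaux_on A. \<Sum>e\<in>G. if ext p0 l e = d then c' e * of_int (tab_col_vec A d a) else 0)"
        unfolding sum_distrib_right by (intro sum.cong refl) auto
      also have "\<dots> = (\<Sum>e\<in>G. \<Sum>d\<in>tableaux_on A. if ext p0 l e = d then c' e * of_int (tab_col_vec A d a) else 0)"
        by (rule sum.swap)
      also have "\<dots> = (\<Sum>e\<in>G. c' e * of_int (tab_col_vec A (ext p0 l e) a))"
        by (intro sum.cong refl) (simp add: finite_tableaux_on[OF fin] ext(1))
      finally have "(\<Sum>d\<in>tableaux_on A. c d * of_int (tab_col_vec A d a)) = \<phi>' a + (\<Sum>e\<in>G. c' e * of_int (tab_col_vec A (ext p0 l e) a))"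
        unfolding c_def distrib_right sum.distrib c'' by simp
      then show ?thesis by (simp add: \<phi>'_def)
    qed
    ultimately show ?case by blast
  qed
  have "a p0 \<le> h" if "\<phi> a \<noteq> 0" for a using raise_killedD(2)[OF Suc.prems(2) that p0(1)] by simp
  then show ?case by (rule main[OF order_refl Suc.prems(2)])
qed

text \<open>The coefficients of the expansion in column vectors solve the second system of
  \<open>pairing_nondegenerate\<close>. The bound \<open>card A \<le> h\<close> leaves room for
  every row number of a tableau on \<open>A\<close>.\<close>

corollary rkilled_eq_zero:
  assumes "finite A" "raise_killed A h \<phi>" "card A \<le> h"
    and "\<And>d. d \<in> tableaux_on A \<Longrightarrow> (\<Sum>a\<in>fbox h A. \<phi> a * of_int (tab_young_vec A d a)) = 0"
  shows "\<phi> a = 0"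
proof -
  obtain c where c: "\<And>a. \<phi> a = (\<Sum>d\<in>tableaux_on A. c d * of_int (tab_col_vec A d a))"
    using raise_killed_span[OF assms(1,2)] by blast
  have "\<forall>d\<in>tableaux_on A. c d = 0"
  proof (rule pairing_nondegenerate(2)[OF assms(1,3)])
    fix d assume "d \<in> tableaux_on A"
    then have "0 = (\<Sum>a\<in>fbox h A. \<Sum>d'\<in>tableaux_on A. c d' * of_int (tab_col_vec A d' a) * of_int (tab_young_vec A d a))"
      using assms(4)[of d] by (simp add: c sum_distrib_right)
    also have "\<dots> = (\<Sum>d'\<in>tableaux_on A. \<Sum>a\<in>fbox h A. c d' * of_int (tab_col_vec A d' a) * of_int (tab_young_vec A d a))"
      by (rule sum.swap)
    also have "\<dots> = (\<Sum>d'\<in>tableaux_on A. of_int (pairing h A (tab_col_vec A d') (tab_young_vec A d)) * c d')"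
      by (simp add: pairing_def sum_distrib_right sum_distrib_left mult_ac)
    finally show "(\<Sum>d'\<in>tableaux_on A. of_int (pairing h A (tab_col_vec A d') (tab_young_vec A d)) * c d') = 0" by simp
  qed
  then show ?thesis by (simp add: c)
qed

subsection \<open>Traceless tensors\<close>

lemma fbox_split:
  assumes "p \<in> A"
  shows "(\<Sum>a\<in>fbox n A. f a) = (\<Sum>a\<in>fbox n (A - {p}). \<Sum>l\<in>{1..n}. f (a(p := l)))"
proof -
  have upd: "a(p := l) \<in> fbox n A" if "a \<in> fbox n (A - {p})" "l \<in> {1..n}" for a l
  proof (rule PiE_I)
    fix q assume "q \<in> A"
    then show "(a(p := l)) q \<in> {1..n}" using that PiE_mem[OF that(1), of q] by (cases "q = p") auto
  next
    fix q assume "q \<notin> A"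
    then show "(a(p := l)) q = undefined" using PiE_arb[OF that(1), of q] assms by (cases "q = p") auto
  qed
  have del: "a(p := undefined) \<in> fbox n (A - {p})" if "a \<in> fbox n A" for a
  proof (rule PiE_I)
    fix q assume "q \<in> A - {p}"
    then show "(a(p := undefined)) q \<in> {1..n}" using PiE_mem[OF that, of q] by (cases "q = p") auto
  next
    fix q assume "q \<notin> A - {p}"
    then show "(a(p := undefined)) q = undefined" using PiE_arb[OF that, of q] by (cases "q = p") auto
  qed
  have und: "a p = undefined" if "a \<in> fbox n (A - {p})" for a
    using PiE_arb[OF that, of p] by simp
  show ?thesis
    unfolding sum.cartesian_product
  proof (rule sum.reindex_bij_witness[where i = "\<lambda>(a, l). a(p := l)" and j = "\<lambda>a. (a(p := undefined), a p)"])
    fix x assume x: "x \<in> fbox n (A - {p}) \<times> {1..n}"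
    obtain a l where [simp]: "x = (a, l)" by (cases x)
    show "(\<lambda>a. (a(p := undefined), a p)) (case x of (a, l) \<Rightarrow> a(p := l)) = x"
      using x und[of a] by (auto simp: fun_upd_idem)
    show "(case x of (a, l) \<Rightarrow> a(p := l)) \<in> fbox n A" using x upd[of a l] by auto
  qed (simp_all add: del fbox_val assms del: atLeastAtMost_iff)
qed

lemma swap_comp: "p \<noteq> p' \<Longrightarrow> a(p := a p', p' := a p) = a \<circ> transpose p p'"
  by (auto simp: fun_eq_iff transpose_def)

lemma Re_cnj_mult_ge: "- ((cmod x)\<^sup>2 + (cmod y)\<^sup>2) / 2 \<le> Re (cnj x * y)"
proof -
  have 1: "\<bar>Re (cnj x * y)\<bar> \<le> cmod x * cmod y" using abs_Re_le_cmod[of "cnj x * y"] unfolding norm_mult complex_mod_cnj .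
  have 2: "2 * (cmod x * cmod y) \<le> (cmod x)\<^sup>2 + (cmod y)\<^sup>2"
    using sum_squares_bound[of "cmod x" "cmod y"] unfolding mult.assoc .
  have "- ((cmod x)\<^sup>2 + (cmod y)\<^sup>2) / 2 \<le> - (cmod x * cmod y)" using 2 by simp
  also have "\<dots> \<le> Re (cnj x * y)" by (rule minus_le_iff[THEN iffD1, OF abs_le_D2[OF 1]])
  finally show ?thesis .
qed

lemma half_sum_le: "x \<le> z \<Longrightarrow> x = - (f + g) / 2 \<Longrightarrow> g \<le> u' \<Longrightarrow> f \<le> u \<Longrightarrow> - (u + u') / 2 \<le> (z :: real)"
  by (simp add: field_simps)

text \<open>\<open>L\<close> holds the allowed values for the slots in \<open>A\<close>,
  \<open>H\<close> the forbidden ones. Nothing refers to the order of the values or to which slots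
  are dual, so the argument applies to the \<open>V\<close> slots and, with the roles exchanged, to
  the dual slots.\<close>

context
  fixes n :: nat and A B L H :: "nat set" and \<psi> :: "(nat \<Rightarrow> nat) \<Rightarrow> (nat \<Rightarrow> nat) \<Rightarrow> complex"
  assumes fin: "finite A" "finite B" and LH: "L \<union> H = {1..n}" "L \<inter> H = {}"
    and kil: "\<And>i j a b. i \<in> L \<Longrightarrow> j \<in> H \<Longrightarrow> a \<in> fbox n A \<Longrightarrow> b \<in> fbox n B \<Longrightarrow>
      (\<Sum>p\<in>{p\<in>A. a p = i}. \<psi> (a(p := j)) b) = (\<Sum>q\<in>{q\<in>B. b q = j}. \<psi> a (b(q := i)))"
    and tr: "\<And>p q a b. p \<in> A \<Longrightarrow> q \<in> B \<Longrightarrow> a \<in> fbox n A \<Longrightarrow> b \<in> fbox n B \<Longrightarrow>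
      (\<Sum>l\<in>{1..n}. \<psi> (a(p := l)) (b(q := l))) = 0"
begin

lemma finLH: "finite L" "finite H"
  using LH(1) by (metis finite_Un finite_atLeastAtMost)+

text \<open>With \<open>i\<close> written into slot \<open>p\<close>, the operator carrying
  \<open>a p\<close> to \<open>i\<close> produces \<open>\<psi> a b\<close> from slot
  \<open>p\<close>, a swap from every other slot with value \<open>i\<close>, and on the other side
  a pair of entries \<open>i\<close> at \<open>p\<close> and \<open>q\<close>. Summed over
  \<open>L\<close>, tracelessness turns these pairs into minus the pairs over
  \<open>H\<close>.\<close>

lemma swap_bracket:
  assumes a: "a \<in> fbox n A" and b: "b \<in> fbox n B" and p: "p \<in> A" "a p \<in> H"
  shows "of_nat (card L) * \<psi> a b
     + (\<Sum>p'\<in>A - {p}. if a p' \<in> L then \<psi> (a \<circ> transpose p p') b else 0)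
     + (\<Sum>q\<in>B. if b q = a p then (\<Sum>l\<in>H. \<psi> (a(p := l)) (b(q := l))) else 0) = 0"
proof -
  have LV: "i \<in> {1..n}" if "i \<in> L" for i using LH(1) that by blast
  have e: "\<psi> a b + (\<Sum>p'\<in>A - {p}. if a p' = i then \<psi> (a \<circ> transpose p p') b else 0)
      = (\<Sum>q\<in>B. if b q = a p then \<psi> (a(p := i)) (b(q := i)) else 0)" if i: "i \<in> L" for i
  proof -
    let ?a = "a(p := i)"
    have a': "?a \<in> fbox n A" by (rule fbox_upd[OF a p(1) LV[OF i]])
    have "(\<Sum>q\<in>B. if b q = a p then \<psi> ?a (b(q := i)) else 0) = (\<Sum>q\<in>{q\<in>B. b q = a p}. \<psi> ?a (b(q := i)))"
      using fin(2) by (rule sum.inter_filter[symmetric])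
    also have "\<dots> = (\<Sum>p'\<in>{p'\<in>A. ?a p' = i}. \<psi> (?a(p' := a p)) b)"
      by (rule kil[OF i p(2) a' b, symmetric])
    also have "\<dots> = (\<Sum>p'\<in>A. if ?a p' = i then \<psi> (?a(p' := a p)) b else 0)"
      using fin(1) by (rule sum.inter_filter)
    also have "\<dots> = \<psi> a b + (\<Sum>p'\<in>A - {p}. if ?a p' = i then \<psi> (?a(p' := a p)) b else 0)"
      by (subst sum.remove[OF fin(1) p(1)]) simp
    also have "(\<Sum>p'\<in>A - {p}. if ?a p' = i then \<psi> (?a(p' := a p)) b else 0)
      = (\<Sum>p'\<in>A - {p}. if a p' = i then \<psi> (a \<circ> transpose p p') b else 0)"
    proof (rule sum.cong[OF refl])
      fix p' assume "p' \<in> A - {p}"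
      then have ne: "p \<noteq> p'" by blast
      show "(if ?a p' = i then \<psi> (?a(p' := a p)) b else 0) = (if a p' = i then \<psi> (a \<circ> transpose p p') b else 0)"
      proof (cases "a p' = i")
        case True
        have "?a(p' := a p) = a \<circ> transpose p p'" using swap_comp[OF ne, of a] unfolding True .
        then show ?thesis by (simp only: fun_upd_other[OF ne[symmetric]])
      next
        case False
        then show ?thesis by (simp only: fun_upd_other[OF ne[symmetric]] if_False)
      qed
    qed
    finally show ?thesis by simp
  qed
  have s1: "(\<Sum>i\<in>L. \<Sum>p'\<in>A - {p}. if a p' = i then \<psi> (a \<circ> transpose p p') b else 0)
    = (\<Sum>p'\<in>A - {p}. if a p' \<in> L then \<psi> (a \<circ> transpose p p') b else 0)"
    by (subst sum.swap) (simp add: finLH)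
  have s2: "(\<Sum>i\<in>L. \<Sum>q\<in>B. if b q = a p then \<psi> (a(p := i)) (b(q := i)) else 0)
    = - (\<Sum>q\<in>B. if b q = a p then (\<Sum>l\<in>H. \<psi> (a(p := l)) (b(q := l))) else 0)"
  proof -
    have "(\<Sum>i\<in>L. if b q = a p then \<psi> (a(p := i)) (b(q := i)) else 0)
      = - (if b q = a p then (\<Sum>l\<in>H. \<psi> (a(p := l)) (b(q := l))) else 0)" if q: "q \<in> B" for q
    proof (cases "b q = a p")
      case True
      have "0 = (\<Sum>l\<in>L \<union> H. \<psi> (a(p := l)) (b(q := l)))" using tr[OF p(1) q a b] unfolding LH(1) by (rule sym)
      also have "\<dots> = (\<Sum>l\<in>L. \<psi> (a(p := l)) (b(q := l))) + (\<Sum>l\<in>H. \<psi> (a(p := l)) (b(q := l)))"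
        by (rule sum.union_disjoint[OF finLH LH(2)])
      finally show ?thesis using True by (simp add: eq_neg_iff_add_eq_0)
    qed simp
    then have "(\<Sum>q\<in>B. \<Sum>i\<in>L. if b q = a p then \<psi> (a(p := i)) (b(q := i)) else 0)
      = (\<Sum>q\<in>B. - (if b q = a p then (\<Sum>l\<in>H. \<psi> (a(p := l)) (b(q := l))) else 0))"
      by (rule sum.cong[OF refl])
    then show ?thesis by (subst sum.swap) (simp only: sum_negf)
  qed
  have "(\<Sum>i\<in>L. \<psi> a b + (\<Sum>p'\<in>A - {p}. if a p' = i then \<psi> (a \<circ> transpose p p') b else 0))
    = (\<Sum>i\<in>L. \<Sum>q\<in>B. if b q = a p then \<psi> (a(p := i)) (b(q := i)) else 0)"
    by (rule sum.cong[OF refl e])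
  then show ?thesis unfolding sum.distrib s1 s2 by (simp add: eq_neg_iff_add_eq_0)
qed

text \<open>The squared norm of the part of \<open>\<psi>\<close> with a forbidden value in slot
  \<open>p\<close>; the goal is that it vanishes.\<close>

definition slot_mass :: "nat \<Rightarrow> real" where
  "slot_mass p = (\<Sum>a\<in>fbox n A. \<Sum>b\<in>fbox n B. if a p \<in> H then (cmod (\<psi> a b))\<^sup>2 else 0)"

lemma slot_mass_nonneg: "0 \<le> slot_mass p"
  unfolding slot_mass_def by (simp add: sum_nonneg)

text \<open>The swap moves the forbidden value from \<open>p\<close> to \<open>p'\<close>. By
  \<open>2 x y \<le> x^2 + y^2\<close> each product is bounded below by minus half the two squares,
  the first counted in \<open>slot_mass p\<close>, the second in
  \<open>slot_mass p'\<close>.\<close>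

lemma swap_term:
  assumes p: "p \<in> A" "p' \<in> A" "p \<noteq> p'"
  shows "- (slot_mass p + slot_mass p') / 2 \<le> (\<Sum>a\<in>fbox n A. \<Sum>b\<in>fbox n B.
    if a p \<in> H then Re (cnj (\<psi> a b) * (if a p' \<in> L then \<psi> (a \<circ> transpose p p') b else 0)) else 0)"
proof -
  let ?t = "transpose p p'"
  have t: "?t permutes A" using p by (intro permutes_swap_id)
  define F where "F a = (\<Sum>b\<in>fbox n B. (cmod (\<psi> a b))\<^sup>2)" for a
  have F0: "0 \<le> F a" for a unfolding F_def by (simp add: sum_nonneg)
  have "(\<Sum>a\<in>fbox n A. if a p \<in> H \<and> a p' \<in> L then F (a \<circ> ?t) else 0)
     = (\<Sum>a\<in>fbox n A. if (a \<circ> ?t) p \<in> L \<and> (a \<circ> ?t) p' \<in> H then F (a \<circ> ?t) else 0)"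
    by (intro sum.cong refl) auto
  also have "\<dots> = (\<Sum>a\<in>fbox n A. if a p \<in> L \<and> a p' \<in> H then F a else 0)"
    by (rule fbox_sum_comp[OF t])
  also have "\<dots> \<le> (\<Sum>a\<in>fbox n A. if a p' \<in> H then F a else 0)"
    by (intro sum_mono) (auto simp: F0)
  also have "\<dots> = slot_mass p'" unfolding slot_mass_def F_def by (intro sum.cong refl) auto
  finally have 1: "(\<Sum>a\<in>fbox n A. if a p \<in> H \<and> a p' \<in> L then F (a \<circ> ?t) else 0) \<le> slot_mass p'" .
  have "(\<Sum>a\<in>fbox n A. if a p \<in> H \<and> a p' \<in> L then F a else 0) \<le> (\<Sum>a\<in>fbox n A. if a p \<in> H then F a else 0)"
    by (intro sum_mono) (auto simp: F0)
  also have "\<dots> = slot_mass p" unfolding slot_mass_def F_def by (intro sum.cong refl) auto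
  finally have 2: "(\<Sum>a\<in>fbox n A. if a p \<in> H \<and> a p' \<in> L then F a else 0) \<le> slot_mass p" .
  have "(\<Sum>a\<in>fbox n A. if a p \<in> H \<and> a p' \<in> L then - (F a + F (a \<circ> ?t)) / 2 else 0)
    \<le> (\<Sum>a\<in>fbox n A. \<Sum>b\<in>fbox n B.
    if a p \<in> H then Re (cnj (\<psi> a b) * (if a p' \<in> L then \<psi> (a \<circ> ?t) b else 0)) else 0)"
  proof (rule sum_mono)
    fix a
    have *: "- (F a + F (a \<circ> ?t)) / 2 \<le> (\<Sum>b\<in>fbox n B. Re (cnj (\<psi> a b) * \<psi> (a \<circ> ?t) b))"
    proof -
      have "- (F a + F (a \<circ> ?t)) / 2 = (\<Sum>b\<in>fbox n B. - ((cmod (\<psi> a b))\<^sup>2 + (cmod (\<psi> (a \<circ> ?t) b))\<^sup>2) / 2)"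
        unfolding F_def sum_divide_distrib[symmetric] sum_negf sum.distrib ..
      also have "\<dots> \<le> (\<Sum>b\<in>fbox n B. Re (cnj (\<psi> a b) * \<psi> (a \<circ> ?t) b))"
        by (rule sum_mono) (rule Re_cnj_mult_ge)
      finally show ?thesis .
    qed
    show "(if a p \<in> H \<and> a p' \<in> L then - (F a + F (a \<circ> ?t)) / 2 else 0)
      \<le> (\<Sum>b\<in>fbox n B. if a p \<in> H then Re (cnj (\<psi> a b) * (if a p' \<in> L then \<psi> (a \<circ> ?t) b else 0)) else 0)"
    proof (cases "a p \<in> H \<and> a p' \<in> L")
      case True
      then have "a p \<in> H" "a p' \<in> L" by auto
      with * show ?thesis by (simp only: if_True simp_thms)
    next
      case False
      have "(\<Sum>b\<in>fbox n B. if a p \<in> H then Re (cnj (\<psi> a b) * (if a p' \<in> L then \<psi> (a \<circ> ?t) b else 0)) else 0) = 0"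
        using False by (intro sum.neutral ballI) simp
      then show ?thesis using False by (simp only: if_False order_refl)
    qed
  qed
  moreover have "(\<Sum>a\<in>fbox n A. if a p \<in> H \<and> a p' \<in> L then - (F a + F (a \<circ> ?t)) / 2 else 0)
    = - ((\<Sum>a\<in>fbox n A. if a p \<in> H \<and> a p' \<in> L then F a else 0)
      + (\<Sum>a\<in>fbox n A. if a p \<in> H \<and> a p' \<in> L then F (a \<circ> ?t) else 0)) / 2"
    unfolding sum.distrib[symmetric] sum_negf[symmetric] sum_divide_distrib
    by (intro sum.cong refl) simp
  ultimately show ?thesis by (rule half_sum_le[OF _ _ 1 2])
qed

text \<open>With all slots but \<open>p\<close> and \<open>q\<close> held fixed, the terms with a
  common value in \<open>H\<close> add up to the squared modulus of the partial trace
  \<open>D\<close> over \<open>H\<close>.\<close>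

lemma trace_term:
  assumes p: "p \<in> A" and q: "q \<in> B"
  shows "0 \<le> (\<Sum>a\<in>fbox n A. \<Sum>b\<in>fbox n B. if a p \<in> H then
    Re (cnj (\<psi> a b) * (if b q = a p then (\<Sum>l\<in>H. \<psi> (a(p := l)) (b(q := l))) else 0)) else 0)"
proof -
  define D where "D a b = (\<Sum>l\<in>H. \<psi> (a(p := l)) (b(q := l)))" for a b
  have Dupd: "D (a(p := l)) (b(q := m)) = D a b" for a b l m by (simp add: D_def)
  have HV: "H \<subseteq> {1..n}" using LH(1) by blast
  have "(\<Sum>a\<in>fbox n A. \<Sum>b\<in>fbox n B. if a p \<in> H then
    Re (cnj (\<psi> a b) * (if b q = a p then D a b else 0)) else 0)
    = (\<Sum>a\<in>fbox n (A - {p}). \<Sum>l\<in>{1..n}. \<Sum>b\<in>fbox n (B - {q}). \<Sum>m\<in>{1..n}. if l \<in> H then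
      Re (cnj (\<psi> (a(p := l)) (b(q := m))) * (if m = l then D a b else 0)) else 0)"
    by (subst fbox_split[OF p], subst fbox_split[OF q]) (simp only: Dupd fun_upd_same)
  also have "\<dots> = (\<Sum>a\<in>fbox n (A - {p}). \<Sum>b\<in>fbox n (B - {q}). \<Sum>l\<in>{1..n}. \<Sum>m\<in>{1..n}. if l \<in> H then
      Re (cnj (\<psi> (a(p := l)) (b(q := m))) * (if m = l then D a b else 0)) else 0)"
    by (intro sum.cong refl sum.swap)
  also have "\<dots> = (\<Sum>a\<in>fbox n (A - {p}). \<Sum>b\<in>fbox n (B - {q}). (cmod (D a b))\<^sup>2)"
  proof (rule sum.cong[OF refl], rule sum.cong[OF refl])
    fix a b
    have "(\<Sum>l\<in>{1..n}. \<Sum>m\<in>{1..n}. if l \<in> H then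
        Re (cnj (\<psi> (a(p := l)) (b(q := m))) * (if m = l then D a b else 0)) else 0)
      = (\<Sum>l\<in>{1..n}. if l \<in> H then Re (cnj (\<psi> (a(p := l)) (b(q := l))) * D a b) else 0)"
    proof (rule sum.cong[OF refl])
      fix l assume l: "l \<in> {1..n}"
      have "(\<Sum>m\<in>{1..n}. if l \<in> H then Re (cnj (\<psi> (a(p := l)) (b(q := m))) * (if m = l then D a b else 0)) else 0)
        = (\<Sum>m\<in>{1..n}. if m = l then (if l \<in> H then Re (cnj (\<psi> (a(p := l)) (b(q := l))) * D a b) else 0) else 0)"
        by (rule sum.cong[OF refl]) auto
      then show "(\<Sum>m\<in>{1..n}. if l \<in> H then Re (cnj (\<psi> (a(p := l)) (b(q := m))) * (if m = l then D a b else 0)) else 0)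
        = (if l \<in> H then Re (cnj (\<psi> (a(p := l)) (b(q := l))) * D a b) else 0)"
        using l by simp
    qed
    also have "\<dots> = (\<Sum>l\<in>H. Re (cnj (\<psi> (a(p := l)) (b(q := l))) * D a b))"
      using HV by (simp add: sum.If_cases Int_absorb1)
    also have "\<dots> = Re (cnj (D a b) * D a b)"
      by (simp only: Re_sum[symmetric] sum_distrib_right[symmetric] D_def cnj_sum)
    also have "\<dots> = (cmod (D a b))\<^sup>2"
      using complex_norm_square[of "D a b"] by (metis Re_complex_of_real mult.commute)
    finally show "(\<Sum>l\<in>{1..n}. \<Sum>m\<in>{1..n}. if l \<in> H then
        Re (cnj (\<psi> (a(p := l)) (b(q := m))) * (if m = l then D a b else 0)) else 0) = (cmod (D a b))\<^sup>2" .
  qed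
  also have "0 \<le> \<dots>" by (intro sum_nonneg) simp
  finally show ?thesis unfolding D_def .
qed

text \<open>\<open>swap_bracket\<close> is multiplied by the conjugate of \<open>\<psi>\<close> and
  summed over the indices with \<open>a p\<close> in \<open>H\<close>: the first term gives the left
  side, the swaps are bounded by \<open>swap_term\<close>, the traces are nonnegative.\<close>

lemma slot_mass_ineq:
  assumes p: "p \<in> A"
  shows "real (card L) * slot_mass p \<le> (\<Sum>p'\<in>A - {p}. (slot_mass p + slot_mass p') / 2)"
proof -
  define X where "X a b = (\<Sum>p'\<in>A - {p}. if a p' \<in> L then \<psi> (a \<circ> transpose p p') b else 0)" for a b
  define Y where "Y a b = (\<Sum>q\<in>B. if b q = a p then (\<Sum>l\<in>H. \<psi> (a(p := l)) (b(q := l))) else 0)" for a b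
  have "0 = (\<Sum>a\<in>fbox n A. \<Sum>b\<in>fbox n B. if a p \<in> H then
      Re (cnj (\<psi> a b) * (of_nat (card L) * \<psi> a b + X a b + Y a b)) else 0)"
  proof -
    have "(if a p \<in> H then Re (cnj (\<psi> a b) * (of_nat (card L) * \<psi> a b + X a b + Y a b)) else 0) = 0"
      if "a \<in> fbox n A" "b \<in> fbox n B" for a b
    proof (cases "a p \<in> H")
      case True
      show ?thesis using swap_bracket[OF that p True] unfolding X_def[symmetric] Y_def[symmetric]
        by (simp only: if_cancel mult_zero_right zero_complex.sel)
    qed simp
    then show ?thesis by (intro sum.neutral[symmetric] ballI) (rule sum.neutral, blast)
  qed
  also have "\<dots> = (\<Sum>a\<in>fbox n A. \<Sum>b\<in>fbox n B.
      real (card L) * (if a p \<in> H then (cmod (\<psi> a b))\<^sup>2 else 0)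
      + (if a p \<in> H then Re (cnj (\<psi> a b) * X a b) else 0) + (if a p \<in> H then Re (cnj (\<psi> a b) * Y a b) else 0))"
  proof (rule sum.cong[OF refl], rule sum.cong[OF refl])
    fix a b
    have "Re (cnj (\<psi> a b) * (of_nat (card L) * \<psi> a b)) = real (card L) * (cmod (\<psi> a b))\<^sup>2"
    proof -
      have "cnj (\<psi> a b) * (of_nat (card L) * \<psi> a b) = of_nat (card L) * (\<psi> a b * cnj (\<psi> a b))"
        by (simp only: mult_ac)
      also have "\<dots> = of_real (real (card L) * (cmod (\<psi> a b))\<^sup>2)"
        unfolding complex_norm_square[symmetric] by simp
      finally show ?thesis by (simp only: Re_complex_of_real)
    qed
    then show "(if a p \<in> H then Re (cnj (\<psi> a b) * (of_nat (card L) * \<psi> a b + X a b + Y a b)) else 0)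
      = real (card L) * (if a p \<in> H then (cmod (\<psi> a b))\<^sup>2 else 0)
      + (if a p \<in> H then Re (cnj (\<psi> a b) * X a b) else 0) + (if a p \<in> H then Re (cnj (\<psi> a b) * Y a b) else 0)"
      by (simp only: distrib_left plus_complex.sel) simp
  qed
  also have "\<dots> = real (card L) * slot_mass p
      + (\<Sum>a\<in>fbox n A. \<Sum>b\<in>fbox n B. if a p \<in> H then Re (cnj (\<psi> a b) * X a b) else 0)
      + (\<Sum>a\<in>fbox n A. \<Sum>b\<in>fbox n B. if a p \<in> H then Re (cnj (\<psi> a b) * Y a b) else 0)"
    unfolding slot_mass_def by (simp only: sum.distrib sum_distrib_left)
  finally have eq: "0 = real (card L) * slot_mass p
      + (\<Sum>a\<in>fbox n A. \<Sum>b\<in>fbox n B. if a p \<in> H then Re (cnj (\<psi> a b) * X a b) else 0)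
      + (\<Sum>a\<in>fbox n A. \<Sum>b\<in>fbox n B. if a p \<in> H then Re (cnj (\<psi> a b) * Y a b) else 0)" .
  have sw: "(\<Sum>a\<in>fbox n A. \<Sum>b\<in>fbox n B. if a p \<in> H then Re (cnj (\<psi> a b) * (\<Sum>d\<in>D. f d a b)) else 0)
    = (\<Sum>d\<in>D. \<Sum>a\<in>fbox n A. \<Sum>b\<in>fbox n B. if a p \<in> H then Re (cnj (\<psi> a b) * f d a b) else 0)"
    for D :: "nat set" and f
  proof -
    have "(if a p \<in> H then Re (cnj (\<psi> a b) * (\<Sum>d\<in>D. f d a b)) else 0)
      = (\<Sum>d\<in>D. if a p \<in> H then Re (cnj (\<psi> a b) * f d a b) else 0)" for a b
      by (simp only: sum_distrib_left Re_sum split: if_split) simp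
    then show ?thesis by (simp only: sum.swap[of _ D])
  qed
  have "- (\<Sum>p'\<in>A - {p}. (slot_mass p + slot_mass p') / 2) = (\<Sum>p'\<in>A - {p}. - (slot_mass p + slot_mass p') / 2)"
    by (simp only: sum_negf minus_divide_left[symmetric])
  also have "\<dots> \<le> (\<Sum>a\<in>fbox n A. \<Sum>b\<in>fbox n B. if a p \<in> H then Re (cnj (\<psi> a b) * X a b) else 0)"
    unfolding X_def sw using p by (intro sum_mono swap_term) auto
  finally have 1: "- (\<Sum>p'\<in>A - {p}. (slot_mass p + slot_mass p') / 2)
    \<le> (\<Sum>a\<in>fbox n A. \<Sum>b\<in>fbox n B. if a p \<in> H then Re (cnj (\<psi> a b) * X a b) else 0)" .
  have 2: "0 \<le> (\<Sum>a\<in>fbox n A. \<Sum>b\<in>fbox n B. if a p \<in> H then Re (cnj (\<psi> a b) * Y a b) else 0)"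
    unfolding Y_def sw by (intro sum_nonneg trace_term p)
  show ?thesis using eq 1 2 by linarith
qed

text \<open>Applied at a slot of largest mass, where every average in \<open>slot_mass_ineq\<close>
  is at most that mass: the factor \<open>card L\<close> exceeds the number
  \<open>card A - 1\<close> of averages, so all masses vanish.\<close>

lemma traceless_low:
  assumes card: "card A \<le> card L" and ab: "a \<in> fbox n A" "b \<in> fbox n B" "\<psi> a b \<noteq> 0" and p: "p \<in> A"
  shows "a p \<in> L"
proof (rule ccontr)
  assume "a p \<notin> L"
  then have ap: "a p \<in> H" using fbox_val[OF ab(1) p] LH(1) by blast
  have ne: "slot_mass ` A \<noteq> {}" "finite (slot_mass ` A)" using p fin(1) by auto
  obtain p0 where p0: "p0 \<in> A" "slot_mass p0 = Max (slot_mass ` A)" using Max_in[OF ne(2,1)] by auto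
  have mx: "slot_mass q \<le> slot_mass p0" if "q \<in> A" for q unfolding p0(2) using ne(2) that by simp
  have "real (card L) * slot_mass p0 \<le> (\<Sum>p'\<in>A - {p0}. (slot_mass p0 + slot_mass p') / 2)" by (rule slot_mass_ineq[OF p0(1)])
  also have "\<dots> \<le> (\<Sum>p'\<in>A - {p0}. slot_mass p0)" by (rule sum_mono) (use mx in auto)
  also have "\<dots> = (real (card A) - 1) * slot_mass p0"
  proof -
    have "real (card (A - {p0})) = real (card A) - 1"
      unfolding card.remove[OF fin(1) p0(1)] of_nat_Suc by simp
    then show ?thesis by (simp only: sum_constant)
  qed
  also have "\<dots> \<le> (real (card L) - 1) * slot_mass p0" using card slot_mass_nonneg by (intro mult_right_mono) auto
  finally have "slot_mass p0 \<le> 0" by (simp add: algebra_simps)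
  then have "slot_mass p = 0" using mx[OF p] slot_mass_nonneg[of p] by simp
  moreover have "(cmod (\<psi> a b))\<^sup>2 \<le> slot_mass p"
  proof -
    have "(cmod (\<psi> a b))\<^sup>2 = (if a p \<in> H then (cmod (\<psi> a b))\<^sup>2 else 0)" using ap by simp
    also have "\<dots> \<le> (\<Sum>b\<in>fbox n B. if a p \<in> H then (cmod (\<psi> a b))\<^sup>2 else 0)"
      by (rule member_le_sum[OF ab(2)]) (simp_all add: fin)
    also have "\<dots> \<le> slot_mass p" unfolding slot_mass_def
      by (rule member_le_sum[OF ab(1)]) (simp_all add: fin sum_nonneg)
    finally show ?thesis .
  qed
  ultimately show False using ab(3) by simp
qed

end

subsection \<open>Contractions\<close>

lemma Idx_upd:
  "(a, b) \<in> Idx n k \<Longrightarrow> i \<in> {1..k} \<Longrightarrow> l \<in> {1..n} \<Longrightarrow> (a(i := l), b) \<in> Idx n k"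
  "(a, b) \<in> Idx n k \<Longrightarrow> j \<in> {1..k} \<Longrightarrow> l \<in> {1..n} \<Longrightarrow> (a, b(j := l)) \<in> Idx n k"
  by (auto simp: Idx_eq simp del: atLeastAtMost_iff intro: fbox_upd)

lemma Idx_val:
  "(a, b) \<in> Idx n k \<Longrightarrow> i \<in> {1..k} \<Longrightarrow> a i \<in> {1..n}"
  "(a, b) \<in> Idx n k \<Longrightarrow> i \<in> {1..k} \<Longrightarrow> b i \<in> {1..n}"
  by (auto simp: Idx_eq simp del: atLeastAtMost_iff intro: fbox_val)

lemma contr_eq: "contr n k i j x (a, b) =
  (if (a, b) \<in> Idx n k \<and> a i = b j then (\<Sum>l\<in>{1..n}. x (a(i := l), b(j := l))) else 0)"
  by (simp add: contr_def)

lemma contr_add: "contr n k i j (\<lambda>\<iota>. x \<iota> + y \<iota>) = (\<lambda>\<iota>. contr n k i j x \<iota> + contr n k i j y \<iota>)"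
  by (rule ext) (simp add: contr_def sum.distrib)

lemma contr_smult: "contr n k i j (\<lambda>\<iota>. c * x \<iota>) = (\<lambda>\<iota>. c * contr n k i j x \<iota>)"
  by (rule ext) (simp add: contr_def sum_distrib_left)

lemma contr_Mcar: "contr n k i j x \<in> Mcar n k"
  by (simp add: Mcar_def contr_def)

text \<open>The contributions of the contracted slots cancel on both sides: after contracting, each
  is \<open>X (a i) (b j)\<close> times the trace \<open>S\<close>; before, each is the trace of
  \<open>X\<close> against the two slots. What is left is the action on the other slots,
  \<open>G\<close>.\<close>

lemma contr_act:
  assumes ij: "i \<in> {1..k}" "j \<in> {1..k}"
  shows "contr n k i j (act n k X x) = act n k X (contr n k i j x)"
proof
  fix \<iota> :: idx
  obtain a b where \<iota>: "\<iota> = (a, b)" by (cases \<iota>)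
  show "contr n k i j (act n k X x) \<iota> = act n k X (contr n k i j x) \<iota>"
  proof (cases "(a, b) \<in> Idx n k")
    case False
    then show ?thesis by (simp add: \<iota> contr_eq act_eq)
  next
    case I: True
    let ?K = "{1..k}" and ?N = "{1..n}"
    define S where "S = (\<Sum>l\<in>?N. x (a(i := l), b(j := l)))"
    define G where "G = (\<Sum>p\<in>?K - {i}. \<Sum>c\<in>?N. X (a p) c * (\<Sum>l\<in>?N. x (a(i := l, p := c), b(j := l))))
      - (\<Sum>q\<in>?K - {j}. \<Sum>c\<in>?N. (\<Sum>l\<in>?N. x (a(i := l), b(j := l, q := c))) * X c (b q))"
    have c1: "contr n k i j x (a(i := c), b) = (if c = b j then S else 0)" if "c \<in> ?N" for c
      using Idx_upd(1)[OF I ij(1) that] by (simp only: contr_eq fun_upd_same fun_upd_upd S_def simp_thms)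
    have c2: "contr n k i j x (a, b(j := c)) = (if c = a i then S else 0)" if "c \<in> ?N" for c
      using Idx_upd(2)[OF I ij(2) that] by (simp only: contr_eq fun_upd_same fun_upd_upd S_def simp_thms eq_commute)
    have c3: "contr n k i j x (a(p := c), b) = (if a i = b j then (\<Sum>l\<in>?N. x (a(i := l, p := c), b(j := l))) else 0)"
      if "p \<in> ?K - {i}" "c \<in> ?N" for p c
    proof -
      have "p \<noteq> i" "p \<in> ?K" using that by blast+
      then show ?thesis using Idx_upd(1)[OF I \<open>p \<in> ?K\<close> that(2)]
        by (simp only: contr_eq fun_upd_other[OF \<open>p \<noteq> i\<close>[symmetric]] simp_thms fun_upd_twist[OF \<open>p \<noteq> i\<close>])
    qed
    have c4: "contr n k i j x (a, b(q := c)) = (if a i = b j then (\<Sum>l\<in>?N. x (a(i := l), b(j := l, q := c))) else 0)"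
      if "q \<in> ?K - {j}" "c \<in> ?N" for q c
    proof -
      have "q \<noteq> j" "q \<in> ?K" using that by blast+
      then show ?thesis using Idx_upd(2)[OF I \<open>q \<in> ?K\<close> that(2)]
        by (simp only: contr_eq fun_upd_other[OF \<open>q \<noteq> j\<close>[symmetric]] simp_thms fun_upd_twist[OF \<open>q \<noteq> j\<close>])
    qed
    have R1: "left_act n ?K X (contr n k i j x) (a, b) = X (a i) (b j) * S
      + (\<Sum>p\<in>?K - {i}. \<Sum>c\<in>?N. X (a p) c * (if a i = b j then (\<Sum>l\<in>?N. x (a(i := l, p := c), b(j := l))) else 0))"
    proof -
      have "(\<Sum>c\<in>?N. X (a i) c * contr n k i j x (a(i := c), b)) = (\<Sum>c\<in>?N. if c = b j then X (a i) (b j) * S else 0)"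
        by (rule sum.cong[OF refl]) (simp add: c1 del: atLeastAtMost_iff)
      also have "\<dots> = X (a i) (b j) * S" using Idx_val(2)[OF I ij(2)] by (simp del: atLeastAtMost_iff)
      finally have "(\<Sum>c\<in>?N. X (a i) c * contr n k i j x (a(i := c), b)) = X (a i) (b j) * S" .
      moreover have "(\<Sum>p\<in>?K - {i}. \<Sum>c\<in>?N. X (a p) c * contr n k i j x (a(p := c), b))
        = (\<Sum>p\<in>?K - {i}. \<Sum>c\<in>?N. X (a p) c * (if a i = b j then (\<Sum>l\<in>?N. x (a(i := l, p := c), b(j := l))) else 0))"
        by (rule sum.cong[OF refl], rule sum.cong[OF refl]) (simp only: c3)
      ultimately show ?thesis unfolding left_act_def fst_conv snd_conv sum.remove[OF finite_atLeastAtMost ij(1)] by simp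
    qed
    have R2: "right_act n ?K X (contr n k i j x) (a, b) = X (a i) (b j) * S
      + (\<Sum>q\<in>?K - {j}. \<Sum>c\<in>?N. (if a i = b j then (\<Sum>l\<in>?N. x (a(i := l), b(j := l, q := c))) else 0) * X c (b q))"
    proof -
      have "(\<Sum>c\<in>?N. contr n k i j x (a, b(j := c)) * X c (b j)) = (\<Sum>c\<in>?N. if c = a i then X (a i) (b j) * S else 0)"
        by (rule sum.cong[OF refl]) (simp add: c2 mult.commute del: atLeastAtMost_iff)
      also have "\<dots> = X (a i) (b j) * S" using Idx_val(1)[OF I ij(1)] by (simp del: atLeastAtMost_iff)
      finally have "(\<Sum>c\<in>?N. contr n k i j x (a, b(j := c)) * X c (b j)) = X (a i) (b j) * S" .
      moreover have "(\<Sum>q\<in>?K - {j}. \<Sum>c\<in>?N. contr n k i j x (a, b(q := c)) * X c (b q))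
        = (\<Sum>q\<in>?K - {j}. \<Sum>c\<in>?N. (if a i = b j then (\<Sum>l\<in>?N. x (a(i := l), b(j := l, q := c))) else 0) * X c (b q))"
        by (rule sum.cong[OF refl], rule sum.cong[OF refl]) (simp only: c4)
      ultimately show ?thesis unfolding right_act_def fst_conv snd_conv sum.remove[OF finite_atLeastAtMost ij(2)] by simp
    qed
    have R: "act n k X (contr n k i j x) (a, b) = (if a i = b j then G else 0)"
      using I unfolding act_eq gl_act_def R1 R2 by (simp add: G_def)
    have L1: "left_act n ?K X x (a(i := l), b(j := l)) = (\<Sum>c\<in>?N. X l c * x (a(i := c), b(j := l)))
      + (\<Sum>p\<in>?K - {i}. \<Sum>c\<in>?N. X (a p) c * x (a(i := l, p := c), b(j := l)))" for l
    proof -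
      have "(\<Sum>p\<in>?K - {i}. \<Sum>c\<in>?N. X ((a(i := l)) p) c * x (a(i := l, p := c), b(j := l)))
        = (\<Sum>p\<in>?K - {i}. \<Sum>c\<in>?N. X (a p) c * x (a(i := l, p := c), b(j := l)))"
        by (rule sum.cong[OF refl]) auto
      then show ?thesis
        unfolding left_act_def fst_conv snd_conv sum.remove[OF finite_atLeastAtMost ij(1)] by simp
    qed
    have L2: "right_act n ?K X x (a(i := l), b(j := l)) = (\<Sum>c\<in>?N. x (a(i := l), b(j := c)) * X c l)
      + (\<Sum>q\<in>?K - {j}. \<Sum>c\<in>?N. x (a(i := l), b(j := l, q := c)) * X c (b q))" for l
    proof -
      have "(\<Sum>q\<in>?K - {j}. \<Sum>c\<in>?N. x (a(i := l), b(j := l, q := c)) * X c ((b(j := l)) q))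
        = (\<Sum>q\<in>?K - {j}. \<Sum>c\<in>?N. x (a(i := l), b(j := l, q := c)) * X c (b q))"
        by (rule sum.cong[OF refl]) auto
      then show ?thesis
        unfolding right_act_def fst_conv snd_conv sum.remove[OF finite_atLeastAtMost ij(2)] by simp
    qed
    have "(\<Sum>l\<in>?N. act n k X x (a(i := l), b(j := l))) = (\<Sum>l\<in>?N. gl_act n ?K ?K X x (a(i := l), b(j := l)))"
    proof (rule sum.cong[OF refl])
      fix l assume "l \<in> ?N"
      then have "(a(i := l), b(j := l)) \<in> Idx n k" by (intro Idx_upd I ij)
      then show "act n k X x (a(i := l), b(j := l)) = gl_act n ?K ?K X x (a(i := l), b(j := l))" by (simp add: act_eq)
    qed
    also have "\<dots> = (\<Sum>l\<in>?N. \<Sum>c\<in>?N. X l c * x (a(i := c), b(j := l)))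
        + (\<Sum>l\<in>?N. \<Sum>p\<in>?K - {i}. \<Sum>c\<in>?N. X (a p) c * x (a(i := l, p := c), b(j := l)))
        - ((\<Sum>l\<in>?N. \<Sum>c\<in>?N. x (a(i := l), b(j := c)) * X c l)
        + (\<Sum>l\<in>?N. \<Sum>q\<in>?K - {j}. \<Sum>c\<in>?N. x (a(i := l), b(j := l, q := c)) * X c (b q)))"
      unfolding gl_act_def L1 L2 by (simp only: sum.distrib sum_subtractf)
    also have "(\<Sum>l\<in>?N. \<Sum>c\<in>?N. X l c * x (a(i := c), b(j := l))) = (\<Sum>l\<in>?N. \<Sum>c\<in>?N. x (a(i := l), b(j := c)) * X c l)"
      by (subst sum.swap) (simp only: mult.commute)
    also have "(\<Sum>l\<in>?N. \<Sum>p\<in>?K - {i}. \<Sum>c\<in>?N. X (a p) c * x (a(i := l, p := c), b(j := l)))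
      = (\<Sum>p\<in>?K - {i}. \<Sum>c\<in>?N. X (a p) c * (\<Sum>l\<in>?N. x (a(i := l, p := c), b(j := l))))"
      unfolding sum_distrib_left by (subst sum.swap, rule sum.cong[OF refl], rule sum.swap)
    also have "(\<Sum>l\<in>?N. \<Sum>q\<in>?K - {j}. \<Sum>c\<in>?N. x (a(i := l), b(j := l, q := c)) * X c (b q))
      = (\<Sum>q\<in>?K - {j}. \<Sum>c\<in>?N. (\<Sum>l\<in>?N. x (a(i := l), b(j := l, q := c))) * X c (b q))"
      unfolding sum_distrib_right by (subst sum.swap, rule sum.cong[OF refl], rule sum.swap)
    finally have "(\<Sum>l\<in>?N. act n k X x (a(i := l), b(j := l))) = G" unfolding G_def add_diff_cancel_left .
    then show ?thesis using I R by (simp add: \<iota> contr_eq)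
  qed
qed

lemma contr_mhom:
  assumes "i \<in> {1..k}" "j \<in> {1..k}"
  shows "mhom n k (contr n k i j)"
  unfolding mhom_def by (simp add: contr_Mcar contr_add contr_smult contr_act[OF assms])

text \<open>Both sides equal the Hermitian product of the partial traces \<open>D x\<close> and
  \<open>D y\<close>: a contraction is a trace followed by the adjoint of that trace.\<close>

lemma contr_adj:
  assumes ij: "i \<in> {1..k}" "j \<in> {1..k}"
  shows "herm_k n k (contr n k i j x) y = herm_k n k x (contr n k i j y)"
proof -
  define D where "D x a b = (\<Sum>l\<in>{1..n}. x (a(i := l), b(j := l)))" for x :: tens and a b
  have Du: "D x (a(i := l)) (b(j := m)) = D x a b" for x a b l m by (simp add: D_def)
  have split: "(\<Sum>a\<in>fbox n {1..k}. \<Sum>b\<in>fbox n {1..k}. f a b)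
    = (\<Sum>a\<in>fbox n ({1..k} - {i}). \<Sum>b\<in>fbox n ({1..k} - {j}). \<Sum>l\<in>{1..n}. \<Sum>m\<in>{1..n}. f (a(i := l)) (b(j := m)))"
    for f :: "(nat \<Rightarrow> nat) \<Rightarrow> (nat \<Rightarrow> nat) \<Rightarrow> complex"
    by (subst fbox_split[OF ij(1)], subst fbox_split[OF ij(2)], rule sum.cong[OF refl], rule sum.swap)
  have row: "(\<Sum>l\<in>{1..n}. \<Sum>m\<in>{1..n}. if l = m then f l m else 0) = (\<Sum>l\<in>{1..n}. f l l)"
    for f :: "nat \<Rightarrow> nat \<Rightarrow> complex"
  proof (rule sum.cong[OF refl])
    fix l assume l: "l \<in> {1..n}"
    have "(\<Sum>m\<in>{1..n}. if l = m then f l m else 0) = (\<Sum>m\<in>{1..n}. if m = l then f l l else 0)"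
      by (rule sum.cong[OF refl]) auto
    then show "(\<Sum>m\<in>{1..n}. if l = m then f l m else 0) = f l l" using l by simp
  qed
  have "herm_k n k (contr n k i j x) y
    = (\<Sum>a\<in>fbox n {1..k}. \<Sum>b\<in>fbox n {1..k}. if a i = b j then D x a b * cnj (y (a, b)) else 0)"
    unfolding herm_alt by (rule sum.cong[OF refl], rule sum.cong[OF refl]) (simp add: contr_eq Idx_eq D_def)
  also have "\<dots> = (\<Sum>a\<in>fbox n ({1..k} - {i}). \<Sum>b\<in>fbox n ({1..k} - {j}). D x a b * cnj (D y a b))"
    unfolding split fun_upd_same Du row by (simp only: D_def cnj_sum sum_distrib_left)
  also have "\<dots> = (\<Sum>a\<in>fbox n {1..k}. \<Sum>b\<in>fbox n {1..k}. if a i = b j then x (a, b) * cnj (D y a b) else 0)"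
    unfolding split fun_upd_same Du row by (simp only: D_def sum_distrib_right)
  also have "\<dots> = herm_k n k x (contr n k i j y)"
    unfolding herm_alt by (rule sum.cong[OF refl], rule sum.cong[OF refl]) (simp add: contr_eq Idx_eq D_def)
  finally show ?thesis .
qed

lemma contr_contr:
  assumes "i \<in> {1..k}" "j \<in> {1..k}" "i' \<noteq> i" "j' \<noteq> j"
  shows "contr n k i j (contr n k i' j' x) (a, b) = (if (a, b) \<in> Idx n k \<and> a i = b j \<and> a i' = b j'
    then (\<Sum>l\<in>{1..n}. \<Sum>l'\<in>{1..n}. x (a(i := l, i' := l'), b(j := l, j' := l'))) else 0)"
proof (cases "(a, b) \<in> Idx n k \<and> a i = b j")
  case True
  have "contr n k i' j' x (a(i := l), b(j := l)) = (if a i' = b j'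
      then (\<Sum>l'\<in>{1..n}. x (a(i := l, i' := l'), b(j := l, j' := l'))) else 0)" if "l \<in> {1..n}" for l
  proof -
    have "(a(i := l), b(j := l)) \<in> Idx n k" using True that assms by (intro Idx_upd) auto
    then show ?thesis using assms(3,4) by (simp add: contr_eq)
  qed
  then have "(\<Sum>l\<in>{1..n}. contr n k i' j' x (a(i := l), b(j := l))) = (\<Sum>l\<in>{1..n}. if a i' = b j'
      then (\<Sum>l'\<in>{1..n}. x (a(i := l, i' := l'), b(j := l, j' := l'))) else 0)"
    by (rule sum.cong[OF refl])
  then show ?thesis using True by (simp add: contr_eq[of _ _ i j])
next
  case False
  then show ?thesis by (auto simp: contr_eq[of _ _ i j])
qed

lemma contr_commute:
  assumes "i \<in> {1..k}" "j \<in> {1..k}" "i' \<in> {1..k}" "j' \<in> {1..k}" "i' \<noteq> i" "j' \<noteq> j"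
  shows "contr n k i j (contr n k i' j' x) = contr n k i' j' (contr n k i j x)"
proof
  fix \<iota> :: idx
  obtain a b where \<iota>: "\<iota> = (a, b)" by (cases \<iota>)
  have "(\<Sum>l\<in>{1..n}. \<Sum>l'\<in>{1..n}. x (a(i := l, i' := l'), b(j := l, j' := l')))
    = (\<Sum>l'\<in>{1..n}. \<Sum>l\<in>{1..n}. x (a(i' := l', i := l), b(j' := l', j := l)))"
    by (subst sum.swap) (simp only: fun_upd_twist[OF assms(5)] fun_upd_twist[OF assms(6)])
  then show "contr n k i j (contr n k i' j' x) \<iota> = contr n k i' j' (contr n k i j x) \<iota>"
    unfolding \<iota> contr_contr[OF assms(1,2,5,6)] contr_contr[OF assms(3,4) assms(5,6)[symmetric]]
    by (auto simp: conj_commute)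
qed

text \<open>The pair inserted by a contraction has trace \<open>n\<close>. This is why division by
  \<open>n\<close> makes a contraction idempotent.\<close>

lemma contr_square:
  assumes "i \<in> {1..k}" "j \<in> {1..k}"
  shows "contr n k i j (contr n k i j x) = (\<lambda>\<iota>. of_nat n * contr n k i j x \<iota>)"
proof
  fix \<iota> :: idx
  obtain a b where \<iota>: "\<iota> = (a, b)" by (cases \<iota>)
  show "contr n k i j (contr n k i j x) \<iota> = of_nat n * contr n k i j x \<iota>"
  proof (cases "(a, b) \<in> Idx n k \<and> a i = b j")
    case True
    have "contr n k i j x (a(i := l), b(j := l)) = contr n k i j x (a, b)" if "l \<in> {1..n}" for l
    proof -
      have "(a(i := l), b(j := l)) \<in> Idx n k" using True that assms by (intro Idx_upd) auto
      then show ?thesis using True by (simp add: contr_eq)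
    qed
    then have "(\<Sum>l\<in>{1..n}. contr n k i j x (a(i := l), b(j := l))) = (\<Sum>l\<in>{1..n}. contr n k i j x (a, b))"
      by (rule sum.cong[OF refl])
    then show ?thesis using True unfolding \<iota> contr_eq[of _ _ i j "contr n k i j x"] by simp
  next
    case False
    then show ?thesis unfolding \<iota> by (auto simp: contr_eq)
  qed
qed

subsection \<open>The projection onto \<open>sl\<close>-tensors\<close>

text \<open>An arbitrary list of slots in place of \<open>[1..<k+1]\<close> allows induction over
  the factors of \<open>e\<close>.\<close>

definition traceless_proj :: "nat \<Rightarrow> nat \<Rightarrow> nat list \<Rightarrow> tens \<Rightarrow> tens" where
  "traceless_proj n k L x = foldr (\<lambda>i y. (\<lambda>\<iota>. y \<iota> - contr n k i i y \<iota> / of_nat n)) L x"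

lemma e_op_traceless_proj: "e_op n k = traceless_proj n k [1..<k+1]"
  by (simp add: fun_eq_iff e_op_def traceless_proj_def)

lemma traceless_proj_simps: "traceless_proj n k [] x = x"
  "traceless_proj n k (i # L) x = (\<lambda>\<iota>. traceless_proj n k L x \<iota> - contr n k i i (traceless_proj n k L x) \<iota> / of_nat n)"
  by (simp_all add: traceless_proj_def)

lemma mhom_add_smult:
  assumes "mhom n k f"
  shows "mhom n k (\<lambda>y \<iota>. y \<iota> + c * f y \<iota>)"
proof -
  note F = mhomD[OF assms] and M = is_submodD[OF Mcar_submod[of n k]]
  have "(\<lambda>\<iota>. y \<iota> + c * f y \<iota>) \<in> Mcar n k" if "y \<in> Mcar n k" for y
    by (intro M(3) M(4) F(1) that)
  then show ?thesis
    unfolding mhom_def by (simp add: F(2-4) act_add act_smult algebra_simps)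
qed

lemma mhom_proj:
  assumes "i \<in> {1..k}"
  shows "mhom n k (\<lambda>y \<iota>. y \<iota> - contr n k i i y \<iota> / of_nat n)"
  using mhom_add_smult[OF contr_mhom[OF assms assms], of n "- 1 / of_nat n"] by simp

lemma mhom_traceless_proj: "set L \<subseteq> {1..k} \<Longrightarrow> mhom n k (traceless_proj n k L)"
proof (induction L)
  case Nil
  show ?case by (simp add: mhom_def traceless_proj_simps)
next
  case (Cons i L)
  then have "mhom n k ((\<lambda>y \<iota>. y \<iota> - contr n k i i y \<iota> / of_nat n) \<circ> traceless_proj n k L)"
    by (intro mhom_comp mhom_proj) auto
  moreover have "(\<lambda>y \<iota>. y \<iota> - contr n k i i y \<iota> / of_nat n) \<circ> traceless_proj n k L = traceless_proj n k (i # L)"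
    by (simp add: fun_eq_iff traceless_proj_simps)
  ultimately show ?case by simp
qed

lemma contr_diff_div:
  "contr n k i j (\<lambda>\<iota>. x \<iota> - y \<iota> / of_nat m) = (\<lambda>\<iota>. contr n k i j x \<iota> - contr n k i j y \<iota> / of_nat m)"
  using contr_add[of n k i j x "\<lambda>\<iota>. (- 1 / of_nat m) * y \<iota>"]
  by (simp only: contr_smult) (simp add: fun_eq_iff)

lemma contr_zero: "contr n k i j (\<lambda>_. 0) = (\<lambda>_. 0)"
  by (rule ext) (simp add: contr_def)

text \<open>By \<open>contr_square\<close> the contraction annihilates its own factor; it commutes
  with the factors for the other slots.\<close>

lemma contr_traceless_proj:
  assumes "0 < n" "set L \<subseteq> {1..k}" "i \<in> set L"
  shows "contr n k i i (traceless_proj n k L x) = (\<lambda>_. 0)"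
  using assms(2,3)
proof (induction L)
  case (Cons j L)
  have ij: "i \<in> {1..k}" "j \<in> {1..k}" using Cons.prems by auto
  show ?case
  proof (cases "i = j")
    case True
    have c: "contr n k j j (contr n k j j (traceless_proj n k L x)) = (\<lambda>\<iota>. of_nat n * contr n k j j (traceless_proj n k L x) \<iota>)"
      by (rule contr_square[OF ij(2,2)])
    show ?thesis unfolding traceless_proj_simps contr_diff_div True c using assms(1) by (simp add: fun_eq_iff)
  next
    case False
    then have z: "contr n k i i (traceless_proj n k L x) = (\<lambda>_. 0)" using Cons by auto
    have c: "contr n k i i (contr n k j j (traceless_proj n k L x)) = contr n k j j (contr n k i i (traceless_proj n k L x))"
      by (rule contr_commute[OF ij(1,1) ij(2,2)]) (use False in auto)
    show ?thesis unfolding traceless_proj_simps contr_diff_div c z contr_zero by simp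
  qed
qed simp

lemma traceless_proj_fixed: "(\<And>i. i \<in> set L \<Longrightarrow> contr n k i i x = (\<lambda>_. 0)) \<Longrightarrow> traceless_proj n k L x = x"
  by (induction L) (simp_all add: traceless_proj_simps)

lemma herm_k_traceless_proj:
  assumes "set L \<subseteq> {1..k}" "\<And>i. i \<in> set L \<Longrightarrow> contr n k i i z = (\<lambda>_. 0)"
  shows "herm_k n k z (traceless_proj n k L x) = herm_k n k z x"
  using assms
proof (induction L)
  case (Cons j L)
  have j: "j \<in> {1..k}" using Cons.prems(1) by simp
  have "herm_k n k z (\<lambda>\<iota>. (1 / of_nat n) * contr n k j j (traceless_proj n k L x) \<iota>) = 0"
    unfolding herm_smult_right contr_adj[OF j j, symmetric] using Cons.prems(2)[of j] by simp
  then show ?case using Cons by (simp add: traceless_proj_simps herm_diff_right)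
qed (simp add: traceless_proj_simps)

text \<open>Contractions at \<open>(i, i)\<close> produce coefficients only where
  \<open>a i = b i\<close>. Away from these coincidences the projection is invisible, which is how
  the generators are evaluated at generic indices.\<close>

lemma traceless_proj_eval: "(\<And>i. i \<in> set L \<Longrightarrow> a i \<noteq> b i) \<Longrightarrow> traceless_proj n k L x (a, b) = x (a, b)"
  by (induction L) (simp_all add: traceless_proj_simps contr_eq)

section \<open>Products of contractions along a partial matching\<close>

definition contr_pairs :: "nat \<Rightarrow> nat \<Rightarrow> (nat \<times> nat) list \<Rightarrow> tens \<Rightarrow> tens" where
  "contr_pairs n k ps z = foldr (\<lambda>(i, j) y. contr n k i j y) ps z"

lemma cst_contr_pairs: "cst n k s t z = contr_pairs n k (zip s t) z"
  by (simp add: cst_def contr_pairs_def)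

lemma contr_pairs_simps: "contr_pairs n k [] z = z" "contr_pairs n k ((i, j) # ps) z = contr n k i j (contr_pairs n k ps z)"
  by (simp_all add: contr_pairs_def)

lemma contr_pairs_append: "contr_pairs n k (ps @ qs) z = contr_pairs n k ps (contr_pairs n k qs z)"
  by (simp add: contr_pairs_def)

text \<open>A partial matching between \<open>V\<close> slots and dual slots, given as a
  list.\<close>

definition valid_pairs :: "nat \<Rightarrow> (nat \<times> nat) list \<Rightarrow> bool" where
  "valid_pairs k ps \<longleftrightarrow> distinct (map fst ps) \<and> distinct (map snd ps) \<and> set ps \<subseteq> {1..k} \<times> {1..k}"

lemma valid_pairs_Cons: "valid_pairs k ((i, j) # ps) \<longleftrightarrow> valid_pairs k ps \<and> i \<in> {1..k} \<and> j \<in> {1..k}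
    \<and> (\<forall>p\<in>set ps. fst p \<noteq> i \<and> snd p \<noteq> j)"
  by (auto simp: valid_pairs_def image_iff)

lemma mhom_contr_pairs: "valid_pairs k ps \<Longrightarrow> mhom n k (contr_pairs n k ps)"
proof (induction ps)
  case Nil
  show ?case by (simp add: mhom_def contr_pairs_simps)
next
  case (Cons p ps)
  obtain i j where p: "p = (i, j)" by (cases p)
  have "mhom n k (contr n k i j \<circ> contr_pairs n k ps)"
    using Cons p by (intro mhom_comp contr_mhom) (simp_all add: valid_pairs_Cons del: atLeastAtMost_iff)
  moreover have "contr n k i j \<circ> contr_pairs n k ps = contr_pairs n k (p # ps)" by (simp add: fun_eq_iff p contr_pairs_simps)
  ultimately show ?case by simp
qed

lemma contr_pairs_adj: "valid_pairs k ps \<Longrightarrow> herm_k n k (contr_pairs n k ps z) w = herm_k n k z (contr_pairs n k (rev ps) w)"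
proof (induction ps arbitrary: w)
  case Nil
  show ?case by (simp add: contr_pairs_simps)
next
  case (Cons p ps)
  obtain i j where p: "p = (i, j)" by (cases p)
  have v: "valid_pairs k ps" "i \<in> {1..k}" "j \<in> {1..k}" using Cons.prems unfolding p valid_pairs_Cons by blast+
  show ?case unfolding p contr_pairs_simps contr_adj[OF v(2,3)] Cons.IH[OF v(1)] rev.simps contr_pairs_append ..
qed

text \<open>Contractions at disjoint pairs commute, so a new pair can take its place in increasing
  order, as \<open>data\<close> requires of \<open>s\<close>.\<close>

lemma contr_pairs_insort:
  assumes "valid_pairs k ((i, j) # ps)"
  shows "contr_pairs n k (insort_key fst (i, j) ps) z = contr n k i j (contr_pairs n k ps z)"
  using assms
proof (induction ps)
  case Nil
  show ?case by (simp add: contr_pairs_simps)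
next
  case (Cons p ps)
  obtain i' j' where p: "p = (i', j')" by (cases p)
  have v: "i \<in> {1..k}" "j \<in> {1..k}" "i' \<in> {1..k}" "j' \<in> {1..k}" "i' \<noteq> i" "j' \<noteq> j" "valid_pairs k ((i, j) # ps)"
    using Cons.prems unfolding p by (auto simp: valid_pairs_Cons simp del: atLeastAtMost_iff)
  show ?case
    using Cons.IH[OF v(7)] contr_commute[OF v(1-6), of n "contr_pairs n k ps z"] by (simp add: p contr_pairs_simps)
qed

lemma contr_pairs_support:
  assumes "valid_pairs k ps" "z \<in> Mcar n k" "contr_pairs n k ps z (a, b) \<noteq> 0"
  shows "(a, b) \<in> Idx n k \<and> (\<forall>p\<in>set ps. a (fst p) = b (snd p))"
  using assms(1,3)
proof (induction ps arbitrary: a b)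
  case Nil
  then show ?case using McarD[OF assms(2), of "(a, b)"] by (auto simp: contr_pairs_simps)
next
  case (Cons p ps)
  obtain i j where p: "p = (i, j)" by (cases p)
  have v: "valid_pairs k ps" "\<forall>p\<in>set ps. fst p \<noteq> i \<and> snd p \<noteq> j" using Cons.prems(1) unfolding p valid_pairs_Cons by blast+
  have ab: "(a, b) \<in> Idx n k \<and> a i = b j"
  proof (rule ccontr)
    assume "\<not> ?thesis"
    then have "contr_pairs n k (p # ps) z (a, b) = 0" unfolding p contr_pairs_simps contr_eq by (rule if_not_P)
    then show False using Cons.prems(2) by blast
  qed
  then have "(\<Sum>l\<in>{1..n}. contr_pairs n k ps z (a(i := l), b(j := l))) \<noteq> 0"
    using Cons.prems(2) unfolding p contr_pairs_simps contr_eq by (simp only: simp_thms if_True)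
  then obtain l where "contr_pairs n k ps z (a(i := l), b(j := l)) \<noteq> 0"
    by (rule sum.not_neutral_contains_not_neutral)
  then have m: "\<forall>p\<in>set ps. (a(i := l)) (fst p) = (b(j := l)) (snd p)" using Cons.IH[OF v(1)] by blast
  have "\<forall>p\<in>set ps. a (fst p) = b (snd p)"
  proof
    fix q assume q: "q \<in> set ps"
    then have ne: "fst q \<noteq> i" "snd q \<noteq> j" using v(2) by blast+
    show "a (fst q) = b (snd q)"
      using m[rule_format, OF q] unfolding fun_upd_other[OF ne(1)] fun_upd_other[OF ne(2)] .
  qed
  then show ?case using ab by (simp add: p)
qed

text \<open>A contraction leaves the sum over \<open>l\<close> of \<open>v_l\<close> tensor its dual
  at the contracted pair, whose coefficient is the same for every common value
  \<open>l\<close>.\<close>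

lemma contr_pairs_inv:
  assumes "valid_pairs k ps" "(i, j) \<in> set ps" "(a, b) \<in> Idx n k" "a i = b j" "l \<in> {1..n}"
  shows "contr_pairs n k ps z (a(i := l), b(j := l)) = contr_pairs n k ps z (a, b)"
  using assms(1-4)
proof (induction ps arbitrary: a b)
  case (Cons p ps)
  obtain i' j' where p: "p = (i', j')" by (cases p)
  have v: "valid_pairs k ps" "\<forall>p\<in>set ps. fst p \<noteq> i' \<and> snd p \<noteq> j'" "i' \<in> {1..k}" "j' \<in> {1..k}"
    using Cons.prems(1) unfolding p valid_pairs_Cons by blast+
  have ij: "i \<in> {1..k}" "j \<in> {1..k}" using Cons.prems(1,2) by (auto simp: valid_pairs_def simp del: atLeastAtMost_iff)
  have I: "(a(i := l), b(j := l)) \<in> Idx n k" by (intro Idx_upd Cons.prems(3) ij assms(5))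
  show ?case
  proof (cases "(i, j) = p")
    case True
    then have e: "i' = i" "j' = j" by (simp_all add: p)
    show ?thesis using I Cons.prems(3,4) unfolding p contr_pairs_simps contr_eq e
      by (simp only: fun_upd_same fun_upd_upd simp_thms if_True)
  next
    case False
    then have mem: "(i, j) \<in> set ps" using Cons.prems(2) by auto
    then have ne: "i \<noteq> i'" "j \<noteq> j'" using v(2) by fastforce+
    have "contr_pairs n k ps z (a(i := l, i' := m), b(j := l, j' := m)) = contr_pairs n k ps z (a(i' := m), b(j' := m))"
      if m: "m \<in> {1..n}" for m
    proof -
      have "(a(i' := m), b(j' := m)) \<in> Idx n k" by (intro Idx_upd Cons.prems(3) v m)
      moreover have "(a(i' := m)) i = (b(j' := m)) j" using ne Cons.prems(4) by simp
      ultimately show ?thesis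
        using Cons.IH[OF v(1) mem] by (simp only: fun_upd_twist[OF ne(1)] fun_upd_twist[OF ne(2)])
    qed
    then have "(\<Sum>m\<in>{1..n}. contr_pairs n k ps z (a(i := l, i' := m), b(j := l, j' := m)))
      = (\<Sum>m\<in>{1..n}. contr_pairs n k ps z (a(i' := m), b(j' := m)))" by (rule sum.cong[OF refl])
    then show ?thesis
      using I Cons.prems(3) unfolding p contr_pairs_simps contr_eq
      by (simp only: fun_upd_other[OF ne(1)[symmetric]] fun_upd_other[OF ne(2)[symmetric]] simp_thms)
  qed
qed simp

text \<open>Interpolates between \<open>y x'\<close>, whose contracted slots carry the values prescribed by \<open>v\<close>, and the
  tensor obtained after all contractions: the pairs in \<open>P\<close> have been contracted, those in \<open>Q\<close> not yet.\<close>

definition partial_pairing :: "nat \<Rightarrow> nat \<Rightarrow> (nat \<times> nat) set \<Rightarrow> (nat \<times> nat) set \<Rightarrow> (nat \<Rightarrow> nat) \<Rightarrow> tens \<Rightarrow> tens" where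
  "partial_pairing n k P Q v \<psi> \<iota> = (if \<iota> \<in> Idx n k \<and> (\<forall>p\<in>P. fst \<iota> (fst p) = snd \<iota> (snd p))
     \<and> (\<forall>p\<in>Q. fst \<iota> (fst p) = v (fst p) \<and> snd \<iota> (snd p) = v (fst p)) then \<psi> \<iota> else 0)"

text \<open>The form of a tensor after contraction: each pair in \<open>P\<close> carries the
  invariant tensor, the sum over \<open>l\<close> of \<open>v_l\<close> tensor its dual, and
  \<open>\<psi>\<close> gives the coefficient on the remaining slots.\<close>

definition pair_insert :: "nat \<Rightarrow> nat \<Rightarrow> (nat \<times> nat) set \<Rightarrow> tens \<Rightarrow> tens" where
  "pair_insert n k P \<psi> \<iota> = (if \<iota> \<in> Idx n k \<and> (\<forall>p\<in>P. fst \<iota> (fst p) = snd \<iota> (snd p)) then \<psi> \<iota> else 0)"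

definition indep_of_pairs :: "(nat \<times> nat) set \<Rightarrow> tens \<Rightarrow> bool" where
  "indep_of_pairs P \<psi> \<longleftrightarrow> (\<forall>p\<in>P. \<forall>a b l. \<psi> (a(fst p := l), b) = \<psi> (a, b) \<and> \<psi> (a, b(snd p := l)) = \<psi> (a, b))"

lemma indepD:
  assumes "indep_of_pairs P \<psi>" "(i, j) \<in> P"
  shows "\<psi> (a(i := l), b) = \<psi> (a, b)" "\<psi> (a, b(j := l)) = \<psi> (a, b)"
  using assms unfolding indep_of_pairs_def by force+

text \<open>In the trace over \<open>l\<close> only \<open>l = v i\<close> meets the prescribed
  values of the pair, so the trace reproduces \<open>\<psi>\<close> once and leaves the condition
  that the two entries coincide.\<close>

lemma contr_partial_pairing:
  assumes ij: "i \<in> {1..k}" "j \<in> {1..k}" "v i \<in> {1..n}" and ne: "\<forall>p\<in>P \<union> Q. fst p \<noteq> i \<and> snd p \<noteq> j"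
    and ind: "indep_of_pairs {(i, j)} \<psi>"
  shows "contr n k i j (partial_pairing n k P (insert (i, j) Q) v \<psi>) = partial_pairing n k (insert (i, j) P) Q v \<psi>"
proof
  fix \<iota> :: idx
  obtain a b where \<iota>: "\<iota> = (a, b)" by (cases \<iota>)
  show "contr n k i j (partial_pairing n k P (insert (i, j) Q) v \<psi>) \<iota> = partial_pairing n k (insert (i, j) P) Q v \<psi> \<iota>"
  proof (cases "(a, b) \<in> Idx n k \<and> a i = b j")
    case False
    then show ?thesis unfolding \<iota> contr_eq partial_pairing_def by auto
  next
    case True
    have "partial_pairing n k P (insert (i, j) Q) v \<psi> (a(i := l), b(j := l))
        = (if l = v i then partial_pairing n k P Q v \<psi> (a, b) else 0)" if l: "l \<in> {1..n}" for l
    proof -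
      have I: "(a(i := l), b(j := l)) \<in> Idx n k" using True by (intro Idx_upd ij l) blast
      have u: "(a(i := l)) (fst p) = a (fst p)" "(b(j := l)) (snd p) = b (snd p)" if "p \<in> P \<union> Q" for p
        using ne that by auto
      have P: "(\<forall>p\<in>P. (a(i := l)) (fst p) = (b(j := l)) (snd p)) \<longleftrightarrow> (\<forall>p\<in>P. a (fst p) = b (snd p))"
        by (rule ball_cong[OF refl]) (simp only: u UnI1)
      have Q: "(\<forall>p\<in>Q. (a(i := l)) (fst p) = v (fst p) \<and> (b(j := l)) (snd p) = v (fst p))
          \<longleftrightarrow> (\<forall>p\<in>Q. a (fst p) = v (fst p) \<and> b (snd p) = v (fst p))"
        by (rule ball_cong[OF refl]) (simp only: u UnI2)
      have psi: "\<psi> (a(i := l), b(j := l)) = \<psi> (a, b)" by (simp only: indepD[OF ind insertI1])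
      show ?thesis using True I unfolding partial_pairing_def ball_simps(7) fst_conv snd_conv P Q psi fun_upd_same by simp
    qed
    then have "(\<Sum>l\<in>{1..n}. partial_pairing n k P (insert (i, j) Q) v \<psi> (a(i := l), b(j := l)))
      = (\<Sum>l\<in>{1..n}. if l = v i then partial_pairing n k P Q v \<psi> (a, b) else 0)" by (rule sum.cong[OF refl])
    also have "\<dots> = partial_pairing n k P Q v \<psi> (a, b)" using ij(3) by simp
    also have "\<dots> = partial_pairing n k (insert (i, j) P) Q v \<psi> (a, b)" using True unfolding partial_pairing_def by simp
    finally show ?thesis using True unfolding \<iota> contr_eq by simp
  qed
qed

text \<open>\<open>Q\<close> holds the pairs that stand further left in the list and are contracted
  later, so it grows along the recursion.\<close>

lemma contr_pairs_partial_pairing: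
  assumes "valid_pairs k ps" "\<forall>p\<in>set ps. v (fst p) \<in> {1..n}" "indep_of_pairs (set ps) \<psi>"
    "\<forall>p\<in>set ps. \<forall>q\<in>Q. fst p \<noteq> fst q \<and> snd p \<noteq> snd q"
  shows "contr_pairs n k ps (partial_pairing n k {} (set ps \<union> Q) v \<psi>) = partial_pairing n k (set ps) Q v \<psi>"
  using assms
proof (induction ps arbitrary: Q)
  case Nil
  show ?case by (simp add: contr_pairs_simps)
next
  case (Cons p ps)
  obtain i j where p: "p = (i, j)" by (cases p)
  have v: "valid_pairs k ps" "\<forall>p\<in>set ps. fst p \<noteq> i \<and> snd p \<noteq> j" "i \<in> {1..k}" "j \<in> {1..k}"
    using Cons.prems(1) unfolding p valid_pairs_Cons by blast+
  have e: "set (p # ps) \<union> Q = set ps \<union> insert (i, j) Q" by (auto simp: p)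
  have IH: "contr_pairs n k ps (partial_pairing n k {} (set ps \<union> insert (i, j) Q) v \<psi>) = partial_pairing n k (set ps) (insert (i, j) Q) v \<psi>"
  proof (rule Cons.IH[OF v(1)])
    show "\<forall>p\<in>set ps. v (fst p) \<in> {1..n}" using Cons.prems(2) by simp
    show "indep_of_pairs (set ps) \<psi>" using Cons.prems(3) by (simp add: indep_of_pairs_def)
    show "\<forall>p\<in>set ps. \<forall>q\<in>insert (i, j) Q. fst p \<noteq> fst q \<and> snd p \<noteq> snd q" using Cons.prems(4) v(2) by simp
  qed
  have "contr n k i j (partial_pairing n k (set ps) (insert (i, j) Q) v \<psi>) = partial_pairing n k (insert (i, j) (set ps)) Q v \<psi>"
  proof (rule contr_partial_pairing[OF v(3,4)])
    show "v i \<in> {1..n}" using Cons.prems(2) by (simp add: p)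
    show "\<forall>p\<in>set ps \<union> Q. fst p \<noteq> i \<and> snd p \<noteq> j"
    proof
      fix q assume "q \<in> set ps \<union> Q"
      then show "fst q \<noteq> i \<and> snd q \<noteq> j" using Cons.prems(4) v(2) unfolding p by force
    qed
    show "indep_of_pairs {(i, j)} \<psi>" using Cons.prems(3) by (simp add: indep_of_pairs_def p)
  qed
  then show ?case unfolding e unfolding p contr_pairs_simps IH by simp
qed

lemma partial_pairing_empty: "partial_pairing n k P {} v \<psi> = pair_insert n k P \<psi>"
  by (simp add: fun_eq_iff partial_pairing_def pair_insert_def)

lemma pair_insert_Mcar: "pair_insert n k P \<psi> \<in> Mcar n k"
  by (simp add: Mcar_def pair_insert_def)

text \<open>The invariant tensor at a pair is annihilated: the action on its \<open>V\<close> slot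
  and on its dual slot both contribute \<open>U p\<close> and cancel. Only the free slots
  remain.\<close>

lemma pair_insert_act:
  assumes P: "P \<subseteq> {1..k} \<times> {1..k}" "inj_on fst P" "inj_on snd P" and ind: "indep_of_pairs P \<psi>"
  shows "act n k X (pair_insert n k P \<psi>) = pair_insert n k P (gl_act n ({1..k} - fst ` P) ({1..k} - snd ` P) X \<psi>)"
proof
  fix \<iota> :: idx
  obtain a b where \<iota>: "\<iota> = (a, b)" by (cases \<iota>)
  show "act n k X (pair_insert n k P \<psi>) \<iota> = pair_insert n k P (gl_act n ({1..k} - fst ` P) ({1..k} - snd ` P) X \<psi>) \<iota>"
  proof (cases "(a, b) \<in> Idx n k")
    case False
    then show ?thesis by (simp add: \<iota> act_eq pair_insert_def)
  next
    case I: True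
    let ?K = "{1..k}" and ?N = "{1..n}"
    define M where "M \<longleftrightarrow> (\<forall>p\<in>P. a (fst p) = b (snd p))"
    \<comment> \<open>The two entries of the pair \<open>p\<close> itself may differ here; all other
      pairs must coincide.\<close>
    define U where "U p = (if \<forall>q\<in>P - {p}. a (fst q) = b (snd q) then X (a (fst p)) (b (snd p)) * \<psi> (a, b) else 0)" for p
    have A1: "pair_insert n k P \<psi> (a(p := c), b) = (if M then \<psi> (a(p := c), b) else 0)"
      if "p \<in> ?K - fst ` P" "c \<in> ?N" for p c
    proof -
      have I': "(a(p := c), b) \<in> Idx n k" using that by (intro Idx_upd(1) I) blast+
      have "(\<forall>q\<in>P. (a(p := c)) (fst q) = b (snd q)) \<longleftrightarrow> M"
        unfolding M_def using that(1) by (intro ball_cong refl) (auto simp: image_iff)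
      then show ?thesis using I' unfolding pair_insert_def by simp
    qed
    have B1: "pair_insert n k P \<psi> (a, b(p := c)) = (if M then \<psi> (a, b(p := c)) else 0)"
      if "p \<in> ?K - snd ` P" "c \<in> ?N" for p c
    proof -
      have I': "(a, b(p := c)) \<in> Idx n k" using that by (intro Idx_upd(2) I) blast+
      have "(\<forall>q\<in>P. a (fst q) = (b(p := c)) (snd q)) \<longleftrightarrow> M"
        unfolding M_def using that(1) by (intro ball_cong refl) (auto simp: image_iff)
      then show ?thesis using I' unfolding pair_insert_def by simp
    qed
    have A2: "(\<Sum>c\<in>?N. X (a (fst p)) c * pair_insert n k P \<psi> (a(fst p := c), b)) = U p" if p: "p \<in> P" for p
    proof -
      have fp: "fst p \<in> ?K" "snd p \<in> ?K" using p P(1) by auto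
      have "pair_insert n k P \<psi> (a(fst p := c), b) = (if c = b (snd p) then
          (if \<forall>q\<in>P - {p}. a (fst q) = b (snd q) then \<psi> (a, b) else 0) else 0)" if c: "c \<in> ?N" for c
      proof -
        have I': "(a(fst p := c), b) \<in> Idx n k" by (intro Idx_upd(1) I fp c)
        have "fst q \<noteq> fst p" if "q \<in> P - {p}" for q using inj_onD[OF P(2), of q p] that p by blast
        then have e1: "(\<forall>q\<in>P - {p}. (a(fst p := c)) (fst q) = b (snd q)) \<longleftrightarrow> (\<forall>q\<in>P - {p}. a (fst q) = b (snd q))"
          by (intro ball_cong refl) simp
        have e2: "(\<forall>q\<in>P. (a(fst p := c)) (fst q) = b (snd q))
            \<longleftrightarrow> c = b (snd p) \<and> (\<forall>q\<in>P - {p}. (a(fst p := c)) (fst q) = b (snd q))"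
          using p by auto
        have psi: "\<psi> (a(fst p := c), b) = \<psi> (a, b)" using indepD(1)[OF ind, of "fst p" "snd p"] p by simp
        show ?thesis using I' unfolding pair_insert_def fst_conv snd_conv e2 e1 psi by simp
      qed
      then have "(\<Sum>c\<in>?N. X (a (fst p)) c * pair_insert n k P \<psi> (a(fst p := c), b))
        = (\<Sum>c\<in>?N. if c = b (snd p) then U p else 0)"
        by (intro sum.cong refl) (simp add: U_def del: atLeastAtMost_iff)
      then show ?thesis using Idx_val(2)[OF I fp(2)] by (simp del: atLeastAtMost_iff)
    qed
    have B2: "(\<Sum>c\<in>?N. pair_insert n k P \<psi> (a, b(snd p := c)) * X c (b (snd p))) = U p" if p: "p \<in> P" for p
    proof -
      have fp: "fst p \<in> ?K" "snd p \<in> ?K" using p P(1) by auto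
      have "pair_insert n k P \<psi> (a, b(snd p := c)) = (if c = a (fst p) then
          (if \<forall>q\<in>P - {p}. a (fst q) = b (snd q) then \<psi> (a, b) else 0) else 0)" if c: "c \<in> ?N" for c
      proof -
        have I': "(a, b(snd p := c)) \<in> Idx n k" by (intro Idx_upd(2) I fp c)
        have "snd q \<noteq> snd p" if "q \<in> P - {p}" for q using inj_onD[OF P(3), of q p] that p by blast
        then have e1: "(\<forall>q\<in>P - {p}. a (fst q) = (b(snd p := c)) (snd q)) \<longleftrightarrow> (\<forall>q\<in>P - {p}. a (fst q) = b (snd q))"
          by (intro ball_cong refl) simp
        have e2: "(\<forall>q\<in>P. a (fst q) = (b(snd p := c)) (snd q))
            \<longleftrightarrow> c = a (fst p) \<and> (\<forall>q\<in>P - {p}. a (fst q) = (b(snd p := c)) (snd q))"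
          using p by auto
        have psi: "\<psi> (a, b(snd p := c)) = \<psi> (a, b)" using indepD(2)[OF ind, of "fst p" "snd p"] p by simp
        show ?thesis using I' unfolding pair_insert_def fst_conv snd_conv e2 e1 psi by simp
      qed
      then have "(\<Sum>c\<in>?N. pair_insert n k P \<psi> (a, b(snd p := c)) * X c (b (snd p)))
        = (\<Sum>c\<in>?N. if c = a (fst p) then U p else 0)"
        by (intro sum.cong refl) (simp add: U_def mult.commute del: atLeastAtMost_iff)
      then show ?thesis using Idx_val(1)[OF I fp(1)] by (simp del: atLeastAtMost_iff)
    qed
    have FP: "fst ` P \<subseteq> ?K" "snd ` P \<subseteq> ?K" using P(1) by auto
    have "left_act n ?K X (pair_insert n k P \<psi>) (a, b) = (\<Sum>p\<in>?K - fst ` P. \<Sum>c\<in>?N. X (a p) c * pair_insert n k P \<psi> (a(p := c), b))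
        + (\<Sum>p\<in>fst ` P. \<Sum>c\<in>?N. X (a p) c * pair_insert n k P \<psi> (a(p := c), b))"
      unfolding left_act_def fst_conv snd_conv by (rule sum.subset_diff[OF FP(1)]) simp
    also have "(\<Sum>p\<in>fst ` P. \<Sum>c\<in>?N. X (a p) c * pair_insert n k P \<psi> (a(p := c), b)) = sum U P"
      unfolding sum.reindex[OF P(2)] o_def by (rule sum.cong[OF refl A2])
    also have "(\<Sum>p\<in>?K - fst ` P. \<Sum>c\<in>?N. X (a p) c * pair_insert n k P \<psi> (a(p := c), b))
        = (\<Sum>p\<in>?K - fst ` P. \<Sum>c\<in>?N. X (a p) c * (if M then \<psi> (a(p := c), b) else 0))"
      by (rule sum.cong[OF refl], rule sum.cong[OF refl]) (simp only: A1)
    also have "\<dots> = (if M then left_act n (?K - fst ` P) X \<psi> (a, b) else 0)" by (simp add: left_act_def)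
    finally have g1: "left_act n ?K X (pair_insert n k P \<psi>) (a, b) = (if M then left_act n (?K - fst ` P) X \<psi> (a, b) else 0) + sum U P" .
    have "right_act n ?K X (pair_insert n k P \<psi>) (a, b) = (\<Sum>p\<in>?K - snd ` P. \<Sum>c\<in>?N. pair_insert n k P \<psi> (a, b(p := c)) * X c (b p))
        + (\<Sum>p\<in>snd ` P. \<Sum>c\<in>?N. pair_insert n k P \<psi> (a, b(p := c)) * X c (b p))"
      unfolding right_act_def fst_conv snd_conv by (rule sum.subset_diff[OF FP(2)]) simp
    also have "(\<Sum>p\<in>snd ` P. \<Sum>c\<in>?N. pair_insert n k P \<psi> (a, b(p := c)) * X c (b p)) = sum U P"
      unfolding sum.reindex[OF P(3)] o_def by (rule sum.cong[OF refl B2])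
    also have "(\<Sum>p\<in>?K - snd ` P. \<Sum>c\<in>?N. pair_insert n k P \<psi> (a, b(p := c)) * X c (b p))
        = (\<Sum>p\<in>?K - snd ` P. \<Sum>c\<in>?N. (if M then \<psi> (a, b(p := c)) else 0) * X c (b p))"
      by (rule sum.cong[OF refl], rule sum.cong[OF refl]) (simp only: B1)
    also have "\<dots> = (if M then right_act n (?K - snd ` P) X \<psi> (a, b) else 0)" by (simp add: right_act_def)
    finally have g2: "right_act n ?K X (pair_insert n k P \<psi>) (a, b) = (if M then right_act n (?K - snd ` P) X \<psi> (a, b) else 0) + sum U P" .
    have Ms: "(\<forall>p\<in>P. fst (a, b) (fst p) = snd (a, b) (snd p)) \<longleftrightarrow> M" by (simp add: M_def)
    have "act n k X (pair_insert n k P \<psi>) (a, b) = (if M then gl_act n (?K - fst ` P) (?K - snd ` P) X \<psi> (a, b) else 0)"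
      using I unfolding act_eq by (simp add: gl_act_def[of n ?K ?K] g1 g2 gl_act_def)
    then show ?thesis using I unfolding \<iota> pair_insert_def Ms by simp
  qed
qed

subsection \<open>The generating vectors\<close>

definition perm_V :: "(nat \<Rightarrow> nat) \<Rightarrow> tens \<Rightarrow> tens" where
  "perm_V \<sigma> x = (\<lambda>\<iota>. x (fst \<iota> \<circ> \<sigma>, snd \<iota>))"

definition perm_Vdual :: "(nat \<Rightarrow> nat) \<Rightarrow> tens \<Rightarrow> tens" where
  "perm_Vdual \<sigma> x = (\<lambda>\<iota>. x (fst \<iota>, snd \<iota> \<circ> \<sigma>))"

lemma fbox_comp_iff:
  assumes "\<sigma> permutes A"
  shows "a \<circ> \<sigma> \<in> fbox n A \<longleftrightarrow> a \<in> fbox n A"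
proof
  assume "a \<circ> \<sigma> \<in> fbox n A"
  then have "(a \<circ> \<sigma>) \<circ> inv \<sigma> \<in> fbox n A" by (rule fbox_comp[OF _ permutes_inv[OF assms]])
  then show "a \<in> fbox n A" by (simp add: comp_assoc permutes_inv_o[OF assms])
qed (rule fbox_comp[OF _ assms])

lemma left_act_perm_V:
  assumes "\<sigma> permutes A"
  shows "left_act n A X (perm_V \<sigma> x) (a, b) = left_act n A X x (a \<circ> \<sigma>, b)"
proof -
  have "left_act n A X x (a \<circ> \<sigma>, b) = (\<Sum>p\<in>A. \<Sum>c\<in>{1..n}. X (a (\<sigma> p)) c * x (a(\<sigma> p := c) \<circ> \<sigma>, b))"
    unfolding left_act_def by (simp add: upd_comp[OF permutes_inj[OF assms]])
  also have "\<dots> = (\<Sum>p\<in>A. \<Sum>c\<in>{1..n}. X (a p) c * x (a(p := c) \<circ> \<sigma>, b))"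
    by (rule trans[OF _ sum.permute[OF assms, of "\<lambda>p. \<Sum>c\<in>{1..n}. X (a p) c * x (a(p := c) \<circ> \<sigma>, b)", symmetric]],
        rule sum.cong[OF refl]) (simp only: o_apply)
  finally show ?thesis by (simp add: left_act_def perm_V_def)
qed

lemma right_act_perm_V: "right_act n B X (perm_V \<sigma> x) (a, b) = right_act n B X x (a \<circ> \<sigma>, b)"
  by (simp add: right_act_def perm_V_def)

lemma act_perm_V:
  assumes "\<sigma> permutes {1..k}"
  shows "act n k X (perm_V \<sigma> x) = perm_V \<sigma> (act n k X x)"
proof
  fix \<iota> :: idx
  obtain a b where \<iota>: "\<iota> = (a, b)" by (cases \<iota>)
  have I: "(a \<circ> \<sigma>, b) \<in> Idx n k \<longleftrightarrow> (a, b) \<in> Idx n k" using fbox_comp_iff[OF assms] by (simp add: Idx_eq)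
  have "gl_act n {1..k} {1..k} X (perm_V \<sigma> x) (a, b) = gl_act n {1..k} {1..k} X x (a \<circ> \<sigma>, b)"
    unfolding gl_act_def left_act_perm_V[OF assms] right_act_perm_V ..
  then show "act n k X (perm_V \<sigma> x) \<iota> = perm_V \<sigma> (act n k X x) \<iota>"
    unfolding \<iota> act_eq perm_V_def[of _ "act n k X x"] fst_conv snd_conv I by simp
qed

lemma act_perm_Vdual:
  assumes "\<sigma> permutes {1..k}"
  shows "act n k X (perm_Vdual \<sigma> x) = perm_Vdual \<sigma> (act n k X x)"
proof
  fix \<iota> :: idx
  obtain a b where \<iota>: "\<iota> = (a, b)" by (cases \<iota>)
  have I: "(a, b \<circ> \<sigma>) \<in> Idx n k \<longleftrightarrow> (a, b) \<in> Idx n k" using fbox_comp_iff[OF assms] by (simp add: Idx_eq)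
  have sw: "perm_Vdual \<sigma> x \<circ> prod.swap = perm_V \<sigma> (x \<circ> prod.swap)" by (auto simp: fun_eq_iff perm_V_def perm_Vdual_def)
  have "right_act n {1..k} X (perm_Vdual \<sigma> x) (a, b) = right_act n {1..k} X x (a, b \<circ> \<sigma>)"
    unfolding right_act_eq_left_act sw left_act_perm_V[OF assms] ..
  moreover have "left_act n {1..k} X (perm_Vdual \<sigma> x) (a, b) = left_act n {1..k} X x (a, b \<circ> \<sigma>)"
    by (simp add: left_act_def perm_Vdual_def)
  ultimately have "gl_act n {1..k} {1..k} X (perm_Vdual \<sigma> x) (a, b) = gl_act n {1..k} {1..k} X x (a, b \<circ> \<sigma>)"
    unfolding gl_act_def by simp
  then show "act n k X (perm_Vdual \<sigma> x) \<iota> = perm_Vdual \<sigma> (act n k X x) \<iota>"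
    unfolding \<iota> act_eq perm_Vdual_def[of _ "act n k X x"] fst_conv snd_conv I by simp
qed

lemma perm_V_mhom:
  assumes "\<sigma> permutes {1..k}"
  shows "mhom n k (perm_V \<sigma>)"
proof -
  have "perm_V \<sigma> x \<in> Mcar n k" if x: "x \<in> Mcar n k" for x
    unfolding Mcar_def
  proof (intro CollectI allI impI)
    fix \<iota> assume "\<iota> \<notin> Idx n k"
    then have "(fst \<iota> \<circ> \<sigma>, snd \<iota>) \<notin> Idx n k" using fbox_comp_iff[OF assms] by (cases \<iota>) (simp add: Idx_eq)
    then show "perm_V \<sigma> x \<iota> = 0" unfolding perm_V_def by (rule McarD[OF x])
  qed
  then show ?thesis unfolding mhom_def act_perm_V[OF assms] by (simp add: perm_V_def)
qed

lemma perm_Vdual_mhom: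
  assumes "\<sigma> permutes {1..k}"
  shows "mhom n k (perm_Vdual \<sigma>)"
proof -
  have "perm_Vdual \<sigma> x \<in> Mcar n k" if x: "x \<in> Mcar n k" for x
    unfolding Mcar_def
  proof (intro CollectI allI impI)
    fix \<iota> assume "\<iota> \<notin> Idx n k"
    then have "(fst \<iota>, snd \<iota> \<circ> \<sigma>) \<notin> Idx n k" using fbox_comp_iff[OF assms] by (cases \<iota>) (simp add: Idx_eq)
    then show "perm_Vdual \<sigma> x \<iota> = 0" unfolding perm_Vdual_def by (rule McarD[OF x])
  qed
  then show ?thesis unfolding mhom_def act_perm_Vdual[OF assms] by (simp add: perm_Vdual_def)
qed

lemma mhom_sum:
  assumes "\<And>d. d \<in> D \<Longrightarrow> mhom n k (f d)"
  shows "mhom n k (\<lambda>x \<iota>. \<Sum>d\<in>D. c d * f d x \<iota>)"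
proof -
  note F = mhomD[OF assms]
  have M: "(\<lambda>\<iota>. \<Sum>d\<in>D. c d * f d x \<iota>) \<in> Mcar n k" if "x \<in> Mcar n k" for x
    by (rule submod_sum[OF Mcar_submod, of _ "\<lambda>d \<iota>. c d * f d x \<iota>"]) (intro is_submodD(4)[OF Mcar_submod] F(1) that)
  have A: "(\<lambda>\<iota>. \<Sum>d\<in>D. c d * f d (\<lambda>\<iota>. x \<iota> + y \<iota>) \<iota>) = (\<lambda>\<iota>. (\<Sum>d\<in>D. c d * f d x \<iota>) + (\<Sum>d\<in>D. c d * f d y \<iota>))" for x y
    unfolding sum.distrib[symmetric] by (intro ext sum.cong refl) (simp add: F(2) algebra_simps)
  have S: "(\<lambda>\<iota>. \<Sum>d\<in>D. c d * f d (\<lambda>\<iota>. e * x \<iota>) \<iota>) = (\<lambda>\<iota>. e * (\<Sum>d\<in>D. c d * f d x \<iota>))" for x e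
    unfolding sum_distrib_left by (intro ext sum.cong refl) (simp add: F(3))
  have X: "(\<lambda>\<iota>. \<Sum>d\<in>D. c d * f d (act n k X x) \<iota>) = act n k X (\<lambda>\<iota>. \<Sum>d\<in>D. c d * f d x \<iota>)"
    if "x \<in> Mcar n k" for x X
    unfolding act_sum act_smult by (intro ext sum.cong refl) (simp add: F(4)[OF _ that])
  show ?thesis unfolding mhom_def using M A S X by blast
qed

text \<open>The factor \<open>1\<close> gives the outer sum the form that \<open>mhom_sum\<close>
  expects.\<close>

lemma yV_eq: "yV la T = (\<lambda>x \<iota>. \<Sum>\<rho>\<in>row_grp la T. 1 * (perm_V \<rho> \<circ> (\<lambda>x \<iota>. \<Sum>\<gamma>\<in>col_grp la T. of_int (sign \<gamma>) * perm_V \<gamma> x \<iota>)) x \<iota>)"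
  by (simp add: fun_eq_iff yV_def perm_V_def Let_def)

lemma yW_eq: "yW la T = (\<lambda>x \<iota>. \<Sum>\<rho>\<in>row_grp la T. 1 * (perm_Vdual \<rho> \<circ> (\<lambda>x \<iota>. \<Sum>\<gamma>\<in>col_grp la T. of_int (sign \<gamma>) * perm_Vdual \<gamma> x \<iota>)) x \<iota>)"
  by (simp add: fun_eq_iff yW_def perm_Vdual_def Let_def)

lemma yV_mhom:
  assumes "std_tab la A T" "A \<subseteq> {1..k}"
  shows "mhom n k (yV la T)"
  unfolding yV_eq row_grp_eq[OF assms(1)] col_grp_eq[OF assms(1)]
  by (rule mhom_sum, rule mhom_comp, rule perm_V_mhom, erule permutes_subset[OF fixgrp_permutes assms(2)],
      rule mhom_sum, rule perm_V_mhom, erule permutes_subset[OF fixgrp_permutes assms(2)])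

lemma yW_mhom:
  assumes "std_tab la A T" "A \<subseteq> {1..k}"
  shows "mhom n k (yW la T)"
  unfolding yW_eq row_grp_eq[OF assms(1)] col_grp_eq[OF assms(1)]
  by (rule mhom_sum, rule mhom_comp, rule perm_Vdual_mhom, erule permutes_subset[OF fixgrp_permutes assms(2)],
      rule mhom_sum, rule perm_Vdual_mhom, erule permutes_subset[OF fixgrp_permutes assms(2)])

text \<open>The reflection of \<open>{1..n}\<close>. After it the dual slots show row numbers of
  their tableau, and the dual action of a raising operator becomes again a \<open>raise_op\<close>
  with increasing indices, so one theory serves both kinds of slots.\<close>

definition flip :: "nat \<Rightarrow> (nat \<Rightarrow> nat) \<Rightarrow> nat \<Rightarrow> nat" where
  "flip n b = (\<lambda>q. n + 1 - b q)"

definition young_product :: "nat \<Rightarrow> nat set \<Rightarrow> nat set \<Rightarrow> tab \<Rightarrow> tab \<Rightarrow> tens" where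
  "young_product n A B d d' \<iota> = of_int (tab_young_vec A d (fst \<iota>)) * of_int (tab_young_vec B d' (flip n (snd \<iota>)))"

lemma pair_insert_perm_V:
  assumes "\<sigma> permutes A" "A \<subseteq> {1..k}" "fst ` P \<inter> A = {}"
  shows "pair_insert n k P \<psi> (a \<circ> \<sigma>, b) = (if (a, b) \<in> Idx n k \<and> (\<forall>p\<in>P. a (fst p) = b (snd p)) then \<psi> (a \<circ> \<sigma>, b) else 0)"
proof -
  have I: "(a \<circ> \<sigma>, b) \<in> Idx n k \<longleftrightarrow> (a, b) \<in> Idx n k"
    using fbox_comp_iff[OF permutes_subset[OF assms(1,2)]] by (simp add: Idx_eq)
  have "\<sigma> (fst p) = fst p" if "p \<in> P" for p using assms(1,3) that by (intro permutes_not_in[OF assms(1)]) blast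
  then have "(\<forall>p\<in>P. (a \<circ> \<sigma>) (fst p) = b (snd p)) \<longleftrightarrow> (\<forall>p\<in>P. a (fst p) = b (snd p))"
    by (intro ball_cong refl) simp
  then show ?thesis unfolding pair_insert_def fst_conv snd_conv I by simp
qed

lemma pair_insert_perm_Vdual:
  assumes "\<sigma> permutes B" "B \<subseteq> {1..k}" "snd ` P \<inter> B = {}"
  shows "pair_insert n k P \<psi> (a, b \<circ> \<sigma>) = (if (a, b) \<in> Idx n k \<and> (\<forall>p\<in>P. a (fst p) = b (snd p)) then \<psi> (a, b \<circ> \<sigma>) else 0)"
proof -
  have I: "(a, b \<circ> \<sigma>) \<in> Idx n k \<longleftrightarrow> (a, b) \<in> Idx n k"
    using fbox_comp_iff[OF permutes_subset[OF assms(1,2)]] by (simp add: Idx_eq)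
  have "\<sigma> (snd p) = snd p" if "p \<in> P" for p using assms(1,3) that by (intro permutes_not_in[OF assms(1)]) blast
  then have "(\<forall>p\<in>P. a (fst p) = (b \<circ> \<sigma>) (snd p)) \<longleftrightarrow> (\<forall>p\<in>P. a (fst p) = b (snd p))"
    by (intro ball_cong refl) simp
  then show ?thesis unfolding pair_insert_def fst_conv snd_conv I by simp
qed

text \<open>The symmetrizer moves only free slots, so it passes through the insertion of the pairs
  and acts on the basis tensor of row numbers, where it gives the Young vector.\<close>

lemma yV_pair_insert:
  assumes "std_tab la A T" "A \<subseteq> {1..k}" "fst ` P \<inter> A = {}"
  shows "yV la T (pair_insert n k P (\<lambda>\<iota>. (if \<forall>p\<in>A. fst \<iota> p = tab_row la T p then 1 else 0) * g (snd \<iota>)))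
    = pair_insert n k P (\<lambda>\<iota>. of_int (tab_young_vec A (la, T) (fst \<iota>)) * g (snd \<iota>))"
proof
  fix \<iota> :: idx
  obtain a b where \<iota>: "\<iota> = (a, b)" by (cases \<iota>)
  let ?R = "fixgrp A (tab_row la T)" and ?C = "fixgrp A (tab_col la T)"
  let ?\<psi> = "\<lambda>\<iota>. (if \<forall>p\<in>A. fst \<iota> p = tab_row la T p then 1 else 0) * g (snd \<iota>)"
  have "yV la T (pair_insert n k P ?\<psi>) (a, b) = (\<Sum>\<rho>\<in>?R. \<Sum>\<gamma>\<in>?C. of_int (sign \<gamma>) * pair_insert n k P ?\<psi> (a \<circ> (\<rho> \<circ> \<gamma>), b))"
    by (simp add: yV_def row_grp_eq[OF assms(1)] col_grp_eq[OF assms(1)] comp_assoc)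
  also have "\<dots> = (\<Sum>\<rho>\<in>?R. \<Sum>\<gamma>\<in>?C. of_int (sign \<gamma>) *
    (if (a, b) \<in> Idx n k \<and> (\<forall>p\<in>P. a (fst p) = b (snd p)) then ?\<psi> (a \<circ> (\<rho> \<circ> \<gamma>), b) else 0))"
  proof (rule sum.cong[OF refl], rule sum.cong[OF refl])
    fix \<rho> \<gamma> assume "\<rho> \<in> ?R" "\<gamma> \<in> ?C"
    then have "\<rho> \<circ> \<gamma> permutes A" by (intro permutes_compose fixgrp_permutes)
    then show "of_int (sign \<gamma>) * pair_insert n k P ?\<psi> (a \<circ> (\<rho> \<circ> \<gamma>), b) = of_int (sign \<gamma>) *
      (if (a, b) \<in> Idx n k \<and> (\<forall>p\<in>P. a (fst p) = b (snd p)) then ?\<psi> (a \<circ> (\<rho> \<circ> \<gamma>), b) else 0)"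
      by (simp only: pair_insert_perm_V[OF _ assms(2,3)])
  qed
  also have "\<dots> = pair_insert n k P (\<lambda>\<iota>. of_int (tab_young_vec A (la, T) (fst \<iota>)) * g (snd \<iota>)) (a, b)"
  proof (cases "(a, b) \<in> Idx n k \<and> (\<forall>p\<in>P. a (fst p) = b (snd p))")
    case True
    have "of_int (tab_young_vec A (la, T) a) * g b
      = (\<Sum>\<rho>\<in>?R. \<Sum>\<gamma>\<in>?C. of_int (sign \<gamma>) * ((if \<forall>p\<in>A. (a \<circ> (\<rho> \<circ> \<gamma>)) p = tab_row la T p then 1 else 0) * g b))"
      unfolding tab_young_vec_def young_vec_def col_vec_def fst_conv snd_conv of_int_sum sum_distrib_right of_int_mult comp_assoc
      by (intro sum.cong refl) simp
    then show ?thesis using True by (simp add: pair_insert_def)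
  next
    case False
    then show ?thesis unfolding pair_insert_def fst_conv snd_conv by (simp only: if_False mult_zero_right sum.neutral_const)
  qed
  finally show "yV la T (pair_insert n k P ?\<psi>) \<iota> = pair_insert n k P (\<lambda>\<iota>. of_int (tab_young_vec A (la, T) (fst \<iota>)) * g (snd \<iota>)) \<iota>"
    by (simp only: \<iota>)
qed

lemma yW_pair_insert:
  assumes "std_tab mu B T" "B \<subseteq> {1..k}" "snd ` P \<inter> B = {}" and rng: "\<And>q. q \<in> B \<Longrightarrow> tab_row mu T q \<in> {1..n}"
  shows "yW mu T (pair_insert n k P (\<lambda>\<iota>. g (fst \<iota>) * (if \<forall>q\<in>B. snd \<iota> q = n + 1 - tab_row mu T q then 1 else 0)))
    = pair_insert n k P (\<lambda>\<iota>. g (fst \<iota>) * of_int (tab_young_vec B (mu, T) (flip n (snd \<iota>))))"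
proof
  fix \<iota> :: idx
  obtain a b where \<iota>: "\<iota> = (a, b)" by (cases \<iota>)
  let ?R = "fixgrp B (tab_row mu T)" and ?C = "fixgrp B (tab_col mu T)"
  let ?\<psi> = "\<lambda>\<iota>. g (fst \<iota>) * (if \<forall>q\<in>B. snd \<iota> q = n + 1 - tab_row mu T q then 1 else 0)"
  have "yW mu T (pair_insert n k P ?\<psi>) (a, b) = (\<Sum>\<rho>\<in>?R. \<Sum>\<gamma>\<in>?C. of_int (sign \<gamma>) * pair_insert n k P ?\<psi> (a, b \<circ> (\<rho> \<circ> \<gamma>)))"
    by (simp add: yW_def row_grp_eq[OF assms(1)] col_grp_eq[OF assms(1)] comp_assoc)
  also have "\<dots> = (\<Sum>\<rho>\<in>?R. \<Sum>\<gamma>\<in>?C. of_int (sign \<gamma>) *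
    (if (a, b) \<in> Idx n k \<and> (\<forall>p\<in>P. a (fst p) = b (snd p)) then ?\<psi> (a, b \<circ> (\<rho> \<circ> \<gamma>)) else 0))"
  proof (rule sum.cong[OF refl], rule sum.cong[OF refl])
    fix \<rho> \<gamma> assume "\<rho> \<in> ?R" "\<gamma> \<in> ?C"
    then have "\<rho> \<circ> \<gamma> permutes B" by (intro permutes_compose fixgrp_permutes)
    then show "of_int (sign \<gamma>) * pair_insert n k P ?\<psi> (a, b \<circ> (\<rho> \<circ> \<gamma>)) = of_int (sign \<gamma>) *
      (if (a, b) \<in> Idx n k \<and> (\<forall>p\<in>P. a (fst p) = b (snd p)) then ?\<psi> (a, b \<circ> (\<rho> \<circ> \<gamma>)) else 0)"
      by (simp only: pair_insert_perm_Vdual[OF _ assms(2,3)])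
  qed
  also have "\<dots> = pair_insert n k P (\<lambda>\<iota>. g (fst \<iota>) * of_int (tab_young_vec B (mu, T) (flip n (snd \<iota>)))) (a, b)"
  proof (cases "(a, b) \<in> Idx n k \<and> (\<forall>p\<in>P. a (fst p) = b (snd p))")
    case True
    \<comment> \<open>Truncated subtraction makes the reflection invertible only within
      \<open>{1..n}\<close>; the entries of \<open>b\<close> and the row numbers both lie
      there.\<close>
    have fl: "(\<forall>q\<in>B. (b \<circ> \<sigma>) q = n + 1 - tab_row mu T q) \<longleftrightarrow> (\<forall>q\<in>B. (flip n b \<circ> \<sigma>) q = tab_row mu T q)"
      if "\<sigma> permutes B" for \<sigma>
    proof (rule ball_cong[OF refl])
      fix q assume q: "q \<in> B"
      then have "\<sigma> q \<in> {1..k}" using permutes_in_image[OF that] assms(2) by blast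
      then have "b (\<sigma> q) \<in> {1..n}" using Idx_val(2)[of a b n k "\<sigma> q"] True by blast
      then show "(b \<circ> \<sigma>) q = n + 1 - tab_row mu T q \<longleftrightarrow> (flip n b \<circ> \<sigma>) q = tab_row mu T q"
        using rng[OF q] by (auto simp: flip_def)
    qed
    have "g a * of_int (tab_young_vec B (mu, T) (flip n b))
      = (\<Sum>\<rho>\<in>?R. \<Sum>\<gamma>\<in>?C. of_int (sign \<gamma>) * (g a * (if \<forall>q\<in>B. (flip n b \<circ> (\<rho> \<circ> \<gamma>)) q = tab_row mu T q then 1 else 0)))"
      unfolding tab_young_vec_def young_vec_def col_vec_def fst_conv snd_conv of_int_sum sum_distrib_left of_int_mult comp_assoc
      by (intro sum.cong refl) simp
    also have "\<dots> = (\<Sum>\<rho>\<in>?R. \<Sum>\<gamma>\<in>?C. of_int (sign \<gamma>) * (g a * (if \<forall>q\<in>B. (b \<circ> (\<rho> \<circ> \<gamma>)) q = n + 1 - tab_row mu T q then 1 else 0)))"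
    proof (rule sum.cong[OF refl], rule sum.cong[OF refl])
      fix \<rho> \<gamma> assume "\<rho> \<in> ?R" "\<gamma> \<in> ?C"
      then have "\<rho> \<circ> \<gamma> permutes B" by (intro permutes_compose fixgrp_permutes)
      then show "of_int (sign \<gamma>) * (g a * (if \<forall>q\<in>B. (flip n b \<circ> (\<rho> \<circ> \<gamma>)) q = tab_row mu T q then 1 else 0))
        = of_int (sign \<gamma>) * (g a * (if \<forall>q\<in>B. (b \<circ> (\<rho> \<circ> \<gamma>)) q = n + 1 - tab_row mu T q then 1 else 0))"
        by (simp only: fl)
    qed
    finally show ?thesis using True by (simp add: pair_insert_def)
  next
    case False
    then show ?thesis unfolding pair_insert_def fst_conv snd_conv by (simp only: if_False mult_zero_right sum.neutral_const)
  qed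
  finally show "yW mu T (pair_insert n k P ?\<psi>) \<iota> = pair_insert n k P (\<lambda>\<iota>. g (fst \<iota>) * of_int (tab_young_vec B (mu, T) (flip n (snd \<iota>)))) \<iota>"
    by (simp only: \<iota>)
qed

section \<open>Data and generic indices\<close>

lemma lpos_nth:
  assumes "distinct s" "i < length s"
  shows "lpos s (s ! i) = Suc i"
proof -
  have "(THE j. j < length s \<and> s ! j = s ! i) = i"
    using assms by (intro the_equality) (auto simp: nth_eq_iff_index_eq)
  then show ?thesis by (simp add: lpos_def)
qed

lemma dataD:
  assumes "(r, s, t, la, mu, T, T') \<in> data k"
  shows "r \<le> k" "valid_pairs k (zip s t)" "length s = k - r" "length t = k - r" "distinct s" "distinct t"
    "sorted_wrt (<) s" "set s \<subseteq> {1..k}" "set t \<subseteq> {1..k}"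
    "fst ` set (zip s t) = set s" "snd ` set (zip s t) = set t"
    "card ({1..k} - set s) = r" "card ({1..k} - set t) = r"
    "(la, T) \<in> tableaux_on ({1..k} - set s)" "(mu, T') \<in> tableaux_on ({1..k} - set t)"
    "\<And>i. (i, i) \<notin> set (zip s t)"
proof -
  note D = assms[unfolded data_def mem_Collect_eq prod.case]
  show 1: "r \<le> k" "length s = k - r" "length t = k - r" "distinct t"
    "sorted_wrt (<) s" "set s \<subseteq> {1..k}" "set t \<subseteq> {1..k}" using D by simp_all
  show 2: "distinct s" using 1(5) by (simp add: strict_sorted_iff)
  have len: "length s = length t" using 1 by simp
  show "fst ` set (zip s t) = set s" "snd ` set (zip s t) = set t"
    using map_fst_zip[OF len] map_snd_zip[OF len] by (metis list.set_map)+
  then show "valid_pairs k (zip s t)" unfolding valid_pairs_def map_fst_zip[OF len] map_snd_zip[OF len]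
    using 1 2 by (auto dest: set_zip_leftD set_zip_rightD)
  show c: "card ({1..k} - set s) = r" "card ({1..k} - set t) = r"
    using 1 2 by (simp_all add: card_Diff_subset distinct_card)
  show "(la, T) \<in> tableaux_on ({1..k} - set s)" "(mu, T') \<in> tableaux_on ({1..k} - set t)"
    using D by (simp_all add: tableaux_on_def c)
  show "(i, i) \<notin> set (zip s t)" for i
    using D by (auto simp: set_zip)
qed

lemma dataI:
  assumes "r \<le> k" "length s = k - r" "sorted_wrt (<) s" "length t = k - r" "distinct t"
    "set s \<subseteq> {1..k}" "set t \<subseteq> {1..k}" "\<And>i. (i, i) \<notin> set (zip s t)"
    "(la, T) \<in> tableaux_on ({1..k} - set s)" "(mu, T') \<in> tableaux_on ({1..k} - set t)"
  shows "(r, s, t, la, mu, T, T') \<in> data k"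
proof -
  have "distinct s" using assms(3) by (simp add: strict_sorted_iff)
  then have c: "card ({1..k} - set s) = r" "card ({1..k} - set t) = r"
    using assms by (simp_all add: card_Diff_subset distinct_card)
  have "s ! i \<noteq> t ! i" if "i < k - r" for i
  proof
    assume "s ! i = t ! i"
    then have "(s ! i, s ! i) \<in> set (zip s t)" using that assms(2,4) by (auto simp: set_zip intro!: exI[of _ i])
    then show False using assms(8) by blast
  qed
  then show ?thesis using assms by (simp add: data_def tableaux_on_def c)
qed

text \<open>Serves for \<open>V\<close> slots with \<open>s\<close> and for dual slots with
  \<open>t\<close>. A listed slot gets a value determined by its position in the list, so the two
  ends of a pair agree.\<close>

definition gen_a :: "nat \<Rightarrow> nat \<Rightarrow> nat list \<Rightarrow> (nat \<Rightarrow> nat) \<Rightarrow> nat \<Rightarrow> nat" where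
  "gen_a k r s f = restrict (\<lambda>p. if p \<in> set s then r + lpos s p else f p) {1..k}"

lemma lpos_range: "distinct s \<Longrightarrow> p \<in> set s \<Longrightarrow> lpos s p \<in> {1..length s}"
  by (auto simp: in_set_conv_nth lpos_nth)

lemma zip_lpos:
  assumes "distinct s" "distinct t" "length s = length t" "i \<in> set s" "j \<in> set t"
  shows "lpos s i = lpos t j \<longleftrightarrow> (i, j) \<in> set (zip s t)"
proof -
  obtain x where x: "x < length s" "i = s ! x" using assms(4) by (auto simp: in_set_conv_nth)
  obtain y where y: "y < length t" "j = t ! y" using assms(5) by (auto simp: in_set_conv_nth)
  have "lpos s i = lpos t j \<longleftrightarrow> x = y" using x y assms by (simp add: lpos_nth)
  also have "\<dots> \<longleftrightarrow> (i, j) \<in> set (zip s t)"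
  proof
    assume "(i, j) \<in> set (zip s t)"
    then obtain z where z: "z < length s" "z < length t" "i = s ! z" "j = t ! z" by (auto simp: set_zip)
    then have "x = z" "y = z" using x y assms by (auto simp: nth_eq_iff_index_eq)
    then show "x = y" by simp
  qed (use x y in \<open>auto simp: set_zip\<close>)
  finally show ?thesis .
qed

text \<open>Generic indices: contracted slots carry the values \<open>r + 1, \<dots>, k\<close>, the remaining slots of
  \<open>V\<close> values up to \<open>r\<close> and those of the dual values above \<open>n - r\<close>; since \<open>2 k \<le> n\<close>, the only
  coincidences are those prescribed by the contraction.\<close>

lemma gen_coincide:
  assumes n: "2 * k \<le> n" and d: "(r, s, t, la, mu, T, T') \<in> data k"
    and f: "\<And>p. p \<in> {1..k} - set s \<Longrightarrow> f p \<in> {1..r}" and g: "\<And>q. q \<in> {1..k} - set t \<Longrightarrow> g q \<in> {n + 1 - r..n}"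
  shows "(gen_a k r s f, gen_a k r t g) \<in> Idx n k"
    and "i \<in> {1..k} \<Longrightarrow> j \<in> {1..k} \<Longrightarrow> gen_a k r s f i = gen_a k r t g j \<longleftrightarrow> (i, j) \<in> set (zip s t)"
    and "i \<in> {1..k} \<Longrightarrow> gen_a k r s f i \<noteq> gen_a k r t g i"
proof -
  note D = dataD[OF d]
  have sv: "r + lpos s p \<in> {r + 1..k}" if "p \<in> set s" for p using lpos_range[OF D(5) that] D(1,3) by auto
  have tv: "r + lpos t p \<in> {r + 1..k}" if "p \<in> set t" for p using lpos_range[OF D(6) that] D(1,4) by auto
  have gav: "gen_a k r s f p \<in> {1..n}" if "p \<in> {1..k}" for p
    using sv[of p] f[of p] that D(1) n by (auto simp: gen_a_def)
  have gbv: "gen_a k r t g p \<in> {1..n}" if "p \<in> {1..k}" for p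
    using tv[of p] g[of p] that D(1) n by (auto simp: gen_a_def)
  show "(gen_a k r s f, gen_a k r t g) \<in> Idx n k"
    unfolding Idx_eq mem_Sigma_iff PiE_iff using gav gbv by (auto simp: gen_a_def)
  show coin: "gen_a k r s f i = gen_a k r t g j \<longleftrightarrow> (i, j) \<in> set (zip s t)" if ij: "i \<in> {1..k}" "j \<in> {1..k}" for i j
  proof (cases "i \<in> set s \<and> j \<in> set t")
    case True
    then show ?thesis using zip_lpos[OF D(5,6), of i j] ij D(3,4) by (simp add: gen_a_def)
  next
    case False
    then have "(i, j) \<notin> set (zip s t)" by (auto dest: set_zip_leftD set_zip_rightD)
    moreover have "gen_a k r s f i \<noteq> gen_a k r t g j"
    proof (cases "i \<in> set s")
      case True
      then have "j \<notin> set t" using False by blast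
      then show ?thesis using sv[OF True] True g[of j] ij D(1) n by (auto simp: gen_a_def)
    next
      case i: False
      show ?thesis
      proof (cases "j \<in> set t")
        case True
        then show ?thesis using tv[OF True] i f[of i] ij by (auto simp: gen_a_def)
      next
        case False
        then show ?thesis using i f[of i] g[of j] ij D(1) n by (auto simp: gen_a_def)
      qed
    qed
    ultimately show ?thesis by blast
  qed
  show "gen_a k r s f i \<noteq> gen_a k r t g i" if "i \<in> {1..k}" using coin[OF that that] D(16)[of i] by blast
qed

lemma xprime_gen: "xprime n k r s t la mu T T' =
  basis_vec (gen_a k r s (tab_row la T), gen_a k r t (\<lambda>q. n + 1 - tab_row mu T' q))"
  by (simp add: xprime_def gen_a_def)

lemma data_rows:
  assumes "2 * k \<le> n" "(r, s, t, la, mu, T, T') \<in> data k"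
  shows "p \<in> {1..k} - set s \<Longrightarrow> tab_row la T p \<in> {1..r}"
    "q \<in> {1..k} - set t \<Longrightarrow> tab_row mu T' q \<in> {1..r}"
    "q \<in> {1..k} - set t \<Longrightarrow> n + 1 - tab_row mu T' q \<in> {n + 1 - r..n}"
proof -
  note D = dataD[OF assms(2)]
  show "tab_row la T p \<in> {1..r}" if "p \<in> {1..k} - set s"
    using tab_row_range[of r la "{1..k} - set s" T p] D(14) that by (simp add: tableaux_on_def D(12) del: atLeastAtMost_iff)
  show *: "tab_row mu T' q \<in> {1..r}" if "q \<in> {1..k} - set t"
    using tab_row_range[of r mu "{1..k} - set t" T' q] D(15) that by (simp add: tableaux_on_def D(13) del: atLeastAtMost_iff)
  show "n + 1 - tab_row mu T' q \<in> {n + 1 - r..n}" if "q \<in> {1..k} - set t"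
    using *[OF that] D(1) assms(1) by auto
qed

text \<open>The starting point of the interpolation by \<open>partial_pairing\<close>: no pair is
  contracted and all carry prescribed values. The empty union matches
  \<open>contr_pairs_partial_pairing\<close> with \<open>Q\<close> empty.\<close>

lemma xprime_partial_pairing:
  assumes n: "2 * k \<le> n" and d: "(r, s, t, la, mu, T, T') \<in> data k"
  shows "xprime n k r s t la mu T T' = partial_pairing n k {} (set (zip s t) \<union> {}) (\<lambda>p. r + lpos s p)
    (\<lambda>\<iota>. (if \<forall>p\<in>{1..k} - set s. fst \<iota> p = tab_row la T p then 1 else 0)
       * (if \<forall>q\<in>{1..k} - set t. snd \<iota> q = n + 1 - tab_row mu T' q then 1 else 0))"
    (is "_ = partial_pairing n k {} _ ?v ?\<psi>")
proof
  note D = dataD[OF d] and R = data_rows[OF n d]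
  let ?a = "gen_a k r s (tab_row la T)" and ?b = "gen_a k r t (\<lambda>q. n + 1 - tab_row mu T' q)"
  let ?A = "{1..k} - set s" and ?B = "{1..k} - set t" and ?P = "set (zip s t)"
  have I: "(?a, ?b) \<in> Idx n k" by (rule gen_coincide(1)[OF n d R(1) R(3)])
  have P1: "fst p \<in> set s \<and> snd p \<in> set t" if "p \<in> ?P" for p
    unfolding D(10)[symmetric] D(11)[symmetric] using that by (intro conjI imageI)
  have P2: "lpos t (snd p) = lpos s (fst p)" if "p \<in> ?P" for p
    using zip_lpos[OF D(5,6), of "fst p" "snd p"] P1[OF that] that D(3,4) by simp
  fix \<iota> :: idx
  obtain a b where \<iota>: "\<iota> = (a, b)" by (cases \<iota>)
  have "(a, b) = (?a, ?b) \<longleftrightarrow> (a, b) \<in> Idx n k \<and> (\<forall>p\<in>?P. a (fst p) = ?v (fst p) \<and> b (snd p) = ?v (fst p))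
    \<and> (\<forall>p\<in>?A. a p = tab_row la T p) \<and> (\<forall>q\<in>?B. b q = n + 1 - tab_row mu T' q)" (is "?L \<longleftrightarrow> ?R")
  proof
    assume ?L
    then have ab: "a = ?a" "b = ?b" by auto
    have "?a (fst p) = ?v (fst p) \<and> ?b (snd p) = ?v (fst p)" if "p \<in> ?P" for p
    proof -
      have "fst p \<in> {1..k}" "snd p \<in> {1..k}" using P1[OF that] D(8,9) by blast+
      then show ?thesis using P1[OF that] P2[OF that] by (simp add: gen_a_def)
    qed
    moreover have "\<forall>p\<in>?A. ?a p = tab_row la T p" "\<forall>q\<in>?B. ?b q = n + 1 - tab_row mu T' q"
      by (auto simp: gen_a_def)
    ultimately show ?R unfolding ab using I by blast
  next
    assume R: ?R
    have aE: "a p = undefined" "b p = undefined" if "p \<notin> {1..k}" for p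
      using R that by (auto simp: Idx_eq PiE_iff extensional_def)
    have "a p = ?a p" for p
    proof (cases "p \<in> {1..k}")
      case True
      show ?thesis
      proof (cases "p \<in> set s")
        case s: True
        then have "p \<in> fst ` ?P" by (simp only: D(10))
        then obtain q where "q \<in> ?P" "p = fst q" by blast
        then have "a p = ?v p" using R by blast
        then show ?thesis using s True by (simp add: gen_a_def)
      next
        case False
        then have "a p = tab_row la T p" using R True by blast
        then show ?thesis using False True by (simp add: gen_a_def)
      qed
    next
      case False
      then show ?thesis using aE(1)[OF False] by (simp only: gen_a_def restrict_apply if_False)
    qed
    moreover have "b p = ?b p" for p
    proof (cases "p \<in> {1..k}")
      case True
      show ?thesis
      proof (cases "p \<in> set t")
        case t: True
        then have "p \<in> snd ` ?P" by (simp only: D(11))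
        then obtain q where q: "q \<in> ?P" "p = snd q" by blast
        then have "b p = ?v (fst q)" using R by blast
        then show ?thesis using t True P2[OF q(1)] q(2) by (simp add: gen_a_def)
      next
        case False
        then have "b p = n + 1 - tab_row mu T' p" using R True by blast
        then show ?thesis using False True by (simp add: gen_a_def)
      qed
    next
      case False
      then show ?thesis using aE(2)[OF False] by (simp only: gen_a_def restrict_apply if_False)
    qed
    ultimately show ?L by (simp add: fun_eq_iff)
  qed
  then show "xprime n k r s t la mu T T' \<iota> = partial_pairing n k {} (?P \<union> {}) ?v ?\<psi> \<iota>"
    unfolding xprime_gen basis_vec_def partial_pairing_def \<iota> fst_conv snd_conv by auto
qed

lemma yop_xprime:
  assumes n: "2 * k \<le> n" and d: "(r, s, t, la, mu, T, T') \<in> data k"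
  shows "yop n k s t la mu T T' (xprime n k r s t la mu T T')
    = pair_insert n k (set (zip s t)) (young_product n ({1..k} - set s) ({1..k} - set t) (la, T) (mu, T'))"
proof -
  note D = dataD[OF d] and R = data_rows[OF n d]
  let ?A = "{1..k} - set s" and ?B = "{1..k} - set t" and ?P = "set (zip s t)"
  define f where "f a = (if \<forall>p\<in>?A. a p = tab_row la T p then 1 else 0 :: complex)" for a
  define g where "g b = (if \<forall>q\<in>?B. b q = n + 1 - tab_row mu T' q then 1 else 0 :: complex)" for b
  have T: "std_tab la ?A T" "std_tab mu ?B T'" using D(14,15) by (auto simp: tableaux_on_def)
  have P: "fst p \<notin> ?A \<and> snd p \<notin> ?B" if "p \<in> ?P" for p
    using that D(10,11) by blast
  have ind: "indep_of_pairs ?P (\<lambda>\<iota>. f (fst \<iota>) * g (snd \<iota>))"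
    unfolding indep_of_pairs_def
  proof (intro ballI allI)
    fix p a b l assume p: "p \<in> ?P"
    have "f (a(fst p := l)) = f a" unfolding f_def
      using P[OF p] by (intro if_cong ball_cong refl) auto
    moreover have "g (b(snd p := l)) = g b" unfolding g_def
      using P[OF p] by (intro if_cong ball_cong refl) auto
    ultimately show "f (fst (a(fst p := l), b)) * g (snd (a(fst p := l), b)) = f (fst (a, b)) * g (snd (a, b)) \<and>
      f (fst (a, b(snd p := l))) * g (snd (a, b(snd p := l))) = f (fst (a, b)) * g (snd (a, b))"
      by (simp only: fst_conv snd_conv simp_thms)
  qed
  have v: "\<forall>p\<in>?P. r + lpos s (fst p) \<in> {1..n}"
  proof
    fix p assume "p \<in> ?P"
    then have "fst p \<in> set s" using D(10) by blast
    then show "r + lpos s (fst p) \<in> {1..n}" using lpos_range[OF D(5), of "fst p"] D(1,3) n by auto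
  qed
  have "xprime n k r s t la mu T T' = partial_pairing n k {} (?P \<union> {}) (\<lambda>p. r + lpos s p) (\<lambda>\<iota>. f (fst \<iota>) * g (snd \<iota>))"
    unfolding f_def g_def by (rule xprime_partial_pairing[OF n d])
  moreover have "contr_pairs n k (zip s t) (partial_pairing n k {} (?P \<union> {}) (\<lambda>p. r + lpos s p) (\<lambda>\<iota>. f (fst \<iota>) * g (snd \<iota>)))
      = partial_pairing n k ?P {} (\<lambda>p. r + lpos s p) (\<lambda>\<iota>. f (fst \<iota>) * g (snd \<iota>))"
    by (rule contr_pairs_partial_pairing[OF D(2) v ind]) simp
  ultimately have "cst n k s t (xprime n k r s t la mu T T') = pair_insert n k ?P (\<lambda>\<iota>. f (fst \<iota>) * g (snd \<iota>))"
    unfolding cst_contr_pairs by (simp only: partial_pairing_empty)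
  moreover have "yW mu T' (pair_insert n k ?P (\<lambda>\<iota>. f (fst \<iota>) * g (snd \<iota>)))
      = pair_insert n k ?P (\<lambda>\<iota>. f (fst \<iota>) * of_int (tab_young_vec ?B (mu, T') (flip n (snd \<iota>))))"
    unfolding g_def
  proof (rule yW_pair_insert[OF T(2)])
    show "snd ` ?P \<inter> ?B = {}" unfolding D(11) by blast
    show "tab_row mu T' q \<in> {1..n}" if "q \<in> ?B" for q using R(2)[OF that] D(1) n by auto
  qed blast
  moreover have "yV la T (pair_insert n k ?P (\<lambda>\<iota>. f (fst \<iota>) * of_int (tab_young_vec ?B (mu, T') (flip n (snd \<iota>)))))
      = pair_insert n k ?P (\<lambda>\<iota>. of_int (tab_young_vec ?A (la, T) (fst \<iota>)) * of_int (tab_young_vec ?B (mu, T') (flip n (snd \<iota>))))"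
    unfolding f_def
  proof (rule yV_pair_insert[OF T(1)])
    show "fst ` ?P \<inter> ?A = {}" unfolding D(10) by blast
  qed blast
  ultimately show ?thesis unfolding yop_def by (simp only: young_product_def[abs_def])
qed

text \<open>After reflection \<open>Eij i j\<close> acts on dual slots as the operator with indices
  \<open>n + 1 - j\<close> and \<open>n + 1 - i\<close>. For \<open>i < j\<close> these are again
  increasing, so both factors are hit by raising operators.\<close>

lemma gl_act_young_product:
  assumes AB: "A \<subseteq> {1..k}" "B \<subseteq> {1..k}" and I: "(a, b) \<in> Idx n k" and ij: "i \<in> {1..n}" "j \<in> {1..n}"
  shows "gl_act n A B (Eij i j) (young_product n A B d d') (a, b)
    = of_int (raise_op A i j (tab_young_vec A d) a) * of_int (tab_young_vec B d' (flip n b))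
      - of_int (tab_young_vec A d a) * of_int (raise_op B (n + 1 - j) (n + 1 - i) (tab_young_vec B d') (flip n b))"
proof -
  have fin: "finite A" "finite B" using AB finite_subset by blast+
  have bB: "b q \<in> {1..n}" if "q \<in> B" for q using Idx_val(2)[OF I] that AB(2) by blast
  have set: "{q\<in>B. b q = j} = {q\<in>B. flip n b q = n + 1 - j}"
    using bB ij unfolding flip_def by fastforce
  have upd: "flip n (b(q := i)) = (flip n b)(q := n + 1 - i)" for q
    by (auto simp: flip_def fun_eq_iff)
  show ?thesis
    unfolding gl_act_Eij[OF fin ij] raise_op_def set young_product_def fst_conv snd_conv upd of_int_sum sum_distrib_right sum_distrib_left ..
qed

text \<open>The vectors \<open>\<theta>\<^sub>d\<close> of the overview in closed form;
  \<open>hw_gen_yop\<close> identifies them with \<open>e y x'\<close>.\<close>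

definition hw_gen :: "nat \<Rightarrow> nat \<Rightarrow> datum \<Rightarrow> tens" where
  "hw_gen n k d = (case d of (r, s, t, la, mu, T, T') \<Rightarrow> e_op n k
     (pair_insert n k (set (zip s t)) (young_product n ({1..k} - set s) ({1..k} - set t) (la, T) (mu, T'))))"

lemma indep_of_pairs_young_product:
  assumes "\<And>p. p \<in> P \<Longrightarrow> fst p \<notin> A \<and> snd p \<notin> B"
  shows "indep_of_pairs P (young_product n A B d d')"
  unfolding indep_of_pairs_def
proof (intro ballI allI)
  fix p a b l assume p: "p \<in> P"
  have "tab_young_vec A d (a(fst p := l)) = tab_young_vec A d a" unfolding tab_young_vec_def
    using assms[OF p] by (intro young_vec_cong) auto
  moreover have "tab_young_vec B d' (flip n (b(snd p := l))) = tab_young_vec B d' (flip n b)" unfolding tab_young_vec_def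
    using assms[OF p] by (intro young_vec_cong) (auto simp: flip_def)
  ultimately show "young_product n A B d d' (a(fst p := l), b) = young_product n A B d d' (a, b) \<and>
      young_product n A B d d' (a, b(snd p := l)) = young_product n A B d d' (a, b)"
    unfolding young_product_def fst_conv snd_conv by simp
qed

lemma hw_shape_fun: "i \<in> {1..n} \<Longrightarrow> hw n la mu i = of_nat (shape_fun la i) - of_nat (shape_fun mu (n + 1 - i))"
  by (auto simp: hw_def shape_fun_def)

lemma mhom_e_op: "mhom n k (e_op n k)"
  unfolding e_op_traceless_proj by (rule mhom_traceless_proj) auto

text \<open>Both \<open>e\<close> and the insertion of pairs carry the action along, so everything
  reduces to the two Young vectors: raising operators kill them, and the diagonal matrix units act
  by their shapes.\<close>

lemma hw_gen_hw_vector: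
  assumes n: "2 * k \<le> n" and d: "(r, s, t, la, mu, T, T') \<in> data k"
  shows "hw_vector n k (hw n la mu) (hw_gen n k (r, s, t, la, mu, T, T'))"
proof -
  note D = dataD[OF d]
  let ?A = "{1..k} - set s" and ?B = "{1..k} - set t" and ?P = "set (zip s t)"
  let ?y = "young_product n ?A ?B (la, T) (mu, T')"
  define q where "q = pair_insert n k ?P ?y"
  have th: "hw_gen n k (r, s, t, la, mu, T, T') = e_op n k q" by (simp add: hw_gen_def q_def)
  have qM: "q \<in> Mcar n k" unfolding q_def by (rule pair_insert_Mcar)
  note E = mhomD[OF mhom_e_op[of n k]]
  have P: "?P \<subseteq> {1..k} \<times> {1..k}" "inj_on fst ?P" "inj_on snd ?P"
    using D(2) by (auto simp: valid_pairs_def distinct_map)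
  have ind: "indep_of_pairs ?P ?y" by (rule indep_of_pairs_young_product) (use D(10,11) in blast)
  have act: "act n k X (e_op n k q) = e_op n k (pair_insert n k ?P (gl_act n ?A ?B X ?y))" for X
    unfolding E(4)[OF qM, symmetric] unfolding q_def pair_insert_act[OF P ind] D(10,11) ..
  have fin: "finite ?A" "finite ?B" by auto
  have up: "act n k (Eij i j) (e_op n k q) = zerot" if ij: "1 \<le> i" "i < j" "j \<le> n" for i j
  proof -
    have "pair_insert n k ?P (gl_act n ?A ?B (Eij i j) ?y) = zerot"
    proof
      fix \<iota> :: idx
      obtain a b where \<iota>: "\<iota> = (a, b)" by (cases \<iota>)
      have "gl_act n ?A ?B (Eij i j) ?y (a, b) = 0" if "(a, b) \<in> Idx n k"
      proof -
        have "raise_op ?A i j (tab_young_vec ?A (la, T)) a = 0" by (rule raise_op_tab_young_vec[OF fin(1) D(14) ij(1,2)])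
        moreover have "raise_op ?B (n + 1 - j) (n + 1 - i) (tab_young_vec ?B (mu, T')) (flip n b) = 0"
          by (rule raise_op_tab_young_vec[OF fin(2) D(15)]) (use ij in auto)
        ultimately show ?thesis using gl_act_young_product[OF _ _ that, of ?A ?B i j "(la, T)" "(mu, T')"] ij by auto
      qed
      then show "pair_insert n k ?P (gl_act n ?A ?B (Eij i j) ?y) \<iota> = zerot \<iota>" unfolding pair_insert_def \<iota> zerot_def by auto
    qed
    then show ?thesis unfolding act using mhom_zero[OF mhom_e_op] by simp
  qed
  have diag: "act n k (Eij i i) (e_op n k q) = (\<lambda>\<iota>. hw n la mu i * e_op n k q \<iota>)" if i: "i \<in> {1..n}" for i
  proof -
    have "pair_insert n k ?P (gl_act n ?A ?B (Eij i i) ?y) = (\<lambda>\<iota>. hw n la mu i * q \<iota>)"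
    proof
      fix \<iota> :: idx
      obtain a b where \<iota>: "\<iota> = (a, b)" by (cases \<iota>)
      have "gl_act n ?A ?B (Eij i i) ?y (a, b) = hw n la mu i * ?y (a, b)" if "(a, b) \<in> Idx n k"
      proof -
        have "of_int (raise_op ?A i i (tab_young_vec ?A (la, T)) a) = of_nat (shape_fun la i) * (of_int (tab_young_vec ?A (la, T) a) :: complex)"
          using tab_young_vec_content[OF D(14), of a] by (cases "tab_young_vec ?A (la, T) a = 0") (simp_all add: raise_op_diag)
        moreover have "of_int (raise_op ?B (n + 1 - i) (n + 1 - i) (tab_young_vec ?B (mu, T')) (flip n b))
            = of_nat (shape_fun mu (n + 1 - i)) * (of_int (tab_young_vec ?B (mu, T') (flip n b)) :: complex)"
          using tab_young_vec_content[OF D(15), of "flip n b"] by (cases "tab_young_vec ?B (mu, T') (flip n b) = 0") (simp_all add: raise_op_diag)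
        ultimately have "gl_act n ?A ?B (Eij i i) ?y (a, b)
          = of_nat (shape_fun la i) * of_int (tab_young_vec ?A (la, T) a) * of_int (tab_young_vec ?B (mu, T') (flip n b))
          - of_int (tab_young_vec ?A (la, T) a) * (of_nat (shape_fun mu (n + 1 - i)) * of_int (tab_young_vec ?B (mu, T') (flip n b)))"
          using gl_act_young_product[OF _ _ that i i, of ?A ?B "(la, T)" "(mu, T')"] by auto
        then show ?thesis unfolding hw_shape_fun[OF i] young_product_def fst_conv snd_conv by (simp add: algebra_simps)
      qed
      then show "pair_insert n k ?P (gl_act n ?A ?B (Eij i i) ?y) \<iota> = hw n la mu i * q \<iota>" unfolding q_def pair_insert_def \<iota> by auto
    qed
    then show ?thesis unfolding act by (simp only: E(3))
  qed
  show ?thesis unfolding th hw_vector_def killed_def using up diag E(1)[OF qM] by blast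
qed

lemma finite_data: "finite (data k)"
proof -
  define L where "L = {s :: nat list. set s \<subseteq> {1..k} \<and> length s \<le> k}"
  define Q where "Q = (\<Union>r\<in>{..k}. {la. partition_of r la})"
  define S where "S = (\<Union>la\<in>Q. \<Union>A\<in>Pow {1..k}. {T. std_tab la A T})"
  have "finite L" unfolding L_def by (rule finite_lists_length_le) simp
  moreover have Q: "finite Q" unfolding Q_def by (simp add: finite_partitions)
  moreover have "finite S" unfolding S_def
    using Q finite_std_tab finite_subset[of _ "{1..k}"] by (intro finite_UN_I) auto
  ultimately have "finite ({..k} \<times> L \<times> L \<times> Q \<times> Q \<times> S \<times> S)" by simp
  moreover have "data k \<subseteq> {..k} \<times> L \<times> L \<times> Q \<times> Q \<times> S \<times> S"
  proof
    fix d assume d: "d \<in> data k"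
    obtain r s t la mu T T' where e: "d = (r, s, t, la, mu, T, T')" by (cases d)
    note D = dataD[OF d[unfolded e]]
    have "la \<in> Q" "mu \<in> Q" using D(1,12-15) by (auto simp: Q_def tableaux_on_def)
    moreover from this have "T \<in> S" "T' \<in> S" using D(14,15) unfolding S_def tableaux_on_def by blast+
    ultimately show "d \<in> {..k} \<times> L \<times> L \<times> Q \<times> Q \<times> S \<times> S"
      using D(1,3,4,8,9) by (simp add: e L_def)
  qed
  ultimately show ?thesis by (rule rev_finite_subset)
qed

section \<open>Linear independence of the generators\<close>

lemma hw_gen_eval:
  assumes "\<And>i. i \<in> {1..k} \<Longrightarrow> a i \<noteq> b i"
  shows "hw_gen n k (r, s, t, la, mu, T, T') (a, b)
    = pair_insert n k (set (zip s t)) (young_product n ({1..k} - set s) ({1..k} - set t) (la, T) (mu, T')) (a, b)"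
proof -
  have "i \<in> {1..k}" if "i \<in> set [1..<k+1]" for i using that by auto
  then show ?thesis unfolding hw_gen_def prod.case e_op_traceless_proj using assms by (intro traceless_proj_eval) blast
qed

lemma card_zip: "(r, s, t, la, mu, T, T') \<in> data k \<Longrightarrow> card (set (zip s t)) = k - r"
  using dataD[of r s t la mu T T' k] by (simp add: distinct_card distinct_zipI1)

text \<open>A datum with \<open>r1 \<le> r\<close> has at least as many pairs, so inclusion of its
  pairs is equality. As \<open>s\<close> is increasing, the set of pairs determines both
  lists.\<close>

lemma zip_data_eq:
  assumes d: "(r, s, t, la, mu, T, T') \<in> data k" and d1: "(r1, s1, t1, la1, mu1, T1, T1') \<in> data k"
    and sub: "set (zip s1 t1) \<subseteq> set (zip s t)" and le: "r1 \<le> r"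
  shows "r1 = r \<and> s1 = s \<and> t1 = t"
proof -
  note D = dataD[OF d] and D1 = dataD[OF d1]
  have eq: "set (zip s1 t1) = set (zip s t)"
    by (rule card_seteq[OF _ sub]) (use le in \<open>simp_all add: card_zip[OF d] card_zip[OF d1]\<close>)
  have "set s1 = set s" using D(10) D1(10) eq by metis
  then have s: "s1 = s" using D(7) D1(7) by (intro strict_sorted_equal)
  then have r: "r1 = r" using D(1,3) D1(1,3) by simp
  have "t1 = t"
  proof (rule nth_equalityI)
    show "length t1 = length t" using D(4) D1(4) r by simp
    fix i assume i: "i < length t1"
    have "(s ! i, t1 ! i) \<in> set (zip s1 t1)" using i D1(3,4) s by (auto simp: set_zip)
    then have "(s ! i, t1 ! i) \<in> set (zip s t)" by (simp only: eq)
    then obtain z where z: "z < length s" "z < length t" "s ! i = s ! z" "t1 ! i = t ! z" by (auto simp: set_zip)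
    have "i < length s" using i D1(3,4) s by simp
    then have "i = z" using z(1,3) D(5) by (simp add: nth_eq_iff_index_eq)
    then show "t1 ! i = t ! i" using z(4) by simp
  qed
  then show ?thesis using r s by blast
qed

text \<open>Testing a combination of product vectors against product vectors splits the double
  system into one system for each kind of slots.\<close>

lemma sum_product_pairing:
  "(\<Sum>a\<in>fbox m A. \<Sum>b\<in>fbox m B. of_int (f a) * of_int (g b) *
      (\<Sum>x\<in>X. \<Sum>y\<in>Y. c x y * (of_int (u x a) * of_int (v y b))))
    = (\<Sum>x\<in>X. of_int (pairing m A f (u x)) * (\<Sum>y\<in>Y. of_int (pairing m B g (v y)) * (c x y :: complex)))"
proof -
  have "(\<Sum>a\<in>fbox m A. \<Sum>b\<in>fbox m B. of_int (f a) * of_int (g b) *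
      (\<Sum>x\<in>X. \<Sum>y\<in>Y. c x y * (of_int (u x a) * of_int (v y b))))
    = (\<Sum>a\<in>fbox m A. \<Sum>b\<in>fbox m B. \<Sum>x\<in>X. \<Sum>y\<in>Y. (of_int (f a) * of_int (u x a)) * ((of_int (g b) * of_int (v y b)) * c x y))"
    unfolding sum_distrib_left by (intro sum.cong refl) (simp only: mult_ac)
  also have "\<dots> = (\<Sum>a\<in>fbox m A. \<Sum>x\<in>X. \<Sum>b\<in>fbox m B. \<Sum>y\<in>Y. (of_int (f a) * of_int (u x a)) * ((of_int (g b) * of_int (v y b)) * c x y))"
    by (rule sum.cong[OF refl], rule sum.swap)
  also have "\<dots> = (\<Sum>x\<in>X. \<Sum>a\<in>fbox m A. \<Sum>y\<in>Y. \<Sum>b\<in>fbox m B. (of_int (f a) * of_int (u x a)) * ((of_int (g b) * of_int (v y b)) * c x y))"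
    by (subst sum.swap, rule sum.cong[OF refl], rule sum.cong[OF refl], rule sum.swap)
  also have "\<dots> = (\<Sum>x\<in>X. \<Sum>a\<in>fbox m A. (of_int (f a) * of_int (u x a)) * (\<Sum>y\<in>Y. of_int (pairing m B g (v y)) * c x y))"
    by (simp only: pairing_def of_int_sum of_int_mult sum_distrib_left[symmetric] sum_distrib_right[symmetric])
  also have "\<dots> = (\<Sum>x\<in>X. of_int (pairing m A f (u x)) * (\<Sum>y\<in>Y. of_int (pairing m B g (v y)) * c x y))"
    by (simp only: pairing_def of_int_sum of_int_mult sum_distrib_right[symmetric])
  finally show ?thesis .
qed

text \<open>At generic indices for a matching with largest \<open>r\<close>, only the data with this
  matching survive. Letting the free entries vary gives a relation between products of Young
  vectors, and \<open>pairing_nondegenerate\<close> is applied to one factor after the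
  other.\<close>

theorem hw_gen_independent:
  assumes n: "2 * k \<le> n" and zero: "(\<lambda>\<iota>. \<Sum>d\<in>data k. c d * hw_gen n k d \<iota>) = zerot"
  shows "\<forall>d\<in>data k. c d = 0"
proof (rule ccontr)
  define D0 where "D0 = {d\<in>data k. c d \<noteq> 0}"
  assume "\<not> ?thesis"
  then have ne: "fst ` D0 \<noteq> {}" unfolding D0_def by blast
  have fin: "finite (fst ` D0)" using finite_data by (simp add: D0_def)
  obtain d0 where d0: "d0 \<in> D0" "fst d0 = Max (fst ` D0)" using Max_in[OF fin ne] by auto
  have mx: "fst d \<le> fst d0" if "d \<in> D0" for d unfolding d0(2) using fin that by simp
  obtain r s t la mu T T' where e0: "d0 = (r, s, t, la, mu, T, T')" by (cases d0)
  have d: "(r, s, t, la, mu, T, T') \<in> data k" using d0(1) by (simp add: D0_def e0)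
  note D = dataD[OF d]
  let ?A = "{1..k} - set s" and ?B = "{1..k} - set t" and ?P = "set (zip s t)"
  \<comment> \<open>All data that share \<open>r\<close>, \<open>s\<close>, \<open>t\<close> with
    \<open>d0\<close>, indexed by their two tableaux.\<close>
  define emb where "emb x = (r, s, t, fst (fst x), fst (snd x), snd (fst x), snd (snd x))" for x :: "tab \<times> tab"
  have finA: "finite ?A" "finite ?B" by auto
  have embD: "emb ` (tableaux_on ?A \<times> tableaux_on ?B) \<subseteq> data k"
    using dataI[OF D(1,3,7,4,6,8,9,16)] by (auto simp: emb_def)
  have embI: "inj_on emb (tableaux_on ?A \<times> tableaux_on ?B)" by (auto simp: inj_on_def emb_def)
  have key: "(\<Sum>x\<in>tableaux_on ?A. \<Sum>y\<in>tableaux_on ?B. c (emb (x, y)) * (of_int (tab_young_vec ?A x a') * of_int (tab_young_vec ?B y b'))) = 0"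
    if a': "a' \<in> fbox r ?A" and b': "b' \<in> fbox r ?B" for a' b'
  proof -
    define a where "a = gen_a k r s a'"
    \<comment> \<open>Reflection places the free dual entries above \<open>n - r\<close>, and the
      \<open>flip\<close> in \<open>young_product\<close> brings them back to
      \<open>b'\<close>.\<close>
    define b where "b = gen_a k r t (flip n b')"
    have av: "a' p \<in> {1..r}" if "p \<in> ?A" for p using fbox_val[OF a' that] .
    have bv: "flip n b' q \<in> {n + 1 - r..n}" if "q \<in> ?B" for q
      using fbox_val[OF b' that] D(1) n by (auto simp: flip_def)
    note G = gen_coincide[OF n d, of a' "flip n b'", OF av bv, folded a_def b_def]
    have I: "(a, b) \<in> Idx n k" by (rule G(1))
    have abA: "a p = a' p" if "p \<in> ?A" for p using that by (auto simp: a_def gen_a_def)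
    have abB: "flip n b q = b' q" if "q \<in> ?B" for q
      using that fbox_val[OF b' that] D(1) n by (auto simp: b_def gen_a_def flip_def)
    have ev: "hw_gen n k (r1, s1, t1, la1, mu1, T1, T1') (a, b)
      = pair_insert n k (set (zip s1 t1)) (young_product n ({1..k} - set s1) ({1..k} - set t1) (la1, T1) (mu1, T1')) (a, b)"
      for r1 s1 t1 la1 mu1 T1 T1'
      by (rule hw_gen_eval) (rule G(3))
    have val: "hw_gen n k (emb (x, y)) (a, b) = of_int (tab_young_vec ?A x a') * of_int (tab_young_vec ?B y b')" for x y
    proof -
      have "\<forall>p\<in>?P. a (fst p) = b (snd p)"
      proof
        fix p assume p: "p \<in> ?P"
        then have "fst p \<in> {1..k}" "snd p \<in> {1..k}" using D(2) by (auto simp: valid_pairs_def)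
        then show "a (fst p) = b (snd p)" using G(2) p by simp
      qed
      then have "hw_gen n k (emb (x, y)) (a, b) = young_product n ?A ?B x y (a, b)"
        unfolding emb_def ev using I by (simp add: pair_insert_def)
      also have "\<dots> = of_int (tab_young_vec ?A x a') * of_int (tab_young_vec ?B y b')"
        unfolding young_product_def tab_young_vec_def fst_conv snd_conv
        using young_vec_cong[of ?A a a'] young_vec_cong[of ?B "flip n b" b'] abA abB by metis
      finally show ?thesis .
    qed
    \<comment> \<open>A competitor that does not vanish at \<open>(a, b)\<close> has its pairs among
      those of \<open>d0\<close>; since \<open>r\<close> is largest, it has the same matching and
      lies in the range of \<open>emb\<close>.\<close>
    have out: "c d1 * hw_gen n k d1 (a, b) = 0" if d1: "d1 \<in> data k - emb ` (tableaux_on ?A \<times> tableaux_on ?B)" for d1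
    proof (rule ccontr)
      assume nz: "\<not> ?thesis"
      obtain r1 s1 t1 la1 mu1 T1 T1' where e1: "d1 = (r1, s1, t1, la1, mu1, T1, T1')" by (cases d1)
      have dd: "(r1, s1, t1, la1, mu1, T1, T1') \<in> data k" using d1 by (simp add: e1)
      have "d1 \<in> D0" using d1 nz by (auto simp: D0_def)
      then have le: "r1 \<le> r" using mx[of d1] by (simp add: e1 e0)
      have "pair_insert n k (set (zip s1 t1)) (young_product n ({1..k} - set s1) ({1..k} - set t1) (la1, T1) (mu1, T1')) (a, b) \<noteq> 0"
        using nz unfolding e1 ev by auto
      then have m: "\<forall>p\<in>set (zip s1 t1). a (fst p) = b (snd p)" by (auto simp: pair_insert_def split: if_splits)
      have "set (zip s1 t1) \<subseteq> ?P"
      proof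
        fix p assume p: "p \<in> set (zip s1 t1)"
        then have "fst p \<in> {1..k}" "snd p \<in> {1..k}" using dataD(2)[OF dd] by (auto simp: valid_pairs_def)
        then show "p \<in> ?P" using G(2)[of "fst p" "snd p"] m p by simp
      qed
      then have "r1 = r" "s1 = s" "t1 = t" using zip_data_eq[OF d dd _ le] by blast+
      then have "d1 = emb ((la1, T1), (mu1, T1'))" "(la1, T1) \<in> tableaux_on ?A" "(mu1, T1') \<in> tableaux_on ?B"
        using dataD(14,15)[OF dd] by (simp_all add: e1 emb_def)
      then show False using d1 by blast
    qed
    have "0 = (\<Sum>d\<in>data k. c d * hw_gen n k d (a, b))" using fun_cong[OF zero, of "(a, b)"] by (simp add: zerot_def)
    also have "\<dots> = (\<Sum>d\<in>emb ` (tableaux_on ?A \<times> tableaux_on ?B). c d * hw_gen n k d (a, b))"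
      by (rule sum.mono_neutral_right[OF finite_data embD]) (use out in blast)
    also have "\<dots> = (\<Sum>z\<in>tableaux_on ?A \<times> tableaux_on ?B. c (emb z) * hw_gen n k (emb z) (a, b))"
      unfolding sum.reindex[OF embI] o_def ..
    also have "\<dots> = (\<Sum>x\<in>tableaux_on ?A. \<Sum>y\<in>tableaux_on ?B. c (emb (x, y)) * hw_gen n k (emb (x, y)) (a, b))"
      unfolding sum.cartesian_product by (rule sum.cong[OF refl]) auto
    finally show ?thesis unfolding val by (rule sym)
  qed
  have pz: "(\<Sum>x\<in>tableaux_on ?A. of_int (pairing r ?A (tab_col_vec ?A x1) (tab_young_vec ?A x)) *
      (\<Sum>y\<in>tableaux_on ?B. of_int (pairing r ?B (tab_col_vec ?B y1) (tab_young_vec ?B y)) * c (emb (x, y)))) = 0" for x1 y1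
    unfolding sum_product_pairing[where c = "\<lambda>x y. c (emb (x, y))", symmetric]
    by (intro sum.neutral ballI) (simp only: key mult_zero_right)
  have "c (emb (x, y)) = 0" if x: "x \<in> tableaux_on ?A" and y: "y \<in> tableaux_on ?B" for x y
  proof -
    have "\<forall>x\<in>tableaux_on ?A. (\<Sum>y\<in>tableaux_on ?B. of_int (pairing r ?B (tab_col_vec ?B y1) (tab_young_vec ?B y)) * c (emb (x, y))) = 0" for y1
      by (rule pairing_nondegenerate(1)[OF finA(1), of r]) (simp_all add: D(12) pz)
    then have "\<forall>y\<in>tableaux_on ?B. c (emb (x, y)) = 0"
      using x by (intro pairing_nondegenerate(1)[OF finA(2), of r]) (simp_all add: D(13))
    then show ?thesis using y by blast
  qed
  moreover have "d0 = emb ((la, T), (mu, T'))" by (simp add: e0 emb_def)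
  ultimately have "c d0 = 0" using D(14,15) by simp
  then show False using d0(1) by (simp add: D0_def)
qed

subsection \<open>Completeness\<close>

text \<open>Free slots are read from \<open>a\<close>, matched slots from a fixed reference index; a
  tensor on all slots becomes a function of the free ones.\<close>

definition merge :: "nat set \<Rightarrow> (nat \<Rightarrow> nat) \<Rightarrow> (nat \<Rightarrow> nat) \<Rightarrow> nat \<Rightarrow> nat" where
  "merge A a a0 = (\<lambda>p. if p \<in> A then a p else a0 p)"

lemma merge_fbox:
  assumes "a0 \<in> fbox n K" "A \<subseteq> K" "\<And>p. p \<in> A \<Longrightarrow> a p \<in> {1..n}"
  shows "merge A a a0 \<in> fbox n K"
proof (rule PiE_I)
  fix p assume "p \<in> K"
  then show "merge A a a0 p \<in> {1..n}"
    unfolding merge_def using assms(3)[of p] PiE_mem[OF assms(1), of p] by (cases "p \<in> A") (simp_all only: if_True if_False)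
next
  fix p assume "p \<notin> K"
  then show "merge A a a0 p = undefined" using assms(2) PiE_arb[OF assms(1), of p] by (auto simp: merge_def)
qed

lemma merge_upd:
  assumes "p \<in> A"
  shows "merge A (a(p := l)) a0 = (merge A a a0)(p := l)"
proof
  fix q
  show "merge A (a(p := l)) a0 q = ((merge A a a0)(p := l)) q"
    using assms by (cases "q = p") (simp_all add: merge_def)
qed

lemma merge_cong: "(\<And>p. p \<in> A \<Longrightarrow> a p = a' p) \<Longrightarrow> merge A a a0 = merge A a' a0"
  by (auto simp: merge_def fun_eq_iff)

lemma sum_merge:
  assumes "finite K" "A \<subseteq> K" "a0 \<in> fbox n K"
  shows "(\<Sum>a\<in>fbox n K. if \<forall>p\<in>K - A. a p = a0 p then f a else 0) = (\<Sum>a\<in>fbox n A. f (merge A a a0) :: complex)"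
proof -
  have bk: "merge A (restrict a A) a0 = a" if "a \<in> fbox n K" "\<forall>p\<in>K - A. a p = a0 p" for a
  proof
    fix p
    show "merge A (restrict a A) a0 p = a p"
      using that(2) PiE_arb[OF that(1), of p] PiE_arb[OF assms(3), of p] by (cases "p \<in> K") (auto simp: merge_def)
  qed
  have "(\<Sum>a\<in>fbox n K. if \<forall>p\<in>K - A. a p = a0 p then f a else 0)
      = (\<Sum>a\<in>{a\<in>fbox n K. \<forall>p\<in>K - A. a p = a0 p}. f a)"
    using assms(1) by (intro sum.inter_filter[symmetric]) simp
  also have "\<dots> = (\<Sum>a\<in>fbox n A. f (merge A a a0))"
  proof (rule sum.reindex_bij_witness[where i = "\<lambda>a. merge A a a0" and j = "\<lambda>a. restrict a A"])
    fix a assume a: "a \<in> {a\<in>fbox n K. \<forall>p\<in>K - A. a p = a0 p}"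
    then show "merge A (restrict a A) a0 = a" "f (merge A (restrict a A) a0) = f a" using bk by simp_all
    show "restrict a A \<in> fbox n A"
      using a assms(2) by (auto simp: PiE_iff simp del: atLeastAtMost_iff)
  next
    fix a assume a: "a \<in> fbox n A"
    show "restrict (merge A a a0) A = a"
      using PiE_arb[OF a] by (auto simp: fun_eq_iff merge_def)
    show "merge A a a0 \<in> {a\<in>fbox n K. \<forall>p\<in>K - A. a p = a0 p}"
      using merge_fbox[OF assms(3,2) fbox_val[OF a]] by (simp add: merge_def)
  qed
  finally show ?thesis .
qed

text \<open>The pairs are moved to their reference values one at a time with
  \<open>contr_pairs_inv\<close>; \<open>Q\<close> is the set of pairs already moved.\<close>

lemma contr_pairs_merge:
  assumes ps: "valid_pairs k ps" and I: "(a, b) \<in> Idx n k" "(a0, b0) \<in> Idx n k"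
    and m: "\<And>p. p \<in> set ps \<Longrightarrow> a (fst p) = b (snd p)" "\<And>p. p \<in> set ps \<Longrightarrow> a0 (fst p) = b0 (snd p)"
  shows "contr_pairs n k ps z (merge ({1..k} - fst ` set ps) a a0, merge ({1..k} - snd ` set ps) b b0) = contr_pairs n k ps z (a, b)"
proof -
  have K: "set ps \<subseteq> {1..k} \<times> {1..k}" and inj: "inj_on fst (set ps)" "inj_on snd (set ps)"
    using ps by (auto simp: valid_pairs_def distinct_map)
  have val: "a p \<in> {1..n}" "b p \<in> {1..n}" if "p \<in> {1..k}" for p
    using Idx_val(1)[OF I(1) that] Idx_val(2)[OF I(1) that] .
  have fb: "a0 \<in> fbox n {1..k}" "b0 \<in> fbox n {1..k}" using I(2) by (auto simp: Idx_eq)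
  have MI: "(merge ({1..k} - A) a a0, merge ({1..k} - B) b b0) \<in> Idx n k" for A B
    unfolding Idx_eq mem_Sigma_iff using val by (intro conjI merge_fbox fb) blast+
  have all: "contr_pairs n k ps z (merge ({1..k} - fst ` Q) a a0, merge ({1..k} - snd ` Q) b b0) = contr_pairs n k ps z (a, b)"
    if "finite Q" "Q \<subseteq> set ps" for Q
    using that
  proof (induction Q rule: finite_induct)
    case empty
    have self: "merge {1..k} c c0 = c" if "c \<in> fbox n {1..k}" "c0 \<in> fbox n {1..k}" for c c0
    proof
      fix p
      show "merge {1..k} c c0 p = c p"
        using PiE_arb[OF that(1), of p] PiE_arb[OF that(2), of p] by (cases "p \<in> {1..k}") (simp_all add: merge_def del: atLeastAtMost_iff)
    qed
    have "merge {1..k} a a0 = a" "merge {1..k} b b0 = b"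
      using I(1) fb by (simp_all only: self Idx_eq mem_Sigma_iff)
    then show ?case by simp
  next
    case (insert p Q)
    obtain i j where p: "p = (i, j)" by (cases p)
    have pm: "(i, j) \<in> set ps" using insert.prems by (simp add: p)
    have ij: "i \<in> {1..k}" "j \<in> {1..k}" using pm K by auto
    have nQ: "i \<notin> fst ` Q" "j \<notin> snd ` Q"
    proof -
      show "i \<notin> fst ` Q"
      proof
        assume "i \<in> fst ` Q"
        then obtain q where "q \<in> Q" "fst q = i" by blast
        then have "q = p" using inj_onD[OF inj(1), of q p] insert.prems by (auto simp: p)
        then show False using insert.hyps \<open>q \<in> Q\<close> by blast
      qed
      show "j \<notin> snd ` Q"
      proof
        assume "j \<in> snd ` Q"
        then obtain q where "q \<in> Q" "snd q = j" by blast
        then have "q = p" using inj_onD[OF inj(2), of q p] insert.prems by (auto simp: p)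
        then show False using insert.hyps \<open>q \<in> Q\<close> by blast
      qed
    qed
    let ?a = "merge ({1..k} - fst ` Q) a a0" and ?b = "merge ({1..k} - snd ` Q) b b0"
    have eq: "merge ({1..k} - fst ` insert p Q) a a0 = ?a(i := a0 i)"
      "merge ({1..k} - snd ` insert p Q) b b0 = ?b(j := b0 j)"
      by (auto simp: merge_def fun_eq_iff p)
    have "?a i = ?b j" using nQ ij m(1)[OF pm] by (simp add: merge_def)
    moreover have "b0 j = a0 i" using m(2)[OF pm] by simp
    ultimately have f: "contr_pairs n k ps z (?a(i := a0 i), ?b(j := b0 j)) = contr_pairs n k ps z (?a, ?b)"
      using contr_pairs_inv[OF ps pm MI _ Idx_val(1)[OF I(2) ij(1)], of "fst ` Q" "snd ` Q" z] by simp
    show ?case unfolding eq f using insert.IH insert.prems by blast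
  qed
  show ?thesis by (rule all) auto
qed

lemma contr_pairs_contr_out: "valid_pairs k ((i, j) # ps) \<Longrightarrow> contr n k i j (contr_pairs n k ps z) = contr_pairs n k ps (contr n k i j z)"
proof (induction ps)
  case Nil
  show ?case by (simp add: contr_pairs_simps)
next
  case (Cons p ps)
  obtain i' j' where p: "p = (i', j')" by (cases p)
  have v: "i \<in> {1..k}" "j \<in> {1..k}" "i' \<in> {1..k}" "j' \<in> {1..k}" "i' \<noteq> i" "j' \<noteq> j" "valid_pairs k ((i, j) # ps)"
    using Cons.prems unfolding p by (auto simp: valid_pairs_Cons simp del: atLeastAtMost_iff)
  show ?case unfolding p contr_pairs_simps contr_commute[OF v(1-6)] Cons.IH[OF v(7)] ..
qed

text \<open>Elements of \<open>eM\<close> have zero contractions at \<open>(i, i)\<close>. A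
  nonvanishing product of contractions of such an element therefore avoids these pairs, as the
  condition on \<open>s\<close> and \<open>t\<close> in \<open>data\<close> demands.\<close>

lemma contr_pairs_diag_zero:
  assumes "valid_pairs k ps" "(i, i) \<in> set ps" "contr n k i i z = (\<lambda>_. 0)"
  shows "contr_pairs n k ps z = (\<lambda>_. 0)"
  using assms(1,2)
proof (induction ps)
  case (Cons p ps)
  obtain i' j' where p: "p = (i', j')" by (cases p)
  have v: "valid_pairs k ps" using Cons.prems(1) by (simp add: p valid_pairs_Cons del: atLeastAtMost_iff)
  show ?case
  proof (cases "p = (i, i)")
    case True
    have "contr_pairs n k (p # ps) z = contr_pairs n k ps (contr n k i i z)"
      using contr_pairs_contr_out[of k i i ps n z] Cons.prems(1) by (simp add: True contr_pairs_simps)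
    also have "\<dots> = (\<lambda>_. 0)"
      using mhom_zero[OF mhom_contr_pairs[OF v, of n]] unfolding assms(3) zerot_def .
    finally show ?thesis .
  next
    case False
    then have "(i, i) \<in> set ps" using Cons.prems(2) by auto
    then show ?thesis unfolding p contr_pairs_simps using Cons.IH[OF v] contr_zero by simp
  qed
qed simp

lemma sum_flip:
  assumes dep: "\<And>b b'. (\<And>q. q \<in> B \<Longrightarrow> b q = b' q) \<Longrightarrow> f b = (f b' :: complex)"
  shows "(\<Sum>b\<in>fbox n B. f b) = (\<Sum>c\<in>fbox n B. f (flip n c))"
proof -
  \<comment> \<open>Restricting the reflection to \<open>B\<close> makes it an involution of the
    extensional functions.\<close>
  define u where "u b = restrict (flip n b) B" for b
  have u: "u b \<in> fbox n B" if "b \<in> fbox n B" for b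
    using fbox_val[OF that] by (force simp: u_def flip_def)
  have uu: "u (u b) = b" if b: "b \<in> fbox n B" for b
  proof
    fix q
    show "u (u b) q = b q" using fbox_val[OF b, of q] PiE_arb[OF b, of q]
      by (cases "q \<in> B") (auto simp: u_def flip_def)
  qed
  have fu: "f (flip n c) = f (u c)" for c by (rule dep) (simp add: u_def)
  show ?thesis unfolding fu
    by (rule sum.reindex_bij_witness[where i = u and j = u]) (simp_all only: u uu)
qed

lemma sum_fbox_mono:
  assumes "finite A" "m \<le> n" "\<And>a. a \<in> fbox n A \<Longrightarrow> f a \<noteq> 0 \<Longrightarrow> (\<forall>p\<in>A. a p \<in> {1..m})"
  shows "(\<Sum>a\<in>fbox n A. f a) = (\<Sum>a\<in>fbox m A. f a :: complex)"
proof (rule sum.mono_neutral_right)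
  show "finite (fbox n A)" using assms(1) by simp
  show "fbox m A \<subseteq> fbox n A" using assms(2) by (intro PiE_mono) auto
  show "\<forall>a\<in>fbox n A - fbox m A. f a = 0"
  proof
    fix a assume a: "a \<in> fbox n A - fbox m A"
    show "f a = 0"
    proof (rule ccontr)
      assume "f a \<noteq> 0"
      then have "\<forall>p\<in>A. a p \<in> {1..m}" using assms(3) a by blast
      then have "a \<in> fbox m A" using a by (auto simp: PiE_iff)
      then show False using a by blast
    qed
  qed
qed

text \<open>By \<open>traceless_low\<close> the tensor lives on disjoint value ranges for the two kinds of slots, where
  the raising operators act separately.\<close>

lemma traceless_killed_zero:
  fixes \<kappa> :: "(nat \<Rightarrow> nat) \<Rightarrow> (nat \<Rightarrow> nat) \<Rightarrow> complex"
  assumes fin: "finite A" "finite B" and card: "card A = r" "card B = r" "2 * r \<le> n"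
    and dep: "\<And>a a' b b'. (\<And>p. p \<in> A \<Longrightarrow> a p = a' p) \<Longrightarrow> (\<And>q. q \<in> B \<Longrightarrow> b q = b' q) \<Longrightarrow> \<kappa> a b = \<kappa> a' b'"
    and kil: "\<And>i j a b. 1 \<le> i \<Longrightarrow> i < j \<Longrightarrow> j \<le> n \<Longrightarrow> a \<in> fbox n A \<Longrightarrow> b \<in> fbox n B \<Longrightarrow>
      (\<Sum>p\<in>{p\<in>A. a p = i}. \<kappa> (a(p := j)) b) = (\<Sum>q\<in>{q\<in>B. b q = j}. \<kappa> a (b(q := i)))"
    and tr: "\<And>p q a b. p \<in> A \<Longrightarrow> q \<in> B \<Longrightarrow> a \<in> fbox n A \<Longrightarrow> b \<in> fbox n B \<Longrightarrow>
      (\<Sum>l\<in>{1..n}. \<kappa> (a(p := l)) (b(q := l))) = 0"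
    and orth: "\<And>d d'. d \<in> tableaux_on A \<Longrightarrow> d' \<in> tableaux_on B \<Longrightarrow>
      (\<Sum>a\<in>fbox n A. \<Sum>b\<in>fbox n B. \<kappa> a b * (of_int (tab_young_vec A d a) * of_int (tab_young_vec B d' (flip n b)))) = 0"
    and ab: "a0 \<in> fbox n A" "b0 \<in> fbox n B"
  shows "\<kappa> a0 b0 = 0"
proof -
  \<comment> \<open>\<open>\<kappa>\<close> cut off to the allowed values. It agrees with
    \<open>\<kappa>\<close> wherever the entries lie in \<open>{1..n}\<close>, and it satisfies the
    value bounds of \<open>raise_killed\<close> at all arguments.\<close>
  define F where "F a b = (if (\<forall>p\<in>A. a p \<in> {1..r}) \<and> (\<forall>q\<in>B. b q \<in> {r + 1..n}) then \<kappa> a b else 0)" for a b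
  have LH: "{1..r} \<union> {r + 1..n} = {1..n}" "{1..r} \<inter> {r + 1..n} = {}"
    "{r + 1..n} \<union> {1..r} = {1..n}" "{r + 1..n} \<inter> {1..r} = {}" using card(3) by auto
  have k1: "(\<Sum>p\<in>{p\<in>A. a p = i}. \<kappa> (a(p := j)) b) = (\<Sum>q\<in>{q\<in>B. b q = j}. \<kappa> a (b(q := i)))"
    if "i \<in> {1..r}" "j \<in> {r + 1..n}" "a \<in> fbox n A" "b \<in> fbox n B" for i j a b
    using that card(3) by (intro kil) auto
  have lowA: "a p \<in> {1..r}" if "a \<in> fbox n A" "b \<in> fbox n B" "\<kappa> a b \<noteq> 0" "p \<in> A" for a b p
  proof (rule traceless_low[where \<psi> = \<kappa> and L = "{1..r}" and H = "{r + 1..n}" and n = n and A = A and B = B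
        and a = a and b = b and p = p, OF fin LH(1,2)])
    show "card A \<le> card {1..r}" using card by simp
  qed (fact k1 tr that)+
  \<comment> \<open>\<open>traceless_low\<close> with the two kinds of slots exchanged: now
    \<open>{r + 1..n}\<close> is allowed, and \<open>card B \<le> n - r\<close> follows from
    \<open>2 * r \<le> n\<close>.\<close>
  have highB: "b q \<in> {r + 1..n}" if "a \<in> fbox n A" "b \<in> fbox n B" "\<kappa> a b \<noteq> 0" "q \<in> B" for a b q
  proof (rule traceless_low[where \<psi> = "\<lambda>b a. \<kappa> a b" and L = "{r + 1..n}" and H = "{1..r}" and n = n and A = B and B = A
        and a = b and b = a and p = q, OF fin(2,1) LH(3,4)])
    show "card B \<le> card {r + 1..n}" using card by simp
    fix i j a b assume "i \<in> {r + 1..n}" "j \<in> {1..r}" "a \<in> fbox n B" "b \<in> fbox n A"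
    then show "(\<Sum>p\<in>{p\<in>B. a p = i}. \<kappa> b (a(p := j))) = (\<Sum>q\<in>{q\<in>A. b q = j}. \<kappa> (b(q := i)) a)"
      by (intro k1[symmetric])
  next
    fix p q a b assume "p \<in> B" "q \<in> A" "a \<in> fbox n B" "b \<in> fbox n A"
    then show "(\<Sum>l\<in>{1..n}. \<kappa> (b(q := l)) (a(p := l))) = 0" by (intro tr)
  qed (fact that)+
  have FK: "\<kappa> a b = F a b" if "\<And>p. p \<in> A \<Longrightarrow> a p \<in> {1..n}" "\<And>q. q \<in> B \<Longrightarrow> b q \<in> {1..n}" for a b
  proof (cases "\<kappa> a b = 0")
    case True
    then show ?thesis by (simp add: F_def)
  next
    case False
    let ?a = "restrict a A" and ?b = "restrict b B"
    have e: "\<kappa> ?a ?b = \<kappa> a b" by (rule dep) simp_all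
    have f: "?a \<in> fbox n A" "?b \<in> fbox n B" using that by (auto simp del: atLeastAtMost_iff)
    have "a p \<in> {1..r}" if "p \<in> A" for p using lowA[OF f _ that] False e that by simp
    moreover have "b q \<in> {r + 1..n}" if "q \<in> B" for q using highB[OF f _ that] False e that by simp
    ultimately show ?thesis unfolding F_def by simp
  qed
  have Fdep: "F a b = F a' b'" if "\<And>p. p \<in> A \<Longrightarrow> a p = a' p" "\<And>q. q \<in> B \<Longrightarrow> b q = b' q" for a a' b b'
  proof -
    have "\<kappa> a b = \<kappa> a' b'" by (rule dep[OF that])
    then show ?thesis unfolding F_def using that by simp
  qed
  have FvalA: "a p \<in> {1..r}" if "F a b \<noteq> 0" "p \<in> A" for a b p
    using that unfolding F_def by (auto split: if_splits)
  have FvalB: "b q \<in> {r + 1..n}" if "F a b \<noteq> 0" "q \<in> B" for a b q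
    using that unfolding F_def by (auto split: if_splits)
  have Fkil: "(\<Sum>p\<in>{p\<in>A. a p = i}. F (a(p := j)) b) = (\<Sum>q\<in>{q\<in>B. b q = j}. F a (b(q := i)))"
    if ij: "1 \<le> i" "i < j" "j \<le> n" and av: "\<And>p. p \<in> A \<Longrightarrow> a p \<in> {1..n}" and bv: "\<And>q. q \<in> B \<Longrightarrow> b q \<in> {1..n}" for i j a b
  proof -
    let ?a = "restrict a A" and ?b = "restrict b B"
    have f: "?a \<in> fbox n A" "?b \<in> fbox n B" using av bv by (auto simp del: atLeastAtMost_iff)
    have sA: "{p\<in>A. ?a p = i} = {p\<in>A. a p = i}" and sB: "{q\<in>B. ?b q = j} = {q\<in>B. b q = j}" by auto
    have "(\<Sum>p\<in>{p\<in>A. a p = i}. F (a(p := j)) b) = (\<Sum>p\<in>{p\<in>A. ?a p = i}. \<kappa> (?a(p := j)) ?b)"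
      unfolding sA
    proof (rule sum.cong[OF refl])
      fix p assume "p \<in> {p\<in>A. a p = i}"
      have "F (a(p := j)) b = \<kappa> (a(p := j)) b"
        by (rule FK[symmetric]) (use av bv ij in auto)
      also have "\<dots> = \<kappa> (?a(p := j)) ?b" by (rule dep) simp_all
      finally show "F (a(p := j)) b = \<kappa> (?a(p := j)) ?b" .
    qed
    also have "\<dots> = (\<Sum>q\<in>{q\<in>B. ?b q = j}. \<kappa> ?a (?b(q := i)))" by (rule kil[OF ij f])
    also have "\<dots> = (\<Sum>q\<in>{q\<in>B. b q = j}. F a (b(q := i)))"
      unfolding sB
    proof (rule sum.cong[OF refl])
      fix q assume "q \<in> {q\<in>B. b q = j}"
      have "F a (b(q := i)) = \<kappa> a (b(q := i))"
        by (rule FK[symmetric]) (use av bv ij in auto)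
      also have "\<dots> = \<kappa> ?a (?b(q := i))" by (rule dep) simp_all
      finally show "\<kappa> ?a (?b(q := i)) = F a (b(q := i))" by (rule sym)
    qed
    finally show ?thesis .
  qed
  have rn: "r \<le> n" "card B \<le> n - r" using card by simp_all
  have RA: "raise_killed A r (\<lambda>a. F a b)" for b
    unfolding raise_killed_def
  proof (intro conjI allI impI ballI)
    fix a a' :: "nat \<Rightarrow> nat" assume "\<forall>p\<in>A. a p = a' p"
    then show "F a b = F a' b" by (intro Fdep) auto
  next
    fix a p assume "F a b \<noteq> 0" "p \<in> A"
    then show "a p \<in> {1..r}" by (rule FvalA)
  next
    fix i j a assume ij: "1 \<le> i" "i < j" "j \<le> r"
    show "raise_op A i j (\<lambda>a. F a b) a = 0"
    proof (rule ccontr)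
      assume nz: "\<not> ?thesis"
      then obtain p where p: "p \<in> {p\<in>A. a p = i}" "F (a(p := j)) b \<noteq> 0"
        unfolding raise_op_def by (rule sum.not_neutral_contains_not_neutral)
      have bv: "b q \<in> {r + 1..n}" if "q \<in> B" for q by (rule FvalB[OF p(2) that])
      have av: "a p' \<in> {1..r}" if "p' \<in> A" for p'
        using FvalA[OF p(2) that] p(1) ij by (cases "p' = p") auto
      \<comment> \<open>All dual entries exceed \<open>r\<close>, so none equals \<open>j\<close>
        and the dual side of the raising identity is an empty sum: the operator acts on the
        \<open>V\<close> slots alone.\<close>
      have "raise_op A i j (\<lambda>a. F a b) a = (\<Sum>q\<in>{q\<in>B. b q = j}. F a (b(q := i)))"
        unfolding raise_op_def using av bv ij rn by (intro Fkil) fastforce+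
      also have "{q\<in>B. b q = j} = {}" using bv ij by fastforce
      finally show False using nz by simp
    qed
  qed
  have RB: "raise_killed B (n - r) (\<lambda>c. F a (flip n c))" for a
    unfolding raise_killed_def
  proof (intro conjI allI impI ballI)
    fix c c' :: "nat \<Rightarrow> nat" assume "\<forall>q\<in>B. c q = c' q"
    then show "F a (flip n c) = F a (flip n c')" by (intro Fdep) (auto simp: flip_def)
  next
    fix c q assume "F a (flip n c) \<noteq> 0" "q \<in> B"
    then have "flip n c q \<in> {r + 1..n}" by (rule FvalB)
    then show "c q \<in> {1..n - r}" by (auto simp: flip_def)
  next
    fix i j c assume ij: "1 \<le> i" "i < j" "j \<le> n - r"
    show "raise_op B i j (\<lambda>c. F a (flip n c)) c = 0"
    proof (rule ccontr)
      assume nz: "\<not> ?thesis"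
      then obtain q where q: "q \<in> {q\<in>B. c q = i}" "F a (flip n (c(q := j))) \<noteq> 0"
        unfolding raise_op_def by (rule sum.not_neutral_contains_not_neutral)
      have av: "a p \<in> {1..r}" if "p \<in> A" for p by (rule FvalA[OF q(2) that])
      have col_vec: "c q' \<in> {1..n - r}" if "q' \<in> B" for q'
        using FvalB[OF q(2) that] q(1) ij by (cases "q' = q") (auto simp: flip_def)
      have upd: "flip n (c(q := j)) = (flip n c)(q := n + 1 - j)" for q
        by (auto simp: flip_def fun_eq_iff)
      have set: "{q\<in>B. c q = i} = {q\<in>B. flip n c q = n + 1 - i}"
        using col_vec ij unfolding flip_def by fastforce
      have "raise_op B i j (\<lambda>c. F a (flip n c)) c = (\<Sum>q\<in>{q\<in>B. flip n c q = n + 1 - i}. F a ((flip n c)(q := n + 1 - j)))"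
        unfolding raise_op_def upd set ..
      also have "\<dots> = (\<Sum>p\<in>{p\<in>A. a p = n + 1 - j}. F (a(p := n + 1 - i)) (flip n c))"
      proof (rule Fkil[symmetric])
        show "a p \<in> {1..n}" if "p \<in> A" for p using av[OF that] rn by simp
        show "flip n c q \<in> {1..n}" if "q \<in> B" for q using col_vec[OF that] by (auto simp: flip_def)
      qed (use ij in auto)
      also have "{p\<in>A. a p = n + 1 - j} = {}" using av ij by fastforce
      finally show False using nz by simp
    qed
  qed
  have G0: "(\<Sum>a\<in>fbox r A. F a (flip n c) * of_int (tab_young_vec A d a)) = 0" if d: "d \<in> tableaux_on A" for d c
  proof -
    \<comment> \<open>The pairing with one Young vector on the \<open>V\<close> slots is still
      \<open>raise_killed\<close> as a function of the dual slots, so the two kinds are treated in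
      turn. The form \<open>0 - ...\<close> is that of \<open>raise_killed_lincomb\<close>.\<close>
    define g where "g c = 0 - (\<Sum>a\<in>fbox r A. of_int (tab_young_vec A d a) * F a (flip n c))" for c
    have "raise_killed B (n - r) (\<lambda>_. 0)" by (simp add: raise_killed_def raise_op_def)
    then have Rg: "raise_killed B (n - r) g" unfolding g_def[abs_def] by (rule raise_killed_lincomb) (rule RB)
    have "g c = 0"
    proof (rule rkilled_eq_zero[OF fin(2) Rg rn(2)])
      fix d' assume d': "d' \<in> tableaux_on B"
      have "0 = (\<Sum>a\<in>fbox n A. \<Sum>b\<in>fbox n B. F a b * (of_int (tab_young_vec A d a) * of_int (tab_young_vec B d' (flip n b))))"
      proof -
        have "\<kappa> a b = F a b" if "a \<in> fbox n A" "b \<in> fbox n B" for a b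
          by (rule FK) (use fbox_val[OF that(1)] fbox_val[OF that(2)] in blast)+
        then show ?thesis unfolding orth[OF d d', symmetric] by (intro sum.cong refl) simp
      qed
      also have "\<dots> = (\<Sum>a\<in>fbox n A. \<Sum>c\<in>fbox (n - r) B. F a (flip n c) * (of_int (tab_young_vec A d a) * of_int (tab_young_vec B d' c)))"
      proof (rule sum.cong[OF refl])
        fix a
        have "(\<Sum>b\<in>fbox n B. F a b * (of_int (tab_young_vec A d a) * of_int (tab_young_vec B d' (flip n b))))
          = (\<Sum>c\<in>fbox n B. F a (flip n c) * (of_int (tab_young_vec A d a) * of_int (tab_young_vec B d' (flip n (flip n c)))))"
        proof (rule sum_flip)
          fix b b' :: "nat \<Rightarrow> nat" assume e: "\<And>q. q \<in> B \<Longrightarrow> b q = b' q"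
          have "F a b = F a b'" by (rule Fdep) (simp_all add: e)
          moreover have "tab_young_vec B d' (flip n b) = tab_young_vec B d' (flip n b')"
            unfolding tab_young_vec_def by (rule young_vec_cong) (simp add: flip_def e)
          ultimately show "F a b * (of_int (tab_young_vec A d a) * of_int (tab_young_vec B d' (flip n b)))
            = F a b' * (of_int (tab_young_vec A d a) * of_int (tab_young_vec B d' (flip n b')))" by simp
        qed
        also have "\<dots> = (\<Sum>c\<in>fbox n B. F a (flip n c) * (of_int (tab_young_vec A d a) * of_int (tab_young_vec B d' c)))"
        proof (rule sum.cong[OF refl])
          fix c assume c: "c \<in> fbox n B"
          have "tab_young_vec B d' (flip n (flip n c)) = tab_young_vec B d' c"
            unfolding tab_young_vec_def
          proof (rule young_vec_cong)
            fix q assume "q \<in> B"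
            then show "flip n (flip n c) q = c q" using fbox_val[OF c, of q] by (simp add: flip_def)
          qed
          then show "F a (flip n c) * (of_int (tab_young_vec A d a) * of_int (tab_young_vec B d' (flip n (flip n c))))
            = F a (flip n c) * (of_int (tab_young_vec A d a) * of_int (tab_young_vec B d' c))" by simp
        qed
        also have "\<dots> = (\<Sum>c\<in>fbox (n - r) B. F a (flip n c) * (of_int (tab_young_vec A d a) * of_int (tab_young_vec B d' c)))"
        proof (rule sum_fbox_mono[OF fin(2)])
          fix c assume "F a (flip n c) * (of_int (tab_young_vec A d a) * of_int (tab_young_vec B d' c)) \<noteq> 0"
          then have "F a (flip n c) \<noteq> 0" by auto
          then show "\<forall>q\<in>B. c q \<in> {1..n - r}" using raise_killedD(2)[OF RB] by blast
        qed simp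
        finally show "(\<Sum>b\<in>fbox n B. F a b * (of_int (tab_young_vec A d a) * of_int (tab_young_vec B d' (flip n b))))
          = (\<Sum>c\<in>fbox (n - r) B. F a (flip n c) * (of_int (tab_young_vec A d a) * of_int (tab_young_vec B d' c)))" .
      qed
      also have "\<dots> = (\<Sum>a\<in>fbox r A. \<Sum>c\<in>fbox (n - r) B. F a (flip n c) * (of_int (tab_young_vec A d a) * of_int (tab_young_vec B d' c)))"
      proof (rule sum_fbox_mono[OF fin(1) rn(1)])
        fix a assume "(\<Sum>c\<in>fbox (n - r) B. F a (flip n c) * (of_int (tab_young_vec A d a) * of_int (tab_young_vec B d' c))) \<noteq> 0"
        then obtain c where "F a (flip n c) * (of_int (tab_young_vec A d a) * of_int (tab_young_vec B d' c)) \<noteq> 0"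
          by (rule sum.not_neutral_contains_not_neutral)
        then have "F a (flip n c) \<noteq> 0" by auto
        then show "\<forall>p\<in>A. a p \<in> {1..r}" using FvalA by blast
      qed
      also have "\<dots> = (\<Sum>c\<in>fbox (n - r) B. \<Sum>a\<in>fbox r A. F a (flip n c) * (of_int (tab_young_vec A d a) * of_int (tab_young_vec B d' c)))"
        by (rule sum.swap)
      also have "\<dots> = - (\<Sum>c\<in>fbox (n - r) B. g c * of_int (tab_young_vec B d' c))"
        unfolding g_def diff_0 mult_minus_left sum_negf minus_minus sum_distrib_right
        by (intro sum.cong refl) (simp only: mult_ac)
      finally show "(\<Sum>c\<in>fbox (n - r) B. g c * of_int (tab_young_vec B d' c)) = 0" by simp
    qed
    then show ?thesis unfolding g_def by (simp add: mult.commute)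
  qed
  have F0: "F a (flip n c) = 0" for a c
    by (rule rkilled_eq_zero[OF fin(1) RA]) (use card G0 in simp_all)
  have "\<kappa> a0 b0 = F a0 b0" by (rule FK) (use fbox_val[OF ab(1)] fbox_val[OF ab(2)] in blast)+
  also have "\<dots> = F a0 (flip n (flip n b0))"
  proof (rule Fdep)
    fix q assume "q \<in> B"
    then show "b0 q = flip n (flip n b0) q" using fbox_val[OF ab(2), of q] by (simp add: flip_def)
  qed simp
  finally show ?thesis using F0 by simp
qed

lemma valid_pairs_length:
  assumes "valid_pairs k ps"
  shows "length ps \<le> k"
proof -
  have "length ps = card (set (map fst ps))" using distinct_card[of "map fst ps"] assms by (simp add: valid_pairs_def)
  also have "\<dots> \<le> card {1..k}" using assms by (intro card_mono) (auto simp: valid_pairs_def)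
  finally show ?thesis by simp
qed

lemma valid_pairs_insort:
  assumes "valid_pairs k (p # ps)" "sorted_wrt (<) (map fst ps)"
  shows "valid_pairs k (insort_key fst p ps)" "sorted_wrt (<) (map fst (insort_key fst p ps))"
proof -
  have 1: "distinct (map fst (insort_key fst p ps))"
    using assms(1) by (simp add: valid_pairs_def distinct_insort_key)
  have d1: "distinct (insort_key fst p ps)"
    using assms(1) by (auto simp: valid_pairs_def distinct_insort distinct_map)
  have "inj_on snd (insert p (set ps))" using assms(1) by (auto simp: valid_pairs_def distinct_map)
  then have 2: "distinct (map snd (insort_key fst p ps))" using d1 by (simp add: distinct_map set_insort_key)
  show "valid_pairs k (insort_key fst p ps)" using assms(1) 1 2 by (simp add: valid_pairs_def set_insort_key)
  show "sorted_wrt (<) (map fst (insort_key fst p ps))"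
    using assms(2) 1 by (simp add: strict_sorted_iff sorted_insort_key)
qed

text \<open>A largest nonvanishing contraction \<open>w\<close> of \<open>z\<close> is an insertion
  of pairs with a coefficient function \<open>\<kappa>\<close> on the free slots.
  \<open>\<kappa>\<close> inherits the raising identity from \<open>z\<close>, tracelessness from
  maximality and orthogonality from the generators, so \<open>traceless_killed_zero\<close> makes
  \<open>w\<close> vanish.\<close>

theorem killed_orth_zero:
  assumes n: "2 * k \<le> n" and zE: "z \<in> e_op n k ` Mcar n k" and zk: "killed n k z"
    and zo: "\<And>d. d \<in> data k \<Longrightarrow> herm_k n k z (hw_gen n k d) = 0"
  shows "z = zerot"
proof (rule ccontr)
  assume nz: "z \<noteq> zerot"
  have zM: "z \<in> Mcar n k" using zk by (simp add: killed_def)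
  obtain x where x: "z = e_op n k x" using zE by blast
  have c0: "contr n k i i z = (\<lambda>_. 0)" if "i \<in> {1..k}" for i
    unfolding x e_op_traceless_proj by (rule contr_traceless_proj) (use that n in auto)
  \<comment> \<open>Only lists with increasing first components are considered, so that the list
    found splits into the \<open>s\<close> and \<open>t\<close> of a datum.\<close>
  define V where "V ps \<longleftrightarrow> valid_pairs k ps \<and> sorted_wrt (<) (map fst ps) \<and> contr_pairs n k ps z \<noteq> zerot" for ps
  have "V []" using nz by (simp add: V_def valid_pairs_def contr_pairs_simps)
  moreover have "\<forall>ps. V ps \<longrightarrow> length ps < Suc k" using valid_pairs_length by (auto simp: V_def less_Suc_eq_le)
  ultimately have "\<exists>ps. V ps \<and> (\<forall>qs. V qs \<longrightarrow> length qs \<le> length ps)" by (rule ex_has_greatest_nat)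
  then obtain ps where ps: "V ps" and mx: "\<And>qs. V qs \<Longrightarrow> length qs \<le> length ps" by blast
  have v: "valid_pairs k ps" and srt: "sorted_wrt (<) (map fst ps)" and w0: "contr_pairs n k ps z \<noteq> zerot" using ps by (auto simp: V_def)
  define s where "s = map fst ps"
  define t where "t = map snd ps"
  define r where "r = k - length ps"
  define w where "w = contr_pairs n k ps z"
  have zst: "zip s t = ps" by (simp add: s_def t_def zip_map_fst_snd)
  have fs: "fst ` set ps = set s" "snd ` set ps = set t" by (simp_all add: s_def t_def)
  have len: "length ps \<le> k" by (rule valid_pairs_length[OF v])
  have S: "r \<le> k" "length s = k - r" "sorted_wrt (<) s" "length t = k - r" "distinct t" "set s \<subseteq> {1..k}" "set t \<subseteq> {1..k}" "distinct s"
    using len v srt by (auto simp: r_def s_def t_def valid_pairs_def)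
  have nd: "(i, i) \<notin> set (zip s t)" for i
  proof
    assume "(i, i) \<in> set (zip s t)"
    then have i: "(i, i) \<in> set ps" by (simp only: zst)
    then have "i \<in> {1..k}" using v by (auto simp: valid_pairs_def)
    then show False using contr_pairs_diag_zero[OF v i c0] w0 by (simp add: zerot_def)
  qed
  note mkdata = dataI[OF S(1-7) nd]
  let ?A = "{1..k} - set s" and ?B = "{1..k} - set t" and ?P = "set ps"
  have fin: "finite ?A" "finite ?B" by auto
  have cA: "card ?A = r" "card ?B = r" using S by (simp_all add: card_Diff_subset distinct_card)
  have r2: "2 * r \<le> n" using S(1) n by simp
  define v0 where "v0 p = r + lpos s p" for p
  \<comment> \<open>The reference index: matched slots carry generic values; the \<open>1\<close> in
    the free slots is a placeholder that \<open>merge\<close> overwrites.\<close>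
  define a0 where "a0 = gen_a k r s (\<lambda>_. 1)"
  define b0 where "b0 = gen_a k r t (\<lambda>_. 1)"
  have sv: "v0 p \<in> {1..n}" if "p \<in> set s" for p
    using lpos_range[OF S(8) that] S(1,2) n by (auto simp: v0_def)
  have tv: "r + lpos t p \<in> {1..n}" if "p \<in> set t" for p
    using lpos_range[OF S(5) that] S(1,4) n by auto
  have I0: "(a0, b0) \<in> Idx n k"
    unfolding Idx_eq mem_Sigma_iff PiE_iff a0_def b0_def using sv tv n by (auto simp: gen_a_def v0_def)
  have P12: "fst p \<in> set s" "snd p \<in> set t" if "p \<in> ?P" for p using that fs by blast+
  have P12K: "fst p \<in> {1..k}" "snd p \<in> {1..k}" if "p \<in> ?P" for p using P12[OF that] S(6,7) by blast+
  have av: "a0 p = v0 p" if "p \<in> set s" for p using that S(6) by (auto simp: a0_def gen_a_def v0_def)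
  have bv: "b0 (snd p) = v0 (fst p)" if p: "p \<in> ?P" for p
  proof -
    have "lpos s (fst p) = lpos t (snd p)"
      using zip_lpos[OF S(8,5) _ P12[OF p]] p S(2,4) by (simp add: zst)
    then show ?thesis using P12[OF p] P12K[OF p] by (simp add: b0_def gen_a_def v0_def)
  qed
  have m0: "a0 (fst p) = b0 (snd p)" if p: "p \<in> ?P" for p using av[OF P12(1)[OF p]] bv[OF p] by simp
  have fb0: "a0 \<in> fbox n {1..k}" "b0 \<in> fbox n {1..k}" using I0 by (auto simp: Idx_eq)
  define \<kappa> where "\<kappa> a b = w (merge ?A a a0, merge ?B b b0)" for a b
  have dep: "\<kappa> a b = \<kappa> a' b'" if "\<And>p. p \<in> ?A \<Longrightarrow> a p = a' p" "\<And>q. q \<in> ?B \<Longrightarrow> b q = b' q" for a a' b b'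
    unfolding \<kappa>_def using merge_cong[of ?A a a' a0, OF that(1)] merge_cong[of ?B b b' b0, OF that(2)] by simp
  have MI: "(merge ?A a a0, merge ?B b b0) \<in> Idx n k"
    if "\<And>p. p \<in> ?A \<Longrightarrow> a p \<in> {1..n}" "\<And>q. q \<in> ?B \<Longrightarrow> b q \<in> {1..n}" for a b
    unfolding Idx_eq mem_Sigma_iff using that by (intro conjI merge_fbox fb0) blast+
  have Mm: "merge ?A a a0 (fst p) = merge ?B b b0 (snd p)" if "p \<in> ?P" for a b p
    using m0[OF that] P12[OF that] by (simp add: merge_def)
  \<comment> \<open>\<open>w\<close> has the support and the invariance of a tensor with inserted
    pairs, so it is determined by its values at the reference entries of the matched slots.\<close>
  have wins: "w = pair_insert n k ?P (\<lambda>\<iota>. \<kappa> (fst \<iota>) (snd \<iota>))"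
  proof
    fix \<iota> :: idx
    obtain a b where \<iota>: "\<iota> = (a, b)" by (cases \<iota>)
    show "w \<iota> = pair_insert n k ?P (\<lambda>\<iota>. \<kappa> (fst \<iota>) (snd \<iota>)) \<iota>"
    proof (cases "(a, b) \<in> Idx n k \<and> (\<forall>p\<in>?P. a (fst p) = b (snd p))")
      case True
      then have "w (a, b) = \<kappa> a b" unfolding w_def \<kappa>_def fs[symmetric]
        by (intro contr_pairs_merge[OF v _ I0 _ m0, symmetric]) auto
      then show ?thesis using True by (simp add: \<iota> pair_insert_def)
    next
      case False
      then have "w (a, b) = 0" using contr_pairs_support[OF v zM, of a b] unfolding w_def by blast
      then show ?thesis using False by (simp only: \<iota> pair_insert_def fst_conv snd_conv if_False)
    qed
  qed
  have indk: "indep_of_pairs ?P (\<lambda>\<iota>. \<kappa> (fst \<iota>) (snd \<iota>))"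
    unfolding indep_of_pairs_def
  proof (intro ballI allI conjI)
    fix p a b l assume p: "p \<in> ?P"
    show "\<kappa> (fst (a(fst p := l), b)) (snd (a(fst p := l), b)) = \<kappa> (fst (a, b)) (snd (a, b))"
      unfolding fst_conv snd_conv using P12[OF p] by (intro dep) auto
    show "\<kappa> (fst (a, b(snd p := l))) (snd (a, b(snd p := l))) = \<kappa> (fst (a, b)) (snd (a, b))"
      unfolding fst_conv snd_conv using P12[OF p] by (intro dep) auto
  qed
  have PP: "?P \<subseteq> {1..k} \<times> {1..k}" "inj_on fst ?P" "inj_on snd ?P"
    using v by (auto simp: valid_pairs_def distinct_map)
  have kil: "(\<Sum>p\<in>{p\<in>?A. a p = i}. \<kappa> (a(p := j)) b) = (\<Sum>q\<in>{q\<in>?B. b q = j}. \<kappa> a (b(q := i)))"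
    if ij: "1 \<le> i" "i < j" "j \<le> n" and ab: "a \<in> fbox n ?A" "b \<in> fbox n ?B" for i j a b
  proof -
    let ?X = "Eij i j" and ?a = "merge ?A a a0" and ?b = "merge ?B b b0"
    have "act n k ?X w = contr_pairs n k ps (act n k ?X z)"
      unfolding w_def by (rule mhomD(4)[OF mhom_contr_pairs[OF v] zM, symmetric])
    also have "act n k ?X z = zerot" using zk ij by (simp add: killed_def)
    also have "contr_pairs n k ps zerot = zerot" by (rule mhom_zero[OF mhom_contr_pairs[OF v]])
    finally have "pair_insert n k ?P (gl_act n ?A ?B ?X (\<lambda>\<iota>. \<kappa> (fst \<iota>) (snd \<iota>))) = zerot"
      unfolding wins pair_insert_act[OF PP indk] fs .
    from fun_cong[OF this, of "(?a, ?b)"]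
    have "pair_insert n k ?P (gl_act n ?A ?B ?X (\<lambda>\<iota>. \<kappa> (fst \<iota>) (snd \<iota>))) (?a, ?b) = 0" by (simp add: zerot_def)
    moreover have "(?a, ?b) \<in> Idx n k" by (rule MI) (use fbox_val[OF ab(1)] fbox_val[OF ab(2)] in blast)+
    ultimately have "gl_act n ?A ?B ?X (\<lambda>\<iota>. \<kappa> (fst \<iota>) (snd \<iota>)) (?a, ?b) = 0"
      using Mm[where a = a and b = b] unfolding pair_insert_def fst_conv snd_conv by (simp only: simp_thms ball_triv if_True) auto
    then have "(\<Sum>p\<in>{p\<in>?A. ?a p = i}. \<kappa> (?a(p := j)) ?b) - (\<Sum>q\<in>{q\<in>?B. ?b q = j}. \<kappa> ?a (?b(q := i))) = 0"
      using gl_act_Eij[OF fin, of i n j "\<lambda>\<iota>. \<kappa> (fst \<iota>) (snd \<iota>)" ?a ?b] ij by simp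
    moreover have "{p\<in>?A. ?a p = i} = {p\<in>?A. a p = i}" "{q\<in>?B. ?b q = j} = {q\<in>?B. b q = j}"
      by (auto simp: merge_def)
    moreover have "\<kappa> (?a(p := j)) ?b = \<kappa> (a(p := j)) b" for p by (rule dep) (auto simp: merge_def)
    moreover have "\<kappa> ?a (?b(q := i)) = \<kappa> a (b(q := i))" for q by (rule dep) (auto simp: merge_def)
    ultimately show ?thesis by simp
  qed
  have tr: "(\<Sum>l\<in>{1..n}. \<kappa> (a(p := l)) (b(q := l))) = 0"
    if pq: "p \<in> ?A" "q \<in> ?B" and ab: "a \<in> fbox n ?A" "b \<in> fbox n ?B" for p q a b
  proof -
    let ?a = "merge ?A a a0" and ?b = "merge ?B b b0"
    have "p \<in> {1..k}" "q \<in> {1..k}" using pq by blast+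
    then have vp: "valid_pairs k ((p, q) # ps)" using v P12 pq unfolding valid_pairs_Cons by blast
    \<comment> \<open>A nonzero contraction at one more pair would be a longer list satisfying
      \<open>V\<close>.\<close>
    have "contr_pairs n k (insort_key fst (p, q) ps) z = zerot"
    proof (rule ccontr)
      assume "contr_pairs n k (insort_key fst (p, q) ps) z \<noteq> zerot"
      then have "V (insort_key fst (p, q) ps)" unfolding V_def using valid_pairs_insort[OF vp srt] by blast
      then show False using mx by fastforce
    qed
    then have c: "contr n k p q w = zerot" unfolding contr_pairs_insort[OF vp] w_def .
    have n1: "1 \<in> {1..n}" using \<open>p \<in> {1..k}\<close> n by simp
    \<comment> \<open>Any common value at \<open>p\<close> and \<open>q\<close> will do; the
      contraction there is the trace over \<open>l\<close>.\<close>
    have "(?a(p := 1), ?b(q := 1)) \<in> Idx n k"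
    proof (intro Idx_upd MI)
      show "a p \<in> {1..n}" if "p \<in> ?A" for p using fbox_val[OF ab(1) that] .
      show "b q \<in> {1..n}" if "q \<in> ?B" for q using fbox_val[OF ab(2) that] .
    qed (fact n1 \<open>p \<in> {1..k}\<close> \<open>q \<in> {1..k}\<close>)+
    then have "contr n k p q w (?a(p := 1), ?b(q := 1)) = (\<Sum>l\<in>{1..n}. w (?a(p := l), ?b(q := l)))"
      unfolding contr_eq fun_upd_same fun_upd_upd by (simp only: simp_thms if_True)
    then have "(\<Sum>l\<in>{1..n}. w (?a(p := l), ?b(q := l))) = 0" unfolding c zerot_def by (rule sym)
    then show ?thesis unfolding \<kappa>_def merge_upd[OF pq(1)] merge_upd[OF pq(2)] .
  qed
  have orth: "(\<Sum>a\<in>fbox n ?A. \<Sum>b\<in>fbox n ?B. \<kappa> a b * (of_int (tab_young_vec ?A d a) * of_int (tab_young_vec ?B d' (flip n b)))) = 0"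
    if d: "d \<in> tableaux_on ?A" and d': "d' \<in> tableaux_on ?B" for d d'
  proof -
    let ?y = "young_product n ?A ?B d d'"
    have dat: "(r, s, t, fst d, fst d', snd d, snd d') \<in> data k" using d d' by (intro mkdata) simp_all
    have ind: "indep_of_pairs ?P ?y" by (rule indep_of_pairs_young_product) (use P12 in blast)
    have vr: "valid_pairs k (rev ps)" using v by (simp add: valid_pairs_def rev_map[symmetric])
    have vv: "\<forall>p\<in>set (rev ps). v0 (fst p) \<in> {1..n}" using sv P12 by (simp del: atLeastAtMost_iff)
    \<comment> \<open>The inserted pairs are themselves a product of contractions, applied to a
      tensor with fixed values \<open>v0\<close> in the matched slots. By adjointness these
      contractions pass to \<open>z\<close>, and the pairing with a generator becomes a pairing of
      \<open>w\<close> at these values.\<close>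
    have "contr_pairs n k (rev ps) (partial_pairing n k {} (set (rev ps) \<union> {}) v0 ?y) = partial_pairing n k (set (rev ps)) {} v0 ?y"
      by (rule contr_pairs_partial_pairing[OF vr vv]) (use ind in simp_all)
    then have mixy: "contr_pairs n k (rev ps) (partial_pairing n k {} ?P v0 ?y) = pair_insert n k ?P ?y"
      by (simp only: partial_pairing_empty set_rev Un_empty_right)
    have "herm_k n k z (hw_gen n k (r, s, t, fst d, fst d', snd d, snd d')) = herm_k n k z (pair_insert n k ?P ?y)"
      unfolding hw_gen_def prod.case e_op_traceless_proj zst prod.collapse by (rule herm_k_traceless_proj) (use c0 in auto)
    also have "\<dots> = herm_k n k w (partial_pairing n k {} ?P v0 ?y)"
      unfolding mixy[symmetric] w_def by (rule contr_pairs_adj[OF v, symmetric])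
    also have "\<dots> = (\<Sum>a\<in>fbox n {1..k}. if \<forall>p\<in>{1..k} - ?A. a p = a0 p then
        (\<Sum>b\<in>fbox n {1..k}. if \<forall>q\<in>{1..k} - ?B. b q = b0 q then w (a, b) * cnj (?y (a, b)) else 0) else 0)"
      unfolding herm_alt
    proof (rule sum.cong[OF refl])
      fix a assume a: "a \<in> fbox n {1..k}"
      have KA: "{1..k} - ?A = set s" "{1..k} - ?B = set t" using S(6,7) by auto
      have mx: "partial_pairing n k {} ?P v0 ?y (a, b) = (if (\<forall>p\<in>set s. a p = a0 p) \<and> (\<forall>q\<in>set t. b q = b0 q) then ?y (a, b) else 0)"
        if b: "b \<in> fbox n {1..k}" for b
      proof -
        have "(\<forall>p\<in>?P. a (fst p) = v0 (fst p) \<and> b (snd p) = v0 (fst p))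
          \<longleftrightarrow> (\<forall>p\<in>?P. a (fst p) = a0 (fst p) \<and> b (snd p) = b0 (snd p))"
          by (rule ball_cong[OF refl]) (simp add: av P12 bv)
        also have "\<dots> \<longleftrightarrow> (\<forall>p\<in>set s. a p = a0 p) \<and> (\<forall>q\<in>set t. b q = b0 q)"
          unfolding fs[symmetric] by blast
        finally show ?thesis using a b unfolding partial_pairing_def Idx_eq by simp
      qed
      have "(\<Sum>b\<in>fbox n {1..k}. w (a, b) * cnj (partial_pairing n k {} ?P v0 ?y (a, b)))
        = (\<Sum>b\<in>fbox n {1..k}. if \<forall>p\<in>set s. a p = a0 p then (if \<forall>q\<in>set t. b q = b0 q then w (a, b) * cnj (?y (a, b)) else 0) else 0)"
        by (rule sum.cong[OF refl]) (simp add: mx)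
      also have "\<dots> = (if \<forall>p\<in>set s. a p = a0 p then
          (\<Sum>b\<in>fbox n {1..k}. if \<forall>q\<in>set t. b q = b0 q then w (a, b) * cnj (?y (a, b)) else 0) else 0)"
      proof (cases "\<forall>p\<in>set s. a p = a0 p")
        case True
        show ?thesis unfolding if_P[OF True] ..
      next
        case False
        show ?thesis unfolding if_not_P[OF False] by (rule sum.neutral_const)
      qed
      finally show "(\<Sum>b\<in>fbox n {1..k}. w (a, b) * cnj (partial_pairing n k {} ?P v0 ?y (a, b)))
        = (if \<forall>p\<in>{1..k} - ?A. a p = a0 p then
          (\<Sum>b\<in>fbox n {1..k}. if \<forall>q\<in>{1..k} - ?B. b q = b0 q then w (a, b) * cnj (?y (a, b)) else 0) else 0)"
        unfolding KA .
    qed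
    also have "\<dots> = (\<Sum>a\<in>fbox n ?A. \<Sum>b\<in>fbox n ?B. \<kappa> a b * cnj (?y (merge ?A a a0, merge ?B b b0)))"
      unfolding sum_merge[OF finite_atLeastAtMost Diff_subset fb0(1)] sum_merge[OF finite_atLeastAtMost Diff_subset fb0(2)] \<kappa>_def ..
    also have "\<dots> = (\<Sum>a\<in>fbox n ?A. \<Sum>b\<in>fbox n ?B. \<kappa> a b * (of_int (tab_young_vec ?A d a) * of_int (tab_young_vec ?B d' (flip n b))))"
    proof -
      have "tab_young_vec ?A d (merge ?A a a0) = tab_young_vec ?A d a" for a
        unfolding tab_young_vec_def by (rule young_vec_cong) (simp add: merge_def)
      moreover have "tab_young_vec ?B d' (flip n (merge ?B b b0)) = tab_young_vec ?B d' (flip n b)" for b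
        unfolding tab_young_vec_def by (rule young_vec_cong) (simp add: merge_def flip_def)
      ultimately show ?thesis unfolding young_product_def fst_conv snd_conv by simp
    qed
    finally show ?thesis using zo[OF dat] by simp
  qed
  have k0: "\<kappa> a b = 0" if "a \<in> fbox n ?A" "b \<in> fbox n ?B" for a b
    by (rule traceless_killed_zero[where \<kappa> = \<kappa> and A = ?A and B = ?B and n = n and r = r, OF fin cA r2 dep kil tr orth that])
  have "w = zerot"
  proof
    fix \<iota> :: idx
    obtain a b where \<iota>: "\<iota> = (a, b)" by (cases \<iota>)
    have "\<kappa> a b = 0" if I: "(a, b) \<in> Idx n k"
    proof -
      have "\<kappa> a b = \<kappa> (restrict a ?A) (restrict b ?B)" by (rule dep) simp_all
      also have "\<dots> = 0"
        by (rule k0) (use Idx_val(1)[OF I] Idx_val(2)[OF I] in \<open>auto simp del: atLeastAtMost_iff\<close>)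
      finally show ?thesis .
    qed
    then show "w \<iota> = zerot \<iota>" unfolding wins pair_insert_def \<iota> zerot_def fst_conv snd_conv by simp
  qed
  then show False using w0 by (simp add: w_def)
qed

section \<open>The modules of the data and the decomposition\<close>

lemma hw_gen_yop:
  assumes "2 * k \<le> n" "(r, s, t, la, mu, T, T') \<in> data k"
  shows "e_op n k (yop n k s t la mu T T' (xprime n k r s t la mu T T')) = hw_gen n k (r, s, t, la, mu, T, T')"
  unfolding yop_xprime[OF assms] hw_gen_def prod.case ..

text \<open>A vanishing generator would be a linear relation with a single coefficient 1.\<close>

lemma hw_gen_nonzero:
  assumes "2 * k \<le> n" "d \<in> data k"
  shows "hw_gen n k d \<noteq> zerot"
proof
  assume z: "hw_gen n k d = zerot"
  have "(\<Sum>d'\<in>data k. (if d' = d then 1 else 0) * hw_gen n k d' \<iota>) = 0" for \<iota>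
    by (rule sum.neutral) (use z in \<open>auto simp: zerot_def\<close>)
  then have "(\<lambda>\<iota>. \<Sum>d'\<in>data k. (if d' = d then 1 else 0) * hw_gen n k d' \<iota>) = zerot" by (simp add: zerot_def)
  from hw_gen_independent[OF assms(1) this] assms(2) show False by force
qed

lemma xprime_Mcar:
  assumes "2 * k \<le> n" "(r, s, t, la, mu, T, T') \<in> data k"
  shows "xprime n k r s t la mu T T' \<in> Mcar n k"
  unfolding xprime_partial_pairing[OF assms] by (simp add: Mcar_def partial_pairing_def)

text \<open>\<open>x'\<close> is a basis tensor at an index with no coincidence
  \<open>a i = b i\<close>, so all its contractions at \<open>(i, i)\<close> vanish; hence the inner
  \<open>e\<close> in \<open>eye\<close> leaves it alone.\<close>

lemma e_xprime:
  assumes "2 * k \<le> n" "(r, s, t, la, mu, T, T') \<in> data k"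
  shows "e_op n k (xprime n k r s t la mu T T') = xprime n k r s t la mu T T'"
  unfolding e_op_traceless_proj
proof (rule traceless_proj_fixed)
  fix i assume "i \<in> set [1..<k + 1]"
  then have i: "i \<in> {1..k}" by auto
  let ?a = "gen_a k r s (tab_row la T)" and ?b = "gen_a k r t (\<lambda>q. n + 1 - tab_row mu T' q)"
  have ne: "?a i \<noteq> ?b i"
    by (rule gen_coincide(3)[OF assms _ _ i]) (fact data_rows[OF assms])+
  show "contr n k i i (xprime n k r s t la mu T T') = (\<lambda>_. 0)"
  proof
    fix \<iota> :: idx
    have "xprime n k r s t la mu T T' ((fst \<iota>)(i := l), (snd \<iota>)(i := l)) = 0" for l
    proof -
      have "((fst \<iota>)(i := l), (snd \<iota>)(i := l)) \<noteq> (?a, ?b)"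
      proof
        assume "((fst \<iota>)(i := l), (snd \<iota>)(i := l)) = (?a, ?b)"
        then have "?a i = l" "?b i = l" by (metis fun_upd_same prod.inject)+
        then show False using ne by simp
      qed
      then show ?thesis unfolding xprime_gen basis_vec_def by (simp only: if_False)
    qed
    then show "contr n k i i (xprime n k r s t la mu T T') \<iota> = 0" unfolding contr_def by (simp only: sum.neutral_const if_cancel)
  qed
qed

lemma yop_mhom:
  assumes "(r, s, t, la, mu, T, T') \<in> data k"
  shows "mhom n k (yop n k s t la mu T T')"
proof -
  note D = dataD[OF assms]
  have "mhom n k (yV la T \<circ> (yW mu T' \<circ> contr_pairs n k (zip s t)))"
    using D(14,15) by (intro mhom_comp yV_mhom yW_mhom mhom_contr_pairs D(2)) (auto simp: tableaux_on_def)
  moreover have "yV la T \<circ> (yW mu T' \<circ> contr_pairs n k (zip s t)) = yop n k s t la mu T T'"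
    by (simp add: fun_eq_iff yop_def cst_contr_pairs)
  ultimately show ?thesis by simp
qed

lemma datum_module:
  assumes n: "2 * k \<le> n" and d: "(r, s, t, la, mu, T, T') \<in> data k"
  defines "y \<equiv> yop n k s t la mu T T'" and "x' \<equiv> xprime n k r s t la mu T T'"
  defines "W \<equiv> Ugen n k (e_op n k (y x'))"
  shows "(e_op n k \<circ> y \<circ> e_op n k) ` Ugen n k x' = W \<and> W = e_op n k ` Ugen n k (y x')
    \<and> is_submod n k W \<and> W \<subseteq> e_op n k ` Mcar n k
    \<and> irreducible_mod n k W \<and> has_highest_weight n k W (hw n la mu)"
proof -
  have xM: "x' \<in> Mcar n k" unfolding x'_def by (rule xprime_Mcar[OF n d])
  have ym: "mhom n k y" unfolding y_def by (rule yop_mhom[OF d])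
  note em = mhom_e_op[of n k]
  have yM: "y x' \<in> Mcar n k" by (rule mhomD(1)[OF ym xM])
  have th: "e_op n k (y x') = hw_gen n k (r, s, t, la, mu, T, T')" unfolding y_def x'_def by (rule hw_gen_yop[OF n d])
  have hwv: "hw_vector n k (hw n la mu) (e_op n k (y x'))" unfolding th by (rule hw_gen_hw_vector[OF n d])
  have nz: "e_op n k (y x') \<noteq> zerot" unfolding th by (rule hw_gen_nonzero[OF n d])
  have "(e_op n k \<circ> y \<circ> e_op n k) ` Ugen n k x' = Ugen n k ((e_op n k \<circ> y \<circ> e_op n k) x')"
    by (intro Ugen_image mhom_comp em ym xM)
  moreover have "(e_op n k \<circ> y \<circ> e_op n k) x' = e_op n k (y x')" using e_xprime[OF n d] by (simp add: x'_def)
  ultimately have 1: "(e_op n k \<circ> y \<circ> e_op n k) ` Ugen n k x' = W" unfolding W_def by simp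
  have 2: "W = e_op n k ` Ugen n k (y x')" unfolding W_def by (rule Ugen_image[OF em yM, symmetric])
  have 3: "is_submod n k W" unfolding W_def by (intro Ugen_submod mhomD(1)[OF em] yM)
  have 4: "W \<subseteq> e_op n k ` Mcar n k" unfolding W_def
    by (intro Ugen_least mhom_image_submod em Mcar_submod imageI yM)
  have 5: "irreducible_mod n k W" unfolding W_def by (rule hw_vector_irreducible[OF hwv nz])
  have 6: "has_highest_weight n k W (hw n la mu)"
    unfolding has_highest_weight_def
    using Ugen_self[of "e_op n k (y x')" n k, folded W_def] nz hwv unfolding hw_vector_def killed_def by blast
  show ?thesis using 1 2 3 4 5 6 by blast
qed

theorem theorem1p17:
  fixes n k :: nat
  assumes "2 * k \<le> n"
  shows "(\<forall>(r, s, t, la, mu, T, T') \<in> data k.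
           let y = yop n k s t la mu T T'; x' = xprime n k r s t la mu T T';
               W = Ugen n k (e_op n k (y x'))
           in (e_op n k \<circ> y \<circ> e_op n k) ` Ugen n k x' = W
            \<and> W = e_op n k ` Ugen n k (y x')
            \<and> is_submod n k W \<and> W \<subseteq> e_op n k ` Mcar n k
            \<and> irreducible_mod n k W \<and> has_highest_weight n k W (hw n la mu))
       \<and> (\<forall>v \<in> e_op n k ` Mcar n k. \<exists>f. (\<forall>d\<in>data k. f d \<in> Wmod n k d)
              \<and> v = (\<lambda>\<iota>. \<Sum>d\<in>data k. f d \<iota>))
       \<and> (\<forall>f. (\<forall>d\<in>data k. f d \<in> Wmod n k d) \<and> (\<lambda>\<iota>. \<Sum>d\<in>data k. f d \<iota>) = zerot
              \<longrightarrow> (\<forall>d\<in>data k. f d = zerot))"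
proof -
  define E where "E = e_op n k ` Mcar n k"
  define \<omega> where "\<omega> d = (case d of (r, s, t, la, mu, T, T') \<Rightarrow> hw n la mu)" for d :: datum
  have E: "is_submod n k E" unfolding E_def by (rule mhom_image_submod[OF mhom_e_op Mcar_submod])
  have W: "Wmod n k d = Ugen n k (hw_gen n k d)" if d: "d \<in> data k" for d
  proof -
    obtain r s t la mu T T' where e: "d = (r, s, t, la, mu, T, T')" by (cases d)
    show ?thesis unfolding e Wmod_def prod.case hw_gen_yop[OF assms d[unfolded e]] ..
  qed
  have thE: "hw_gen n k d \<in> E" if d: "d \<in> data k" for d
  proof -
    obtain r s t la mu T T' where e: "d = (r, s, t, la, mu, T, T')" by (cases d)
    show ?thesis unfolding e hw_gen_def prod.case E_def by (intro imageI pair_insert_Mcar)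
  qed
  have thw: "hw_vector n k (\<omega> d) (hw_gen n k d)" if d: "d \<in> data k" for d
  proof -
    obtain r s t la mu T T' where e: "d = (r, s, t, la, mu, T, T')" by (cases d)
    show ?thesis using hw_gen_hw_vector[OF assms d[unfolded e]] by (simp add: e \<omega>_def)
  qed
  have ind: "\<forall>d\<in>data k. c d = 0" if "(\<lambda>\<iota>. \<Sum>d\<in>data k. c d * hw_gen n k d \<iota>) = zerot" for c
    using hw_gen_independent[OF assms that] .
  have cmp: "z = zerot" if "z \<in> E" "killed n k z" "\<And>d. d \<in> data k \<Longrightarrow> herm_k n k z (hw_gen n k d) = 0" for z
    by (rule killed_orth_zero[OF assms that(1)[unfolded E_def] that(2,3)])
  have DS: "E \<subseteq> family_sum n k (data k) (\<lambda>d. Ugen n k (hw_gen n k d))"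
    by (rule hw_direct_sum(1)[where \<theta> = "hw_gen n k" and \<omega> = \<omega>]) (fact finite_data E thE thw ind cmp)+
  have 2: "\<exists>f. (\<forall>d\<in>data k. f d \<in> Wmod n k d) \<and> v = (\<lambda>\<iota>. \<Sum>d\<in>data k. f d \<iota>)" if "v \<in> E" for v
  proof -
    have "v \<in> family_sum n k (data k) (\<lambda>d. Ugen n k (hw_gen n k d))" using DS that by blast
    then show ?thesis unfolding family_sum_def by (auto simp: W)
  qed
  have 3: "\<forall>d\<in>data k. f d = zerot"
    if "\<forall>d\<in>data k. f d \<in> Wmod n k d" "(\<lambda>\<iota>. \<Sum>d\<in>data k. f d \<iota>) = zerot" for f
  proof (rule hw_direct_sum(2)[where \<theta> = "hw_gen n k" and \<omega> = \<omega>])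
    show "f d \<in> Ugen n k (hw_gen n k d)" if "d \<in> data k" for d using \<open>\<forall>d\<in>data k. f d \<in> Wmod n k d\<close> W[OF that] that by blast
  qed (fact finite_data E thE thw ind cmp that)+
  have 1: "\<forall>(r, s, t, la, mu, T, T') \<in> data k.
           let y = yop n k s t la mu T T'; x' = xprime n k r s t la mu T T';
               W = Ugen n k (e_op n k (y x'))
           in (e_op n k \<circ> y \<circ> e_op n k) ` Ugen n k x' = W
            \<and> W = e_op n k ` Ugen n k (y x')
            \<and> is_submod n k W \<and> W \<subseteq> e_op n k ` Mcar n k
            \<and> irreducible_mod n k W \<and> has_highest_weight n k W (hw n la mu)"
    unfolding Let_def using datum_module[OF assms] by blast
  show ?thesis using 1 2 3 unfolding E_def by blast
qed

end
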